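(* Let $P(x)=\sum_{k=0}^K p_kx^k$, $p_K\ne 0$, be a polynomial with real coefficients and let $h(t)=P(\ln t)\,t^{-1}$, $t>0$. The Hankel operator $H$ in $L^2(\mathbb{R}_+)$ with kernel $h(t)$, $(Hf)(t)=\int_0^\infty h(t+s)f(s)\,ds$, is essentially self-adjoint on the domain $\mathcal{D}_0$, and its closure is self-adjoint on the domain $F^*\mathcal{D}_*$.
   Context: $\mathcal{D}_0$ is the set of functions $f$ on $\mathbb{R}_+$ satisfying $|f(t)|\le C\,t^{-1/2}(1+|\ln t|)^{-n}$ for some $C$ and some $n>K+1$. The unitary operator $F:L^2(\mathbb{R}_+)\to L^2(\mathbb{R})$ is $$(Ff)(\xi)=\frac{\Gamma(1/2+i\xi)}{|\Gamma(1/2+i\xi)|}(\Phi Uf)(\xi),\quad (Uf)(x)=e^{x/2}f(e^x),\quad (\Phi u)(\xi)=(2\pi)^{-1/2}\int_{-\infty}^\infty u(x)e^{-ix\xi}\,dx.$$ Let $v(\xi)=\sqrt{\pi}/\sqrt{\cosh(\pi\xi)}$, $D=i\,d/d\xi$, and $Q(x)=\sum_{k=0}^Kq_kx^k$ with $q_k=\sum_{\ell=k}^K\binom{\ell}{k}\omega^{(\ell-k)}(0)p_\ell$, $\omega(z)=\Gamma(1-z)^{-1}$. The set $\mathcal{D}_*\subset L^2(\mathbb{R})$ consists of $g\in L^2(\mathbb{R})$ such that $vQ(D)(vg)\in L^2(\mathbb{R})$, where derivatives are understood in the sense of distributions. *)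

theory Defs
  imports "HOL-Analysis.Analysis" "HOL-Computational_Algebra.Polynomial"
begin

section \<open>The space \<open>L\<^sup>2\<close>\<close>

text \<open>
  An element of \<open>L\<^sup>2(M)\<close> is represented by any of its measurable representatives.  Operators
  are graphs, i.e. sets of pairs of representatives, that are saturated under equality almost
  everywhere; hence equality of domains or of graphs as sets of representatives is equality of
  the corresponding sets of classes.
\<close>

definition L2 :: "'a measure \<Rightarrow> ('a \<Rightarrow> complex) set" where
  "L2 M = {f \<in> borel_measurable M. integrable M (\<lambda>x. (norm (f x))\<^sup>2)}"

definition L2_inner :: "'a measure \<Rightarrow> ('a \<Rightarrow> complex) \<Rightarrow> ('a \<Rightarrow> complex) \<Rightarrow> complex" where
  "L2_inner M f g = (LINT x|M. f x * cnj (g x))"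

definition L2_norm :: "'a measure \<Rightarrow> ('a \<Rightarrow> complex) \<Rightarrow> real" where
  "L2_norm M f = sqrt (LINT x|M. (norm (f x))\<^sup>2)"

text \<open>
  Membership in \<^term>\<open>L2 M\<close> is required explicitly, because the integral in \<^term>\<open>L2_norm M\<close>
  is \<open>0\<close> by convention when it does not exist.
\<close>

definition L2_tendsto ::
    "'a measure \<Rightarrow> (nat \<Rightarrow> 'a \<Rightarrow> complex) \<Rightarrow> ('a \<Rightarrow> complex) \<Rightarrow> bool" where
  "L2_tendsto M fs f \<longleftrightarrow> (\<forall>n. fs n \<in> L2 M) \<and> f \<in> L2 M \<and>
     (\<lambda>n. L2_norm M (\<lambda>x. fs n x - f x)) \<longlonglongrightarrow> 0"

definition L2_dense :: "'a measure \<Rightarrow> ('a \<Rightarrow> complex) set \<Rightarrow> bool" where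
  "L2_dense M D \<longleftrightarrow> D \<subseteq> L2 M \<and>
     (\<forall>f\<in>L2 M. \<exists>fs. (\<forall>n. fs n \<in> D) \<and> L2_tendsto M fs f)"


section \<open>Unbounded operators\<close>

type_synonym ('a, 'b) L2_graph = "(('a \<Rightarrow> complex) \<times> ('b \<Rightarrow> complex)) set"

definition L2_operator :: "'a measure \<Rightarrow> 'b measure \<Rightarrow> ('a, 'b) L2_graph \<Rightarrow> bool" where
  "L2_operator M N T \<longleftrightarrow>
     T \<subseteq> L2 M \<times> L2 N \<and>
     (\<lambda>_. 0, \<lambda>_. 0) \<in> T \<and>
     (\<forall>f g f' g'. (f, g) \<in> T \<and> (f', g') \<in> T \<longrightarrow>
        (\<lambda>x. f x + f' x, \<lambda>y. g y + g' y) \<in> T) \<and>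
     (\<forall>f g c. (f, g) \<in> T \<longrightarrow> (\<lambda>x. c * f x, \<lambda>y. c * g y) \<in> T) \<and>
     (\<forall>f g f' g'. (f, g) \<in> T \<and> f' \<in> L2 M \<and> g' \<in> L2 N \<and>
        (AE x in M. f' x = f x) \<and> (AE y in N. g' y = g y) \<longrightarrow> (f', g') \<in> T) \<and>
     (\<forall>f g g'. (f, g) \<in> T \<and> (f, g') \<in> T \<longrightarrow> (AE y in N. g y = g' y))"

definition L2_restrict :: "('a, 'b) L2_graph \<Rightarrow> ('a \<Rightarrow> complex) set \<Rightarrow> ('a, 'b) L2_graph" where
  "L2_restrict T D = T \<inter> D \<times> UNIV"

definition L2_adjoint ::
    "'a measure \<Rightarrow> 'b measure \<Rightarrow> ('a, 'b) L2_graph \<Rightarrow> ('b, 'a) L2_graph" where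
  "L2_adjoint M N T = {(g, f). g \<in> L2 N \<and> f \<in> L2 M \<and>
     (\<forall>(u, w)\<in>T. L2_inner N w g = L2_inner M u f)}"

definition L2_closure ::
    "'a measure \<Rightarrow> 'b measure \<Rightarrow> ('a, 'b) L2_graph \<Rightarrow> ('a, 'b) L2_graph" where
  "L2_closure M N T = {(f, g). \<exists>fs gs. (\<forall>n. (fs n, gs n) \<in> T) \<and>
     L2_tendsto M fs f \<and> L2_tendsto N gs g}"

definition self_adjoint :: "'a measure \<Rightarrow> ('a, 'a) L2_graph \<Rightarrow> bool" where
  "self_adjoint M T \<longleftrightarrow> L2_operator M M T \<and> L2_dense M (Domain T) \<and> L2_adjoint M M T = T"

definition symmetric_operator :: "'a measure \<Rightarrow> ('a, 'a) L2_graph \<Rightarrow> bool" where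
  "symmetric_operator M T \<longleftrightarrow> L2_operator M M T \<and> L2_dense M (Domain T) \<and>
     (\<forall>(f, g)\<in>T. \<forall>(u, w)\<in>T. L2_inner M g u = L2_inner M f w)"

text \<open>
  In the next definition \<open>D \<subseteq> Domain T\<close> says that \<open>T\<close> really is defined on all of \<open>D\<close>.
\<close>

definition essentially_self_adjoint_on ::
    "'a measure \<Rightarrow> ('a, 'a) L2_graph \<Rightarrow> ('a \<Rightarrow> complex) set \<Rightarrow> bool" where
  "essentially_self_adjoint_on M T D \<longleftrightarrow> D \<subseteq> Domain T \<and>
     symmetric_operator M (L2_restrict T D) \<and>
     self_adjoint M (L2_closure M M (L2_restrict T D))"

definition self_adjoint_on ::
    "'a measure \<Rightarrow> ('a, 'a) L2_graph \<Rightarrow> ('a \<Rightarrow> complex) set \<Rightarrow> bool" where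
  "self_adjoint_on M T D \<longleftrightarrow> Domain T = D \<and> self_adjoint M T"


section \<open>Hankel operators\<close>

abbreviation lborel_pos :: "real measure" where
  "lborel_pos \<equiv> restrict_space lborel {0<..}"

definition hankel_operator :: "(real \<Rightarrow> real) \<Rightarrow> (real, real) L2_graph" where
  "hankel_operator h = {(f, g). f \<in> L2 lborel_pos \<and> g \<in> L2 lborel_pos \<and>
     (AE t in lborel_pos.
        has_bochner_integral lborel_pos (\<lambda>s. complex_of_real (h (t + s)) * f s) (g t))}"

text \<open>The exponent \<open>n\<close> is real.\<close>

definition D_zero :: "nat \<Rightarrow> (real \<Rightarrow> complex) set" where
  "D_zero K = {f \<in> L2 lborel_pos. \<exists>C n :: real. n > real K + 1 \<and>
     (AE t in lborel_pos.
        norm (f t) \<le> C * t powr (-1/2) * (1 + \<bar>ln t\<bar>) powr (-n))}"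


section \<open>The unitary operator \<open>F\<close>\<close>

text \<open>
  For \<open>u\<close> in \<open>L\<^sup>2\<close> the Fourier integral converges only in the mean: the transform is the
  \<open>L\<^sup>2\<close> limit of the integrals over \<open>[-N, N]\<close>.
\<close>

definition fourier_L2 :: "(real, real) L2_graph" where
  "fourier_L2 = {(u, w). u \<in> L2 lborel \<and>
     L2_tendsto lborel
       (\<lambda>N \<xi>. complex_of_real ((2 * pi) powr (-1/2)) *
          (LINT x:{- real N..real N}|lborel. u x * exp (- (\<i> * complex_of_real (x * \<xi>))))) w}"

definition log_substitution :: "(real \<Rightarrow> complex) \<Rightarrow> real \<Rightarrow> complex" where
  "log_substitution f x = complex_of_real (exp (x / 2)) * f (exp x)"

definition gamma_phase :: "real \<Rightarrow> complex" where
  "gamma_phase \<xi> = Gamma (1/2 + \<i> * complex_of_real \<xi>) /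
     complex_of_real (norm (Gamma (1/2 + \<i> * complex_of_real \<xi>)))"

definition F_op :: "(real, real) L2_graph" where
  "F_op = {(f, w). f \<in> L2 lborel_pos \<and> w \<in> L2 lborel \<and>
     (\<exists>u. (log_substitution f, u) \<in> fourier_L2 \<and>
        (AE \<xi> in lborel. w \<xi> = gamma_phase \<xi> * u \<xi>))}"


section \<open>Distributions on the line\<close>

definition vderiv :: "(real \<Rightarrow> complex) \<Rightarrow> real \<Rightarrow> complex" where
  "vderiv \<phi> = (\<lambda>x. vector_derivative \<phi> (at x))"

definition test_functions :: "(real \<Rightarrow> complex) set" where
  "test_functions = {\<phi>. (\<forall>k x. (vderiv ^^ k) \<phi> differentiable (at x)) \<and>
     compact (closure {x. \<phi> x \<noteq> 0})}"

text \<open>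
  Distributions are represented as functionals, of which only the values on
  \<^term>\<open>test_functions\<close> matter.  The pairing is bilinear (no complex conjugation).
\<close>

type_synonym distribution = "(real \<Rightarrow> complex) \<Rightarrow> complex"

definition dist_of :: "(real \<Rightarrow> complex) \<Rightarrow> distribution" where
  "dist_of u \<phi> = (LINT x|lborel. u x * \<phi> x)"

definition dist_deriv :: "distribution \<Rightarrow> distribution" where
  "dist_deriv T \<phi> = - T (vderiv \<phi>)"

definition dist_mult :: "(real \<Rightarrow> complex) \<Rightarrow> distribution \<Rightarrow> distribution" where
  "dist_mult a T \<phi> = T (\<lambda>x. a x * \<phi> x)"

definition dist_D :: "distribution \<Rightarrow> distribution" where
  "dist_D T \<phi> = \<i> * dist_deriv T \<phi>"

definition poly_dist_D :: "complex poly \<Rightarrow> distribution \<Rightarrow> distribution" where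
  "poly_dist_D Q T \<phi> = (\<Sum>k\<le>degree Q. coeff Q k * (dist_D ^^ k) T \<phi>)"

definition dist_in_L2 :: "distribution \<Rightarrow> bool" where
  "dist_in_L2 T \<longleftrightarrow> (\<exists>w\<in>L2 lborel. \<forall>\<phi>\<in>test_functions. T \<phi> = dist_of w \<phi>)"


section \<open>The domain \<open>D\<^sub>*\<close>\<close>

text \<open>The entire function \<open>\<Gamma>(1 - z)\<^sup>-\<^sup>1\<close>; \<^const>\<open>rGamma\<close> is the reciprocal Gamma function.\<close>

definition omega_fun :: "complex \<Rightarrow> complex" where
  "omega_fun z = rGamma (1 - z)"

definition Q_coeff :: "real poly \<Rightarrow> nat \<Rightarrow> complex" where
  "Q_coeff P k = (\<Sum>l=k..degree P.
     of_nat (l choose k) * (deriv ^^ (l - k)) omega_fun 0 * complex_of_real (coeff P l))"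

definition Q_poly :: "real poly \<Rightarrow> complex poly" where
  "Q_poly P = (\<Sum>k\<le>degree P. monom (Q_coeff P k) k)"

definition v_weight :: "real \<Rightarrow> complex" where
  "v_weight \<xi> = complex_of_real (sqrt pi / sqrt (cosh (pi * \<xi>)))"

definition D_star :: "real poly \<Rightarrow> (real \<Rightarrow> complex) set" where
  "D_star P = {g \<in> L2 lborel.
     dist_in_L2 (dist_mult v_weight (poly_dist_D (Q_poly P) (dist_of (\<lambda>\<xi>. v_weight \<xi> * g \<xi>))))}"

end

theory Submission
  imports Defs "HOL-Complex_Analysis.Complex_Analysis" "HOL-Probability.Probability"
begin

text \<open>
  Write \<open>x = ln t\<close> and \<open>u(x) = e\<^sup>x\<^sup>/\<^sup>2 f(e\<^sup>x)\<close>, and let \<open>L\<close> be the Laplace transform.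

  \<^emph>\<open>Diagonalization.\<close>  Since \<open>t\<^sup>z\<^sup>-\<^sup>1 = \<omega>(z) \<integral> e\<^sup>-\<^sup>t\<^sup>\<lambda> \<lambda>\<^sup>-\<^sup>z d\<lambda>\<close>, taking derivatives in \<open>z\<close> at \<open>0\<close> gives
  \<open>h(t) = \<integral> e\<^sup>-\<^sup>t\<^sup>\<lambda> Q(- ln \<lambda>) d\<lambda>\<close>; this is where the coefficients of \<open>Q\<close> come from
  (\<open>poly_eq_Q_moments\<close>).  Hence \<open>H = L\<^sup>* Q(- ln \<lambda>) L\<close>.  In the variables \<open>x\<close> and \<open>\<zeta> = - ln \<lambda>\<close> the
  Laplace transform is the convolution with \<open>b(s) = exp(- e\<^sup>s) e\<^sup>s\<^sup>/\<^sup>2\<close>, whose Fourier integral is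
  \<open>\<Gamma>(1/2 + i\<xi>) = v(\<xi>) \<Gamma>(1/2 + i\<xi>) / |\<Gamma>(1/2 + i\<xi>)|\<close>, while multiplication by \<open>\<zeta>\<close> becomes \<open>D\<close>.  So
  \<open>F H F\<^sup>* = v Q(D) v\<close> on test functions (\<open>log_hankel_diagonal\<close>).  \<open>F\<close> is unitary by the Plancherel
  theorem, which is obtained below by Gaussian regularization.

  \<^emph>\<open>Self-adjointness.\<close>  Let \<open>A\<close> be \<open>v Q(D) v\<close> on test functions.  By the definition of
  distributional derivatives, and because \<open>Q\<close> has real coefficients, \<open>g\<close> lies in \<open>D\<^sub>*\<close> with
  \<open>v Q(D) v g = w\<close> exactly if \<open>(g, w)\<close> lies in the graph of the adjoint of \<open>A\<close>
  (\<open>D_star_iff_weak_solution\<close>).  The main point is that this adjoint is contained in the closure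
  of \<open>A\<close> (\<open>weak_solution_approx\<close>).  Put \<open>y = v g\<close>, so that \<open>Q(D) y = w / v\<close>, and mollify \<open>y\<close>
  instead of \<open>g\<close>: convolution with \<open>\<rho>\<^sub>\<epsilon>\<close> commutes with \<open>Q(D)\<close>, and although it does not commute
  with \<open>v\<close>, the weights \<open>v\<close> and \<open>1/v\<close> change only by bounded factors over bounded distances, so
  \<open>(\<rho>\<^sub>\<epsilon> * y) / v \<rightarrow> g\<close> and \<open>v Q(D) (\<rho>\<^sub>\<epsilon> * y) = v (\<rho>\<^sub>\<epsilon> * (w / v)) \<rightarrow> w\<close>.  For fixed \<open>\<epsilon>\<close> all derivatives of
  \<open>\<rho>\<^sub>\<epsilon> * y\<close>, divided by \<open>v\<close>, are square integrable.  Therefore the lower-order terms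
  that a cutoff \<open>\<chi>(\<xi>/n)\<close> produces tend to zero, and no boundary terms at infinity have to be analysed.

  \<^emph>\<open>Conclusion.\<close>  Let \<open>H\<^sub>0\<close> be \<open>H\<close> on \<open>\<D>\<^sub>0\<close>.  It is symmetric, by the symmetry of its kernel, and
  it extends \<open>F\<^sup>* A F\<close>, because the functions \<open>F\<^sup>* \<psi>\<close> with \<open>\<psi>\<close> a test function decay faster
  than any power of \<open>ln t\<close>.  The adjoint of \<open>H\<^sub>0\<close> is thus contained in that of \<open>F\<^sup>* A F\<close>, which is
  contained in the closure of \<open>F\<^sup>* A F\<close>, hence in the closure of \<open>H\<^sub>0\<close>.  For a symmetric operator
  this inclusion says that the closure is self-adjoint, and the domain of the closure is that
  of the adjoint of \<open>F\<^sup>* A F\<close>, which is \<open>F\<^sup>* D\<^sub>*\<close>.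
\<close>

section \<open>Square-integrable functions\<close>

lemma borel_measurable_cnj [measurable (raw)]:
  "f \<in> borel_measurable M \<Longrightarrow> (\<lambda>x. cnj (f x)) \<in> borel_measurable M"
  by (rule measurable_compose[OF _ borel_measurable_continuous_onI]) (auto intro: continuous_intros)

lemma L2_measurable [measurable_dest]: "f \<in> L2 M \<Longrightarrow> f \<in> borel_measurable M"
  by (simp add: L2_def)

lemma L2_sq_integrable: "f \<in> L2 M \<Longrightarrow> integrable M (\<lambda>x. (norm (f x))\<^sup>2)"
  by (simp add: L2_def)

lemma L2_I: "f \<in> borel_measurable M \<Longrightarrow> integrable M (\<lambda>x. (norm (f x))\<^sup>2) \<Longrightarrow> f \<in> L2 M"
  by (simp add: L2_def)

lemma L2_dominated:
  assumes "integrable M (\<lambda>x. (w x :: real)\<^sup>2)" "f \<in> borel_measurable M" "AE x in M. norm (f x) \<le> w x"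
  shows "f \<in> L2 M"
proof (rule L2_I)
  show "integrable M (\<lambda>x. (norm (f x))\<^sup>2)"
    by (rule Bochner_Integration.integrable_bound[OF assms(1)])
      (use assms(2,3) in \<open>auto elim!: eventually_mono simp: power_mono\<close>)
qed fact

lemma L2_cong_AE:
  assumes "f \<in> L2 M" "g \<in> borel_measurable M" "AE x in M. g x = f x"
  shows "g \<in> L2 M"
  by (rule L2_dominated[OF L2_sq_integrable[OF assms(1)] assms(2)]) (use assms(3) in \<open>auto elim!: eventually_mono\<close>)

lemma L2_zero [simp]: "(\<lambda>x. 0) \<in> L2 M"
  by (simp add: L2_def)

lemma sq_norm_add_le: "(norm (a + b :: 'a::real_normed_vector))\<^sup>2 \<le> 2 * (norm a)\<^sup>2 + 2 * (norm b)\<^sup>2"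
proof -
  have "(norm (a + b))\<^sup>2 \<le> (norm a + norm b)\<^sup>2"
    by (intro power_mono norm_triangle_ineq) auto
  also have "\<dots> \<le> 2 * (norm a)\<^sup>2 + 2 * (norm b)\<^sup>2"
    using sum_squares_bound[of "norm a" "norm b"] by (simp add: power2_sum)
  finally show ?thesis .
qed

lemma L2_add [intro]:
  assumes "f \<in> L2 M" "g \<in> L2 M" shows "(\<lambda>x. f x + g x) \<in> L2 M"
proof (rule L2_I)
  have [measurable]: "f \<in> borel_measurable M" "g \<in> borel_measurable M" using assms by (auto simp: L2_def)
  show "(\<lambda>x. f x + g x) \<in> borel_measurable M" by measurable
  have "integrable M (\<lambda>x. 2 * (norm (f x))\<^sup>2 + 2 * (norm (g x))\<^sup>2)"
    using assms by (auto simp: L2_def)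
  then show "integrable M (\<lambda>x. (norm (f x + g x))\<^sup>2)"
    by (rule Bochner_Integration.integrable_bound) (use sq_norm_add_le in auto)
qed

lemma L2_mult_bounded:
  assumes "f \<in> L2 M" "m \<in> borel_measurable M" "AE x in M. norm (m x) \<le> C"
  shows "(\<lambda>x. m x * f x) \<in> L2 M"
proof (rule L2_dominated)
  show "integrable M (\<lambda>x. (C * norm (f x))\<^sup>2)"
    using L2_sq_integrable[OF assms(1)] by (simp add: power_mult_distrib)
  show "(\<lambda>x. m x * f x) \<in> borel_measurable M" using assms by (auto simp: L2_def)
  show "AE x in M. norm (m x * f x) \<le> C * norm (f x)"
    using assms(3) by eventually_elim (simp add: norm_mult mult_right_mono)
qed

lemma L2_cmult [intro]: "f \<in> L2 M \<Longrightarrow> (\<lambda>x. c * f x) \<in> L2 M"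
  by (rule L2_mult_bounded[where C = "norm c"]) auto

lemma L2_diff [intro]:
  assumes "f \<in> L2 M" "g \<in> L2 M" shows "(\<lambda>x. f x - g x) \<in> L2 M"
  using L2_add[OF assms(1) L2_cmult[OF assms(2), of "-1"]] by simp

lemma L2_cnj [intro]: "f \<in> L2 M \<Longrightarrow> (\<lambda>x. cnj (f x)) \<in> L2 M"
  by (auto simp: L2_def)

lemma L2_mult_integrable:
  assumes "f \<in> L2 M" "g \<in> L2 M" shows "integrable M (\<lambda>x. f x * g x)"
proof -
  have [measurable]: "f \<in> borel_measurable M" "g \<in> borel_measurable M" using assms by (auto simp: L2_def)
  have "integrable M (\<lambda>x. (norm (f x))\<^sup>2 + (norm (g x))\<^sup>2)"
    using assms by (auto simp: L2_def)
  moreover have "norm (f x * g x) \<le> norm ((norm (f x))\<^sup>2 + (norm (g x))\<^sup>2)" for x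
  proof -
    have "2 * norm (f x) * norm (g x) \<le> (norm (f x))\<^sup>2 + (norm (g x))\<^sup>2" by (rule sum_squares_bound)
    moreover have "0 \<le> norm (f x) * norm (g x)" by simp
    ultimately have "norm (f x) * norm (g x) \<le> (norm (f x))\<^sup>2 + (norm (g x))\<^sup>2" by linarith
    then show ?thesis by (simp add: norm_mult)
  qed
  ultimately show ?thesis by (auto intro: Bochner_Integration.integrable_bound)
qed

lemma L2_inner_integrable:
  "f \<in> L2 M \<Longrightarrow> g \<in> L2 M \<Longrightarrow> integrable M (\<lambda>x. f x * cnj (g x))"
  by (intro L2_mult_integrable L2_cnj)

lemma L2_norm_nonneg [simp]: "0 \<le> L2_norm M f"
  by (simp add: L2_norm_def)

lemma L2_norm_sq: "(L2_norm M f)\<^sup>2 = (LINT x|M. (norm (f x))\<^sup>2)"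
  by (simp add: L2_norm_def)

lemma L2_norm_cmult: "L2_norm M (\<lambda>x. c * f x) = norm c * L2_norm M f"
  by (simp add: L2_norm_def norm_mult power_mult_distrib real_sqrt_mult)

lemma L2_norm_minus_commute: "L2_norm M (\<lambda>x. f x - g x) = L2_norm M (\<lambda>x. g x - f x)"
  by (simp add: L2_norm_def norm_minus_commute)

lemma L2_norm_cong_AE:
  assumes "f \<in> borel_measurable M" "g \<in> borel_measurable M" "AE x in M. f x = g x"
  shows "L2_norm M f = L2_norm M g"
  unfolding L2_norm_def by (intro arg_cong[where f=sqrt] integral_cong_AE)
    (use assms in \<open>auto elim: eventually_mono\<close>)

lemma L2_inner_cong_AE:
  assumes "f \<in> borel_measurable M" "g \<in> borel_measurable M" "AE x in M. f x = g x"
    "f' \<in> borel_measurable M" "g' \<in> borel_measurable M" "AE x in M. f' x = g' x"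
  shows "L2_inner M f f' = L2_inner M g g'"
  unfolding L2_inner_def
proof (rule integral_cong_AE)
  show "AE x in M. f x * cnj (f' x) = g x * cnj (g' x)"
    using assms(3,6) by eventually_elim simp
qed (use assms in auto)

lemma L2_inner_self: "L2_inner M f f = complex_of_real ((L2_norm M f)\<^sup>2)"
  by (simp add: L2_inner_def L2_norm_sq complex_norm_square[symmetric] flip: of_real_power)

lemma L2_inner_cnj: "cnj (L2_inner M f g) = L2_inner M g f"
  unfolding L2_inner_def by (subst Bochner_Integration.integral_cnj[symmetric]) (simp add: mult.commute)

lemma L2_inner_add_left:
  assumes "f \<in> L2 M" "g \<in> L2 M" "u \<in> L2 M"
  shows "L2_inner M (\<lambda>x. f x + g x) u = L2_inner M f u + L2_inner M g u"
  using assms by (simp add: L2_inner_def distrib_right L2_inner_integrable)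

lemma L2_inner_diff_left:
  assumes "f \<in> L2 M" "g \<in> L2 M" "u \<in> L2 M"
  shows "L2_inner M (\<lambda>x. f x - g x) u = L2_inner M f u - L2_inner M g u"
  using assms by (simp add: L2_inner_def left_diff_distrib L2_inner_integrable)

lemma L2_inner_diff_right:
  assumes "f \<in> L2 M" "g \<in> L2 M" "u \<in> L2 M"
  shows "L2_inner M u (\<lambda>x. f x - g x) = L2_inner M u f - L2_inner M u g"
  using assms by (simp add: L2_inner_def right_diff_distrib L2_inner_integrable)

lemma L2_inner_cmult_left: "L2_inner M (\<lambda>x. c * f x) u = c * L2_inner M f u"
  by (simp add: L2_inner_def mult.assoc)

lemma L2_norm_eq_0_AE:
  assumes "f \<in> L2 M" "L2_norm M f = 0" shows "AE x in M. f x = 0"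
proof -
  have "(LINT x|M. (norm (f x))\<^sup>2) = 0" using assms(2) L2_norm_sq[of M f] by simp
  then have "AE x in M. (norm (f x))\<^sup>2 = 0"
    using integral_nonneg_eq_0_iff_AE[OF L2_sq_integrable[OF assms(1)]] by simp
  then show ?thesis by eventually_elim simp
qed

lemma L2_cauchy_schwarz_real:
  assumes "f \<in> L2 M" "g \<in> L2 M"
  shows "(LINT x|M. norm (f x) * norm (g x)) \<le> L2_norm M f * L2_norm M g"
proof -
  let ?I = "LINT x|M. norm (f x) * norm (g x)"
  have int: "integrable M (\<lambda>x. norm (f x) * norm (g x))"
    using integrable_norm[OF L2_mult_integrable[OF assms]] by (simp add: norm_mult)
  have quad: "0 \<le> s\<^sup>2 * (L2_norm M f)\<^sup>2 + t\<^sup>2 * (L2_norm M g)\<^sup>2 - 2 * (s * t) * ?I" for s t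
  proof -
    have "0 \<le> (LINT x|M. (s * norm (f x) - t * norm (g x))\<^sup>2)" by simp
    also have "\<dots> = (LINT x|M. s\<^sup>2 * (norm (f x))\<^sup>2 + t\<^sup>2 * (norm (g x))\<^sup>2 - 2 * (s * t) * (norm (f x) * norm (g x)))"
      by (intro Bochner_Integration.integral_cong) (auto simp: power2_diff power_mult_distrib)
    also have "\<dots> = s\<^sup>2 * (L2_norm M f)\<^sup>2 + t\<^sup>2 * (L2_norm M g)\<^sup>2 - 2 * (s * t) * ?I"
      using int L2_sq_integrable[OF assms(1)] L2_sq_integrable[OF assms(2)] by (simp add: L2_norm_sq)
    finally show ?thesis .
  qed
  define a b where "a = L2_norm M f" and "b = L2_norm M g"
  have ab: "a \<ge> 0" "b \<ge> 0" by (auto simp: a_def b_def)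
  show ?thesis
  proof (cases "a = 0 \<or> b = 0")
    case True
    then have "AE x in M. norm (f x) * norm (g x) = 0"
    proof
      assume "a = 0"
      then have "AE x in M. f x = 0" using L2_norm_eq_0_AE[OF assms(1)] by (simp add: a_def)
      then show ?thesis by eventually_elim simp
    next
      assume "b = 0"
      then have "AE x in M. g x = 0" using L2_norm_eq_0_AE[OF assms(2)] by (simp add: b_def)
      then show ?thesis by eventually_elim simp
    qed
    then have "?I = 0" by (rule integral_eq_zero_AE)
    then show ?thesis using True by auto
  next
    case False
    then have pos: "a > 0" "b > 0" using ab by auto
    have "0 \<le> b\<^sup>2 * a\<^sup>2 + a\<^sup>2 * b\<^sup>2 - 2 * (b * a) * ?I" using quad[of b a] by (simp add: a_def b_def)
    then have "2 * (b * a) * ?I \<le> 2 * (b * a) * (a * b)" by (simp add: power2_eq_square algebra_simps)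
    then show ?thesis using pos by (simp add: a_def b_def)
  qed
qed

lemma L2_cauchy_schwarz:
  assumes "f \<in> L2 M" "g \<in> L2 M" shows "norm (L2_inner M f g) \<le> L2_norm M f * L2_norm M g"
proof -
  have "norm (L2_inner M f g) \<le> (LINT x|M. norm (f x * cnj (g x)))"
    unfolding L2_inner_def by (rule integral_norm_bound)
  also have "\<dots> = (LINT x|M. norm (f x) * norm (g x))" by (simp add: norm_mult)
  finally show ?thesis using L2_cauchy_schwarz_real[OF assms] by linarith
qed

lemma L2_norm_triangle:
  assumes "f \<in> L2 M" "g \<in> L2 M" shows "L2_norm M (\<lambda>x. f x + g x) \<le> L2_norm M f + L2_norm M g"
proof (rule power2_le_imp_le)
  have int: "integrable M (\<lambda>x. norm (f x) * norm (g x))"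
    using integrable_norm[OF L2_mult_integrable[OF assms]] by (simp add: norm_mult)
  have "(L2_norm M (\<lambda>x. f x + g x))\<^sup>2 = (LINT x|M. (norm (f x + g x))\<^sup>2)" by (rule L2_norm_sq)
  also have "\<dots> \<le> (LINT x|M. (norm (f x))\<^sup>2 + (norm (g x))\<^sup>2 + 2 * (norm (f x) * norm (g x)))"
  proof (rule integral_mono)
    show "(norm (f x + g x))\<^sup>2 \<le> (norm (f x))\<^sup>2 + (norm (g x))\<^sup>2 + 2 * (norm (f x) * norm (g x))" for x
      using power_mono[OF norm_triangle_ineq[of "f x" "g x"], of 2] by (simp add: power2_sum mult.assoc)
  qed (use int L2_sq_integrable[OF L2_add[OF assms]] L2_sq_integrable[OF assms(1)] L2_sq_integrable[OF assms(2)] in auto)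
  also have "\<dots> = (L2_norm M f)\<^sup>2 + (L2_norm M g)\<^sup>2 + 2 * (LINT x|M. norm (f x) * norm (g x))"
    using int L2_sq_integrable[OF assms(1)] L2_sq_integrable[OF assms(2)] by (simp add: L2_norm_sq)
  also have "\<dots> \<le> (L2_norm M f + L2_norm M g)\<^sup>2"
    using L2_cauchy_schwarz_real[OF assms] by (simp add: power2_sum)
  finally show "(L2_norm M (\<lambda>x. f x + g x))\<^sup>2 \<le> (L2_norm M f + L2_norm M g)\<^sup>2" .
qed simp

lemma L2_norm_triangle_diff:
  assumes "f \<in> L2 M" "g \<in> L2 M" "k \<in> L2 M"
  shows "L2_norm M (\<lambda>x. f x - k x) \<le> L2_norm M (\<lambda>x. f x - g x) + L2_norm M (\<lambda>x. g x - k x)"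
  using L2_norm_triangle[of "\<lambda>x. f x - g x" M "\<lambda>x. g x - k x"] assms by auto

lemma L2_norm_mono:
  assumes "g \<in> L2 M" "f \<in> borel_measurable M" "AE x in M. norm (f x) \<le> norm (g x)"
  shows "L2_norm M f \<le> L2_norm M g"
  unfolding L2_norm_def
proof (intro real_sqrt_le_mono integral_mono_AE)
  have "f \<in> L2 M" by (rule L2_dominated[OF L2_sq_integrable[OF assms(1)] assms(2,3)])
  then show "integrable M (\<lambda>x. (norm (f x))\<^sup>2)" by (rule L2_sq_integrable)
  show "AE x in M. (norm (f x))\<^sup>2 \<le> (norm (g x))\<^sup>2"
    using assms(3) by eventually_elim (simp add: power_mono)
qed (use assms L2_sq_integrable in auto)

section \<open>Convergence in the mean\<close>

lemma L2_tendstoD: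
  assumes "L2_tendsto M fs f"
  shows "fs n \<in> L2 M" "f \<in> L2 M" "(\<lambda>n. L2_norm M (\<lambda>x. fs n x - f x)) \<longlonglongrightarrow> 0"
  using assms by (auto simp: L2_tendsto_def)

lemma L2_tendstoI:
  assumes "\<And>n. fs n \<in> L2 M" "f \<in> L2 M" "(\<lambda>n. L2_norm M (\<lambda>x. fs n x - f x)) \<longlonglongrightarrow> 0"
  shows "L2_tendsto M fs f"
  using assms by (auto simp: L2_tendsto_def)

lemma L2_tendsto_bound:
  assumes "\<And>n. fs n \<in> L2 M" "f \<in> L2 M" "\<And>n. L2_norm M (\<lambda>x. fs n x - f x) \<le> e n" "e \<longlonglongrightarrow> 0"
  shows "L2_tendsto M fs f"
proof (rule L2_tendstoI)
  show "(\<lambda>n. L2_norm M (\<lambda>x. fs n x - f x)) \<longlonglongrightarrow> 0"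
    by (rule tendsto_sandwich[OF _ _ tendsto_const assms(4)]) (auto intro!: always_eventually assms)
qed fact+

lemma L2_tendsto_const: "f \<in> L2 M \<Longrightarrow> L2_tendsto M (\<lambda>_. f) f"
  by (auto simp: L2_tendsto_def L2_norm_def)

lemma L2_tendsto_add:
  assumes "L2_tendsto M fs f" "L2_tendsto M gs g"
  shows "L2_tendsto M (\<lambda>n x. fs n x + gs n x) (\<lambda>x. f x + g x)"
proof (rule L2_tendsto_bound)
  note [intro] = L2_tendstoD[OF assms(1)] L2_tendstoD[OF assms(2)]
  show "(\<lambda>x. fs n x + gs n x) \<in> L2 M" for n by auto
  show "(\<lambda>x. f x + g x) \<in> L2 M" by auto
  show "L2_norm M (\<lambda>x. fs n x + gs n x - (f x + g x)) \<le> L2_norm M (\<lambda>x. fs n x - f x) + L2_norm M (\<lambda>x. gs n x - g x)" for n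
    using L2_norm_triangle[of "\<lambda>x. fs n x - f x" M "\<lambda>x. gs n x - g x"] by (auto simp: add_diff_add)
  show "(\<lambda>n. L2_norm M (\<lambda>x. fs n x - f x) + L2_norm M (\<lambda>x. gs n x - g x)) \<longlonglongrightarrow> 0"
    using tendsto_add[OF L2_tendstoD(3)[OF assms(1)] L2_tendstoD(3)[OF assms(2)]] by simp
qed

lemma L2_tendsto_mult_bounded:
  assumes "L2_tendsto M fs f" "m \<in> borel_measurable M" "AE x in M. norm (m x) \<le> C"
  shows "L2_tendsto M (\<lambda>n x. m x * fs n x) (\<lambda>x. m x * f x)"
proof (rule L2_tendsto_bound)
  note [simp] = L2_tendstoD(1,2)[OF assms(1)]
  show "(\<lambda>x. m x * fs n x) \<in> L2 M" for n using L2_mult_bounded[OF _ assms(2,3)] by simp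
  show "(\<lambda>x. m x * f x) \<in> L2 M" using L2_mult_bounded[OF _ assms(2,3)] by simp
  show "L2_norm M (\<lambda>x. m x * fs n x - m x * f x) \<le> \<bar>C\<bar> * L2_norm M (\<lambda>x. fs n x - f x)" for n
  proof -
    have "L2_norm M (\<lambda>x. m x * fs n x - m x * f x) \<le> L2_norm M (\<lambda>x. complex_of_real \<bar>C\<bar> * (fs n x - f x))"
    proof (rule L2_norm_mono)
      show "AE x in M. norm (m x * fs n x - m x * f x) \<le> norm (complex_of_real \<bar>C\<bar> * (fs n x - f x))"
        using assms(3) by eventually_elim
          (auto simp: norm_mult right_diff_distrib[symmetric] intro!: mult_right_mono)
      show "(\<lambda>x. complex_of_real \<bar>C\<bar> * (fs n x - f x)) \<in> L2 M"
        using L2_cmult[OF L2_diff[OF L2_tendstoD(1,2)[OF assms(1)]]] .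
    qed (intro borel_measurable_diff borel_measurable_times assms(2)
        L2_measurable[OF L2_tendstoD(1)[OF assms(1)]] L2_measurable[OF L2_tendstoD(2)[OF assms(1)]])
    then show ?thesis by (simp add: L2_norm_cmult)
  qed
  show "(\<lambda>n. \<bar>C\<bar> * L2_norm M (\<lambda>x. fs n x - f x)) \<longlonglongrightarrow> 0"
    using tendsto_mult_right_zero[OF L2_tendstoD(3)[OF assms(1)]] by simp
qed

lemma L2_tendsto_cmult: "L2_tendsto M fs f \<Longrightarrow> L2_tendsto M (\<lambda>n x. c * fs n x) (\<lambda>x. c * f x)"
  by (rule L2_tendsto_mult_bounded[where C="norm c"]) auto

lemma L2_tendsto_sum:
  assumes "\<And>i. i \<in> I \<Longrightarrow> L2_tendsto M (fs i) (f i)"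
  shows "L2_tendsto M (\<lambda>n x. \<Sum>i\<in>I. fs i n x) (\<lambda>x. \<Sum>i\<in>I. f i x)"
proof (cases "finite I")
  case True
  then show ?thesis using assms by (induction I) (auto intro: L2_tendsto_const L2_tendsto_add)
qed (auto intro: L2_tendsto_const)

lemma L2_tendsto_cong_AE:
  assumes "L2_tendsto M fs f" "\<And>n. gs n \<in> borel_measurable M" "g \<in> borel_measurable M"
    "\<And>n. AE x in M. gs n x = fs n x" "AE x in M. g x = f x"
  shows "L2_tendsto M gs g"
proof (rule L2_tendstoI)
  show "gs n \<in> L2 M" for n by (rule L2_cong_AE[OF L2_tendstoD(1)[OF assms(1)] assms(2,4)])
  show "g \<in> L2 M" by (rule L2_cong_AE[OF L2_tendstoD(2)[OF assms(1)] assms(3,5)])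
  have "L2_norm M (\<lambda>x. gs n x - g x) = L2_norm M (\<lambda>x. fs n x - f x)" for n
  proof (rule L2_norm_cong_AE)
    show "AE x in M. gs n x - g x = fs n x - f x"
      using assms(4)[of n] assms(5) by eventually_elim simp
  qed (use assms(2,3) L2_tendstoD(1,2)[OF assms(1)] in auto)
  then show "(\<lambda>n. L2_norm M (\<lambda>x. gs n x - g x)) \<longlonglongrightarrow> 0"
    using assms(1) by (simp add: L2_tendsto_def)
qed

lemma L2_tendsto_inner_left:
  assumes "L2_tendsto M fs f" "u \<in> L2 M"
  shows "(\<lambda>n. L2_inner M (fs n) u) \<longlonglongrightarrow> L2_inner M f u"
proof -
  note [intro] = L2_tendstoD[OF assms(1)]
  have "(\<lambda>n. L2_inner M (fs n) u - L2_inner M f u) \<longlonglongrightarrow> 0"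
  proof (rule Lim_null_comparison)
    show "\<forall>\<^sub>F n in sequentially. norm (L2_inner M (fs n) u - L2_inner M f u) \<le> L2_norm M (\<lambda>x. fs n x - f x) * L2_norm M u"
    proof (rule always_eventually, rule allI)
      fix n show "norm (L2_inner M (fs n) u - L2_inner M f u) \<le> L2_norm M (\<lambda>x. fs n x - f x) * L2_norm M u"
        using L2_cauchy_schwarz[of "\<lambda>x. fs n x - f x" M u] assms by (auto simp: L2_inner_diff_left L2_tendsto_def)
    qed
    show "(\<lambda>n. L2_norm M (\<lambda>x. fs n x - f x) * L2_norm M u) \<longlonglongrightarrow> 0"
      using tendsto_mult_left_zero[OF L2_tendstoD(3)[OF assms(1)]] by simp
  qed
  then show ?thesis by (simp add: LIM_zero_iff)
qed

lemma L2_tendsto_inner_right: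
  assumes "L2_tendsto M fs f" "u \<in> L2 M"
  shows "(\<lambda>n. L2_inner M u (fs n)) \<longlonglongrightarrow> L2_inner M u f"
  using tendsto_cnj[OF L2_tendsto_inner_left[OF assms]] by (simp add: L2_inner_cnj)

lemma L2_tendsto_norm:
  assumes "L2_tendsto M fs f"
  shows "(\<lambda>n. L2_norm M (fs n)) \<longlonglongrightarrow> L2_norm M f"
proof -
  note D = L2_tendstoD[OF assms]
  have "(\<lambda>n. L2_norm M (fs n) - L2_norm M f) \<longlonglongrightarrow> 0"
  proof (rule Lim_null_comparison[OF always_eventually D(3)], rule allI)
    fix n
    have "L2_norm M (fs n) \<le> L2_norm M (\<lambda>x. fs n x - f x) + L2_norm M f"
      using L2_norm_triangle[OF L2_diff[OF D(1,2)] D(2), of n] by simp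
    moreover have "L2_norm M f \<le> L2_norm M (\<lambda>x. fs n x - f x) + L2_norm M (fs n)"
      using L2_norm_triangle[OF L2_diff[OF D(2,1)] D(1), of n n] L2_norm_minus_commute[of M f "fs n"] by simp
    ultimately show "norm (L2_norm M (fs n) - L2_norm M f) \<le> L2_norm M (\<lambda>x. fs n x - f x)" by simp
  qed
  then show ?thesis by (simp add: LIM_zero_iff)
qed

lemma L2_tendsto_dominated:
  assumes [measurable]: "\<And>n. fs n \<in> borel_measurable M" "f \<in> borel_measurable M"
    and w: "integrable M (\<lambda>x. (w x :: real)\<^sup>2)"
    and lim: "AE x in M. (\<lambda>n. fs n x) \<longlonglongrightarrow> f x" and bd: "\<And>n. AE x in M. norm (fs n x) \<le> w x"
  shows "L2_tendsto M fs f"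
proof -
  have "AE x in M. \<forall>n. norm (fs n x) \<le> w x" using bd by (simp add: AE_all_countable)
  with lim have fb: "AE x in M. norm (f x) \<le> w x"
  proof eventually_elim
    case (elim x)
    show ?case by (rule LIMSEQ_le_const2[OF tendsto_norm[OF elim(1)]]) (use elim in auto)
  qed
  have fs: "fs n \<in> L2 M" for n by (rule L2_dominated[OF w _ bd]) simp
  have f: "f \<in> L2 M" by (rule L2_dominated[OF w _ fb]) simp
  have "(\<lambda>n. LINT x|M. (norm (fs n x - f x))\<^sup>2) \<longlonglongrightarrow> (LINT x|M. (0::real))"
  proof (rule integral_dominated_convergence)
    show "integrable M (\<lambda>x. 4 * (w x)\<^sup>2)" using w by simp
    show "AE x in M. (\<lambda>n. (norm (fs n x - f x))\<^sup>2) \<longlonglongrightarrow> 0"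
      using lim
    proof eventually_elim
      case (elim x)
      have "(\<lambda>n. (norm (fs n x - f x))\<^sup>2) \<longlonglongrightarrow> (norm (f x - f x))\<^sup>2"
        by (intro tendsto_intros elim)
      then show ?case by simp
    qed
    show "AE x in M. norm ((norm (fs n x - f x))\<^sup>2) \<le> 4 * (w x)\<^sup>2" for n
      using bd[of n] fb
    proof eventually_elim
      case (elim x)
      have "norm (fs n x - f x) \<le> 2 * w x" using norm_triangle_ineq4[of "fs n x" "f x"] elim by linarith
      from power_mono[OF this, of 2] show ?case by (simp add: power_mult_distrib)
    qed
  qed auto
  then have "(\<lambda>n. sqrt (LINT x|M. (norm (fs n x - f x))\<^sup>2)) \<longlonglongrightarrow> sqrt 0"
    by (intro tendsto_real_sqrt) simp
  then show ?thesis using fs f by (auto simp: L2_tendsto_def L2_norm_def)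
qed

text \<open>
  Completeness.  Along a subsequence whose increments satisfy \<open>\<parallel>d\<^sub>k\<parallel>\<^sup>2 \<le> 4\<^sup>-\<^sup>k\<close>, the sum
  \<open>\<Sum> 2\<^sup>k |d\<^sub>k|\<^sup>2\<close> has a finite integral and so is finite almost everywhere; because
  \<open>2 |d\<^sub>k| \<le> 2\<^sup>k |d\<^sub>k|\<^sup>2 + 2\<^sup>-\<^sup>k\<close>, the increments are then absolutely summable almost everywhere.
  Fatou's lemma upgrades the pointwise limit to a limit in norm.
\<close>

lemma L2_norm_cauchy_imp_convergent:
  assumes fs: "\<And>n. fs n \<in> L2 M"
    and cauchy: "\<And>e. e > 0 \<Longrightarrow> \<exists>N. \<forall>m\<ge>N. \<forall>n\<ge>N. L2_norm M (\<lambda>x. fs m x - fs n x) < e"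
  shows "\<exists>f. L2_tendsto M fs f"
proof -
  have [measurable]: "fs n \<in> borel_measurable M" for n using fs by (simp add: L2_def)
  obtain N where N: "\<And>k m n. m \<ge> N k \<Longrightarrow> n \<ge> N k \<Longrightarrow> L2_norm M (\<lambda>x. fs m x - fs n x) < (1/2)^k"
    using cauchy[of "(1/2)^k" for k] by (metis zero_less_power half_gt_zero zero_less_one)
  \<comment> \<open>the sum makes \<open>r\<close> exceed all thresholds up to \<open>k\<close>, the summand \<open>k\<close> makes it unbounded\<close>
  define r where "r k = k + (\<Sum>j\<le>k. N j)" for k
  have rN: "r m \<ge> N k" if "m \<ge> k" for m k
  proof -
    have "N k \<le> (\<Sum>j\<le>m. N j)" using that by (intro member_le_sum) auto
    then show ?thesis by (simp add: r_def)
  qed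
  have rk: "r k \<ge> k" for k by (simp add: r_def)
  define d where "d k x = fs (r (Suc k)) x - fs (r k) x" for k x
  have d2: "(\<integral>\<^sup>+x. ennreal ((norm (d k x))\<^sup>2) \<partial>M) \<le> ennreal ((1/4)^k)" for k
  proof -
    have "L2_norm M (d k) \<le> (1/2)^k" unfolding d_def using N[of k "r (Suc k)" "r k"] rN by (simp add: less_imp_le)
    then have "(L2_norm M (d k))\<^sup>2 \<le> ((1/2)^k)\<^sup>2" by (intro power_mono) auto
    also have "((1/2::real)^k)\<^sup>2 = (1/4)^k"
      unfolding power2_eq_square power_mult_distrib[symmetric] by simp
    finally have "(LINT x|M. (norm (d k x))\<^sup>2) \<le> (1/4)^k" by (simp add: L2_norm_sq)
    moreover have "integrable M (\<lambda>x. (norm (d k x))\<^sup>2)"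
      unfolding d_def by (intro L2_sq_integrable L2_diff fs)
    ultimately show ?thesis by (subst nn_integral_eq_integral) (auto intro: ennreal_leI)
  qed
  have [measurable]: "d k \<in> borel_measurable M" for k unfolding d_def by measurable
  have "(\<integral>\<^sup>+x. (\<Sum>k. ennreal (2^k * (norm (d k x))\<^sup>2)) \<partial>M) = (\<Sum>k. \<integral>\<^sup>+x. ennreal (2^k * (norm (d k x))\<^sup>2) \<partial>M)"
    by (rule nn_integral_suminf) measurable
  also have "\<dots> \<le> (\<Sum>k. ennreal ((1/2)^k))"
  proof (intro suminf_le allI)
    fix k
    have "(\<integral>\<^sup>+x. ennreal (2^k * (norm (d k x))\<^sup>2) \<partial>M) = ennreal (2^k) * (\<integral>\<^sup>+x. ennreal ((norm (d k x))\<^sup>2) \<partial>M)"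
      by (subst nn_integral_cmult[symmetric]) (auto simp: ennreal_mult)
    also have "\<dots> \<le> ennreal (2^k) * ennreal ((1/4)^k)" by (intro mult_left_mono d2) auto
    also have "\<dots> = ennreal ((1/2)^k)" by (simp add: ennreal_mult[symmetric] power_mult_distrib[symmetric])
    finally show "(\<integral>\<^sup>+x. ennreal (2^k * (norm (d k x))\<^sup>2) \<partial>M) \<le> ennreal ((1/2)^k)" .
  qed auto
  also have "\<dots> = ennreal (\<Sum>k. (1/2)^k)"
    by (rule suminf_ennreal2) (auto intro: summable_geometric)
  also have "\<dots> < \<infinity>" by simp
  finally have "(\<integral>\<^sup>+x. (\<Sum>k. ennreal (2^k * (norm (d k x))\<^sup>2)) \<partial>M) \<noteq> \<infinity>" by simp
  then have "AE x in M. (\<Sum>k. ennreal (2^k * (norm (d k x))\<^sup>2)) \<noteq> \<infinity>"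
    by (intro nn_integral_PInf_AE) auto
  then have conv: "AE x in M. convergent (\<lambda>k. fs (r k) x)"
  proof eventually_elim
    case (elim x)
    then have s: "summable (\<lambda>k. 2^k * (norm (d k x))\<^sup>2)"
      by (intro summable_suminf_not_top) auto
    have "summable (\<lambda>k. norm (d k x))"
    proof (rule summable_comparison_test')
      have "summable (\<lambda>k. (1/2::real)^k)" by (rule summable_geometric) auto
      with s show "summable (\<lambda>k. 2^k * (norm (d k x))\<^sup>2 + (1/2)^k)" by (rule summable_add)
      fix k :: nat assume "k \<ge> 0"
      have "2 * (sqrt (2^k) * norm (d k x)) * sqrt ((1/2)^k) \<le> (sqrt (2^k) * norm (d k x))\<^sup>2 + (sqrt ((1/2)^k))\<^sup>2"
        by (rule sum_squares_bound)
      also have "\<dots> = 2^k * (norm (d k x))\<^sup>2 + (1/2)^k" by (simp add: power_mult_distrib)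
      also have "2 * (sqrt (2^k) * norm (d k x)) * sqrt ((1/2)^k) = 2 * norm (d k x)"
      proof -
        have "sqrt (2^k) * sqrt ((1/2)^k) = (1::real)"
          by (subst real_sqrt_mult[symmetric]) (simp add: power_mult_distrib[symmetric])
        then show ?thesis by (simp add: mult_ac)
      qed
      finally show "norm (norm (d k x)) \<le> 2^k * (norm (d k x))\<^sup>2 + (1/2)^k" using norm_ge_zero[of "d k x"] unfolding real_norm_def abs_norm_cancel by linarith
    qed
    then have "summable (\<lambda>k. d k x)" by (rule summable_norm_cancel)
    then have "convergent (\<lambda>n. \<Sum>k<n. d k x)" by (simp add: summable_iff_convergent)
    moreover have "(\<Sum>k<n. d k x) = fs (r n) x - fs (r 0) x" for n
      unfolding d_def by (rule sum_lessThan_telescope)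
    ultimately have "convergent (\<lambda>n. fs (r n) x - fs (r 0) x)" by simp
    then have "convergent (\<lambda>n. (fs (r n) x - fs (r 0) x) + fs (r 0) x)" by (intro convergent_add convergent_const)
    then show ?case by simp
  qed
  define f where "f x = lim (\<lambda>k. fs (r k) x)" for x
  have [measurable]: "f \<in> borel_measurable M" unfolding f_def by measurable
  have lim: "AE x in M. (\<lambda>k. fs (r k) x) \<longlonglongrightarrow> f x"
    using conv by eventually_elim (simp add: f_def convergent_LIMSEQ_iff)
  have est: "(\<integral>\<^sup>+x. ennreal ((norm (fs n x - f x))\<^sup>2) \<partial>M) \<le> ennreal (((1/2)^k)\<^sup>2)" if n: "n \<ge> N k" for n k
  proof -
    have "(\<integral>\<^sup>+x. ennreal ((norm (fs n x - f x))\<^sup>2) \<partial>M) = (\<integral>\<^sup>+x. liminf (\<lambda>m. ennreal ((norm (fs n x - fs (r m) x))\<^sup>2)) \<partial>M)"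
    proof (rule nn_integral_cong_AE)
      show "AE x in M. ennreal ((norm (fs n x - f x))\<^sup>2) = liminf (\<lambda>m. ennreal ((norm (fs n x - fs (r m) x))\<^sup>2))"
        using lim
      proof eventually_elim
        case (elim x)
        have "(\<lambda>m. ennreal ((norm (fs n x - fs (r m) x))\<^sup>2)) \<longlonglongrightarrow> ennreal ((norm (fs n x - f x))\<^sup>2)"
          by (intro tendsto_intros tendsto_ennrealI elim)
        then show ?case by (rule lim_imp_Liminf[OF sequentially_bot, symmetric])
      qed
    qed
    also have "\<dots> \<le> liminf (\<lambda>m. \<integral>\<^sup>+x. ennreal ((norm (fs n x - fs (r m) x))\<^sup>2) \<partial>M)"
      by (rule nn_integral_liminf) measurable
    also have "\<dots> \<le> ennreal (((1/2)^k)\<^sup>2)"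
    proof (rule Liminf_le)
      show "\<forall>\<^sub>F m in sequentially. (\<integral>\<^sup>+x. ennreal ((norm (fs n x - fs (r m) x))\<^sup>2) \<partial>M) \<le> ennreal (((1/2)^k)\<^sup>2)"
      proof (rule eventually_sequentiallyI[of k])
        fix m assume "k \<le> m"
        then have "L2_norm M (\<lambda>x. fs n x - fs (r m) x) < (1/2)^k" using N[OF n rN] by simp
        then have "(L2_norm M (\<lambda>x. fs n x - fs (r m) x))\<^sup>2 \<le> ((1/2)^k)\<^sup>2" by (intro power_mono) auto
        then have "(LINT x|M. (norm (fs n x - fs (r m) x))\<^sup>2) \<le> ((1/2)^k)\<^sup>2" by (simp add: L2_norm_sq)
        moreover have "integrable M (\<lambda>x. (norm (fs n x - fs (r m) x))\<^sup>2)"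
          by (intro L2_sq_integrable L2_diff fs)
        ultimately show "(\<integral>\<^sup>+x. ennreal ((norm (fs n x - fs (r m) x))\<^sup>2) \<partial>M) \<le> ennreal (((1/2)^k)\<^sup>2)"
          by (subst nn_integral_eq_integral) (auto intro: ennreal_leI simp del: power_one_over)
      qed
    qed simp
    finally show ?thesis .
  qed
  have dL2: "(\<lambda>x. fs n x - f x) \<in> L2 M" if n: "n \<ge> N k" for n k
  proof (rule L2_I)
    show "integrable M (\<lambda>x. (norm (fs n x - f x))\<^sup>2)"
      by (rule integrableI_bounded) (use est[OF n] in \<open>auto simp: less_top[symmetric] top_unique\<close>)
  qed auto
  have fL2: "f \<in> L2 M"
    using L2_diff[OF fs dL2[of 0 "N 0"], of "N 0"] by simp
  have "(\<lambda>n. L2_norm M (\<lambda>x. fs n x - f x)) \<longlonglongrightarrow> 0"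
  proof (rule LIMSEQ_I)
    fix e :: real assume "e > 0"
    then obtain k where k: "(1/2)^k < e" using real_arch_pow_inv[of e "1/2"] by auto
    show "\<exists>no. \<forall>n\<ge>no. norm (L2_norm M (\<lambda>x. fs n x - f x) - 0) < e"
    proof (intro exI allI impI)
      fix n assume n: "n \<ge> N k"
      have "ennreal (LINT x|M. (norm (fs n x - f x))\<^sup>2) \<le> ennreal (((1/2)^k)\<^sup>2)"
        using est[OF n] L2_sq_integrable[OF dL2[OF n]] by (subst (asm) nn_integral_eq_integral) auto
      then have "(L2_norm M (\<lambda>x. fs n x - f x))\<^sup>2 \<le> ((1/2)^k)\<^sup>2" by (simp add: L2_norm_sq del: power_one_over)
      then have "L2_norm M (\<lambda>x. fs n x - f x) \<le> (1/2)^k" by (rule power2_le_imp_le) simp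
      then show "norm (L2_norm M (\<lambda>x. fs n x - f x) - 0) < e" using k by simp
    qed
  qed
  then show ?thesis using fs fL2 by (auto simp: L2_tendsto_def)
qed

lemma lborel_integrable_shift:
  fixes f :: "real \<Rightarrow> 'a :: {banach, second_countable_topology}"
  shows "integrable lborel (\<lambda>x. f (x - s)) \<longleftrightarrow> integrable lborel f"
    and "integrable lborel (\<lambda>x. f (s - x)) \<longleftrightarrow> integrable lborel f"
    and "integrable lborel (\<lambda>x. f (s + x)) \<longleftrightarrow> integrable lborel f"
    and "integrable lborel (\<lambda>x. f (x + s)) \<longleftrightarrow> integrable lborel f"
  using lborel_integrable_real_affine_iff[of 1 f "-s"] lborel_integrable_real_affine_iff[of "-1" f s]
    lborel_integrable_real_affine_iff[of 1 f s] by (simp_all add: add.commute)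

lemma lborel_integral_shift:
  fixes f :: "real \<Rightarrow> 'a :: {banach, second_countable_topology}"
  shows "(LINT x|lborel. f (x - s)) = (LINT x|lborel. f x)"
    and "(LINT x|lborel. f (s - x)) = (LINT x|lborel. f x)"
    and "(LINT x|lborel. f (s + x)) = (LINT x|lborel. f x)"
    and "(LINT x|lborel. f (x + s)) = (LINT x|lborel. f x)"
  using lborel_integral_real_affine[of 1 f "-s"] lborel_integral_real_affine[of "-1" f s]
    lborel_integral_real_affine[of 1 f s] by (simp_all add: add.commute)

lemma L2_tendsto_inner:
  assumes "L2_tendsto M fs f" "L2_tendsto M gs g"
  shows "(\<lambda>n. L2_inner M (fs n) (gs n)) \<longlonglongrightarrow> L2_inner M f g"
proof -
  note f = L2_tendstoD[OF assms(1)] and g = L2_tendstoD[OF assms(2)]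
  have "(\<lambda>n. L2_inner M (fs n) (gs n) - L2_inner M (fs n) g) \<longlonglongrightarrow> 0"
  proof (rule Lim_null_comparison[OF always_eventually], rule allI)
    fix n
    show "norm (L2_inner M (fs n) (gs n) - L2_inner M (fs n) g) \<le> L2_norm M (fs n) * L2_norm M (\<lambda>x. gs n x - g x)"
      using L2_cauchy_schwarz[OF f(1) L2_diff[OF g(1,2)], of n n] by (simp add: L2_inner_diff_right f g)
    show "(\<lambda>n. L2_norm M (fs n) * L2_norm M (\<lambda>x. gs n x - g x)) \<longlonglongrightarrow> 0"
      using tendsto_mult[OF L2_tendsto_norm[OF assms(1)] g(3)] by simp
  qed
  from tendsto_add[OF this L2_tendsto_inner_left[OF assms(1) g(2)]] show ?thesis by simp
qed

lemma L2_inner_nondegenerate: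
  assumes "f \<in> L2 M" "g \<in> L2 M" "\<And>u. u \<in> L2 M \<Longrightarrow> L2_inner M u f = L2_inner M u g"
  shows "AE x in M. f x = g x"
proof -
  let ?d = "\<lambda>x. f x - g x"
  have "L2_inner M ?d ?d = 0"
    using assms(3)[OF L2_diff[OF assms(1,2)]] by (simp add: L2_inner_diff_right assms L2_diff)
  then have "L2_norm M ?d = 0" by (simp add: L2_inner_self)
  then have "AE x in M. ?d x = 0" by (intro L2_norm_eq_0_AE L2_diff assms)
  then show ?thesis by eventually_elim simp
qed

lemma L2_norm_add_sq:
  assumes "f \<in> L2 M" "g \<in> L2 M"
  shows "(L2_norm M (\<lambda>x. f x + c * g x))\<^sup>2 = (L2_norm M f)\<^sup>2 + (norm c * L2_norm M g)\<^sup>2 + 2 * Re (cnj c * L2_inner M f g)"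
proof -
  have cg: "(\<lambda>x. c * g x) \<in> L2 M" using assms by auto
  have "complex_of_real ((L2_norm M (\<lambda>x. f x + c * g x))\<^sup>2) = L2_inner M (\<lambda>x. f x + c * g x) (\<lambda>x. f x + c * g x)"
    by (simp add: L2_inner_self)
  also have "\<dots> = L2_inner M f (\<lambda>x. f x + c * g x) + L2_inner M (\<lambda>x. c * g x) (\<lambda>x. f x + c * g x)"
    using assms cg by (intro L2_inner_add_left) auto
  also have "L2_inner M f (\<lambda>x. f x + c * g x) = cnj (L2_inner M (\<lambda>x. f x + c * g x) f)" by (simp add: L2_inner_cnj)
  also have "L2_inner M (\<lambda>x. f x + c * g x) f = L2_inner M f f + c * L2_inner M g f"
    using assms cg by (simp add: L2_inner_add_left L2_inner_cmult_left)
  also have "L2_inner M (\<lambda>x. c * g x) (\<lambda>x. f x + c * g x) = cnj (L2_inner M (\<lambda>x. f x + c * g x) (\<lambda>x. c * g x))" by (simp add: L2_inner_cnj)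
  also have "L2_inner M (\<lambda>x. f x + c * g x) (\<lambda>x. c * g x) = L2_inner M f (\<lambda>x. c * g x) + L2_inner M (\<lambda>x. c * g x) (\<lambda>x. c * g x)"
    using assms cg by (intro L2_inner_add_left) auto
  also have "L2_inner M f (\<lambda>x. c * g x) = cnj (c * L2_inner M g f)"
    by (simp add: L2_inner_cmult_left[symmetric] L2_inner_cnj)
  finally have "Re (complex_of_real ((L2_norm M (\<lambda>x. f x + c * g x))\<^sup>2)) = Re (cnj (L2_inner M f f + c * L2_inner M g f) +
    cnj (cnj (c * L2_inner M g f) + L2_inner M (\<lambda>x. c * g x) (\<lambda>x. c * g x)))" by (rule arg_cong)
  moreover have "Re (c * L2_inner M g f) = Re (cnj c * L2_inner M f g)"
    by (metis L2_inner_cnj complex_cnj_cnj complex_cnj_mult complex.sel(1) cnj.simps(1))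
  ultimately show ?thesis by (simp add: L2_inner_self L2_norm_cmult)
qed

text \<open>
  \<open>\<parallel>f + c g\<parallel>\<close> determines the real part of \<open>\<langle>f, g\<rangle>\<close> at \<open>c = 1\<close> and its imaginary part at \<open>c = i\<close>.
\<close>

lemma L2_polarization:
  assumes "f \<in> L2 M" "g \<in> L2 M" "F \<in> L2 N" "G \<in> L2 N"
    and "\<And>c. L2_norm M (\<lambda>x. f x + c * g x) = L2_norm N (\<lambda>x. F x + c * G x)"
    and "L2_norm M f = L2_norm N F" "L2_norm M g = L2_norm N G"
  shows "L2_inner M f g = L2_inner N F G"
proof -
  have "Re (cnj c * L2_inner M f g) = Re (cnj c * L2_inner N F G)" for c
    using L2_norm_add_sq[OF assms(1,2), of c] L2_norm_add_sq[OF assms(3,4), of c] assms(5-7) by simp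
  from this[of 1] this[of \<i>] show ?thesis by (auto intro: complex_eqI)
qed

section \<open>Translations\<close>

lemma L2_borel: "f \<in> L2 lborel \<Longrightarrow> f \<in> borel_measurable borel"
  using L2_measurable[of f lborel] by simp

lemma L2_truncation_tendsto:
  assumes f: "f \<in> L2 lborel"
  shows "L2_tendsto lborel (\<lambda>n x. if \<bar>x\<bar> \<le> real n \<and> norm (f x) \<le> real n then f x else 0) f"
proof (rule L2_tendsto_dominated[where w="\<lambda>x. norm (f x)"])
  note [measurable] = L2_measurable[OF f]
  show "(\<lambda>x. if \<bar>x\<bar> \<le> real n \<and> norm (f x) \<le> real n then f x else 0) \<in> borel_measurable lborel" for n
    by measurable
  show "AE x in lborel. (\<lambda>n. if \<bar>x\<bar> \<le> real n \<and> norm (f x) \<le> real n then f x else 0) \<longlonglongrightarrow> f x"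
  proof (rule AE_I2)
    fix x
    show "(\<lambda>n. if \<bar>x\<bar> \<le> real n \<and> norm (f x) \<le> real n then f x else 0) \<longlonglongrightarrow> f x"
    proof (rule tendsto_eventually, rule eventually_sequentiallyI[of "nat \<lceil>max \<bar>x\<bar> (norm (f x))\<rceil>"])
      fix n assume "nat \<lceil>max \<bar>x\<bar> (norm (f x))\<rceil> \<le> n"
      then have "max \<bar>x\<bar> (norm (f x)) \<le> real n" by linarith
      then show "(if \<bar>x\<bar> \<le> real n \<and> norm (f x) \<le> real n then f x else 0) = f x" by auto
    qed
  qed
qed (use f L2_sq_integrable L2_borel in auto)

lemma integrable_sq_indicator: "integrable lborel (\<lambda>x. (m * indicator {a..b::real} x)\<^sup>2 :: real)"
proof -
  have "integrable lborel (\<lambda>x. m\<^sup>2 * indicator {a..b} x)"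
    by (intro integrable_mult_right integrable_real_indicator) (auto simp: emeasure_lborel_Icc_eq)
  then show ?thesis
    by (rule back_subst[of "integrable lborel"]) (auto simp: power_mult_distrib indicator_def)
qed

text \<open>
  A measurable function is an almost everywhere limit of continuous functions.  A trapezoidal
  cutoff and a radial retraction of the values to the disc of radius \<open>m\<close> keep these continuous,
  leave the limit unchanged, and make them dominated.
\<close>

lemma L2_approx_continuous_bounded:
  assumes f: "f \<in> L2 lborel" and m: "m > 0" "\<And>x. norm (f x) \<le> m" "\<And>x. \<bar>x\<bar> > m \<Longrightarrow> f x = 0"
  shows "\<exists>gs. L2_tendsto lborel gs f \<and> (\<forall>n. continuous_on UNIV (gs n) \<and> (\<forall>x. norm (gs n x) \<le> m) \<and> (\<forall>x. \<bar>x\<bar> > m + 1 \<longrightarrow> gs n x = 0))"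
proof -
  have [measurable]: "f \<in> borel_measurable lborel" using f by (rule L2_measurable)
  then have "f \<in> borel_measurable lebesgue" by (rule measurable_completion)
  then have "f measurable_on UNIV"
    using measurable_on_iff_borel_measurable[of UNIV f] by simp
  then obtain N g where N: "negligible N" and g: "\<And>n. continuous_on UNIV (g n)"
    and lim: "\<And>x. x \<notin> N \<Longrightarrow> (\<lambda>n. g n x) \<longlonglongrightarrow> f x"
    by (auto simp: measurable_on_def)
  define gs where "gs n x = complex_of_real (max 0 (min 1 (m + 1 - \<bar>x\<bar>)) * (m / max m (norm (g n x)))) * g n x" for n x
  have cont: "continuous_on UNIV (gs n)" for n
    unfolding gs_def using m(1)
    by (intro continuous_intros continuous_on_compose2[OF g] g) (auto simp: max_def)
  have bd1: "norm (gs n x) \<le> m * max 0 (min 1 (m + 1 - \<bar>x\<bar>))" for n x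
  proof -
    have "m / max m (norm (g n x)) * norm (g n x) \<le> m"
      using m(1) by (auto simp: max_def field_simps)
    then have "max 0 (min 1 (m + 1 - \<bar>x\<bar>)) * (m / max m (norm (g n x)) * norm (g n x)) \<le> max 0 (min 1 (m + 1 - \<bar>x\<bar>)) * m"
      by (intro mult_left_mono) auto
    moreover have "norm (gs n x) = max 0 (min 1 (m + 1 - \<bar>x\<bar>)) * (m / max m (norm (g n x)) * norm (g n x))"
      unfolding gs_def norm_mult norm_of_real using m(1) by (auto simp: abs_mult)
    ultimately show ?thesis by (simp add: mult.commute)
  qed
  have bd: "norm (gs n x) \<le> m" for n x
  proof -
    have "m * max 0 (min 1 (m + 1 - \<bar>x\<bar>)) \<le> m * 1"
      using m(1) by (intro mult_left_mono) auto
    with bd1[of n x] show ?thesis by linarith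
  qed
  have supp: "gs n x = 0" if "\<bar>x\<bar> > m + 1" for n x
    using that by (simp add: gs_def)
  have "L2_tendsto lborel gs f"
  proof (rule L2_tendsto_dominated[where w="\<lambda>x. m * indicator {-(m+1)..m+1} x"])
    show "gs n \<in> borel_measurable lborel" for n
      using borel_measurable_continuous_onI[OF cont] by simp
    show "integrable lborel (\<lambda>x. (m * indicator {-(m+1)..m+1} x)\<^sup>2)" by (rule integrable_sq_indicator)
    have "N \<in> null_sets lebesgue" using N by (simp add: negligible_iff_null_sets)
    then have "AE x in lebesgue. x \<notin> N" by (rule AE_not_in)
    then have "AE x in lborel. x \<notin> N" by (simp add: AE_completion_iff)
    then show "AE x in lborel. (\<lambda>n. gs n x) \<longlonglongrightarrow> f x"
    proof eventually_elim
      case (elim x)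
      have "(\<lambda>n. gs n x) \<longlonglongrightarrow> complex_of_real (max 0 (min 1 (m + 1 - \<bar>x\<bar>)) * (m / max m (norm (f x)))) * f x"
        unfolding gs_def by (intro tendsto_intros lim elim) (use m(1) in auto)
      also have "complex_of_real (max 0 (min 1 (m + 1 - \<bar>x\<bar>)) * (m / max m (norm (f x)))) * f x = f x"
        using m(1) m(2)[of x] m(3)[of x] by (cases "\<bar>x\<bar> > m") (auto simp: max_def min_def)
      finally show ?case .
    qed
    show "AE x in lborel. norm (gs n x) \<le> m * indicator {-(m+1)..m+1} x" for n
      using bd supp by (auto simp: indicator_def not_le abs_if split: if_splits)
  qed auto
  then show ?thesis using cont bd supp by blast
qed

lemma L2_approx_continuous:
  assumes f: "f \<in> L2 lborel" and "e > 0"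
  obtains g m where "g \<in> L2 lborel" "continuous_on UNIV g" "\<And>x. norm (g x) \<le> m" "\<And>x. \<bar>x\<bar> > m \<Longrightarrow> g x = 0"
    "L2_norm lborel (\<lambda>x. f x - g x) < e"
proof -
  let ?t = "\<lambda>n x. if \<bar>x\<bar> \<le> real n \<and> norm (f x) \<le> real n then f x else 0"
  have T: "L2_tendsto lborel ?t f" by (rule L2_truncation_tendsto[OF f])
  obtain n0 where n0: "\<And>n. n \<ge> n0 \<Longrightarrow> norm (L2_norm lborel (\<lambda>x. ?t n x - f x) - 0) < e/2"
    using LIMSEQ_D[OF L2_tendstoD(3)[OF T], of "e/2"] assms(2) by auto
  define n where "n = Suc n0"
  have tL: "?t n \<in> L2 lborel" using L2_tendstoD(1)[OF T] .
  have "\<exists>gs. L2_tendsto lborel gs (?t n) \<and> (\<forall>k. continuous_on UNIV (gs k) \<and> (\<forall>x. norm (gs k x) \<le> real n) \<and> (\<forall>x. \<bar>x\<bar> > real n + 1 \<longrightarrow> gs k x = 0))"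
    by (rule L2_approx_continuous_bounded[OF tL]) (auto simp: n_def)
  then obtain gs where G: "L2_tendsto lborel gs (?t n)" and
    gs: "\<And>k. continuous_on UNIV (gs k)" "\<And>k x. norm (gs k x) \<le> real n" "\<And>k x. \<bar>x\<bar> > real n + 1 \<Longrightarrow> gs k x = 0" by blast
  obtain k where k: "norm (L2_norm lborel (\<lambda>x. gs k x - ?t n x) - 0) < e/2"
    using LIMSEQ_D[OF L2_tendstoD(3)[OF G], of "e/2"] assms(2) by auto
  have gL: "gs k \<in> L2 lborel" using L2_tendstoD(1)[OF G] .
  show thesis
  proof (rule that[OF gL gs(1)])
    show "norm (gs k x) \<le> real n + 1" for x using gs(2)[of k x] by simp
    show "\<And>x. \<bar>x\<bar> > real n + 1 \<Longrightarrow> gs k x = 0" using gs(3) by simp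
    have "L2_norm lborel (\<lambda>x. f x - gs k x) \<le> L2_norm lborel (\<lambda>x. f x - ?t n x) + L2_norm lborel (\<lambda>x. ?t n x - gs k x)"
      by (rule L2_norm_triangle_diff[OF f tL gL])
    also have "\<dots> = L2_norm lborel (\<lambda>x. ?t n x - f x) + L2_norm lborel (\<lambda>x. gs k x - ?t n x)"
      using L2_norm_minus_commute[of lborel f "?t n"] L2_norm_minus_commute[of lborel "gs k" "?t n"] by simp
    also have "\<dots> < e"
      using n0[of n] k by (simp add: n_def)
    finally show "L2_norm lborel (\<lambda>x. f x - gs k x) < e" .
  qed
qed

lemma L2_translate:
  fixes f :: "real \<Rightarrow> complex"
  assumes "f \<in> L2 lborel" shows "(\<lambda>x. f (x - s)) \<in> L2 lborel"
proof (rule L2_I)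
  show "integrable lborel (\<lambda>x. (norm (f (x - s)))\<^sup>2)"
    using lborel_integrable_shift(1)[of "\<lambda>x. (norm (f x))\<^sup>2" s] L2_sq_integrable[OF assms] by simp
qed (use L2_measurable[OF assms] in measurable)

lemma L2_norm_translate: fixes f :: "real \<Rightarrow> complex" shows "L2_norm lborel (\<lambda>x. f (x - s)) = L2_norm lborel f"
  using lborel_integral_shift(1)[of "\<lambda>x. (norm (f x))\<^sup>2" s] by (simp add: L2_norm_def)

text \<open>
  Dominated convergence gives the claim for continuous functions of compact support, and these are
  dense; translations are isometric, so the error of the approximation does not grow.
\<close>

lemma L2_translation_continuous:
  assumes f: "f \<in> L2 lborel" and s: "s \<longlonglongrightarrow> (0::real)"
  shows "L2_tendsto lborel (\<lambda>n x. f (x - s n)) f"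
proof (rule L2_tendstoI[OF L2_translate[OF f] f])
  show "(\<lambda>n. L2_norm lborel (\<lambda>x. f (x - s n) - f x)) \<longlonglongrightarrow> 0"
  proof (rule LIMSEQ_I)
    fix e :: real assume e: "e > 0"
    obtain g m where gL: "g \<in> L2 lborel" and g: "continuous_on UNIV g" "\<And>x. norm (g x) \<le> m" "\<And>x. \<bar>x\<bar> > m \<Longrightarrow> g x = 0"
      and fg: "L2_norm lborel (\<lambda>x. f x - g x) < e/3"
      using L2_approx_continuous[OF f, of "e/3"] e by auto
    have mm: "m \<ge> 0" using g(2)[of 0] norm_ge_zero[of "g 0"] by linarith
    obtain B where B: "\<And>n. \<bar>s n\<bar> \<le> B"
      using convergent_imp_Bseq[OF convergentI[OF s]] by (auto simp: Bseq_def)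
    have "L2_tendsto lborel (\<lambda>n x. g (x - s n)) g"
    proof (rule L2_tendsto_dominated[where w="\<lambda>x. m * indicator {-(m+B)..m+B} x"])
      note [measurable] = L2_measurable[OF gL]
      show "(\<lambda>x. g (x - s n)) \<in> borel_measurable lborel" for n by measurable
    show "integrable lborel (\<lambda>x. (m * indicator {-(m+B)..m+B} x)\<^sup>2)" by (rule integrable_sq_indicator)
      show "AE x in lborel. (\<lambda>n. g (x - s n)) \<longlonglongrightarrow> g x"
      proof (rule AE_I2)
        fix x
        have "(\<lambda>n. x - s n) \<longlonglongrightarrow> x - 0" by (intro tendsto_intros s)
        then show "(\<lambda>n. g (x - s n)) \<longlonglongrightarrow> g x"
          using continuous_on_tendsto_compose[OF g(1), of "\<lambda>n. x - s n" x sequentially] by auto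
      qed
      show "AE x in lborel. norm (g (x - s n)) \<le> m * indicator {-(m+B)..m+B} x" for n
      proof (rule AE_I2)
        fix x
        show "norm (g (x - s n)) \<le> m * indicator {-(m+B)..m+B} x"
        proof (cases "\<bar>x - s n\<bar> > m")
          case True then show ?thesis using g(3)[of "x - s n"] mm by simp
        next
          case False
          then have "x \<in> {-(m+B)..m+B}" using B[of n] by auto
          then show ?thesis using g(2)[of "x - s n"] by simp
        qed
      qed
    qed (use L2_measurable[OF gL] in auto)
    then obtain n0 where n0: "\<And>n. n \<ge> n0 \<Longrightarrow> norm (L2_norm lborel (\<lambda>x. g (x - s n) - g x) - 0) < e/3"
      using LIMSEQ_D[OF L2_tendstoD(3), of lborel "\<lambda>n x. g (x - s n)" g "e/3"] e by auto
    show "\<exists>no. \<forall>n\<ge>no. norm (L2_norm lborel (\<lambda>x. f (x - s n) - f x) - 0) < e"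
    proof (intro exI allI impI)
      fix n assume n: "n \<ge> n0"
      have "L2_norm lborel (\<lambda>x. f (x - s n) - f x) \<le> L2_norm lborel (\<lambda>x. f (x - s n) - g (x - s n)) + L2_norm lborel (\<lambda>x. g (x - s n) - f x)"
        by (rule L2_norm_triangle_diff) (intro L2_translate f gL)+
      also have "L2_norm lborel (\<lambda>x. g (x - s n) - f x) \<le> L2_norm lborel (\<lambda>x. g (x - s n) - g x) + L2_norm lborel (\<lambda>x. g x - f x)"
        by (rule L2_norm_triangle_diff) (intro L2_translate f gL)+
      also have "L2_norm lborel (\<lambda>x. f (x - s n) - g (x - s n)) = L2_norm lborel (\<lambda>x. f x - g x)"
        using L2_norm_translate[of "\<lambda>x. f x - g x" "s n"] by simp
      also have "L2_norm lborel (\<lambda>x. g x - f x) = L2_norm lborel (\<lambda>x. f x - g x)" by (rule L2_norm_minus_commute)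
      finally show "norm (L2_norm lborel (\<lambda>x. f (x - s n) - f x) - 0) < e"
        using fg n0[OF n] by simp
    qed
  qed
qed

section \<open>The Plancherel theorem\<close>

text \<open>
  On integrable functions; \<open>fourier_L2\<close> is its extension by continuity from truncated functions.
\<close>

definition fourier :: "(real \<Rightarrow> complex) \<Rightarrow> real \<Rightarrow> complex" where
  "fourier u \<xi> = complex_of_real ((2 * pi) powr (-1/2)) * (LINT x|lborel. u x * exp (- (\<i> * complex_of_real (x * \<xi>))))"

definition inv_fourier :: "(real \<Rightarrow> complex) \<Rightarrow> real \<Rightarrow> complex" where
  "inv_fourier u x = complex_of_real ((2 * pi) powr (-1/2)) * (LINT \<xi>|lborel. u \<xi> * exp (\<i> * complex_of_real (x * \<xi>)))"

lemma norm_exp_i [simp]: "norm (exp (\<i> * complex_of_real t)) = 1" "norm (exp (- (\<i> * complex_of_real t))) = 1"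
  by (auto simp: norm_exp_eq_Re)

lemma integrable_mult_unimodular:
  fixes u e :: "'a \<Rightarrow> complex"
  assumes "integrable M u" "e \<in> borel_measurable M" "\<And>x. norm (e x) \<le> 1"
  shows "integrable M (\<lambda>x. u x * e x)"
  by (rule Bochner_Integration.integrable_bound[OF assms(1)])
    (use assms in \<open>auto simp: norm_mult intro!: mult_left_le\<close>)

lemma inv_fourier_cnj: "inv_fourier u x = cnj (fourier (\<lambda>y. cnj (u y)) x)"
  unfolding inv_fourier_def fourier_def complex_cnj_mult Bochner_Integration.integral_cnj[symmetric]
  by (simp add: exp_cnj mult.commute)

lemma fourier_measurable [measurable]: "u \<in> borel_measurable borel \<Longrightarrow> fourier u \<in> borel_measurable borel"
  unfolding fourier_def[abs_def]
  by (intro borel_measurable_times borel_measurable_const lborel.borel_measurable_lebesgue_integral)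
    (simp add: case_prod_beta, measurable)

lemma inv_fourier_measurable [measurable]: "u \<in> borel_measurable borel \<Longrightarrow> inv_fourier u \<in> borel_measurable borel"
  unfolding inv_fourier_def[abs_def]
  by (intro borel_measurable_times borel_measurable_const lborel.borel_measurable_lebesgue_integral)
    (simp add: case_prod_beta, measurable)

lemma norm_fourier_le: "norm (fourier u \<xi>) \<le> (2 * pi) powr (-1/2) * (LINT x|lborel. norm (u x))"
proof -
  have "norm (LINT x|lborel. u x * exp (- (\<i> * complex_of_real (x * \<xi>)))) \<le> (LINT x|lborel. norm (u x * exp (- (\<i> * complex_of_real (x * \<xi>)))))"
    by (rule integral_norm_bound)
  also have "\<dots> = (LINT x|lborel. norm (u x))" by (simp only: norm_mult norm_exp_i mult_1_right)
  finally show ?thesis unfolding fourier_def norm_mult by (simp add: mult_left_mono)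
qed

lemma norm_inv_fourier_le: "norm (inv_fourier u x) \<le> (2 * pi) powr (-1/2) * (LINT x|lborel. norm (u x))"
  using norm_fourier_le[of "\<lambda>y. cnj (u y)" x] by (simp add: inv_fourier_cnj)

text \<open>
  Fubini's criterion for integrability on the plane, with a majorant for the inner integrals.
\<close>

lemma integrable_pairI:
  fixes F :: "real \<Rightarrow> real \<Rightarrow> complex"
  assumes F [measurable]: "(\<lambda>(x, y). F x y) \<in> borel_measurable (borel \<Otimes>\<^sub>M borel)"
    and A: "integrable lborel A"
    and Fx: "\<And>x. integrable lborel (F x)" "\<And>x. (LINT y|lborel. norm (F x y)) \<le> A x"
  shows "integrable (lborel \<Otimes>\<^sub>M lborel) (\<lambda>(x, y). F x y)"
proof (rule lborel_pair.Fubini_integrable)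
  show "integrable lborel (\<lambda>x. LINT y|lborel. norm (case (x, y) of (x, y) \<Rightarrow> F x y))"
    unfolding prod.case
  proof (rule Bochner_Integration.integrable_bound[OF A])
    have "0 \<le> (LINT y|lborel. norm (F x y))" for x by simp
    then show "AE x in lborel. norm (LINT y|lborel. norm (F x y)) \<le> norm (A x)"
      using Fx(2) order_trans[OF _ abs_ge_self] by auto
  qed measurable
qed (use Fx F in auto)

lemma integrable_pair_prod:
  fixes u w :: "real \<Rightarrow> complex"
  assumes u: "integrable lborel u" and w: "integrable lborel w"
  shows "integrable (lborel \<Otimes>\<^sub>M lborel) (\<lambda>(x, y). u x * w y)"
proof (rule integrable_pairI)
  note [measurable] = borel_measurable_integrable[OF u] borel_measurable_integrable[OF w]
  show "(\<lambda>(x, y). u x * w y) \<in> borel_measurable (borel \<Otimes>\<^sub>M borel)" by measurable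
  show "integrable lborel (\<lambda>x. norm (u x) * (LINT y|lborel. norm (w y)))" using u by simp
qed (use w in \<open>auto simp: norm_mult\<close>)

lemma Fubini_bounded_kernel:
  fixes u w :: "real \<Rightarrow> complex" and e :: "real \<Rightarrow> real \<Rightarrow> complex"
  assumes u: "integrable lborel u" and w: "integrable lborel w"
    and e: "(\<lambda>(x, y). e x y) \<in> borel_measurable (borel \<Otimes>\<^sub>M borel)" "\<And>x y. norm (e x y) \<le> C"
  shows "(LINT y|lborel. (LINT x|lborel. u x * e x y) * w y) = (LINT x|lborel. u x * (LINT y|lborel. w y * e x y))"
proof -
  note [measurable] = borel_measurable_integrable[OF u] borel_measurable_integrable[OF w]
  have [measurable]: "(\<lambda>p. e (fst p) (snd p)) \<in> borel_measurable (borel \<Otimes>\<^sub>M borel)"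
    using e(1) by (simp add: case_prod_beta)
  have "integrable (lborel \<Otimes>\<^sub>M lborel) (\<lambda>(x, y). u x * w y * e x y)"
  proof (rule Bochner_Integration.integrable_bound)
    show "integrable (lborel \<Otimes>\<^sub>M lborel) (\<lambda>p. complex_of_real C * (case p of (x, y) \<Rightarrow> u x * w y))"
      by (intro integrable_mult_right integrable_pair_prod u w)
    show "(\<lambda>(x, y). u x * w y * e x y) \<in> borel_measurable (lborel \<Otimes>\<^sub>M lborel)"
      unfolding case_prod_beta by measurable
    show "AE p in lborel \<Otimes>\<^sub>M lborel. norm (case p of (x, y) \<Rightarrow> u x * w y * e x y) \<le> norm (complex_of_real C * (case p of (x, y) \<Rightarrow> u x * w y))"
    proof (rule AE_I2, clarify)
      fix x y :: real
      have "norm (u x * w y) * norm (e x y) \<le> norm (u x * w y) * \<bar>C\<bar>"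
        by (intro mult_left_mono order_trans[OF e(2)]) auto
      then show "norm (u x * w y * e x y) \<le> norm (complex_of_real C * (u x * w y))"
        by (simp add: norm_mult mult_ac)
    qed
  qed
  from lborel_pair.Fubini_integral[OF this]
  have "(LINT y|lborel. LINT x|lborel. u x * w y * e x y) = (LINT x|lborel. LINT y|lborel. u x * w y * e x y)" .
  moreover have "(LINT x|lborel. u x * w y * e x y) = (LINT x|lborel. u x * e x y) * w y" for y
    by (subst integral_mult_left_zero[symmetric]) (simp add: mult_ac)
  moreover have "(LINT y|lborel. u x * w y * e x y) = u x * (LINT y|lborel. w y * e x y)" for x
    by (subst integral_mult_right_zero[symmetric]) (simp add: mult_ac)
  ultimately show ?thesis by simp
qed

lemma fourier_multiplication:
  assumes u: "integrable lborel u" and w: "integrable lborel w"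
  shows "(LINT \<xi>|lborel. fourier u \<xi> * w \<xi>) = (LINT x|lborel. u x * fourier w x)"
proof -
  have "(LINT \<xi>|lborel. (LINT x|lborel. u x * exp (- (\<i> * complex_of_real (x * \<xi>)))) * w \<xi>)
      = (LINT x|lborel. u x * (LINT \<xi>|lborel. w \<xi> * exp (- (\<i> * complex_of_real (x * \<xi>)))))"
    by (rule Fubini_bounded_kernel[OF u w, where C=1]) auto
  moreover have "(LINT \<xi>|lborel. fourier u \<xi> * w \<xi>) = complex_of_real ((2 * pi) powr (-1/2)) * (LINT \<xi>|lborel. (LINT x|lborel. u x * exp (- (\<i> * complex_of_real (x * \<xi>)))) * w \<xi>)"
    unfolding fourier_def by (subst integral_mult_right_zero[symmetric]) (simp add: mult_ac)
  moreover have "(LINT x|lborel. u x * fourier w x) = complex_of_real ((2 * pi) powr (-1/2)) * (LINT x|lborel. u x * (LINT \<xi>|lborel. w \<xi> * exp (- (\<i> * complex_of_real (x * \<xi>)))))"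
    unfolding fourier_def by (subst integral_mult_right_zero[symmetric]) (simp add: mult_ac)
  ultimately show ?thesis by simp
qed

lemma gaussian_fourier_integral:
  fixes s e :: real
  assumes "e > 0"
  shows "integrable lborel (\<lambda>\<xi>. exp (- (e * \<xi>)\<^sup>2 / 2))"
    and "(LINT \<xi>|lborel. complex_of_real (exp (- (e * \<xi>)\<^sup>2 / 2)) * exp (\<i> * complex_of_real (s * \<xi>)))
      = complex_of_real (sqrt (2 * pi) / e * exp (- (s / e)\<^sup>2 / 2))"
proof -
  have d: "exp (- \<eta>\<^sup>2 / 2) = sqrt (2 * pi) * std_normal_density \<eta>" for \<eta>
    by (simp add: std_normal_density_def)
  have i1: "integrable lborel (\<lambda>\<xi>::real. exp (- \<xi>\<^sup>2 / 2))"
    unfolding d by (intro integrable_mult_right integrable_normal_density) simp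
  from lborel_integrable_real_affine[OF this, of e 0] assms
  show "integrable lborel (\<lambda>\<xi>. exp (- (e * \<xi>)\<^sup>2 / 2))" by simp
  have "complex_of_real (exp (- (s / e)\<^sup>2 / 2)) = char std_normal_distribution (s / e)"
    by (simp add: char_std_normal_distribution)
  also have "\<dots> = (LINT x|lborel. std_normal_density x *\<^sub>R exp (\<i> * complex_of_real (s / e * x)))"
    unfolding char_def by (subst integral_density) auto
  finally have c: "(LINT x|lborel. std_normal_density x *\<^sub>R exp (\<i> * complex_of_real (s / e * x))) = complex_of_real (exp (- (s / e)\<^sup>2 / 2))" by simp
  have "(LINT x|lborel. complex_of_real (exp (- x\<^sup>2 / 2)) * exp (\<i> * complex_of_real (s / e * x)))
    = complex_of_real (sqrt (2 * pi)) * (LINT x|lborel. std_normal_density x *\<^sub>R exp (\<i> * complex_of_real (s / e * x)))"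
    unfolding d by (subst integral_mult_right_zero[symmetric]) (simp add: scaleR_conv_of_real mult_ac)
  then have "(LINT x|lborel. complex_of_real (exp (- x\<^sup>2 / 2)) * exp (\<i> * complex_of_real (s / e * x)))
     = complex_of_real (sqrt (2 * pi) * exp (- (s / e)\<^sup>2 / 2))" unfolding c by simp
  moreover have "(LINT x|lborel. complex_of_real (exp (- x\<^sup>2 / 2)) * exp (\<i> * complex_of_real (s / e * x)))
    = \<bar>e\<bar> *\<^sub>R (LINT \<xi>|lborel. complex_of_real (exp (- (e * \<xi>)\<^sup>2 / 2)) * exp (\<i> * complex_of_real (s * \<xi>)))"
    using assms lborel_integral_real_affine[of e "\<lambda>x. complex_of_real (exp (- x\<^sup>2 / 2)) * exp (\<i> * complex_of_real (s / e * x))" 0]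
    by simp
  ultimately show "(LINT \<xi>|lborel. complex_of_real (exp (- (e * \<xi>)\<^sup>2 / 2)) * exp (\<i> * complex_of_real (s * \<xi>)))
      = complex_of_real (sqrt (2 * pi) / e * exp (- (s / e)\<^sup>2 / 2))"
    using assms by (simp add: scaleR_conv_of_real field_simps)
qed

text \<open>
  The multiplication formula, applied twice, moves the transform onto the Gaussian weight.  The
  transform of the weight is a Gaussian of width \<open>e\<close>, so what remains is the autocorrelation of
  \<open>u\<close> averaged over shifts of size \<open>e\<close>.
\<close>

lemma fourier_gaussian_energy:
  assumes u: "integrable lborel u" "u \<in> L2 lborel" and e: "e > 0"
  shows "(LINT \<xi>|lborel. (norm (fourier u \<xi>))\<^sup>2 * exp (- (e * \<xi>)\<^sup>2 / 2))
    = Re (LINT r|lborel. complex_of_real (exp (- r\<^sup>2 / 2) / sqrt (2 * pi)) * L2_inner lborel u (\<lambda>x. u (x - (- e * r))))"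
    and "integrable lborel (\<lambda>\<xi>. (norm (fourier u \<xi>))\<^sup>2 * exp (- (e * \<xi>)\<^sup>2 / 2))"
proof -
  let ?c = "complex_of_real ((2 * pi) powr (-1/2))"
  let ?p = "\<lambda>\<xi>. complex_of_real (exp (- (e * \<xi>)\<^sup>2 / 2))"
  note [measurable] = borel_measurable_integrable[OF u(1)]
  have p: "integrable lborel ?p" using gaussian_fourier_integral(1)[OF e] by (rule integrable_of_real)
  define B where "B = (2 * pi) powr (-1/2) * (LINT x|lborel. norm (u x))"
  have B: "norm (fourier u \<xi>) \<le> B" for \<xi> unfolding B_def by (rule norm_fourier_le)
  show int: "integrable lborel (\<lambda>\<xi>. (norm (fourier u \<xi>))\<^sup>2 * exp (- (e * \<xi>)\<^sup>2 / 2))"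
  proof (rule Bochner_Integration.integrable_bound)
    show "integrable lborel (\<lambda>\<xi>. B\<^sup>2 * exp (- (e * \<xi>)\<^sup>2 / 2))"
      by (intro integrable_mult_right gaussian_fourier_integral(1)[OF e])
    show "AE \<xi> in lborel. norm ((norm (fourier u \<xi>))\<^sup>2 * exp (- (e * \<xi>)\<^sup>2 / 2)) \<le> norm (B\<^sup>2 * exp (- (e * \<xi>)\<^sup>2 / 2))"
      using B by (auto intro!: mult_right_mono power_mono)
  qed measurable
  have w: "integrable lborel (\<lambda>\<xi>. cnj (fourier u \<xi>) * ?p \<xi>)"
  proof (rule Bochner_Integration.integrable_bound)
    show "integrable lborel (\<lambda>\<xi>. complex_of_real B * ?p \<xi>)" by (intro integrable_mult_right p)
    show "AE \<xi> in lborel. norm (cnj (fourier u \<xi>) * ?p \<xi>) \<le> norm (complex_of_real B * ?p \<xi>)"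
      using B by (auto simp: norm_mult intro!: mult_right_mono intro: order_trans[OF B abs_ge_self])
  qed measurable
  have K: "fourier (\<lambda>\<xi>. ?p \<xi> * exp (\<i> * complex_of_real (x * \<xi>))) y = complex_of_real (1 / e * exp (- ((x - y) / e)\<^sup>2 / 2))" for x y
  proof -
    have "exp (\<i> * complex_of_real (x * \<xi>)) * exp (- (\<i> * complex_of_real (\<xi> * y))) = exp (\<i> * complex_of_real ((x - y) * \<xi>))" for \<xi>
      by (simp add: exp_add[symmetric] algebra_simps)
    then have "fourier (\<lambda>\<xi>. ?p \<xi> * exp (\<i> * complex_of_real (x * \<xi>))) y = ?c * (LINT \<xi>|lborel. ?p \<xi> * exp (\<i> * complex_of_real ((x - y) * \<xi>)))"
      unfolding fourier_def mult.assoc by simp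
    also have "\<dots> = ?c * complex_of_real (sqrt (2 * pi)) * complex_of_real (1 / e * exp (- ((x - y) / e)\<^sup>2 / 2))"
      unfolding gaussian_fourier_integral(2)[OF e] by simp
    also have "?c * complex_of_real (sqrt (2 * pi)) = 1"
      unfolding of_real_mult[symmetric] by (simp add: powr_minus_divide powr_half_sqrt)
    finally show ?thesis by simp
  qed
  have F: "fourier (\<lambda>\<xi>. cnj (fourier u \<xi>) * ?p \<xi>) x
     = ?c * (LINT r|lborel. complex_of_real (exp (- r\<^sup>2 / 2)) * cnj (u (x + e * r)))" for x
  proof -
    have "(LINT \<xi>|lborel. cnj (fourier u \<xi>) * ?p \<xi> * exp (- (\<i> * complex_of_real (\<xi> * x))))
       = cnj (LINT \<xi>|lborel. fourier u \<xi> * (?p \<xi> * exp (\<i> * complex_of_real (x * \<xi>))))"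
      unfolding Bochner_Integration.integral_cnj[symmetric] by (simp add: exp_cnj mult_ac)
    also have "(LINT \<xi>|lborel. fourier u \<xi> * (?p \<xi> * exp (\<i> * complex_of_real (x * \<xi>))))
       = (LINT y|lborel. u y * fourier (\<lambda>\<xi>. ?p \<xi> * exp (\<i> * complex_of_real (x * \<xi>))) y)"
      by (intro fourier_multiplication u integrable_mult_unimodular p) auto
    also have "\<dots> = (LINT y|lborel. u y * complex_of_real (1 / e * exp (- ((x - y) / e)\<^sup>2 / 2)))"
      unfolding K ..
    also have "\<dots> = e *\<^sub>R (LINT r|lborel. u (x + e * r) * complex_of_real (1 / e * exp (- r\<^sup>2 / 2)))"
      using e by (subst lborel_integral_real_affine[of e _ x]) auto
    also have "\<dots> = (LINT r|lborel. complex_of_real (exp (- r\<^sup>2 / 2)) * u (x + e * r))"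
      using e by (subst integral_scaleR_right[symmetric]) (simp add: scaleR_conv_of_real field_simps)
    finally show ?thesis
      unfolding fourier_def[of "\<lambda>\<xi>. cnj (fourier u \<xi>) * ?p \<xi>"] Bochner_Integration.integral_cnj[symmetric] by simp
  qed
  have "complex_of_real (LINT \<xi>|lborel. (norm (fourier u \<xi>))\<^sup>2 * exp (- (e * \<xi>)\<^sup>2 / 2))
    = (LINT \<xi>|lborel. fourier u \<xi> * (cnj (fourier u \<xi>) * ?p \<xi>))"
    unfolding integral_complex_of_real[symmetric] of_real_mult complex_norm_square mult.assoc ..
  also have "\<dots> = (LINT x|lborel. u x * fourier (\<lambda>\<xi>. cnj (fourier u \<xi>) * ?p \<xi>) x)"
    by (intro fourier_multiplication u w)
  also have "\<dots> = ?c * (LINT x|lborel. LINT r|lborel. u x * cnj (u (x + e * r)) * complex_of_real (exp (- r\<^sup>2 / 2)))"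
    unfolding F by (subst integral_mult_right_zero[symmetric])+ (simp add: mult_ac)
  also have "(LINT x|lborel. LINT r|lborel. u x * cnj (u (x + e * r)) * complex_of_real (exp (- r\<^sup>2 / 2)))
    = (LINT r|lborel. LINT x|lborel. u x * cnj (u (x + e * r)) * complex_of_real (exp (- r\<^sup>2 / 2)))"
  proof (rule lborel_pair.Fubini_integral[symmetric], rule integrable_pairI)
    show "(\<lambda>(x, r). u x * cnj (u (x + e * r)) * complex_of_real (exp (- r\<^sup>2 / 2))) \<in> borel_measurable (borel \<Otimes>\<^sub>M borel)"
      by measurable
    have ur: "integrable lborel (\<lambda>r. u (x + e * r))" for x
      using lborel_integrable_real_affine[OF u(1), of e x] e by simp
    have ir: "integrable lborel (\<lambda>r. cnj (u (x + e * r)) * complex_of_real (exp (- r\<^sup>2 / 2)))" for x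
      by (rule integrable_mult_unimodular) (use ur in auto)
    then show "integrable lborel (\<lambda>r. u x * cnj (u (x + e * r)) * complex_of_real (exp (- r\<^sup>2 / 2)))" for x
      by (simp add: mult.assoc)
    show "integrable lborel (\<lambda>x. norm (u x) * (1 / e * (LINT y|lborel. norm (u y))))"
      using u by (intro integrable_mult_left integrable_norm)
    fix x
    have "(LINT r|lborel. norm (cnj (u (x + e * r)) * complex_of_real (exp (- r\<^sup>2 / 2)))) \<le> (LINT r|lborel. norm (u (x + e * r)))"
      by (intro integral_mono integrable_norm ir ur) (auto simp: norm_mult intro!: mult_left_le)
    also have "\<dots> = 1 / e * (LINT y|lborel. norm (u y))"
      using e lborel_integral_real_affine[of e "\<lambda>y. norm (u y)" x] by simp
    finally have "norm (u x) * (LINT r|lborel. norm (cnj (u (x + e * r)) * complex_of_real (exp (- r\<^sup>2 / 2)))) \<le> norm (u x) * (1 / e * (LINT y|lborel. norm (u y)))"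
      by (intro mult_left_mono) auto
    then show "(LINT r|lborel. norm (u x * cnj (u (x + e * r)) * complex_of_real (exp (- r\<^sup>2 / 2)))) \<le> norm (u x) * (1 / e * (LINT y|lborel. norm (u y)))"
      by (simp add: norm_mult mult.assoc)
  qed
  also have "?c * \<dots> = (LINT r|lborel. complex_of_real (exp (- r\<^sup>2 / 2) / sqrt (2 * pi)) * L2_inner lborel u (\<lambda>x. u (x - (- e * r))))"
  proof -
    have "(LINT x|lborel. u x * cnj (u (x + e * r)) * complex_of_real (exp (- r\<^sup>2 / 2))) = complex_of_real (exp (- r\<^sup>2 / 2)) * L2_inner lborel u (\<lambda>x. u (x - (- e * r)))" for r
      unfolding L2_inner_def by (subst integral_mult_right_zero[symmetric]) (simp add: mult_ac)
    moreover have "(2 * pi) powr (-1/2) = 1 / sqrt (2 * pi)" by (simp add: powr_minus_divide powr_half_sqrt)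
    ultimately show ?thesis by (subst integral_mult_right_zero[symmetric]) (simp add: mult_ac)
  qed
  finally show "(LINT \<xi>|lborel. (norm (fourier u \<xi>))\<^sup>2 * exp (- (e * \<xi>)\<^sup>2 / 2))
    = Re (LINT r|lborel. complex_of_real (exp (- r\<^sup>2 / 2) / sqrt (2 * pi)) * L2_inner lborel u (\<lambda>x. u (x - (- e * r))))"
    by (metis Re_complex_of_real)
qed

text \<open>
  Let the width of the Gaussian weight tend to infinity.  The weighted energies increase to the
  energy of the transform, while the averaged autocorrelations tend to \<open>\<langle>u, u\<rangle>\<close> because
  translations are continuous in \<open>L\<^sup>2\<close>.
\<close>

theorem plancherel_L1_L2:
  assumes u: "integrable lborel u" "u \<in> L2 lborel"
  shows "fourier u \<in> L2 lborel" "L2_norm lborel (fourier u) = L2_norm lborel u"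
proof -
  note [measurable] = borel_measurable_integrable[OF u(1)]
  define e where "e n = inverse (real (Suc n))" for n
  have e0: "e n > 0" for n by (simp add: e_def)
  have elim: "e \<longlonglongrightarrow> 0" unfolding e_def by (rule LIMSEQ_inverse_real_of_nat)
  let ?f = "\<lambda>n \<xi>. (norm (fourier u \<xi>))\<^sup>2 * exp (- (e n * \<xi>)\<^sup>2 / 2)"
  let ?g = "\<lambda>r. complex_of_real (exp (- r\<^sup>2 / 2) / sqrt (2 * pi))"
  have g: "integrable lborel ?g" using gaussian_fourier_integral(1)[of 1] by simp
  have gint: "(LINT r|lborel. ?g r * L2_inner lborel u u) = L2_inner lborel u u"
  proof -
    have "(LINT r|lborel. ?g r) = complex_of_real (LINT r|lborel. std_normal_density r)"
      unfolding integral_complex_of_real[symmetric] by (simp add: std_normal_density_def)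
    also have "\<dots> = 1" by (simp add: integral_normal_density)
    finally show ?thesis by simp
  qed
  have lim: "(\<lambda>n. LINT r|lborel. ?g r * L2_inner lborel u (\<lambda>x. u (x - (- e n * r)))) \<longlonglongrightarrow> (LINT r|lborel. ?g r * L2_inner lborel u u)"
  proof (rule integral_dominated_convergence)
    show "integrable lborel (\<lambda>r. norm (?g r) * (L2_norm lborel u)\<^sup>2)" by (intro integrable_mult_left integrable_norm g)
    show "(\<lambda>r. ?g r * L2_inner lborel u (\<lambda>x. u (x - (- e n * r)))) \<in> borel_measurable lborel" for n
      unfolding L2_inner_def by measurable
    show "AE r in lborel. (\<lambda>n. ?g r * L2_inner lborel u (\<lambda>x. u (x - (- e n * r)))) \<longlonglongrightarrow> ?g r * L2_inner lborel u u"
    proof (intro AE_I2 tendsto_mult_left L2_tendsto_inner_right L2_translation_continuous u)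
      show "(\<lambda>n. - e n * r) \<longlonglongrightarrow> 0" for r
        using tendsto_mult_left_zero[OF elim, of "-r"] by simp
    qed
    show "AE r in lborel. norm (?g r * L2_inner lborel u (\<lambda>x. u (x - (- e n * r)))) \<le> norm (?g r) * (L2_norm lborel u)\<^sup>2" for n
    proof (rule AE_I2)
      fix r
      have "norm (L2_inner lborel u (\<lambda>x. u (x - (- e n * r)))) \<le> L2_norm lborel u * L2_norm lborel (\<lambda>x. u (x - (- e n * r)))"
        by (intro L2_cauchy_schwarz u L2_translate)
      also have "\<dots> = (L2_norm lborel u)\<^sup>2" unfolding L2_norm_translate by (simp add: power2_eq_square)
      finally show "norm (?g r * L2_inner lborel u (\<lambda>x. u (x - (- e n * r)))) \<le> norm (?g r) * (L2_norm lborel u)\<^sup>2"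
        unfolding norm_mult by (rule mult_left_mono) simp
    qed
  qed simp
  have ilim: "(\<lambda>n. LINT \<xi>|lborel. ?f n \<xi>) \<longlonglongrightarrow> (L2_norm lborel u)\<^sup>2"
    using tendsto_Re[OF lim] unfolding gint fourier_gaussian_energy(1)[OF u e0, symmetric]
    unfolding L2_inner_self Re_complex_of_real .
  have mono: "mono (\<lambda>n. ?f n \<xi>)" for \<xi>
  proof (intro monoI mult_left_mono)
    fix m n :: nat assume "m \<le> n"
    then have "e n \<le> e m" by (simp add: e_def field_simps)
    then have "(e n * \<xi>)\<^sup>2 \<le> (e m * \<xi>)\<^sup>2"
      using e0[of n] by (simp add: power_mult_distrib mult_right_mono power_mono)
    then show "exp (- (e m * \<xi>)\<^sup>2 / 2) \<le> exp (- (e n * \<xi>)\<^sup>2 / 2)" by simp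
  qed auto
  have pl: "(\<lambda>n. ?f n \<xi>) \<longlonglongrightarrow> (norm (fourier u \<xi>))\<^sup>2" for \<xi>
  proof -
    have "(\<lambda>n. ?f n \<xi>) \<longlonglongrightarrow> (norm (fourier u \<xi>))\<^sup>2 * exp (- (0 * \<xi>)\<^sup>2 / 2)"
      by (intro tendsto_intros elim) auto
    then show ?thesis by simp
  qed
  note mc = integrable_monotone_convergence[OF fourier_gaussian_energy(2)[OF u e0] AE_I2[OF mono] AE_I2[OF pl] ilim]
    integral_monotone_convergence[OF fourier_gaussian_energy(2)[OF u e0] AE_I2[OF mono] AE_I2[OF pl] ilim]
  show "fourier u \<in> L2 lborel" by (rule L2_I) (use mc(1) in auto)
  show "L2_norm lborel (fourier u) = L2_norm lborel u"
    unfolding L2_norm_def[of _ "fourier u"] using mc(2) by simp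
qed

section \<open>The Fourier transform on \<open>L\<^sup>2\<close>\<close>

definition truncate_to :: "nat \<Rightarrow> (real \<Rightarrow> complex) \<Rightarrow> real \<Rightarrow> complex" where
  "truncate_to N u x = (if \<bar>x\<bar> \<le> real N then u x else 0)"

lemma truncate_to_measurable [measurable (raw)]:
  assumes [measurable]: "u \<in> borel_measurable borel" shows "truncate_to N u \<in> borel_measurable borel"
  unfolding truncate_to_def[abs_def] by measurable

lemma norm_truncate_to_le: "norm (truncate_to N u x) \<le> norm (u x)"
  by (simp add: truncate_to_def)

lemma truncate_to_L2: "u \<in> L2 lborel \<Longrightarrow> truncate_to N u \<in> L2 lborel"
  by (rule L2_dominated[OF L2_sq_integrable]) (auto simp: norm_truncate_to_le dest: L2_borel)

lemma truncate_to_L1: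
  assumes "u \<in> L2 lborel" shows "integrable lborel (truncate_to N u)"
proof -
  let ?I = "\<lambda>x. complex_of_real (indicator {-real N..real N} x)"
  have "integrable lborel (\<lambda>x. (1 * indicator {-real N..real N} x)\<^sup>2 :: real)" by (rule integrable_sq_indicator)
  then have "?I \<in> L2 lborel" by (intro L2_I) auto
  from L2_mult_integrable[OF this assms] show ?thesis
    by (rule back_subst[of "integrable lborel"]) (auto simp: truncate_to_def indicator_def fun_eq_iff)
qed

lemma truncate_to_tendsto:
  assumes "u \<in> L2 lborel" shows "L2_tendsto lborel (\<lambda>N. truncate_to N u) u"
proof (rule L2_tendsto_dominated[OF _ _ L2_sq_integrable[OF assms]])
  show "AE x in lborel. (\<lambda>N. truncate_to N u x) \<longlonglongrightarrow> u x"
  proof (rule AE_I2, rule tendsto_eventually)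
    fix x show "\<forall>\<^sub>F N in sequentially. truncate_to N u x = u x"
      by (rule eventually_sequentiallyI[of "nat \<lceil>\<bar>x\<bar>\<rceil>"]) (auto simp: truncate_to_def nat_le_iff ceiling_le_iff)
  qed
qed (use L2_borel[OF assms] norm_truncate_to_le in auto)

lemma fourier_add: "integrable lborel u \<Longrightarrow> integrable lborel w \<Longrightarrow> fourier (\<lambda>x. u x + c * w x) \<xi> = fourier u \<xi> + c * fourier w \<xi>"
proof -
  assume "integrable lborel u" "integrable lborel w"
  then have "integrable lborel (\<lambda>x. u x * exp (- (\<i> * complex_of_real (x * \<xi>))))" "integrable lborel (\<lambda>x. c * (w x * exp (- (\<i> * complex_of_real (x * \<xi>)))))"
    by (auto intro!: integrable_mult_unimodular integrable_mult_right)
  then show ?thesis unfolding fourier_def distrib_right mult.assoc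
    by (simp add: distrib_left)
qed

lemma fourier_L2_iff:
  "(u, w) \<in> fourier_L2 \<longleftrightarrow> u \<in> L2 lborel \<and> L2_tendsto lborel (\<lambda>N. fourier (truncate_to N u)) w"
proof -
  have "(LINT x:{- real N..real N}|lborel. u x * exp (- (\<i> * complex_of_real (x * \<xi>))))
    = (LINT x|lborel. truncate_to N u x * exp (- (\<i> * complex_of_real (x * \<xi>))))" for N \<xi>
    unfolding set_lebesgue_integral_def
    by (intro Bochner_Integration.integral_cong) (auto simp: truncate_to_def indicator_def)
  then show ?thesis unfolding fourier_L2_def fourier_def[abs_def] by simp
qed

lemma fourier_L2_D:
  assumes "(u, w) \<in> fourier_L2"
  shows "u \<in> L2 lborel" "w \<in> L2 lborel" "L2_tendsto lborel (\<lambda>N. fourier (truncate_to N u)) w"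
  using assms L2_tendstoD(2) by (auto simp: fourier_L2_iff)

lemma fourier_tendsto:
  assumes us: "\<And>n. integrable lborel (us n)" "L2_tendsto lborel us u" and u: "integrable lborel u"
  shows "L2_tendsto lborel (\<lambda>n. fourier (us n)) (fourier u)"
proof (rule L2_tendstoI)
  note L = L2_tendstoD[OF us(2)]
  show "fourier (us n) \<in> L2 lborel" for n by (intro plancherel_L1_L2 us L)
  show "fourier u \<in> L2 lborel" by (intro plancherel_L1_L2 u L)
  have "L2_norm lborel (\<lambda>\<xi>. fourier (us n) \<xi> - fourier u \<xi>) = L2_norm lborel (\<lambda>x. us n x - u x)" for n
  proof -
    have "fourier (\<lambda>x. us n x - u x) = (\<lambda>\<xi>. fourier (us n) \<xi> - fourier u \<xi>)"
      using fourier_add[OF us(1) u, of n "-1"] by (intro ext) simp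
    then show ?thesis using plancherel_L1_L2(2)[OF Bochner_Integration.integrable_diff[OF us(1) u] L2_diff[OF L(1,2)], of n] by simp
  qed
  then show "(\<lambda>n. L2_norm lborel (\<lambda>\<xi>. fourier (us n) \<xi> - fourier u \<xi>)) \<longlonglongrightarrow> 0" using L(3) by simp
qed

lemma fourier_L2_of_L1:
  assumes "integrable lborel u" "u \<in> L2 lborel" shows "(u, fourier u) \<in> fourier_L2"
  unfolding fourier_L2_iff
  by (intro conjI assms fourier_tendsto truncate_to_L1 truncate_to_tendsto)

lemma fourier_L2_total:
  assumes u: "u \<in> L2 lborel" obtains w where "(u, w) \<in> fourier_L2"
proof -
  note t = truncate_to_L1[OF u] truncate_to_L2[OF u]
  have "\<exists>w. L2_tendsto lborel (\<lambda>N. fourier (truncate_to N u)) w"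
  proof (rule L2_norm_cauchy_imp_convergent)
    show "fourier (truncate_to n u) \<in> L2 lborel" for n by (intro plancherel_L1_L2 t)
    fix e :: real assume "e > 0"
    then obtain N where N: "\<And>n. n \<ge> N \<Longrightarrow> norm (L2_norm lborel (\<lambda>x. truncate_to n u x - u x) - 0) < e/2"
      using LIMSEQ_D[OF L2_tendstoD(3)[OF truncate_to_tendsto[OF u]], of "e/2"] by auto
    show "\<exists>N. \<forall>m\<ge>N. \<forall>n\<ge>N. L2_norm lborel (\<lambda>x. fourier (truncate_to m u) x - fourier (truncate_to n u) x) < e"
    proof (intro exI allI impI)
      fix m n assume mn: "N \<le> m" "N \<le> n"
      have "L2_norm lborel (\<lambda>x. fourier (truncate_to m u) x - fourier (truncate_to n u) x) = L2_norm lborel (\<lambda>x. truncate_to m u x - truncate_to n u x)"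
      proof -
        have "fourier (\<lambda>x. truncate_to m u x - truncate_to n u x) = (\<lambda>\<xi>. fourier (truncate_to m u) \<xi> - fourier (truncate_to n u) \<xi>)"
          using fourier_add[OF t(1) t(1), of m "-1" n] by (intro ext) simp
        then show ?thesis using plancherel_L1_L2(2)[OF Bochner_Integration.integrable_diff[OF t(1) t(1)] L2_diff[OF t(2) t(2)], of m n] by simp
      qed
      also have "\<dots> \<le> L2_norm lborel (\<lambda>x. truncate_to m u x - u x) + L2_norm lborel (\<lambda>x. u x - truncate_to n u x)"
        by (intro L2_norm_triangle_diff t u)
      also have "\<dots> < e" using N[OF mn(1)] N[OF mn(2)] L2_norm_minus_commute[of lborel u] by simp
      finally show "L2_norm lborel (\<lambda>x. fourier (truncate_to m u) x - fourier (truncate_to n u) x) < e" .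
    qed
  qed
  then show thesis using that u by (auto simp: fourier_L2_iff)
qed

lemma fourier_L2_norm:
  assumes "(u, w) \<in> fourier_L2" shows "L2_norm lborel w = L2_norm lborel u"
proof (rule LIMSEQ_unique)
  note D = fourier_L2_D[OF assms]
  show "(\<lambda>N. L2_norm lborel (fourier (truncate_to N u))) \<longlonglongrightarrow> L2_norm lborel w" by (rule L2_tendsto_norm[OF D(3)])
  show "(\<lambda>N. L2_norm lborel (fourier (truncate_to N u))) \<longlonglongrightarrow> L2_norm lborel u"
    unfolding plancherel_L1_L2(2)[OF truncate_to_L1[OF D(1)] truncate_to_L2[OF D(1)]]
    by (rule L2_tendsto_norm[OF truncate_to_tendsto[OF D(1)]])
qed

lemma fourier_L2_add:
  assumes "(u, w) \<in> fourier_L2" "(u', w') \<in> fourier_L2"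
  shows "(\<lambda>x. u x + c * u' x, \<lambda>x. w x + c * w' x) \<in> fourier_L2"
proof -
  note D = fourier_L2_D[OF assms(1)] and D' = fourier_L2_D[OF assms(2)]
  have "truncate_to N (\<lambda>x. u x + c * u' x) = (\<lambda>x. truncate_to N u x + c * truncate_to N u' x)" for N
    by (auto simp: truncate_to_def)
  then have "fourier (truncate_to N (\<lambda>x. u x + c * u' x)) = (\<lambda>\<xi>. fourier (truncate_to N u) \<xi> + c * fourier (truncate_to N u') \<xi>)" for N
    using fourier_add[OF truncate_to_L1[OF D(1)] truncate_to_L1[OF D'(1)]] by auto
  then show ?thesis unfolding fourier_L2_iff
    using L2_tendsto_add[OF D(3) L2_tendsto_cmult[OF D'(3), of c]] D(1) D'(1) by auto
qed

lemma fourier_L2_inner: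
  assumes "(u, w) \<in> fourier_L2" "(u', w') \<in> fourier_L2"
  shows "L2_inner lborel u u' = L2_inner lborel w w'"
  using fourier_L2_D[OF assms(1)] fourier_L2_D[OF assms(2)]
  by (intro L2_polarization fourier_L2_norm[symmetric] assms fourier_L2_add) auto

lemma fourier_L2_unique:
  assumes "(u, w) \<in> fourier_L2" "(u', w') \<in> fourier_L2" "AE x in lborel. u x = u' x"
  shows "AE x in lborel. w x = w' x"
proof -
  note D = fourier_L2_D[OF assms(1)] and D' = fourier_L2_D[OF assms(2)]
  have "L2_norm lborel (\<lambda>x. w x + (-1) * w' x) = L2_norm lborel (\<lambda>x. u x + (-1) * u' x)"
    by (rule fourier_L2_norm[OF fourier_L2_add[OF assms(1,2)]])
  also have "\<dots> = L2_norm lborel (\<lambda>x::real. 0)"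
    by (rule L2_norm_cong_AE) (use D D' assms(3) L2_borel in auto)
  finally have "L2_norm lborel (\<lambda>x. w x - w' x) = 0" by (simp add: L2_norm_def)
  then have "AE x in lborel. w x - w' x = 0" by (intro L2_norm_eq_0_AE L2_diff D D')
  then show ?thesis by eventually_elim simp
qed

lemma fourier_L2_multiplication:
  assumes "(u, w) \<in> fourier_L2" "(u', w') \<in> fourier_L2"
  shows "L2_inner lborel w (\<lambda>x. cnj (u' x)) = L2_inner lborel u (\<lambda>x. cnj (w' x))"
proof (rule LIMSEQ_unique)
  note D = fourier_L2_D[OF assms(1)] and D' = fourier_L2_D[OF assms(2)]
  have cnj_lim: "L2_tendsto lborel (\<lambda>n x. cnj (fs n x)) (\<lambda>x. cnj (f x))" if "L2_tendsto lborel fs f" for fs f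
    using that by (auto simp: L2_tendsto_def L2_norm_def simp flip: complex_cnj_diff)
  show "(\<lambda>N. L2_inner lborel (fourier (truncate_to N u)) (\<lambda>x. cnj (truncate_to N u' x))) \<longlonglongrightarrow> L2_inner lborel w (\<lambda>x. cnj (u' x))"
    by (intro L2_tendsto_inner D cnj_lim truncate_to_tendsto D')
  have "L2_inner lborel (fourier (truncate_to N u)) (\<lambda>x. cnj (truncate_to N u' x)) = L2_inner lborel (truncate_to N u) (\<lambda>x. cnj (fourier (truncate_to N u') x))" for N
    unfolding L2_inner_def using fourier_multiplication[OF truncate_to_L1[OF D(1)] truncate_to_L1[OF D'(1)]] by simp
  then show "(\<lambda>N. L2_inner lborel (fourier (truncate_to N u)) (\<lambda>x. cnj (truncate_to N u' x))) \<longlonglongrightarrow> L2_inner lborel u (\<lambda>x. cnj (w' x))"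
    using L2_tendsto_inner[OF truncate_to_tendsto[OF D(1)] cnj_lim[OF D'(3)]] by simp
qed

text \<open>
  For every \<open>a\<close> with transform \<open>A\<close>, isometry gives \<open>\<langle>A, w\<rangle> = \<langle>a, u\<rangle>\<close>, and the multiplication formula
  gives \<open>\<langle>A, w\<rangle> = \<integral> a z\<close>.  Since every \<open>a\<close> has a transform, \<open>u\<close> and the conjugate of \<open>z\<close> agree.  This
  inversion formula also yields surjectivity.
\<close>

lemma fourier_L2_inversion:
  assumes "(u, w) \<in> fourier_L2" "(\<lambda>x. cnj (w x), z) \<in> fourier_L2"
  shows "AE x in lborel. z x = cnj (u x)"
proof -
  note D = fourier_L2_D[OF assms(1)] and D' = fourier_L2_D[OF assms(2)]
  have "AE x in lborel. u x = cnj (z x)"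
  proof (rule L2_inner_nondegenerate[OF D(1) L2_cnj[OF D'(2)]])
    fix a :: "real \<Rightarrow> complex" assume "a \<in> L2 lborel"
    then obtain A where A: "(a, A) \<in> fourier_L2" by (rule fourier_L2_total)
    show "L2_inner lborel a u = L2_inner lborel a (\<lambda>x. cnj (z x))"
      using fourier_L2_inner[OF A assms(1)] fourier_L2_multiplication[OF A assms(2)] by simp
  qed
  then show ?thesis by eventually_elim simp
qed

lemma fourier_L2_cong:
  assumes "(u, w) \<in> fourier_L2" "w' \<in> borel_measurable borel" "AE x in lborel. w' x = w x"
  shows "(u, w') \<in> fourier_L2"
  unfolding fourier_L2_iff
proof (intro conjI fourier_L2_D(1)[OF assms(1)] L2_tendsto_cong_AE[OF fourier_L2_D(3)[OF assms(1)]])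
  show "fourier (truncate_to n u) \<in> borel_measurable lborel" for n
    using L2_borel[OF fourier_L2_D(1)[OF assms(1)]] by measurable
qed (use assms in auto)

lemma fourier_L2_surj:
  assumes w: "w \<in> L2 lborel" obtains u where "(u, w) \<in> fourier_L2"
proof -
  obtain z where z: "(\<lambda>x. cnj (w x), z) \<in> fourier_L2" using fourier_L2_total[OF L2_cnj[OF w]] .
  obtain w' where w': "(\<lambda>x. cnj (z x), w') \<in> fourier_L2" using fourier_L2_total[OF L2_cnj[OF fourier_L2_D(2)[OF z]]] .
  have "AE x in lborel. w' x = w x" using fourier_L2_inversion[OF z w'] by simp
  then have "AE x in lborel. w x = w' x" by eventually_elim simp
  from fourier_L2_cong[OF w' L2_borel[OF w] this] show thesis by (rule that)
qed

lemma fourier_L2_inv_fourier: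
  assumes c: "integrable lborel c" "c \<in> L2 lborel" shows "(inv_fourier c, c) \<in> fourier_L2"
proof -
  have F: "(\<lambda>x. cnj (c x), fourier (\<lambda>x. cnj (c x))) \<in> fourier_L2"
    using c by (intro fourier_L2_of_L1) auto
  have eq: "inv_fourier c = (\<lambda>x. cnj (fourier (\<lambda>x. cnj (c x)) x))" by (rule ext) (rule inv_fourier_cnj)
  obtain z where z: "(inv_fourier c, z) \<in> fourier_L2"
    using fourier_L2_total[OF L2_cnj[OF fourier_L2_D(2)[OF F]]] unfolding eq .
  have "AE x in lborel. z x = c x" using fourier_L2_inversion[OF F z[unfolded eq]] by simp
  then have "AE x in lborel. c x = z x" by eventually_elim simp
  from fourier_L2_cong[OF z L2_borel[OF c(2)] this] show ?thesis .
qed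

section \<open>The logarithmic substitution\<close>

lemma exp_measurable_lborel_pos [measurable]: "exp \<in> measurable borel lborel_pos"
  by (rule measurable_restrict_space2) auto

text \<open>
  The change of variables \<open>t = e\<^sup>x\<close> as an identity between measures, so that it is available
  for integrals of functions with values in any Banach space.  Substitution on compact intervals
  gives the measure of \<open>A \<inter> [e\<^sup>-\<^sup>n, e\<^sup>n]\<close>, and \<open>n\<close> tends to infinity.
\<close>

lemma lborel_pos_conv_distr: "lborel_pos = distr (density lborel (\<lambda>x. ennreal (exp x))) lborel_pos exp"
proof (rule measure_eqI)
  fix A :: "real set" assume A0: "A \<in> sets lborel_pos"
  then have A: "A \<in> sets borel" "A \<subseteq> {0<..}"
    by (auto simp: sets_restrict_space_iff)
  define B where "B = exp -` A"
  have B: "B \<in> sets borel" unfolding B_def using measurable_sets[OF exp_measurable_lborel_pos A0] by simp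
  define D where "D = density lborel (\<lambda>x. ennreal (exp x))"
  have eq: "emeasure lborel (A \<inter> {exp (- real n)..exp (real n)}) = emeasure D (B \<inter> {- real n..real n})" for n
  proof -
    have "emeasure lborel (A \<inter> {exp (- real n)..exp (real n)}) = (\<integral>\<^sup>+x. ennreal (indicator A x) * indicator {exp (- real n)..exp (real n)} x \<partial>lborel)"
    proof -
      have "emeasure lborel (A \<inter> {exp (- real n)..exp (real n)}) = (\<integral>\<^sup>+x. indicator (A \<inter> {exp (- real n)..exp (real n)}) x \<partial>lborel)"
        using A by (intro nn_integral_indicator[symmetric]) auto
      also have "\<dots> = (\<integral>\<^sup>+x. ennreal (indicator A x) * indicator {exp (- real n)..exp (real n)} x \<partial>lborel)"
        by (intro nn_integral_cong) (auto simp: indicator_def)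
      finally show ?thesis .
    qed
    also have "\<dots> = (\<integral>\<^sup>+x. ennreal (indicator A x * indicator {exp (- real n)..exp (real n)} x) \<partial>lborel)"
      by (intro nn_integral_cong) (auto simp: indicator_def)
    also have "\<dots> = (\<integral>\<^sup>+x. ennreal (indicator A (exp x) * exp x * indicator {- real n..real n} x) \<partial>lborel)"
      using A(1) by (intro nn_integral_substitution)
        (auto intro!: derivative_eq_intros continuous_intros simp: set_borel_measurable_def)
    also have "\<dots> = emeasure D (B \<inter> {- real n..real n})"
      unfolding D_def using B by (subst emeasure_density) (auto intro!: nn_integral_cong simp: indicator_def B_def)
    finally show ?thesis .
  qed
  have "(\<lambda>n. emeasure lborel (A \<inter> {exp (- real n)..exp (real n)})) \<longlonglongrightarrow> emeasure lborel (\<Union>n. A \<inter> {exp (- real n)..exp (real n)})"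
  proof (rule Lim_emeasure_incseq)
    show "incseq (\<lambda>n. A \<inter> {exp (- real n)..exp (real n)})" by (intro monoI Int_mono order_refl) simp
  qed (use A in auto)
  also have "(\<Union>n. A \<inter> {exp (- real n)..exp (real n)}) = A"
  proof -
    have "\<exists>n. exp (- real n) \<le> x \<and> x \<le> exp (real n)" if "x \<in> A" for x
    proof -
      have x: "x > 0" using A(2) that by auto
      obtain n where "\<bar>ln x\<bar> \<le> real n" using real_arch_simple by blast
      then have "- real n \<le> ln x" "ln x \<le> real n" by auto
      then have "exp (- real n) \<le> exp (ln x)" "exp (ln x) \<le> exp (real n)" by simp_all
      then show ?thesis using x by auto
    qed
    then show ?thesis by auto
  qed
  finally have 1: "(\<lambda>n. emeasure D (B \<inter> {- real n..real n})) \<longlonglongrightarrow> emeasure lborel A" unfolding eq .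
  have "(\<lambda>n. emeasure D (B \<inter> {- real n..real n})) \<longlonglongrightarrow> emeasure D (\<Union>n. B \<inter> {- real n..real n})"
    using B by (intro Lim_emeasure_incseq) (auto simp: incseq_def D_def)
  also have "(\<Union>n. B \<inter> {- real n..real n}) = B"
  proof -
    have "\<exists>n. - real n \<le> x \<and> x \<le> real n" for x
    proof -
      obtain n where "\<bar>x\<bar> \<le> real n" using real_arch_simple by blast
      then show ?thesis by (intro exI[of _ n]) auto
    qed
    then show ?thesis by auto
  qed
  finally have "emeasure lborel A = emeasure D B" using 1 LIMSEQ_unique by blast
  moreover have "emeasure lborel_pos A = emeasure lborel A"
    using A by (subst emeasure_restrict_space) auto
  moreover have "emeasure (distr D lborel_pos exp) A = emeasure D B"
    using A0 by (subst emeasure_distr) (auto simp: D_def B_def)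
  ultimately show "emeasure lborel_pos A = emeasure (distr (density lborel (\<lambda>x. ennreal (exp x))) lborel_pos exp) A"
    by (simp add: D_def)
qed simp

lemma AE_lborel_posD: "AE t in lborel_pos. P t \<Longrightarrow> AE x in lborel. P (exp x)"
proof -
  assume "AE t in lborel_pos. P t"
  then have "AE t in distr (density lborel (\<lambda>x. ennreal (exp x))) lborel_pos exp. P t"
    unfolding lborel_pos_conv_distr[symmetric] .
  then have "AE x in density lborel (\<lambda>x. ennreal (exp x)). P (exp x)"
    by (rule AE_distrD[rotated]) simp
  then show ?thesis by (subst (asm) AE_density) auto
qed

text \<open>
  The exceptional set may be non-measurable, so it is enclosed in a null set \<open>N\<close> first, and the
  measurable condition \<open>ln t \<notin> N\<close> is transported.
\<close>

lemma AE_lborel_posI: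
  assumes "AE x in lborel. P (exp x)" shows "AE t in lborel_pos. P t"
proof -
  obtain N where N: "\<And>x. x \<in> space lborel - N \<Longrightarrow> P (exp x)" "N \<in> null_sets lborel"
    using AE_E3[OF assms] by blast
  have "AE x in lborel. x \<notin> N" by (rule AE_not_in[OF N(2)])
  then have "AE x in density lborel (\<lambda>x. ennreal (exp x)). ln (exp x) \<notin> N"
    by (subst AE_density) (auto elim: eventually_mono)
  then have "AE t in distr (density lborel (\<lambda>x. ennreal (exp x))) lborel_pos exp. ln t \<notin> N"
  proof (subst AE_distr_iff)
    have "N \<in> sets borel" using N(2) by auto
    then have "{0<..} - ln -` N \<in> sets borel"
      using measurable_sets[of "ln :: real \<Rightarrow> real" borel borel N] by (intro sets.Diff) auto
    moreover have "{x \<in> space lborel_pos. ln x \<notin> N} = {0<..} - ln -` N"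
      by (auto simp: space_restrict_space)
    ultimately show "{x \<in> space lborel_pos. ln x \<notin> N} \<in> sets lborel_pos"
      by (simp add: sets_restrict_space_iff)
  qed auto
  then have "AE t in lborel_pos. ln t \<notin> N" unfolding lborel_pos_conv_distr[symmetric] .
  moreover have "AE t in lborel_pos. t > 0" by (rule AE_I2) (simp add: space_restrict_space)
  ultimately show ?thesis
  proof eventually_elim
    case (elim t)
    then have "P (exp (ln t))" by (intro N(1)) simp
    then show ?case using elim by simp
  qed
qed

lemma measurable_exp_comp:
  "f \<in> borel_measurable lborel_pos \<Longrightarrow> (\<lambda>x. f (exp x)) \<in> borel_measurable borel"
  by (rule measurable_compose[OF exp_measurable_lborel_pos])

lemma measurable_ln_comp:
  "u \<in> borel_measurable borel \<Longrightarrow> (\<lambda>t. u (ln t)) \<in> borel_measurable lborel_pos"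
  by (intro measurable_restrict_space1) simp

lemma
  fixes f :: "real \<Rightarrow> 'a :: {banach, second_countable_topology}"
  assumes f: "f \<in> borel_measurable lborel_pos"
  shows integrable_lborel_pos_iff: "integrable lborel_pos f \<longleftrightarrow> integrable lborel (\<lambda>x. exp x *\<^sub>R f (exp x))"
    and integral_lborel_pos: "(LINT t|lborel_pos. f t) = (LINT x|lborel. exp x *\<^sub>R f (exp x))"
proof -
  note fm = measurable_exp_comp[OF f]
  show "integrable lborel_pos f \<longleftrightarrow> integrable lborel (\<lambda>x. exp x *\<^sub>R f (exp x))"
    using fm f by (subst lborel_pos_conv_distr) (simp add: integrable_distr_eq integrable_density)
  show "(LINT t|lborel_pos. f t) = (LINT x|lborel. exp x *\<^sub>R f (exp x))"
    using fm f by (subst lborel_pos_conv_distr) (simp add: integral_distr integral_density)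
qed

definition inv_log_substitution :: "(real \<Rightarrow> complex) \<Rightarrow> real \<Rightarrow> complex" where
  "inv_log_substitution u t = complex_of_real (t powr (-1/2)) * u (ln t)"

lemma log_substitution_inv: "log_substitution (inv_log_substitution u) = u"
proof
  fix x :: real
  have "exp (x / 2) * exp x powr (-1/2) = 1"
    by (simp add: exp_powr_real exp_add[symmetric])
  then have "complex_of_real (exp (x / 2)) * complex_of_real (exp x powr (-1/2)) = 1"
    by (metis of_real_1 of_real_mult)
  then show "log_substitution (inv_log_substitution u) x = u x"
    unfolding log_substitution_def inv_log_substitution_def by (simp only: mult.assoc[symmetric] ln_exp mult_1_left)
qed

lemma log_substitution_borel: "f \<in> borel_measurable lborel_pos \<Longrightarrow> log_substitution f \<in> borel_measurable borel"
  unfolding log_substitution_def[abs_def] by (intro borel_measurable_times measurable_exp_comp) auto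

lemma inv_log_substitution_borel: "u \<in> borel_measurable borel \<Longrightarrow> inv_log_substitution u \<in> borel_measurable lborel_pos"
  unfolding inv_log_substitution_def[abs_def]
  by (intro borel_measurable_times measurable_ln_comp measurable_restrict_space1) auto

lemma log_substitution_inner:
  assumes "f \<in> borel_measurable lborel_pos" "g \<in> borel_measurable lborel_pos"
  shows "L2_inner lborel (log_substitution f) (log_substitution g) = L2_inner lborel_pos f g"
proof -
  have "log_substitution f x * cnj (log_substitution g x) = exp x *\<^sub>R (f (exp x) * cnj (g (exp x)))" for x
  proof -
    have "complex_of_real (exp (x/2)) * complex_of_real (exp (x/2)) = complex_of_real (exp x)"
      by (simp only: of_real_mult[symmetric] exp_add[symmetric]) simp
    then show ?thesis unfolding log_substitution_def scaleR_conv_of_real complex_cnj_mult complex_cnj_complex_of_real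
      by (metis (no_types, opaque_lifting) mult.assoc mult.left_commute)
  qed
  then show ?thesis unfolding L2_inner_def
    using assms by (subst integral_lborel_pos) auto
qed

lemma log_substitution_L2:
  assumes f: "f \<in> borel_measurable lborel_pos"
  shows "log_substitution f \<in> L2 lborel \<longleftrightarrow> f \<in> L2 lborel_pos"
    and "L2_norm lborel (log_substitution f) = L2_norm lborel_pos f"
proof -
  have eq: "(norm (log_substitution f x))\<^sup>2 = exp x *\<^sub>R (norm (f (exp x)))\<^sup>2" for x
  proof -
    have "(exp (x/2))\<^sup>2 = exp x" unfolding power2_eq_square exp_add[symmetric] by simp
    then show ?thesis by (simp add: log_substitution_def norm_mult power_mult_distrib)
  qed
  have m: "(\<lambda>t. (norm (f t))\<^sup>2) \<in> borel_measurable lborel_pos" using f by measurable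
  show "log_substitution f \<in> L2 lborel \<longleftrightarrow> f \<in> L2 lborel_pos"
    using f log_substitution_borel[OF f] unfolding L2_def by (auto simp: eq integrable_lborel_pos_iff[OF m])
  show "L2_norm lborel (log_substitution f) = L2_norm lborel_pos f"
    unfolding L2_norm_def integral_lborel_pos[OF m] eq ..
qed

lemma inv_log_substitution_L2:
  assumes "u \<in> L2 lborel" shows "inv_log_substitution u \<in> L2 lborel_pos"
  using log_substitution_L2(1)[OF inv_log_substitution_borel[OF L2_borel[OF assms]]] assms
  by (simp add: log_substitution_inv)

lemma log_substitution_cong_AE:
  "AE t in lborel_pos. f t = g t \<Longrightarrow> AE x in lborel. log_substitution f x = log_substitution g x"
  by (drule AE_lborel_posD) (auto elim: eventually_mono simp: log_substitution_def)

lemma log_substitution_eq_AE: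
  assumes "AE x in lborel. log_substitution f x = log_substitution g x" shows "AE t in lborel_pos. f t = g t"
  by (rule AE_lborel_posI) (use assms in \<open>auto elim: eventually_mono simp: log_substitution_def\<close>)

section \<open>The unitary operator\<close>

lemma half_line_notin_nonpos_Ints: "1/2 + \<i> * complex_of_real \<xi> \<notin> \<int>\<^sub>\<le>\<^sub>0"
proof
  assume "1/2 + \<i> * complex_of_real \<xi> \<in> \<int>\<^sub>\<le>\<^sub>0"
  then obtain n where "1/2 + \<i> * complex_of_real \<xi> = - of_nat n" by (auto elim: nonpos_Ints_cases')
  then have "Re (1/2 + \<i> * complex_of_real \<xi>) = Re (- of_nat n)" by (rule arg_cong)
  then show False by simp
qed

lemma Gamma_half_line_nonzero: "Gamma (1/2 + \<i> * complex_of_real \<xi>) \<noteq> 0"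
  using half_line_notin_nonpos_Ints by (simp add: Gamma_eq_zero_iff)

lemma norm_gamma_phase [simp]: "norm (gamma_phase \<xi>) = 1"
  using Gamma_half_line_nonzero by (simp add: gamma_phase_def norm_divide)

lemma gamma_phase_mult_cnj: "gamma_phase \<xi> * cnj (gamma_phase \<xi>) = 1" "cnj (gamma_phase \<xi>) * gamma_phase \<xi> = 1"
  by (simp_all add: complex_norm_square[symmetric] mult.commute)

lemma gamma_phase_mult_cancel [simp]: "gamma_phase \<xi> * (cnj (gamma_phase \<xi>) * z) = z" "cnj (gamma_phase \<xi>) * (gamma_phase \<xi> * z) = z"
  by (simp_all add: mult.assoc[symmetric] gamma_phase_mult_cnj)

lemma gamma_phase_measurable [measurable]: "gamma_phase \<in> borel_measurable borel"
proof -
  have "continuous_on UNIV (\<lambda>\<xi>. Gamma (1/2 + \<i> * complex_of_real \<xi>))"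
    by (rule continuous_on_compose2[OF continuous_on_Gamma[of "- \<int>\<^sub>\<le>\<^sub>0"]])
      (use half_line_notin_nonpos_Ints in \<open>auto intro!: continuous_intros\<close>)
  then have "continuous_on UNIV gamma_phase"
    unfolding gamma_phase_def[abs_def] using Gamma_half_line_nonzero by (intro continuous_intros) auto
  then show ?thesis by (rule borel_measurable_continuous_onI)
qed

lemma gamma_phase_L2:
  assumes "w \<in> L2 lborel"
  shows "(\<lambda>\<xi>. gamma_phase \<xi> * w \<xi>) \<in> L2 lborel" "(\<lambda>\<xi>. cnj (gamma_phase \<xi>) * w \<xi>) \<in> L2 lborel"
  by (rule L2_mult_bounded[OF assms, where C=1]; simp)+

text \<open>
  The phase is unimodular, so it can be moved to the other side.
\<close>

lemma F_op_iff:
  "(f, w) \<in> F_op \<longleftrightarrow> f \<in> L2 lborel_pos \<and> w \<in> L2 lborel \<and> (log_substitution f, \<lambda>\<xi>. cnj (gamma_phase \<xi>) * w \<xi>) \<in> fourier_L2"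
proof
  assume "(f, w) \<in> F_op"
  then obtain u where fw: "f \<in> L2 lborel_pos" "w \<in> L2 lborel" and u: "(log_substitution f, u) \<in> fourier_L2"
    and ae: "AE \<xi> in lborel. w \<xi> = gamma_phase \<xi> * u \<xi>"
    by (auto simp: F_op_def)
  have "(log_substitution f, \<lambda>\<xi>. cnj (gamma_phase \<xi>) * w \<xi>) \<in> fourier_L2"
  proof (rule fourier_L2_cong[OF u])
    show "AE \<xi> in lborel. cnj (gamma_phase \<xi>) * w \<xi> = u \<xi>" using ae by eventually_elim simp
  qed (use L2_borel[OF fw(2)] in measurable)
  with fw show "f \<in> L2 lborel_pos \<and> w \<in> L2 lborel \<and> (log_substitution f, \<lambda>\<xi>. cnj (gamma_phase \<xi>) * w \<xi>) \<in> fourier_L2" by blast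
qed (auto simp: F_op_def intro!: exI[of _ "\<lambda>\<xi>. cnj (gamma_phase \<xi>) * w \<xi>"])

lemma F_op_total:
  assumes f: "f \<in> L2 lborel_pos" obtains w where "(f, w) \<in> F_op"
proof -
  have "log_substitution f \<in> L2 lborel" using f by (simp add: log_substitution_L2 L2_measurable)
  then obtain u where u: "(log_substitution f, u) \<in> fourier_L2" by (rule fourier_L2_total)
  have "(f, \<lambda>\<xi>. gamma_phase \<xi> * u \<xi>) \<in> F_op"
    unfolding F_op_iff using f u gamma_phase_L2(1)[OF fourier_L2_D(2)[OF u]] by simp
  then show thesis by (rule that)
qed

lemma F_op_surj:
  assumes w: "w \<in> L2 lborel" obtains f where "(f, w) \<in> F_op"
proof -
  obtain u where u: "(u, \<lambda>\<xi>. cnj (gamma_phase \<xi>) * w \<xi>) \<in> fourier_L2" using fourier_L2_surj[OF gamma_phase_L2(2)[OF w]] .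
  have "(inv_log_substitution u, w) \<in> F_op"
    unfolding F_op_iff log_substitution_inv using u w inv_log_substitution_L2[OF fourier_L2_D(1)[OF u]] by simp
  then show thesis by (rule that)
qed

lemma F_op_D:
  assumes "(f, w) \<in> F_op" shows "f \<in> L2 lborel_pos" "w \<in> L2 lborel"
  using assms by (auto simp: F_op_iff)

lemma F_op_inner:
  assumes "(f, w) \<in> F_op" "(f', w') \<in> F_op"
  shows "L2_inner lborel w w' = L2_inner lborel_pos f f'"
proof -
  note a = assms[unfolded F_op_iff]
  have "L2_inner lborel_pos f f' = L2_inner lborel (log_substitution f) (log_substitution f')"
    using a by (simp add: log_substitution_inner L2_measurable)
  also have "\<dots> = L2_inner lborel (\<lambda>\<xi>. cnj (gamma_phase \<xi>) * w \<xi>) (\<lambda>\<xi>. cnj (gamma_phase \<xi>) * w' \<xi>)"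
    using a by (intro fourier_L2_inner) auto
  also have "\<dots> = L2_inner lborel w w'"
    unfolding L2_inner_def by (intro Bochner_Integration.integral_cong) (auto simp: mult_ac)
  finally show ?thesis by simp
qed

lemma F_op_add:
  assumes "(f, w) \<in> F_op" "(f', w') \<in> F_op"
  shows "(\<lambda>x. f x + c * f' x, \<lambda>x. w x + c * w' x) \<in> F_op"
proof -
  note a = assms[unfolded F_op_iff]
  have "log_substitution (\<lambda>x. f x + c * f' x) = (\<lambda>x. log_substitution f x + c * log_substitution f' x)"
    by (auto simp: log_substitution_def algebra_simps)
  moreover have "(\<lambda>\<xi>. cnj (gamma_phase \<xi>) * (w \<xi> + c * w' \<xi>)) = (\<lambda>\<xi>. cnj (gamma_phase \<xi>) * w \<xi> + c * (cnj (gamma_phase \<xi>) * w' \<xi>))"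
    by (auto simp: algebra_simps)
  ultimately show ?thesis unfolding F_op_iff
    using a fourier_L2_add[of "log_substitution f" "\<lambda>\<xi>. cnj (gamma_phase \<xi>) * w \<xi>" "log_substitution f'" "\<lambda>\<xi>. cnj (gamma_phase \<xi>) * w' \<xi>" c] by auto
qed

lemma F_op_norm: "(f, w) \<in> F_op \<Longrightarrow> L2_norm lborel_pos f = L2_norm lborel w"
proof -
  assume "(f, w) \<in> F_op"
  from F_op_inner[OF this this] have "(L2_norm lborel_pos f)\<^sup>2 = (L2_norm lborel w)\<^sup>2"
    by (simp add: L2_inner_self del: of_real_power)
  then show ?thesis using L2_norm_nonneg power2_eq_imp_eq by blast
qed

lemma F_op_cong:
  assumes "(f, w) \<in> F_op" "f' \<in> borel_measurable lborel_pos" "AE t in lborel_pos. f' t = f t"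
  shows "(f', w) \<in> F_op"
proof -
  have f': "f' \<in> L2 lborel_pos" by (rule L2_cong_AE[OF F_op_D(1)[OF assms(1)] assms(2,3)])
  obtain w' where w': "(f', w') \<in> F_op" using F_op_total[OF f'] .
  have "(log_substitution f', \<lambda>\<xi>. cnj (gamma_phase \<xi>) * w \<xi>) \<in> fourier_L2"
  proof (rule fourier_L2_cong)
    show l': "(log_substitution f', \<lambda>\<xi>. cnj (gamma_phase \<xi>) * w' \<xi>) \<in> fourier_L2" using w' by (simp add: F_op_iff)
    have l: "(log_substitution f, \<lambda>\<xi>. cnj (gamma_phase \<xi>) * w \<xi>) \<in> fourier_L2" using assms(1) by (simp add: F_op_iff)
    have "AE t in lborel_pos. f t = f' t" using assms(3) by eventually_elim simp
    then show "AE \<xi> in lborel. cnj (gamma_phase \<xi>) * w \<xi> = cnj (gamma_phase \<xi>) * w' \<xi>"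
      by (intro fourier_L2_unique[OF l l'] log_substitution_cong_AE)
    show "(\<lambda>\<xi>. cnj (gamma_phase \<xi>) * w \<xi>) \<in> borel_measurable borel"
      using L2_borel[OF F_op_D(2)[OF assms(1)]] by measurable
  qed
  then show ?thesis using f' F_op_D(2)[OF assms(1)] by (simp add: F_op_iff)
qed

text \<open>
  The adjoint of a unitary operator is its inverse.  The graph is saturated under equality almost
  everywhere, so the two graphs agree as sets of representatives.
\<close>

lemma F_op_adjoint_iff: "(g, f) \<in> L2_adjoint lborel_pos lborel F_op \<longleftrightarrow> (f, g) \<in> F_op"
proof
  assume fg: "(f, g) \<in> F_op"
  then show "(g, f) \<in> L2_adjoint lborel_pos lborel F_op"
    using F_op_D[OF fg] F_op_inner[OF _ fg] by (auto simp: L2_adjoint_def)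
next
  assume "(g, f) \<in> L2_adjoint lborel_pos lborel F_op"
  then have g: "g \<in> L2 lborel" and f: "f \<in> L2 lborel_pos"
    and adj: "\<And>u w. (u, w) \<in> F_op \<Longrightarrow> L2_inner lborel w g = L2_inner lborel_pos u f"
    by (auto simp: L2_adjoint_def)
  obtain f0 where f0: "(f0, g) \<in> F_op" using F_op_surj[OF g] .
  have "AE t in lborel_pos. f t = f0 t"
  proof (rule L2_inner_nondegenerate[OF f F_op_D(1)[OF f0]])
    fix u :: "real \<Rightarrow> complex" assume "u \<in> L2 lborel_pos"
    then obtain w where w: "(u, w) \<in> F_op" by (rule F_op_total)
    show "L2_inner lborel_pos u f = L2_inner lborel_pos u f0" using adj[OF w] F_op_inner[OF w f0] by simp
  qed
  then show "(f, g) \<in> F_op" by (rule F_op_cong[OF f0 L2_measurable[OF f]])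
qed

lemma F_op_tendsto:
  assumes "\<And>n. (fs n, ws n) \<in> F_op" "(f, w) \<in> F_op" "L2_tendsto lborel ws w"
  shows "L2_tendsto lborel_pos fs f"
proof (rule L2_tendstoI)
  show "(\<lambda>n. L2_norm lborel_pos (\<lambda>x. fs n x - f x)) \<longlonglongrightarrow> 0"
    using F_op_norm[OF F_op_add[OF assms(1,2), of _ "-1"]] L2_tendstoD(3)[OF assms(3)] by simp
qed (use F_op_D assms in blast)+

lemma F_op_inv_fourier:
  assumes "integrable lborel \<phi>" "\<phi> \<in> L2 lborel"
  shows "(inv_log_substitution (inv_fourier (\<lambda>\<xi>. cnj (gamma_phase \<xi>) * \<phi> \<xi>)), \<phi>) \<in> F_op"
proof -
  have "integrable lborel (\<lambda>\<xi>. \<phi> \<xi> * cnj (gamma_phase \<xi>))"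
    by (rule integrable_mult_unimodular[OF assms(1)]) auto
  then have "integrable lborel (\<lambda>\<xi>. cnj (gamma_phase \<xi>) * \<phi> \<xi>)" by (simp add: mult.commute)
  from fourier_L2_inv_fourier[OF this gamma_phase_L2(2)[OF assms(2)]] show ?thesis
    unfolding F_op_iff log_substitution_inv
    using assms(2) inv_log_substitution_L2[OF fourier_L2_D(1)] by blast
qed

section \<open>Smooth functions and test functions\<close>

definition smooth :: "(real \<Rightarrow> complex) \<Rightarrow> bool" where
  "smooth f \<longleftrightarrow> (\<forall>k x. (vderiv ^^ k) f differentiable (at x))"

text \<open>
  Counts derivatives from the inside, so that closure properties of smooth functions follow by
  induction over all functions at once.
\<close>

fun differentiable_upto :: "nat \<Rightarrow> (real \<Rightarrow> complex) \<Rightarrow> bool" where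
  "differentiable_upto 0 f = True"
| "differentiable_upto (Suc k) f = ((\<forall>x. f differentiable (at x)) \<and> differentiable_upto k (vderiv f))"

lemma differentiable_upto_iff: "differentiable_upto n f \<longleftrightarrow> (\<forall>k<n. \<forall>x. (vderiv ^^ k) f differentiable (at x))"
proof (induction n arbitrary: f)
  case (Suc n)
  show ?case unfolding differentiable_upto.simps Suc
    by (auto simp: All_less_Suc2 funpow_swap1 simp del: funpow.simps) (auto simp: funpow_swap1)
qed simp

lemma smooth_iff_differentiable_upto: "smooth f \<longleftrightarrow> (\<forall>n. differentiable_upto n f)"
  unfolding smooth_def differentiable_upto_iff by blast

lemma differentiable_upto_mono: "differentiable_upto n f \<Longrightarrow> m \<le> n \<Longrightarrow> differentiable_upto m f"
  by (auto simp: differentiable_upto_iff)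

lemma smooth_differentiable: "smooth f \<Longrightarrow> f differentiable (at x)"
  unfolding smooth_def using spec[of _ 0] by (metis funpow_0)

lemma smooth_vderiv: "smooth f \<Longrightarrow> smooth (vderiv f)"
  unfolding smooth_def by (metis funpow_swap1 funpow.simps(2) o_apply)

lemma smooth_vderiv_pow: "smooth f \<Longrightarrow> smooth ((vderiv ^^ k) f)"
  by (induction k) (auto intro: smooth_vderiv)

lemma vderiv_pow_Suc: "(vderiv ^^ Suc k) f = (vderiv ^^ k) (vderiv f)"
  by (simp add: funpow_swap1)

lemma has_vderiv: "f differentiable (at x) \<Longrightarrow> (f has_vector_derivative vderiv f x) (at x)"
  unfolding vderiv_def by (rule vector_derivative_works[THEN iffD1])

lemma smooth_has_vderiv: "smooth f \<Longrightarrow> (f has_vector_derivative vderiv f x) (at x)"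
  by (intro has_vderiv smooth_differentiable)

lemma vderiv_eqI: "(\<And>x. (f has_vector_derivative D x) (at x)) \<Longrightarrow> vderiv f = D"
  unfolding vderiv_def by (auto intro!: vector_derivative_at)

lemma has_vderiv_differentiable: "(f has_vector_derivative D) (at x) \<Longrightarrow> f differentiable (at x)"
  by (rule differentiableI_vector)

lemma smooth_continuous: "smooth f \<Longrightarrow> continuous_on S f"
  by (meson continuous_at_imp_continuous_on differentiable_imp_continuous_within smooth_differentiable)

lemma smooth_borel: "smooth f \<Longrightarrow> f \<in> borel_measurable borel"
  by (intro borel_measurable_continuous_onI smooth_continuous)

lemma vderiv_add:
  assumes "\<And>x. f differentiable (at x)" "\<And>x. g differentiable (at x)"
  shows "vderiv (\<lambda>x. f x + g x) = (\<lambda>x. vderiv f x + vderiv g x)"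
  by (rule vderiv_eqI) (intro derivative_intros has_vderiv assms)

lemma has_vderiv_mult:
  assumes "f differentiable (at x)" "g differentiable (at x)"
  shows "((\<lambda>x. f x * g x) has_vector_derivative f x * vderiv g x + vderiv f x * g x) (at x)"
  by (rule has_vector_derivative_mult) (intro has_vderiv assms)+

lemma vderiv_mult:
  assumes "\<And>x. f differentiable (at x)" "\<And>x. g differentiable (at x)"
  shows "vderiv (\<lambda>x. f x * g x) = (\<lambda>x. f x * vderiv g x + vderiv f x * g x)"
  by (rule vderiv_eqI) (intro has_vderiv_mult assms)

lemma differentiable_upto_add:
  "differentiable_upto n f \<Longrightarrow> differentiable_upto n g \<Longrightarrow> differentiable_upto n (\<lambda>x. f x + g x)"
proof (induction n arbitrary: f g)
  case (Suc n)
  then have "vderiv (\<lambda>x. f x + g x) = (\<lambda>x. vderiv f x + vderiv g x)" by (intro vderiv_add) auto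
  with Suc show ?case by auto
qed simp

lemma differentiable_upto_mult:
  "differentiable_upto n f \<Longrightarrow> differentiable_upto n g \<Longrightarrow> differentiable_upto n (\<lambda>x. f x * g x)"
proof (induction n arbitrary: f g)
  case (Suc n)
  then have d: "\<And>x. f differentiable (at x)" "\<And>x. g differentiable (at x)" by auto
  have "differentiable_upto n f" "differentiable_upto n g" using Suc.prems differentiable_upto_mono le_SucI by blast+
  then have "differentiable_upto n (\<lambda>x. f x * vderiv g x + vderiv f x * g x)"
    using Suc.prems by (intro differentiable_upto_add Suc.IH) auto
  moreover have "(\<lambda>x. f x * g x) differentiable (at x)" for x
    by (rule has_vderiv_differentiable[OF has_vderiv_mult[OF d]])
  ultimately show ?case using vderiv_mult[OF d] by simp
qed simp

lemma vderiv_const [simp]: "vderiv (\<lambda>x. c) = (\<lambda>x. 0)"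
  by (rule vderiv_eqI) simp

lemma differentiable_upto_const [simp]: "differentiable_upto n (\<lambda>x. c)"
  by (induction n arbitrary: c) auto

lemma smooth_const [simp]: "smooth (\<lambda>x. c)"
  by (simp add: smooth_iff_differentiable_upto)

lemma smooth_add: "smooth f \<Longrightarrow> smooth g \<Longrightarrow> smooth (\<lambda>x. f x + g x)"
  by (simp add: smooth_iff_differentiable_upto differentiable_upto_add)

lemma smooth_mult: "smooth f \<Longrightarrow> smooth g \<Longrightarrow> smooth (\<lambda>x. f x * g x)"
  by (simp add: smooth_iff_differentiable_upto differentiable_upto_mult)

lemma vderiv_affine:
  assumes "\<And>x. f differentiable (at x)"
  shows "((\<lambda>x. f (a + b * x)) has_vector_derivative complex_of_real b * vderiv f (a + b * x)) (at x)"
proof -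
  have "((\<lambda>x. a + b * x) has_vector_derivative b) (at x)" by (auto intro!: derivative_eq_intros simp: has_real_derivative_iff_has_vector_derivative[symmetric])
  from vector_diff_chain_at[OF this has_vderiv[OF assms]] show ?thesis
    by (simp add: o_def scaleR_conv_of_real)
qed

lemma smooth_affine:
  assumes "smooth f" shows "smooth (\<lambda>x. f (a + b * x))"
proof -
  have "differentiable_upto n (\<lambda>x. f (a + b * x))" if "smooth f" for n f using that
  proof (induction n arbitrary: f)
    case (Suc n)
    note d = vderiv_affine[OF smooth_differentiable[OF Suc.prems], of a b]
    have "differentiable_upto n (\<lambda>x. complex_of_real b * vderiv f (a + b * x))"
      using Suc.IH[OF smooth_vderiv[OF Suc.prems]]
      by (intro differentiable_upto_mult) auto
    then show ?case using vderiv_eqI[OF d] has_vderiv_differentiable[OF d] by simp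
  qed simp
  with assms show ?thesis by (simp add: smooth_iff_differentiable_upto)
qed

lemma vderiv_cnj:
  assumes "\<And>x. f differentiable (at x)"
  shows "((\<lambda>x. cnj (f x)) has_vector_derivative cnj (vderiv f x)) (at x)"
  by (rule bounded_linear.has_vector_derivative[OF bounded_linear_cnj has_vderiv[OF assms]])

lemma vderiv_pow_cnj: "smooth f \<Longrightarrow> (vderiv ^^ k) (\<lambda>x. cnj (f x)) = (\<lambda>x. cnj ((vderiv ^^ k) f x))"
proof (induction k arbitrary: f)
  case (Suc k)
  have "vderiv (\<lambda>x. cnj (f x)) = (\<lambda>x. cnj (vderiv f x))"
    by (rule vderiv_eqI[OF vderiv_cnj[OF smooth_differentiable[OF Suc.prems]]])
  then show ?case using Suc.IH[OF smooth_vderiv[OF Suc.prems]] by (simp only: vderiv_pow_Suc)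
qed simp

lemma smooth_cnj:
  assumes "smooth f" shows "smooth (\<lambda>x. cnj (f x))"
  unfolding smooth_def vderiv_pow_cnj[OF assms]
  using has_vderiv_differentiable[OF vderiv_cnj[OF smooth_differentiable[OF smooth_vderiv_pow[OF assms]]]] by blast

lemma smooth_holomorphic:
  assumes F: "F holomorphic_on S" "open S" and S: "\<And>x::real. a + b * complex_of_real x \<in> S"
  shows "smooth (\<lambda>x. F (a + b * complex_of_real x))"
proof -
  have "differentiable_upto n (\<lambda>x. F (a + b * complex_of_real x))" if "F holomorphic_on S" for n F using that
  proof (induction n arbitrary: F)
    case (Suc n)
    have d: "((\<lambda>x. F (a + b * complex_of_real x)) has_vector_derivative b * deriv F (a + b * complex_of_real x)) (at x)" for x
    proof -
      have "((\<lambda>x. a + b * complex_of_real x) has_vector_derivative b) (at x)"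
        by (auto intro!: derivative_eq_intros)
      from field_vector_diff_chain_at[OF this holomorphic_derivI[OF Suc.prems F(2) S]] show ?thesis
        by (simp add: o_def)
    qed
    have "differentiable_upto n (\<lambda>x. b * deriv F (a + b * complex_of_real x))"
      using Suc.IH[OF holomorphic_deriv[OF Suc.prems F(2)]]
      by (intro differentiable_upto_mult) auto
    then show ?case using vderiv_eqI[OF d] has_vderiv_differentiable[OF d] by simp
  qed simp
  with F show ?thesis by (simp add: smooth_iff_differentiable_upto)
qed

lemma test_functions_iff: "\<phi> \<in> test_functions \<longleftrightarrow> smooth \<phi> \<and> (\<exists>R. \<forall>x. \<bar>x\<bar> > R \<longrightarrow> \<phi> x = 0)"
proof -
  have "compact (closure {x. \<phi> x \<noteq> 0}) \<longleftrightarrow> (\<exists>R. \<forall>x. \<bar>x\<bar> > R \<longrightarrow> \<phi> x = 0)"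
    unfolding compact_closure bounded_iff by (auto simp: not_less[symmetric])
  then show ?thesis by (simp add: test_functions_def smooth_def)
qed

lemma test_smooth: "\<phi> \<in> test_functions \<Longrightarrow> smooth \<phi>"
  by (simp add: test_functions_iff)

lemma test_supportE:
  assumes "\<phi> \<in> test_functions" obtains R where "R > 0" "\<And>x. \<bar>x\<bar> > R \<Longrightarrow> \<phi> x = 0"
proof -
  obtain R where "\<And>x. \<bar>x\<bar> > R \<Longrightarrow> \<phi> x = 0" using assms by (auto simp: test_functions_iff)
  then have "\<And>x. \<bar>x\<bar> > max R 1 \<Longrightarrow> \<phi> x = 0" by simp
  then show thesis using that[of "max R 1"] by simp
qed

lemma test_mult:
  assumes "\<phi> \<in> test_functions" "smooth a" shows "(\<lambda>x. a x * \<phi> x) \<in> test_functions"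
proof -
  obtain R where "\<And>x. \<bar>x\<bar> > R \<Longrightarrow> \<phi> x = 0" using test_supportE[OF assms(1)] by blast
  then show ?thesis using assms by (auto simp: test_functions_iff intro: smooth_mult)
qed

lemma test_add:
  assumes "\<phi> \<in> test_functions" "\<psi> \<in> test_functions" shows "(\<lambda>x. \<phi> x + \<psi> x) \<in> test_functions"
proof -
  obtain R where "\<And>x. \<bar>x\<bar> > R \<Longrightarrow> \<phi> x = 0" using test_supportE[OF assms(1)] by blast
  moreover obtain R' where "\<And>x. \<bar>x\<bar> > R' \<Longrightarrow> \<psi> x = 0" using test_supportE[OF assms(2)] by blast
  ultimately have "\<forall>x. \<bar>x\<bar> > max R R' \<longrightarrow> \<phi> x + \<psi> x = 0" by simp
  then show ?thesis using assms unfolding test_functions_iff by (blast intro: smooth_add)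
qed

lemma test_zero [simp]: "(\<lambda>x. 0) \<in> test_functions"
  by (simp add: test_functions_iff)

lemma test_sum: "(\<And>i. i \<in> I \<Longrightarrow> f i \<in> test_functions) \<Longrightarrow> (\<lambda>x. \<Sum>i\<in>I. f i x) \<in> test_functions"
  by (induction I rule: infinite_finite_induct) (auto intro: test_add)

lemma test_cnj: "\<phi> \<in> test_functions \<Longrightarrow> (\<lambda>x. cnj (\<phi> x)) \<in> test_functions"
  by (auto simp: test_functions_iff intro: smooth_cnj)

lemma vderiv_zero_outside:
  assumes "\<And>x. \<bar>x\<bar> > R \<Longrightarrow> f x = 0" "\<bar>x\<bar> > R" shows "vderiv f x = 0"
proof -
  have "((\<lambda>x. 0) has_vector_derivative 0) (at x)" by simp
  moreover have "open {x::real. \<bar>x\<bar> > R}" by (intro open_Collect_less continuous_intros)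
  ultimately have "(f has_vector_derivative 0) (at x)"
    by (rule has_vector_derivative_transform_within_open[where S="{x. \<bar>x\<bar> > R}"]) (use assms in auto)
  then show ?thesis unfolding vderiv_def by (rule vector_derivative_at)
qed

lemma test_vderiv: "\<phi> \<in> test_functions \<Longrightarrow> vderiv \<phi> \<in> test_functions"
  by (auto simp: test_functions_iff smooth_vderiv intro: vderiv_zero_outside)

lemma test_vderiv_pow: "\<phi> \<in> test_functions \<Longrightarrow> (vderiv ^^ k) \<phi> \<in> test_functions"
  by (induction k) (auto intro: test_vderiv)

lemma test_affine:
  assumes "\<phi> \<in> test_functions" "b \<noteq> 0" shows "(\<lambda>x. \<phi> (a + b * x)) \<in> test_functions"
proof -
  obtain R where R: "\<And>x. \<bar>x\<bar> > R \<Longrightarrow> \<phi> x = 0" using test_supportE[OF assms(1)] by blast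
  have "\<phi> (a + b * x) = 0" if "\<bar>x\<bar> > (R + \<bar>a\<bar>) / \<bar>b\<bar>" for x
  proof -
    have "R + \<bar>a\<bar> < \<bar>b * x\<bar>" using that assms(2) by (simp add: field_simps abs_mult)
    then have "R < \<bar>a + b * x\<bar>" by linarith
    then show ?thesis by (rule R)
  qed
  then show ?thesis using assms by (auto simp: test_functions_iff intro: smooth_affine)
qed

lemma test_bounded:
  assumes "\<phi> \<in> test_functions" obtains B where "B > 0" "\<And>x. norm (\<phi> x) \<le> B"
proof -
  obtain R where R: "\<And>x. \<bar>x\<bar> > R \<Longrightarrow> \<phi> x = 0" using test_supportE[OF assms] by blast
  have "compact (\<phi> ` {-R..R})"
    by (intro compact_continuous_image smooth_continuous test_smooth assms compact_Icc)
  then obtain B where B: "\<And>y. y \<in> \<phi> ` {-R..R} \<Longrightarrow> norm y \<le> B"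
    using compact_imp_bounded[of "\<phi> ` {-R..R}"] unfolding bounded_iff by auto
  have "norm (\<phi> x) \<le> max B 1" for x
  proof (cases "\<bar>x\<bar> > R")
    case False
    then have "norm (\<phi> x) \<le> B" by (intro B imageI) auto
    then show ?thesis by simp
  qed (simp add: R)
  then show thesis using that[of "max B 1"] by simp
qed

lemma test_borel: "\<phi> \<in> test_functions \<Longrightarrow> \<phi> \<in> borel_measurable borel"
  by (intro smooth_borel test_smooth)

lemma test_L2_integrable:
  assumes "\<phi> \<in> test_functions" shows "integrable lborel \<phi>" "\<phi> \<in> L2 lborel"
proof -
  obtain R where R: "\<And>x. \<bar>x\<bar> > R \<Longrightarrow> \<phi> x = 0" using test_supportE[OF assms] by blast
  obtain B where B: "B > 0" "\<And>x. norm (\<phi> x) \<le> B" using test_bounded[OF assms] by blast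
  have le: "norm (\<phi> x) \<le> B * indicator {-R..R} x" for x
    using R[of x] B by (cases "\<bar>x\<bar> > R") (auto simp: indicator_def)
  show "\<phi> \<in> L2 lborel"
    by (rule L2_dominated[OF integrable_sq_indicator]) (use le test_borel[OF assms] in auto)
  show "integrable lborel \<phi>"
  proof (rule Bochner_Integration.integrable_bound)
    show "integrable lborel (\<lambda>x. B * indicator {-R..R} x)"
      by (intro integrable_mult_right integrable_real_indicator) (auto simp: emeasure_lborel_Icc_eq)
    show "AE x in lborel. norm (\<phi> x) \<le> norm (B * indicator {-R..R} x)"
      using le B(1) by (auto simp: abs_mult)
  qed (use test_borel[OF assms] in auto)
qed

lemma integral_vderiv_test:
  assumes "\<phi> \<in> test_functions" shows "(LINT x|lborel. vderiv \<phi> x) = 0"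
proof -
  obtain R where R: "R > 0" "\<And>x. \<bar>x\<bar> > R \<Longrightarrow> \<phi> x = 0" using test_supportE[OF assms] by blast
  have "(LINT x|lborel. indicator {-(R+1)..R+1} x *\<^sub>R vderiv \<phi> x) = \<phi> (R+1) - \<phi> (-(R+1))"
  proof (rule integral_FTC_Icc)
    show "(\<phi> has_vector_derivative vderiv \<phi> x) (at x within {-(R+1)..R+1})" for x
      by (rule has_vector_derivative_at_within[OF smooth_has_vderiv[OF test_smooth[OF assms]]])
    show "continuous_on {-(R+1)..R+1} (vderiv \<phi>)"
      by (intro smooth_continuous smooth_vderiv test_smooth assms)
  qed (use R in auto)
  also have "\<dots> = 0" using R by simp
  also have "(LINT x|lborel. indicator {-(R+1)..R+1} x *\<^sub>R vderiv \<phi> x) = (LINT x|lborel. vderiv \<phi> x)"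
  proof (rule Bochner_Integration.integral_cong)
    fix x
    have "vderiv \<phi> x = 0" if "\<bar>x\<bar> > R" by (rule vderiv_zero_outside[OF R(2) that])
    then show "indicator {-(R+1)..R+1} x *\<^sub>R vderiv \<phi> x = vderiv \<phi> x" by (auto simp: indicator_def)
  qed simp
  finally show ?thesis .
qed

lemma integral_by_parts_test:
  assumes "\<phi> \<in> test_functions" "smooth a"
  shows "(LINT x|lborel. a x * vderiv \<phi> x) = - (LINT x|lborel. vderiv a x * \<phi> x)"
proof -
  have "(LINT x|lborel. a x * vderiv \<phi> x + vderiv a x * \<phi> x) = 0"
    using integral_vderiv_test[OF test_mult[OF assms]]
    by (simp add: vderiv_mult smooth_differentiable assms test_smooth)
  moreover have "integrable lborel (\<lambda>x. a x * vderiv \<phi> x)" "integrable lborel (\<lambda>x. vderiv a x * \<phi> x)"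
    by (intro test_L2_integrable test_mult test_vderiv smooth_vderiv assms)+
  ultimately show ?thesis by (simp add: add_eq_0_iff)
qed

section \<open>A bump function\<close>

definition exp_cutoff :: "real poly \<Rightarrow> real \<Rightarrow> complex" where
  "exp_cutoff p x = (if x > 0 then complex_of_real (poly p (1 / x) * exp (- (1 / x))) else 0)"

lemma poly_exp_tendsto_0: "((\<lambda>x::real. poly p x * exp (- x)) \<longlongrightarrow> 0) at_top"
proof -
  have "((\<lambda>x. \<Sum>i\<le>degree p. coeff p i * (x ^ i / exp x)) \<longlongrightarrow> (\<Sum>i\<le>degree p. coeff p i * 0)) at_top"
    by (intro tendsto_intros tendsto_power_div_exp_0)
  then show ?thesis
    by (simp add: poly_altdef sum_distrib_right exp_minus divide_inverse mult.assoc)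
qed

text \<open>
  The functions \<open>p(1/x) e\<^sup>-\<^sup>1\<^sup>/\<^sup>x\<close>, extended by zero, form a family that is closed under
  differentiation, so that they are all smooth.
\<close>

lemma exp_cutoff_has_vderiv:
  "(exp_cutoff p has_vector_derivative exp_cutoff ([:0, 0, 1:] * (p - pderiv p)) x) (at x)"
proof -
  consider "x > 0" | "x < 0" | "x = 0" by linarith
  then show ?thesis
  proof cases
    case 1
    have "((\<lambda>x. poly p (1 / x) * exp (- (1 / x))) has_real_derivative poly ([:0, 0, 1:] * (p - pderiv p)) (1 / x) * exp (- (1 / x))) (at x)"
      using 1 by (auto intro!: derivative_eq_intros DERIV_chain2[OF poly_DERIV] simp: field_simps power2_eq_square)
    then have "((\<lambda>x. complex_of_real (poly p (1 / x) * exp (- (1 / x)))) has_vector_derivative exp_cutoff ([:0, 0, 1:] * (p - pderiv p)) x) (at x)"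
      using 1 unfolding exp_cutoff_def
      by (simp only: if_True) (rule has_vector_derivative_of_real, simp add: has_real_derivative_iff_has_vector_derivative)
    then show ?thesis
      by (rule has_vector_derivative_transform_within_open[where S="{0<..}"]) (use 1 in \<open>auto simp: exp_cutoff_def\<close>)
  next
    case 2
    have "((\<lambda>x. 0) has_vector_derivative 0) (at x)" by simp
    then have "(exp_cutoff p has_vector_derivative 0) (at x)"
      by (rule has_vector_derivative_transform_within_open[where S="{..<0}"]) (use 2 in \<open>auto simp: exp_cutoff_def\<close>)
    then show ?thesis using 2 by (simp add: exp_cutoff_def)
  next
    case 3
    have "((\<lambda>y. (1 / y) *\<^sub>R exp_cutoff p y) \<longlongrightarrow> 0) (at 0)"
    proof (rule filterlim_split_at)
      have "((\<lambda>y. (1 / y) *\<^sub>R exp_cutoff p y) \<longlongrightarrow> 0) (at_left 0) \<longleftrightarrow> ((\<lambda>y. 0::complex) \<longlongrightarrow> 0) (at_left (0::real))"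
        by (rule tendsto_cong) (auto simp: eventually_at_left_field exp_cutoff_def intro!: exI[of _ "-1"])
      then show "((\<lambda>y. (1 / y) *\<^sub>R exp_cutoff p y) \<longlongrightarrow> 0) (at_left 0)" by simp
      have "((\<lambda>y::real. poly ([:0, 1:] * p) (inverse y) * exp (- inverse y)) \<longlongrightarrow> 0) (at_right 0)"
        by (rule filterlim_compose[OF poly_exp_tendsto_0 filterlim_inverse_at_top_right])
      then have "((\<lambda>y. complex_of_real (poly ([:0, 1:] * p) (inverse y) * exp (- inverse y))) \<longlongrightarrow> complex_of_real 0) (at_right 0)"
        by (rule tendsto_of_real)
      moreover have "\<forall>\<^sub>F y in at_right 0. complex_of_real (poly ([:0, 1:] * p) (inverse y) * exp (- inverse y)) = (1 / y) *\<^sub>R exp_cutoff p y"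
        by (auto simp: eventually_at_right_field exp_cutoff_def scaleR_conv_of_real divide_inverse intro!: exI[of _ 1])
      ultimately show "((\<lambda>y. (1 / y) *\<^sub>R exp_cutoff p y) \<longlongrightarrow> 0) (at_right 0)"
        using tendsto_cong by force
    qed
    then have "((\<lambda>y. norm ((1 / y) *\<^sub>R exp_cutoff p y)) \<longlongrightarrow> 0) (at 0)" by (rule tendsto_norm_zero)
    then have "(exp_cutoff p has_vector_derivative 0) (at 0)"
      unfolding has_vector_derivative_def has_derivative_at by (simp add: exp_cutoff_def[of p 0])
    then show ?thesis using 3 by (simp add: exp_cutoff_def)
  qed
qed

lemma smooth_exp_cutoff: "smooth (exp_cutoff p)"
proof -
  have "differentiable_upto n (exp_cutoff p)" for n
    by (induction n arbitrary: p) (auto simp: vderiv_eqI[OF exp_cutoff_has_vderiv] intro: has_vderiv_differentiable exp_cutoff_has_vderiv)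
  then show ?thesis by (simp add: smooth_iff_differentiable_upto)
qed

text \<open>
  The product \<open>e\<^sup>-\<^sup>1\<^sup>/\<^sup>(\<^sup>1\<^sup>+\<^sup>x\<^sup>) e\<^sup>-\<^sup>1\<^sup>/\<^sup>(\<^sup>1\<^sup>-\<^sup>x\<^sup>)\<close> on the interval \<open>(-1, 1)\<close>, extended by zero.
\<close>

definition bump :: "real \<Rightarrow> real" where
  "bump x = (if \<bar>x\<bar> < 1 then exp (- (1 / (1 + x))) * exp (- (1 / (1 - x))) else 0)"

lemma bump_test: "(\<lambda>x. complex_of_real (bump x)) \<in> test_functions"
proof -
  have "smooth (\<lambda>x. exp_cutoff 1 (1 + 1 * x) * exp_cutoff 1 (1 + (-1) * x))"
    by (intro smooth_mult smooth_affine smooth_exp_cutoff)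
  also have "(\<lambda>x. exp_cutoff 1 (1 + 1 * x) * exp_cutoff 1 (1 + (-1) * x)) = (\<lambda>x. complex_of_real (bump x))"
    by (auto simp: exp_cutoff_def bump_def fun_eq_iff)
  finally show ?thesis unfolding test_functions_iff by (auto intro!: exI[of _ 1] simp: bump_def)
qed

lemma bump_nonneg: "bump x \<ge> 0"
  by (simp add: bump_def)

lemma bump_0: "bump 0 > 0"
  by (simp add: bump_def)

lemma integral_bump_pos: "(LINT x|lborel. bump x) > 0"
proof -
  have i: "integrable lborel bump"
    using integrable_Re[OF test_L2_integrable(1)[OF bump_test]] by simp
  have "(LINT x|lborel. bump x) \<noteq> 0"
  proof
    assume "(LINT x|lborel. bump x) = 0"
    then have "AE x in lborel. bump x = 0"
      using integral_nonneg_eq_0_iff_AE[OF i] bump_nonneg by simp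
    then have "AE x in lborel. x \<notin> {-1<..<1::real}"
      by (rule eventually_mono) (auto simp: bump_def split: if_splits)
    then have "{-1<..<1::real} \<in> null_sets lborel" by (simp add: AE_iff_null_sets)
    then show False by (simp add: null_sets_def)
  qed
  moreover have "(LINT x|lborel. bump x) \<ge> 0" by (simp add: bump_nonneg)
  ultimately show ?thesis by linarith
qed

section \<open>Integrability of even functions\<close>

lemma integrable_even:
  fixes f :: "real \<Rightarrow> real"
  assumes f: "integrable lborel (\<lambda>x. indicator {0..} x * f x)" "\<And>x. x \<ge> 0 \<Longrightarrow> f x \<ge> 0" "f \<in> borel_measurable borel"
  shows "integrable lborel (\<lambda>x. f \<bar>x\<bar>)"
proof (rule Bochner_Integration.integrable_bound)
  show "integrable lborel (\<lambda>x. indicator {0..} x * f x + indicator {0..} (-x) * f (-x))"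
    using f(1) lborel_integrable_real_affine[OF f(1), of "-1" 0] by (intro Bochner_Integration.integrable_add) auto
  show "AE x in lborel. norm (f \<bar>x\<bar>) \<le> norm (indicator {0..} x * f x + indicator {0..} (-x) * f (-x))"
    using f(2) by (intro AE_I2) (auto simp: indicator_def abs_if)
qed (use f(3) in measurable)

lemma integrable_of_has_integral_half_line:
  fixes f :: "real \<Rightarrow> real"
  assumes "(f has_integral I) {a..}" "\<And>x. x \<ge> a \<Longrightarrow> f x \<ge> 0" "f \<in> borel_measurable borel"
  shows "integrable lborel (\<lambda>x. indicator {a..} x * f x)"
proof -
  have "f absolutely_integrable_on {a..}"
    using assms by (intro nonnegative_absolutely_integrable_1) (auto intro: has_integral_integrable)
  then have "integrable lebesgue (\<lambda>x. indicator {a..} x * f x)"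
    by (simp add: set_integrable_def)
  then show ?thesis using assms(3) by (subst (asm) integrable_completion) auto
qed

lemma integrable_exp_abs:
  assumes "a > 0" shows "integrable lborel (\<lambda>x::real. exp (- (a * \<bar>x\<bar>)))"
proof (rule integrable_even[where f="\<lambda>x. exp (- (a * x))"])
  show "integrable lborel (\<lambda>x. indicator {0..} x * exp (- (a * x)))"
    using has_integral_exp_minus_to_infinity[OF assms, of 0]
    by (intro integrable_of_has_integral_half_line) auto
qed auto

lemma integrable_powr_abs:
  assumes "p > 1" shows "integrable lborel (\<lambda>x::real. (1 + \<bar>x\<bar>) powr (- p))"
proof (rule integrable_even[where f="\<lambda>x. (1 + x) powr (- p)"])
  have "((\<lambda>x. x powr (-p)) has_integral -(1 powr (-p + 1)) / (-p + 1)) {1..}"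
    using assms by (intro has_integral_powr_to_inf) auto
  then have "integrable lborel (\<lambda>x. indicator {1..} x * x powr (- p))"
    by (rule integrable_of_has_integral_half_line) auto
  then have "integrable lborel (\<lambda>x. indicator {1..} (1 + 1 * x) * (1 + 1 * x) powr (- p))"
    by (rule lborel_integrable_real_affine) simp
  then show "integrable lborel (\<lambda>x. indicator {0..} x * (1 + x) powr (- p))"
    by (rule back_subst[of "integrable lborel"]) (auto simp: fun_eq_iff indicator_def)
qed auto

section \<open>The weight and the phase\<close>

definition inv_v_weight :: "real \<Rightarrow> complex" where
  "inv_v_weight \<xi> = complex_of_real (sqrt (cosh (pi * \<xi>)) / sqrt pi)"

lemma v_weight_nonzero [simp]: "v_weight \<xi> \<noteq> 0"
  by (simp add: v_weight_def)

lemma v_weight_mult_inv [simp]: "v_weight \<xi> * inv_v_weight \<xi> = 1" "inv_v_weight \<xi> * v_weight \<xi> = 1"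
proof -
  have "sqrt pi / sqrt (cosh (pi * \<xi>)) * (sqrt (cosh (pi * \<xi>)) / sqrt pi) = 1" by simp
  then show "v_weight \<xi> * inv_v_weight \<xi> = 1" unfolding v_weight_def inv_v_weight_def by (metis of_real_1 of_real_mult)
  then show "inv_v_weight \<xi> * v_weight \<xi> = 1" by (simp add: mult.commute)
qed

lemma v_weight_cancel [simp]: "v_weight \<xi> * (inv_v_weight \<xi> * z) = z" "inv_v_weight \<xi> * (v_weight \<xi> * z) = z"
  by (simp_all add: mult.assoc[symmetric])

lemma smooth_tanh: "smooth (\<lambda>x. complex_of_real (tanh (pi * x)))"
proof -
  have d: "((\<lambda>x. complex_of_real (tanh (pi * x))) has_vector_derivative
      complex_of_real pi + complex_of_real (- pi) * (complex_of_real (tanh (pi * x)) * complex_of_real (tanh (pi * x)))) (at x)" for x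
  proof -
    have "((\<lambda>x. tanh (pi * x)) has_real_derivative pi + (- pi) * (tanh (pi * x) * tanh (pi * x))) (at x)"
      by (auto intro!: derivative_eq_intros simp: power2_eq_square algebra_simps)
    from has_vector_derivative_of_real[OF this] show ?thesis
      by simp
  qed
  have "differentiable_upto n (\<lambda>x. complex_of_real (tanh (pi * x)))" for n
  proof (induction n)
    case (Suc n)
    have "differentiable_upto n (\<lambda>x. complex_of_real pi + complex_of_real (- pi) * (complex_of_real (tanh (pi * x)) * complex_of_real (tanh (pi * x))))"
      by (intro differentiable_upto_add differentiable_upto_mult differentiable_upto_const Suc)
    then show ?case unfolding differentiable_upto.simps vderiv_eqI[OF d] using has_vderiv_differentiable[OF d] by blast
  qed simp
  then show ?thesis by (simp add: smooth_iff_differentiable_upto)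
qed

text \<open>
  If \<open>f' = l f\<close> with \<open>l\<close> smooth, then each order of differentiability of \<open>f\<close> yields the next one.
  For \<open>v\<close> and \<open>1/v\<close> the logarithmic derivative is a multiple of \<open>tanh(\<pi>\<xi>)\<close>.
\<close>

lemma smooth_of_log_derivative:
  assumes d: "\<And>x. (f has_vector_derivative l x * f x) (at x)" and l: "smooth l"
  shows "smooth f"
proof -
  have "differentiable_upto n f" for n
  proof (induction n)
    case (Suc n)
    have "differentiable_upto n (\<lambda>x. l x * f x)"
      using l Suc by (intro differentiable_upto_mult) (auto simp: smooth_iff_differentiable_upto)
    then show ?case unfolding differentiable_upto.simps vderiv_eqI[OF d] using has_vderiv_differentiable[OF d] by blast
  qed simp
  then show ?thesis by (simp add: smooth_iff_differentiable_upto)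
qed

lemma sqrt_cosh_has_derivative:
  "((\<lambda>x. sqrt (cosh (pi * x))) has_real_derivative pi / 2 * tanh (pi * x) * sqrt (cosh (pi * x))) (at x)"
proof -
  define s where "s = sqrt (cosh (pi * x))"
  have s: "s > 0" "cosh (pi * x) = s * s" by (simp_all add: s_def)
  have "pi * sinh (pi * x) / (2 * sqrt (cosh (pi * x))) = pi / 2 * tanh (pi * x) * sqrt (cosh (pi * x))"
    unfolding tanh_def s_def[symmetric] unfolding s(2) using s(1) by (simp add: field_simps)
  moreover have "((\<lambda>x. sqrt (cosh (pi * x))) has_real_derivative inverse (sqrt (cosh (pi * x))) / 2 * (sinh (pi * x) * pi)) (at x)"
    by (rule DERIV_chain2[OF DERIV_real_sqrt]) (auto intro!: derivative_eq_intros)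
  moreover have "inverse c / 2 * (d * pi) = pi * d / (2 * c)" for c d :: real
    by (cases "c = 0") (simp_all add: field_simps)
  ultimately show ?thesis by metis
qed

lemma smooth_inv_v_weight: "smooth inv_v_weight"
proof (rule smooth_of_log_derivative)
  show "smooth (\<lambda>x. complex_of_real (pi / 2) * complex_of_real (tanh (pi * x)))"
    by (intro smooth_mult smooth_const smooth_tanh)
  fix x
  have "((\<lambda>x. sqrt (cosh (pi * x)) / sqrt pi) has_real_derivative pi / 2 * tanh (pi * x) * (sqrt (cosh (pi * x)) / sqrt pi)) (at x)"
    by (rule DERIV_cong[OF DERIV_cdivide[OF sqrt_cosh_has_derivative]]) simp
  then have "((\<lambda>x. complex_of_real (sqrt (cosh (pi * x)) / sqrt pi)) has_vector_derivative complex_of_real (pi / 2 * tanh (pi * x) * (sqrt (cosh (pi * x)) / sqrt pi))) (at x)"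
    by (rule has_vector_derivative_of_real)
  then show "(inv_v_weight has_vector_derivative complex_of_real (pi / 2) * complex_of_real (tanh (pi * x)) * inv_v_weight x) (at x)"
    unfolding inv_v_weight_def[abs_def] by simp
qed

lemma smooth_v_weight: "smooth v_weight"
proof (rule smooth_of_log_derivative)
  show "smooth (\<lambda>x. complex_of_real (- pi / 2) * complex_of_real (tanh (pi * x)))"
    by (intro smooth_mult smooth_const smooth_tanh)
  fix x
  have "((\<lambda>x. sqrt pi / sqrt (cosh (pi * x))) has_real_derivative (- pi / 2) * tanh (pi * x) * (sqrt pi / sqrt (cosh (pi * x)))) (at x)"
    by (rule DERIV_cong[OF DERIV_divide[OF DERIV_const sqrt_cosh_has_derivative]]) (auto simp: field_simps)
  then have "((\<lambda>x. complex_of_real (sqrt pi / sqrt (cosh (pi * x)))) has_vector_derivative complex_of_real ((- pi / 2) * tanh (pi * x) * (sqrt pi / sqrt (cosh (pi * x))))) (at x)"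
    by (rule has_vector_derivative_of_real)
  then show "(v_weight has_vector_derivative complex_of_real (- pi / 2) * complex_of_real (tanh (pi * x)) * v_weight x) (at x)"
    unfolding v_weight_def[abs_def] by simp
qed

lemma v_weight_borel [measurable]: "v_weight \<in> borel_measurable borel" "inv_v_weight \<in> borel_measurable borel"
  by (intro smooth_borel smooth_v_weight smooth_inv_v_weight)+

lemma norm_v_weight: "norm (v_weight \<xi>) = sqrt pi / sqrt (cosh (pi * \<xi>))"
  unfolding v_weight_def norm_of_real by simp

lemma norm_inv_v_weight: "norm (inv_v_weight \<xi>) = sqrt (cosh (pi * \<xi>)) / sqrt pi"
  unfolding inv_v_weight_def norm_of_real by simp

lemma sqrt_cosh_shift: "sqrt (cosh (pi * (\<xi> - r))) \<le> exp (pi / 2 * \<bar>r\<bar>) * sqrt (cosh (pi * \<xi>))"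
proof -
  have e: "exp (pi * (\<xi> - r)) = exp (pi * \<xi>) * exp (- (pi * r))" "exp (- (pi * (\<xi> - r))) = exp (- (pi * \<xi>)) * exp (pi * r)"
    by (simp_all add: exp_add[symmetric] algebra_simps)
  have "pi * r \<le> pi * \<bar>r\<bar>" "- (pi * r) \<le> pi * \<bar>r\<bar>"
    using mult_left_mono[of r "\<bar>r\<bar>" pi] mult_left_mono[of "-r" "\<bar>r\<bar>" pi] by auto
  then have "cosh (pi * (\<xi> - r)) \<le> (exp (pi * \<xi>) * exp (pi * \<bar>r\<bar>) + exp (- (pi * \<xi>)) * exp (pi * \<bar>r\<bar>)) / 2"
    unfolding cosh_field_def e by (intro divide_right_mono add_mono mult_left_mono) auto
  also have "\<dots> = exp (pi * \<bar>r\<bar>) * cosh (pi * \<xi>)" by (simp add: cosh_field_def algebra_simps)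
  also have "\<dots> = (exp (pi / 2 * \<bar>r\<bar>))\<^sup>2 * cosh (pi * \<xi>)" by (simp add: power2_eq_square exp_add[symmetric])
  finally have "sqrt (cosh (pi * (\<xi> - r))) \<le> sqrt ((exp (pi / 2 * \<bar>r\<bar>))\<^sup>2 * cosh (pi * \<xi>))" by (rule real_sqrt_le_mono)
  then show ?thesis by (simp add: real_sqrt_mult)
qed

lemma inv_v_weight_shift: "norm (inv_v_weight (\<xi> - r)) \<le> exp (pi / 2 * \<bar>r\<bar>) * norm (inv_v_weight \<xi>)"
  using sqrt_cosh_shift[of \<xi> r] by (simp add: norm_inv_v_weight divide_right_mono)

lemma v_weight_shift: "norm (v_weight (\<xi> - r)) \<le> exp (pi / 2 * \<bar>r\<bar>) * norm (v_weight \<xi>)"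
proof -
  have "sqrt (cosh (pi * \<xi>)) \<le> exp (pi / 2 * \<bar>r\<bar>) * sqrt (cosh (pi * (\<xi> - r)))"
    using sqrt_cosh_shift[of "\<xi> - r" "-r"] by simp
  then show ?thesis by (simp add: norm_v_weight field_simps)
qed

lemma norm_v_weight_le: "norm (v_weight \<xi>) \<le> sqrt pi"
  using cosh_real_ge_1[of "pi * \<xi>"] by (simp add: norm_v_weight divide_le_eq)

lemma v_weight_L2: "v_weight \<in> L2 lborel"
proof (rule L2_I)
  show "integrable lborel (\<lambda>x. (norm (v_weight x))\<^sup>2)"
  proof (rule Bochner_Integration.integrable_bound)
    show "integrable lborel (\<lambda>x. 2 * pi * exp (- (pi * \<bar>x\<bar>)))"
      by (intro integrable_mult_right integrable_exp_abs) simp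
    show "AE x in lborel. norm ((norm (v_weight x))\<^sup>2) \<le> norm (2 * pi * exp (- (pi * \<bar>x\<bar>)))"
    proof (rule AE_I2)
      fix x :: real
      have "exp (pi * \<bar>x\<bar>) \<le> exp (pi * \<bar>x\<bar>) + exp (- (pi * \<bar>x\<bar>))" by simp
      also have "\<dots> = 2 * cosh \<bar>pi * x\<bar>" by (simp add: cosh_field_def abs_mult)
      finally have "exp (pi * \<bar>x\<bar>) / 2 \<le> cosh (pi * x)" by simp
      then have "pi / cosh (pi * x) \<le> pi / (exp (pi * \<bar>x\<bar>) / 2)" by (intro divide_left_mono) auto
      then show "norm ((norm (v_weight x))\<^sup>2) \<le> norm (2 * pi * exp (- (pi * \<bar>x\<bar>)))"
        by (simp add: norm_v_weight power_divide exp_minus field_simps)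
    qed
  qed simp
qed simp

text \<open>
  The reflection formula at \<open>z = 1/2 + i\<xi>\<close>, where \<open>1 - z\<close> is the conjugate of \<open>z\<close>.
\<close>

lemma norm_Gamma_half_line: "norm (Gamma (1/2 + \<i> * complex_of_real \<xi>)) = norm (v_weight \<xi>)"
proof -
  let ?z = "1/2 + \<i> * complex_of_real \<xi>"
  have z: "cnj ?z = 1 - ?z" by (simp add: complex_eq_iff)
  have "complex_of_real ((norm (Gamma ?z))\<^sup>2) = Gamma ?z * Gamma (1 - ?z)"
    unfolding complex_norm_square cnj_Gamma z ..
  also have "\<dots> = of_real pi / sin (of_real pi * ?z)" by (rule Gamma_reflection_complex)
  also have "sin (of_real pi * ?z) = cos (\<i> * complex_of_real (pi * \<xi>))"
  proof -
    have "of_real pi * ?z = complex_of_real (pi / 2) + \<i> * complex_of_real (pi * \<xi>)" by (simp add: algebra_simps)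
    then show ?thesis by (simp only: sin_add sin_of_real cos_of_real) simp
  qed
  also have "\<dots> = complex_of_real (cosh (pi * \<xi>))"
    by (simp add: cos_exp_eq cosh_field_def mult.assoc[symmetric] exp_of_real[symmetric])
  finally have "complex_of_real ((norm (Gamma ?z))\<^sup>2) = complex_of_real (pi / cosh (pi * \<xi>))" by simp
  then have "(norm (Gamma ?z))\<^sup>2 = pi / cosh (pi * \<xi>)" by (simp only: of_real_eq_iff)
  also have "\<dots> = (norm (v_weight \<xi>))\<^sup>2" by (simp add: norm_v_weight power_divide)
  finally show ?thesis by (rule power2_eq_imp_eq) auto
qed

lemma Gamma_half_line: "Gamma (1/2 + \<i> * complex_of_real \<xi>) = v_weight \<xi> * gamma_phase \<xi>"
proof -
  have "complex_of_real (norm (v_weight \<xi>)) = v_weight \<xi>" by (simp only: norm_v_weight) (simp only: v_weight_def)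
  then show ?thesis using Gamma_half_line_nonzero[of \<xi>]
    by (simp add: gamma_phase_def norm_Gamma_half_line)
qed

lemma smooth_gamma_phase: "smooth gamma_phase"
proof -
  have "Gamma holomorphic_on {z. Re z > 0}"
    by (rule holomorphic_Gamma) (auto elim!: nonpos_Ints_cases')
  from smooth_holomorphic[OF this, of "1/2" \<i>] have "smooth (\<lambda>\<xi>. Gamma (1/2 + \<i> * complex_of_real \<xi>))"
    by (simp add: open_halfspace_Re_gt)
  from smooth_mult[OF smooth_inv_v_weight this] show ?thesis
    by (rule back_subst[of smooth]) (simp add: Gamma_half_line)
qed

section \<open>Averages of square-integrable functions\<close>

text \<open>
  Cauchy-Schwarz with respect to the weight \<open>|k|\<close>, for fixed \<open>x\<close>, followed by Tonelli's theorem.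
\<close>

lemma L2_average:
  fixes k :: "real \<Rightarrow> complex" and G :: "real \<Rightarrow> real \<Rightarrow> complex"
  assumes k: "integrable lborel k"
    and G [measurable]: "(\<lambda>(t, x). G t x) \<in> borel_measurable (borel \<Otimes>\<^sub>M borel)"
    and GL: "\<And>t. G t \<in> L2 lborel"
    and int: "integrable lborel (\<lambda>t. norm (k t) * (L2_norm lborel (G t))\<^sup>2)"
  shows "(\<lambda>x. LINT t|lborel. k t * G t x) \<in> L2 lborel"
    and "(L2_norm lborel (\<lambda>x. LINT t|lborel. k t * G t x))\<^sup>2
      \<le> (LINT t|lborel. norm (k t)) * (LINT t|lborel. norm (k t) * (L2_norm lborel (G t))\<^sup>2)"
proof -
  note [measurable] = borel_measurable_integrable[OF k]
  define F where "F x = (LINT t|lborel. k t * G t x)" for x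
  have [measurable]: "F \<in> borel_measurable borel"
    unfolding F_def[abs_def] by measurable
  define A where "A = (LINT t|lborel. norm (k t))"
  define B where "B = (LINT t|lborel. norm (k t) * (L2_norm lborel (G t))\<^sup>2)"
  have A: "(\<integral>\<^sup>+t. ennreal (norm (k t)) \<partial>lborel) = ennreal A" "A \<ge> 0"
    unfolding A_def using k by (auto intro!: nn_integral_eq_integral)
  have B0: "B \<ge> 0" unfolding B_def by (intro Bochner_Integration.integral_nonneg) auto
  have point: "ennreal ((norm (F x))\<^sup>2) \<le> ennreal A * (\<integral>\<^sup>+t. ennreal (norm (k t) * (norm (G t x))\<^sup>2) \<partial>lborel)" for x
  proof -
    have "ennreal (norm (F x)) \<le> (\<integral>\<^sup>+t. ennreal (norm (k t * G t x)) \<partial>lborel)"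
      unfolding F_def
      by (cases "integrable lborel (\<lambda>t. k t * G t x)") (auto intro: integral_norm_bound_ennreal simp: not_integrable_integral_eq)
    also have "\<dots> = (\<integral>\<^sup>+t. ennreal (sqrt (norm (k t))) * ennreal (sqrt (norm (k t)) * norm (G t x)) \<partial>lborel)"
      by (intro nn_integral_cong) (simp add: ennreal_mult[symmetric] norm_mult mult.assoc[symmetric])
    finally have "(ennreal (norm (F x)))\<^sup>2 \<le> (\<integral>\<^sup>+t. ennreal (sqrt (norm (k t))) * ennreal (sqrt (norm (k t)) * norm (G t x)) \<partial>lborel)\<^sup>2"
      by (rule power_mono) simp
    also have "\<dots> \<le> (\<integral>\<^sup>+t. (ennreal (sqrt (norm (k t))))\<^sup>2 \<partial>lborel) * (\<integral>\<^sup>+t. (ennreal (sqrt (norm (k t)) * norm (G t x)))\<^sup>2 \<partial>lborel)"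
      by (rule Cauchy_Schwarz_nn_integral) measurable
    also have "(\<integral>\<^sup>+t. (ennreal (sqrt (norm (k t))))\<^sup>2 \<partial>lborel) = ennreal A"
      by (subst A(1)[symmetric], intro nn_integral_cong) (simp add: ennreal_power)
    also have "(\<integral>\<^sup>+t. (ennreal (sqrt (norm (k t)) * norm (G t x)))\<^sup>2 \<partial>lborel) = (\<integral>\<^sup>+t. ennreal (norm (k t) * (norm (G t x))\<^sup>2) \<partial>lborel)"
      by (intro nn_integral_cong) (simp add: ennreal_power power_mult_distrib)
    finally show ?thesis by (simp add: ennreal_power)
  qed
  have "(\<integral>\<^sup>+x. ennreal ((norm (F x))\<^sup>2) \<partial>lborel) \<le> (\<integral>\<^sup>+x. ennreal A * (\<integral>\<^sup>+t. ennreal (norm (k t) * (norm (G t x))\<^sup>2) \<partial>lborel) \<partial>lborel)"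
    by (intro nn_integral_mono point)
  also have "\<dots> = ennreal A * (\<integral>\<^sup>+x. (\<integral>\<^sup>+t. ennreal (norm (k t) * (norm (G t x))\<^sup>2) \<partial>lborel) \<partial>lborel)"
    by (rule nn_integral_cmult) measurable
  also have "(\<integral>\<^sup>+x. (\<integral>\<^sup>+t. ennreal (norm (k t) * (norm (G t x))\<^sup>2) \<partial>lborel) \<partial>lborel)
      = (\<integral>\<^sup>+t. (\<integral>\<^sup>+x. ennreal (norm (k t) * (norm (G t x))\<^sup>2) \<partial>lborel) \<partial>lborel)"
    by (rule lborel_pair.Fubini') measurable
  also have "\<dots> = (\<integral>\<^sup>+t. ennreal (norm (k t) * (L2_norm lborel (G t))\<^sup>2) \<partial>lborel)"
  proof (rule nn_integral_cong)
    fix t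
    have "(\<integral>\<^sup>+x. ennreal (norm (k t) * (norm (G t x))\<^sup>2) \<partial>lborel) = ennreal (LINT x|lborel. norm (k t) * (norm (G t x))\<^sup>2)"
      using L2_sq_integrable[OF GL] by (intro nn_integral_eq_integral) auto
    then show "(\<integral>\<^sup>+x. ennreal (norm (k t) * (norm (G t x))\<^sup>2) \<partial>lborel) = ennreal (norm (k t) * (L2_norm lborel (G t))\<^sup>2)"
      by (simp add: L2_norm_sq)
  qed
  also have "\<dots> = ennreal B" unfolding B_def by (intro nn_integral_eq_integral int) auto
  finally have le: "(\<integral>\<^sup>+x. ennreal ((norm (F x))\<^sup>2) \<partial>lborel) \<le> ennreal (A * B)"
    using A(2) B0 by (simp add: ennreal_mult)
  have i: "integrable lborel (\<lambda>x. (norm (F x))\<^sup>2)"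
    by (rule integrableI_bounded) (use le in \<open>auto simp: less_top[symmetric] top_unique\<close>)
  show "(\<lambda>x. LINT t|lborel. k t * G t x) \<in> L2 lborel"
    unfolding F_def[symmetric] by (rule L2_I) (use i in auto)
  have "ennreal (LINT x|lborel. (norm (F x))\<^sup>2) \<le> ennreal (A * B)"
    using le i by (subst (asm) nn_integral_eq_integral) auto
  then show "(L2_norm lborel (\<lambda>x. LINT t|lborel. k t * G t x))\<^sup>2
      \<le> (LINT t|lborel. norm (k t)) * (LINT t|lborel. norm (k t) * (L2_norm lborel (G t))\<^sup>2)"
    unfolding F_def[symmetric] L2_norm_sq[of lborel F] A_def[symmetric] B_def[symmetric]
    using A(2) B0 by simp
qed

section \<open>Weighted translations and mollification\<close>

text \<open>
  Translation by \<open>r\<close>, conjugated with multiplication by \<open>m\<close>.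
\<close>

definition weighted_shift :: "(real \<Rightarrow> real) \<Rightarrow> real \<Rightarrow> (real \<Rightarrow> complex) \<Rightarrow> real \<Rightarrow> complex" where
  "weighted_shift m r g x = complex_of_real (m (x - r) / m x) * g (x - r)"

text \<open>
  Weights that change over a distance \<open>r\<close> by a factor of at most \<open>e\<^sup>c\<^sup>r\<close>, in either direction.
\<close>

definition mild_weight :: "real \<Rightarrow> (real \<Rightarrow> real) \<Rightarrow> bool" where
  "mild_weight c m \<longleftrightarrow> 0 \<le> c \<and> m \<in> borel_measurable borel \<and> (\<forall>x. m x > 0) \<and> (\<forall>x r. m (x - r) \<le> exp (c * \<bar>r\<bar>) * m x)"

lemma mild_weightD:
  assumes "mild_weight c m"
  shows "0 \<le> c" "m \<in> borel_measurable borel" "m x > 0" "m (x - r) \<le> exp (c * \<bar>r\<bar>) * m x"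
    "m (x - r) / m x \<le> exp (c * \<bar>r\<bar>)" "0 \<le> m (x - r) / m x" "\<bar>m (x - r) / m x - 1\<bar> \<le> exp (c * \<bar>r\<bar>) - 1"
proof -
  have pos: "\<And>x. m x > 0" and sh: "\<And>x r. m (x - r) \<le> exp (c * \<bar>r\<bar>) * m x" and c: "0 \<le> c"
    using assms by (auto simp: mild_weight_def)
  show "0 \<le> c" "m \<in> borel_measurable borel" "m x > 0" "m (x - r) \<le> exp (c * \<bar>r\<bar>) * m x"
    using assms by (auto simp: mild_weight_def)
  show up: "m (x - r) / m x \<le> exp (c * \<bar>r\<bar>)" using sh[of x r] pos[of x] by (simp add: divide_le_eq)
  show "0 \<le> m (x - r) / m x" using pos[of x] pos[of "x - r"] by simp
  have "m x \<le> exp (c * \<bar>r\<bar>) * m (x - r)" using sh[of "x - r" "-r"] by simp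
  then have "exp (- (c * \<bar>r\<bar>)) \<le> m (x - r) / m x"
    using pos[of x] by (simp add: exp_minus field_simps)
  moreover have "1 - exp (- (c * \<bar>r\<bar>)) \<le> exp (c * \<bar>r\<bar>) - 1"
    using exp_ge_add_one_self[of "c * \<bar>r\<bar>"] exp_ge_add_one_self[of "- (c * \<bar>r\<bar>)"] by linarith
  ultimately show "\<bar>m (x - r) / m x - 1\<bar> \<le> exp (c * \<bar>r\<bar>) - 1" using up by linarith
qed

lemma weighted_shift_L2:
  assumes m: "mild_weight c m" and g: "g \<in> L2 lborel"
  shows "weighted_shift m r g \<in> L2 lborel" "L2_norm lborel (weighted_shift m r g) \<le> exp (c * \<bar>r\<bar>) * L2_norm lborel g"
proof -
  note [measurable] = mild_weightD(2)[OF m] L2_borel[OF g]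
  have le: "norm (weighted_shift m r g x) \<le> norm (complex_of_real (exp (c * \<bar>r\<bar>)) * g (x - r))" for x
    using mild_weightD(5,6)[OF m, of x r] unfolding weighted_shift_def norm_mult norm_of_real
    by (intro mult_right_mono) auto
  have L: "(\<lambda>x. complex_of_real (exp (c * \<bar>r\<bar>)) * g (x - r)) \<in> L2 lborel"
    by (intro L2_cmult L2_translate g)
  have [measurable]: "weighted_shift m r g \<in> borel_measurable borel" unfolding weighted_shift_def[abs_def] by measurable
  show "weighted_shift m r g \<in> L2 lborel"
    by (rule L2_dominated[OF L2_sq_integrable[OF L]]) (use le in auto)
  have "L2_norm lborel (weighted_shift m r g) \<le> L2_norm lborel (\<lambda>x. complex_of_real (exp (c * \<bar>r\<bar>)) * g (x - r))"
    by (rule L2_norm_mono[OF L]) (use le in auto)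
  also have "\<dots> = exp (c * \<bar>r\<bar>) * L2_norm lborel g"
    by (simp only: L2_norm_cmult L2_norm_translate norm_of_real abs_exp_cancel)
  finally show "L2_norm lborel (weighted_shift m r g) \<le> exp (c * \<bar>r\<bar>) * L2_norm lborel g" .
qed

lemma weighted_shift_tendsto:
  assumes m: "mild_weight c m" and g: "g \<in> L2 lborel" and r: "r \<longlonglongrightarrow> (0::real)"
  shows "L2_tendsto lborel (\<lambda>n. weighted_shift m (r n) g) g"
proof (rule L2_tendsto_bound)
  show "weighted_shift m (r n) g \<in> L2 lborel" for n by (rule weighted_shift_L2[OF m g])
  note [measurable] = mild_weightD(2)[OF m] L2_borel[OF g]
  show "L2_norm lborel (\<lambda>x. weighted_shift m (r n) g x - g x)
     \<le> (exp (c * \<bar>r n\<bar>) - 1) * L2_norm lborel g + L2_norm lborel (\<lambda>x. g (x - r n) - g x)" for n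
  proof -
    have L: "(\<lambda>x. complex_of_real (exp (c * \<bar>r n\<bar>) - 1) * g (x - r n)) \<in> L2 lborel"
      by (intro L2_cmult L2_translate g)
    have "L2_norm lborel (\<lambda>x. weighted_shift m (r n) g x - g x) \<le> L2_norm lborel (\<lambda>x. weighted_shift m (r n) g x - g (x - r n)) + L2_norm lborel (\<lambda>x. g (x - r n) - g x)"
      by (intro L2_norm_triangle_diff weighted_shift_L2[OF m g] L2_translate g)
    also have "L2_norm lborel (\<lambda>x. weighted_shift m (r n) g x - g (x - r n)) \<le> L2_norm lborel (\<lambda>x. complex_of_real (exp (c * \<bar>r n\<bar>) - 1) * g (x - r n))"
    proof (rule L2_norm_mono[OF L])
      show "(\<lambda>x. weighted_shift m (r n) g x - g (x - r n)) \<in> borel_measurable lborel"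
        unfolding weighted_shift_def by measurable
      show "AE x in lborel. norm (weighted_shift m (r n) g x - g (x - r n)) \<le> norm (complex_of_real (exp (c * \<bar>r n\<bar>) - 1) * g (x - r n))"
      proof (rule AE_I2)
        fix x
        have "weighted_shift m (r n) g x - g (x - r n) = complex_of_real (m (x - r n) / m x - 1) * g (x - r n)"
          by (simp add: weighted_shift_def algebra_simps)
        then show "norm (weighted_shift m (r n) g x - g (x - r n)) \<le> norm (complex_of_real (exp (c * \<bar>r n\<bar>) - 1) * g (x - r n))"
          using mild_weightD(7)[OF m, of x "r n"] by (simp only: norm_mult norm_of_real) (intro mult_right_mono, auto)
      qed
    qed
    also have "\<dots> = (exp (c * \<bar>r n\<bar>) - 1) * L2_norm lborel g"
      using mild_weightD(1)[OF m] by (simp only: L2_norm_cmult L2_norm_translate norm_of_real) simp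
    finally show ?thesis by simp
  qed
  have "(\<lambda>n. (exp (c * \<bar>r n\<bar>) - 1) * L2_norm lborel g + L2_norm lborel (\<lambda>x. g (x - r n) - g x)) \<longlonglongrightarrow> (exp (c * \<bar>0\<bar>) - 1) * L2_norm lborel g + 0"
    by (intro tendsto_intros r L2_tendstoD(3) L2_translation_continuous g)
  then show "(\<lambda>n. (exp (c * \<bar>r n\<bar>) - 1) * L2_norm lborel g + L2_norm lborel (\<lambda>x. g (x - r n) - g x)) \<longlonglongrightarrow> 0" by simp
qed fact

lemma weighted_shift_measurable:
  assumes "mild_weight c m" and g: "g \<in> L2 lborel"
  shows "(\<lambda>(t, x). weighted_shift m (a * t) g x) \<in> borel_measurable (borel \<Otimes>\<^sub>M borel)"
proof -
  note [measurable] = mild_weightD(2)[OF assms(1)] L2_borel[OF g]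
  show ?thesis unfolding weighted_shift_def by measurable
qed

lemma integrable_test_weighted_shift:
  assumes m: "mild_weight c m" and g: "g \<in> L2 lborel" and k: "k \<in> test_functions" and a: "a \<noteq> 0"
  shows "integrable lborel (\<lambda>t. k t * weighted_shift m (a * t) g x)"
proof -
  note [measurable] = mild_weightD(2)[OF m] L2_borel[OF g] test_borel[OF k]
  obtain R where R: "R > 0" "\<And>x. \<bar>x\<bar> > R \<Longrightarrow> k x = 0" using test_supportE[OF k] by blast
  have "(\<lambda>t. complex_of_real (m (x - a * t) / m x) * k t) \<in> L2 lborel"
  proof (rule L2_dominated)
    show "integrable lborel (\<lambda>t. (norm (complex_of_real (exp (c * (\<bar>a\<bar> * R))) * k t))\<^sup>2)"
      by (intro L2_sq_integrable L2_cmult test_L2_integrable k)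
    show "AE t in lborel. norm (complex_of_real (m (x - a * t) / m x) * k t) \<le> norm (complex_of_real (exp (c * (\<bar>a\<bar> * R))) * k t)"
    proof (rule AE_I2)
      fix t
      show "norm (complex_of_real (m (x - a * t) / m x) * k t) \<le> norm (complex_of_real (exp (c * (\<bar>a\<bar> * R))) * k t)"
      proof (cases "\<bar>t\<bar> > R")
        case False
        then have "c * \<bar>a * t\<bar> \<le> c * (\<bar>a\<bar> * R)"
          using mild_weightD(1)[OF m] unfolding abs_mult by (intro mult_left_mono) auto
        then have "m (x - a * t) / m x \<le> exp (c * (\<bar>a\<bar> * R))"
          using order_trans[OF mild_weightD(5)[OF m, of x "a * t"]] by simp
        then show ?thesis using mild_weightD(6)[OF m, of x "a * t"]
          by (simp only: norm_mult norm_of_real) (intro mult_right_mono, auto)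
      qed (simp add: R)
    qed
  qed measurable
  moreover have "(\<lambda>t. g (x - a * t)) \<in> L2 lborel"
  proof (rule L2_I)
    show "integrable lborel (\<lambda>t. (norm (g (x - a * t)))\<^sup>2)"
      using lborel_integrable_real_affine[OF L2_sq_integrable[OF g], of "- a" x] a by simp
  qed measurable
  ultimately have "integrable lborel (\<lambda>t. complex_of_real (m (x - a * t) / m x) * k t * g (x - a * t))"
    by (rule L2_mult_integrable)
  then show ?thesis by (rule back_subst[of "integrable lborel"]) (auto simp: weighted_shift_def)
qed

lemma L2_weighted_convolution:
  assumes m: "mild_weight c m" and g: "g \<in> L2 lborel" and k: "k \<in> test_functions"
  shows "(\<lambda>x. LINT t|lborel. k t * weighted_shift m t g x) \<in> L2 lborel"
proof (rule L2_average)
  show "(\<lambda>(t, x). weighted_shift m t g x) \<in> borel_measurable (borel \<Otimes>\<^sub>M borel)"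
    using weighted_shift_measurable[OF m g, of 1] by simp
  obtain R where R: "R > 0" "\<And>x. \<bar>x\<bar> > R \<Longrightarrow> k x = 0" using test_supportE[OF k] by blast
  note [measurable] = mild_weightD(2)[OF m] L2_borel[OF g] test_borel[OF k]
  show "integrable lborel (\<lambda>t. norm (k t) * (L2_norm lborel (weighted_shift m t g))\<^sup>2)"
  proof (rule Bochner_Integration.integrable_bound)
    show "integrable lborel (\<lambda>t. norm (k t) * (exp (c * R) * L2_norm lborel g)\<^sup>2)"
      by (intro integrable_mult_left integrable_norm test_L2_integrable k)
    show "(\<lambda>t. norm (k t) * (L2_norm lborel (weighted_shift m t g))\<^sup>2) \<in> borel_measurable lborel"
      unfolding L2_norm_def weighted_shift_def by measurable
    show "AE t in lborel. norm (norm (k t) * (L2_norm lborel (weighted_shift m t g))\<^sup>2) \<le> norm (norm (k t) * (exp (c * R) * L2_norm lborel g)\<^sup>2)"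
    proof (rule AE_I2)
      fix t
      show "norm (norm (k t) * (L2_norm lborel (weighted_shift m t g))\<^sup>2) \<le> norm (norm (k t) * (exp (c * R) * L2_norm lborel g)\<^sup>2)"
      proof (cases "\<bar>t\<bar> > R")
        case False
        then have "c * \<bar>t\<bar> \<le> c * R" using mild_weightD(1)[OF m] by (intro mult_left_mono) auto
        then have "exp (c * \<bar>t\<bar>) * L2_norm lborel g \<le> exp (c * R) * L2_norm lborel g"
          by (intro mult_right_mono) auto
        then have "L2_norm lborel (weighted_shift m t g) \<le> exp (c * R) * L2_norm lborel g"
          using weighted_shift_L2(2)[OF m g, of t] by linarith
        then have "(L2_norm lborel (weighted_shift m t g))\<^sup>2 \<le> (exp (c * R) * L2_norm lborel g)\<^sup>2"
          by (rule power_mono) simp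
        then show ?thesis by (simp add: abs_mult mult_left_mono)
      qed (simp add: R)
    qed
  qed
qed (intro test_L2_integrable k weighted_shift_L2[OF m g])+

definition mollifier :: "real \<Rightarrow> complex" where
  "mollifier x = complex_of_real (bump x / (LINT t|lborel. bump t))"

lemma mollifier_test: "mollifier \<in> test_functions"
proof -
  have "(\<lambda>x. complex_of_real (1 / (LINT t|lborel. bump t)) * complex_of_real (bump x)) \<in> test_functions"
    by (intro test_mult bump_test smooth_const)
  then show ?thesis by (rule back_subst[of "\<lambda>f. f \<in> test_functions"]) (auto simp: mollifier_def)
qed

lemma integral_mollifier: "(LINT x|lborel. mollifier x) = 1" "(LINT x|lborel. norm (mollifier x)) = 1"
proof -
  have "(LINT x|lborel. mollifier x) = complex_of_real (LINT x|lborel. bump x / (LINT t|lborel. bump t))"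
    unfolding mollifier_def by (rule integral_complex_of_real)
  then show "(LINT x|lborel. mollifier x) = 1" using integral_bump_pos by simp
  have "norm (mollifier x) = bump x / (LINT t|lborel. bump t)" for x
    unfolding mollifier_def norm_of_real using bump_nonneg[of x] integral_bump_pos by simp
  then show "(LINT x|lborel. norm (mollifier x)) = 1" using integral_bump_pos by simp
qed

text \<open>
  Mollification of \<open>m g\<close> instead of \<open>g\<close> still approximates \<open>g\<close> after division by \<open>m\<close>, because the
  translations conjugated with \<open>m\<close> are continuous at \<open>0\<close>.  The scale of the mollifier is put into
  the translation, which leaves a fixed probability density to integrate against.
\<close>

lemma mollification_tendsto:
  assumes m: "mild_weight c m" and g: "g \<in> L2 lborel"
  shows "L2_tendsto lborel (\<lambda>n x. LINT t|lborel. mollifier t * weighted_shift m (1 / real (Suc n) * t) g x) g"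
proof -
  note [measurable] = mild_weightD(2)[OF m] L2_borel[OF g] test_borel[OF mollifier_test]
  define G where "G n t x = weighted_shift m (1 / real (Suc n) * t) g x - g x" for n t x
  have GL: "G n t \<in> L2 lborel" for n t unfolding G_def by (intro L2_diff weighted_shift_L2[OF m g] g)
  have Gm [measurable]: "(\<lambda>(t, x). G n t x) \<in> borel_measurable (borel \<Otimes>\<^sub>M borel)" for n
    unfolding G_def weighted_shift_def by measurable
  have moll: "integrable lborel mollifier" by (rule test_L2_integrable[OF mollifier_test])
  have Gbd: "L2_norm lborel (G n t) \<le> (exp c + 1) * L2_norm lborel g" if "\<bar>t\<bar> \<le> 1" for n t
  proof -
    have "L2_norm lborel (G n t) \<le> L2_norm lborel (weighted_shift m (1 / real (Suc n) * t) g) + L2_norm lborel g"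
      unfolding G_def using L2_norm_triangle[OF weighted_shift_L2(1)[OF m g] L2_cmult[OF g, of "-1"]]
      by (simp add: L2_norm_cmult[of _ "-1", simplified])
    also have "L2_norm lborel (weighted_shift m (1 / real (Suc n) * t) g) \<le> exp (c * \<bar>1 / real (Suc n) * t\<bar>) * L2_norm lborel g"
      by (rule weighted_shift_L2[OF m g])
    also have "\<dots> \<le> exp (c * 1) * L2_norm lborel g"
    proof (intro mult_right_mono)
      have "\<bar>1 / real (Suc n) * t\<bar> \<le> 1" using that by (simp add: abs_mult divide_le_eq)
      then have "c * \<bar>1 / real (Suc n) * t\<bar> \<le> c * 1" using mild_weightD(1)[OF m] by (rule mult_left_mono)
      then show "exp (c * \<bar>1 / real (Suc n) * t\<bar>) \<le> exp (c * 1)" by simp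
    qed simp
    finally show ?thesis by (simp add: algebra_simps)
  qed
  have bd: "norm (norm (mollifier t) * (L2_norm lborel (G n t))\<^sup>2) \<le> norm (mollifier t) * ((exp c + 1) * L2_norm lborel g)\<^sup>2" for n t
  proof (cases "\<bar>t\<bar> \<le> 1")
    case True
    then show ?thesis using power_mono[OF Gbd[OF True, of n], of 2] by (simp add: abs_mult mult_left_mono)
  qed (simp add: mollifier_def bump_def)
  have meas: "(\<lambda>t. norm (mollifier t) * (L2_norm lborel (G n t))\<^sup>2) \<in> borel_measurable lborel" for n
    unfolding L2_norm_def by measurable
  have domint: "integrable lborel (\<lambda>t. norm (mollifier t) * ((exp c + 1) * L2_norm lborel g)\<^sup>2)"
    by (intro integrable_mult_left integrable_norm moll)
  have int: "integrable lborel (\<lambda>t. norm (mollifier t) * (L2_norm lborel (G n t))\<^sup>2)" for n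
    by (rule Bochner_Integration.integrable_bound[OF domint meas]) (use order_trans[OF bd abs_ge_self] in auto)
  have lim: "(\<lambda>n. LINT t|lborel. norm (mollifier t) * (L2_norm lborel (G n t))\<^sup>2) \<longlonglongrightarrow> (LINT t::real|lborel. (0::real))"
  proof (rule integral_dominated_convergence[OF _ meas domint])
    show "AE t in lborel. (\<lambda>n. norm (mollifier t) * (L2_norm lborel (G n t))\<^sup>2) \<longlonglongrightarrow> 0"
    proof (rule AE_I2)
      fix t
      have "(\<lambda>n. t * inverse (real (Suc n))) \<longlonglongrightarrow> t * 0"
        by (intro tendsto_intros LIMSEQ_inverse_real_of_nat)
      then have "(\<lambda>n. 1 / real (Suc n) * t) \<longlonglongrightarrow> 0" by (simp add: divide_inverse mult.commute)
      from L2_tendstoD(3)[OF weighted_shift_tendsto[OF m g this]]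
      have "(\<lambda>n. norm (mollifier t) * (L2_norm lborel (G n t))\<^sup>2) \<longlonglongrightarrow> norm (mollifier t) * 0\<^sup>2"
        unfolding G_def by (intro tendsto_intros)
      then show "(\<lambda>n. norm (mollifier t) * (L2_norm lborel (G n t))\<^sup>2) \<longlonglongrightarrow> 0" by simp
    qed
  qed (use bd in auto)
  define J where "J n x = (LINT t|lborel. mollifier t * weighted_shift m (1 / real (Suc n) * t) g x)" for n x
  have J: "(\<lambda>x. J n x - g x) = (\<lambda>x. LINT t|lborel. mollifier t * G n t x)" for n
  proof
    fix x
    have "(LINT t|lborel. mollifier t * G n t x) = J n x - (LINT t|lborel. mollifier t * g x)"
      unfolding G_def right_diff_distrib J_def
      by (intro Bochner_Integration.integral_diff integrable_test_weighted_shift[OF m g mollifier_test] integrable_mult_left moll) auto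
    then show "J n x - g x = (LINT t|lborel. mollifier t * G n t x)" by (simp add: integral_mollifier)
  qed
  note av = L2_average[OF moll Gm GL int]
  have JL: "J n \<in> L2 lborel" for n
  proof -
    have "(\<lambda>x. (J n x - g x) + g x) \<in> L2 lborel" unfolding fun_cong[OF J] by (rule L2_add[OF av(1) g])
    then show ?thesis by simp
  qed
  have "L2_tendsto lborel J g"
  proof (rule L2_tendsto_bound[OF JL g])
    show "L2_norm lborel (\<lambda>x. J n x - g x) \<le> sqrt (LINT t|lborel. norm (mollifier t) * (L2_norm lborel (G n t))\<^sup>2)" for n
      unfolding J using av(2)[of n] by (intro real_le_rsqrt) (simp add: integral_mollifier)
    show "(\<lambda>n. sqrt (LINT t|lborel. norm (mollifier t) * (L2_norm lborel (G n t))\<^sup>2)) \<longlonglongrightarrow> 0"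
      using tendsto_real_sqrt[OF lim] by simp
  qed
  then show ?thesis unfolding J_def .
qed

section \<open>Convolution with test functions\<close>

definition convolve :: "(real \<Rightarrow> complex) \<Rightarrow> (real \<Rightarrow> complex) \<Rightarrow> real \<Rightarrow> complex" where
  "convolve k y x = (LINT s|lborel. k (x - s) * y s)"

text \<open>
  The substitution \<open>s = x - t / a\<close> expresses convolution with a rescaled kernel through weighted
  translations.
\<close>

lemma convolve_eq_weighted_shift:
  assumes m: "mild_weight c m" and a: "a > 0"
  shows "convolve (\<lambda>r. complex_of_real a * k (0 + a * r)) (\<lambda>s. complex_of_real (m s) * g s) x
    = complex_of_real (m x) * (LINT t|lborel. k t * weighted_shift m (1 / a * t) g x)"
proof -
  have "m x \<noteq> 0" using mild_weightD(3)[OF m, of x] by simp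
  have "convolve (\<lambda>r. complex_of_real a * k (0 + a * r)) (\<lambda>s. complex_of_real (m s) * g s) x
    = \<bar>- 1 / a\<bar> *\<^sub>R (LINT t|lborel. complex_of_real a * k (0 + a * (x - (x + (- 1 / a) * t))) * (complex_of_real (m (x + (- 1 / a) * t)) * g (x + (- 1 / a) * t)))"
    unfolding convolve_def using a by (intro lborel_integral_real_affine) simp
  also have "\<dots> = (LINT t|lborel. complex_of_real (m x) * (k t * weighted_shift m (1 / a * t) g x))"
    using a \<open>m x \<noteq> 0\<close> unfolding weighted_shift_def
    by (subst integral_scaleR_right[symmetric]) (simp add: scaleR_conv_of_real field_simps)
  also have "\<dots> = complex_of_real (m x) * (LINT t|lborel. k t * weighted_shift m (1 / a * t) g x)" by simp
  finally show ?thesis .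
qed

text \<open>
  The mean value inequality for \<open>k'\<close>, and then for \<open>k\<close>; a bound for \<open>k''\<close> makes the estimate uniform
  in the base point.
\<close>

lemma test_taylor_bound:
  assumes k: "k \<in> test_functions"
  obtains B where "B \<ge> 0" "\<And>u h. norm (k (u + h) - k u - complex_of_real h * vderiv k u) \<le> B * h\<^sup>2"
proof -
  obtain B where B: "B > 0" "\<And>x. norm (vderiv (vderiv k) x) \<le> B"
    using test_bounded[OF test_vderiv[OF test_vderiv[OF k]]] by blast
  have lip: "norm (vderiv k b - vderiv k a) \<le> 3 * B * \<bar>b - a\<bar>" for a b
  proof -
    have "norm (vderiv k b - vderiv k a - (b - a) *\<^sub>R vderiv (vderiv k) a) \<le> norm (b - a) * (2 * B)"
    proof (rule vector_differentiable_bound_linearization[where S=UNIV])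
      show "(vderiv k has_vector_derivative vderiv (vderiv k) x) (at x within UNIV)" for x
        using smooth_has_vderiv[OF test_smooth[OF test_vderiv[OF k]]] by simp
      show "norm (vderiv (vderiv k) x - vderiv (vderiv k) a) \<le> 2 * B" for x
        using norm_triangle_ineq4[of "vderiv (vderiv k) x" "vderiv (vderiv k) a"] B(2)[of x] B(2)[of a] by linarith
    qed auto
    moreover have "norm ((b - a) *\<^sub>R vderiv (vderiv k) a) \<le> \<bar>b - a\<bar> * B"
      using B by (simp add: mult_left_mono)
    moreover have "norm (vderiv k b - vderiv k a) \<le> norm (vderiv k b - vderiv k a - (b - a) *\<^sub>R vderiv (vderiv k) a) + norm ((b - a) *\<^sub>R vderiv (vderiv k) a)"
      using norm_triangle_ineq[of "vderiv k b - vderiv k a - (b - a) *\<^sub>R vderiv (vderiv k) a" "(b - a) *\<^sub>R vderiv (vderiv k) a"] by simp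
    ultimately show ?thesis by (simp add: algebra_simps)
  qed
  have "norm (k (u + h) - k u - complex_of_real h * vderiv k u) \<le> 3 * B * h\<^sup>2" for u h
  proof -
    have "norm (k (u + h) - k u - ((u + h) - u) *\<^sub>R vderiv k u) \<le> norm ((u + h) - u) * (3 * B * \<bar>h\<bar>)"
    proof (rule vector_differentiable_bound_linearization[where S="closed_segment u (u + h)"])
      show "(k has_vector_derivative vderiv k x) (at x within closed_segment u (u + h))" for x
        by (rule has_vector_derivative_at_within[OF smooth_has_vderiv[OF test_smooth[OF k]]])
      fix x assume "x \<in> closed_segment u (u + h)"
      then have "\<bar>x - u\<bar> \<le> \<bar>h\<bar>" using segment_bound(1)[of x u "u + h"] by simp
      then have "3 * B * \<bar>x - u\<bar> \<le> 3 * B * \<bar>h\<bar>" using B(1) by (intro mult_left_mono) auto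
      then show "norm (vderiv k x - vderiv k u) \<le> 3 * B * \<bar>h\<bar>" using lip[of x u] by linarith
    qed auto
    then show ?thesis by (simp add: scaleR_conv_of_real power2_eq_square mult_ac)
  qed
  then show thesis using that[of "3 * B"] B(1) by simp
qed

lemma integrable_convolve:
  assumes k: "k \<in> test_functions" and y: "integrable lborel y"
  shows "integrable lborel (\<lambda>s. k (x - s) * y s)"
proof -
  note [measurable] = borel_measurable_integrable[OF y] test_borel[OF k]
  obtain B where B: "B > 0" "\<And>x. norm (k x) \<le> B" using test_bounded[OF k] by blast
  show ?thesis
  proof (rule Bochner_Integration.integrable_bound)
    show "integrable lborel (\<lambda>s. complex_of_real B * y s)" using y by simp
    show "AE s in lborel. norm (k (x - s) * y s) \<le> norm (complex_of_real B * y s)"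
      using B by (auto simp: norm_mult intro!: mult_right_mono)
  qed measurable
qed

lemma convolve_has_vderiv:
  assumes k: "k \<in> test_functions" and y: "integrable lborel y"
  shows "(convolve k y has_vector_derivative convolve (vderiv k) y x) (at x)"
proof -
  note [measurable] = borel_measurable_integrable[OF y] test_borel[OF k] test_borel[OF test_vderiv[OF k]]
  obtain B where B: "B \<ge> 0" "\<And>u h. norm (k (u + h) - k u - complex_of_real h * vderiv k u) \<le> B * h\<^sup>2"
    using test_taylor_bound[OF k] by blast
  define Y where "Y = (LINT s|lborel. norm (y s))"
  have est: "norm (convolve k y (x + h) - convolve k y x - h *\<^sub>R convolve (vderiv k) y x) \<le> B * h\<^sup>2 * Y" for h
  proof -
    note i = integrable_convolve[OF k y] integrable_mult_right[OF integrable_convolve[OF test_vderiv[OF k] y]]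
    have eq: "convolve k y (x + h) - convolve k y x - h *\<^sub>R convolve (vderiv k) y x
      = (LINT s|lborel. k (x + h - s) * y s - k (x - s) * y s - complex_of_real h * (vderiv k (x - s) * y s))"
      unfolding convolve_def scaleR_conv_of_real using i by simp
    have "norm (convolve k y (x + h) - convolve k y x - h *\<^sub>R convolve (vderiv k) y x)
      \<le> (LINT s|lborel. norm (k (x + h - s) * y s - k (x - s) * y s - complex_of_real h * (vderiv k (x - s) * y s)))"
      unfolding eq by (rule integral_norm_bound)
    also have "\<dots> \<le> (LINT s|lborel. B * h\<^sup>2 * norm (y s))"
    proof (rule integral_mono)
      fix s
      have "k (x + h - s) * y s - k (x - s) * y s - complex_of_real h * (vderiv k (x - s) * y s)
        = (k (x - s + h) - k (x - s) - complex_of_real h * vderiv k (x - s)) * y s"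
      proof -
        have e: "x + h - s = x - s + h" by simp
        show ?thesis unfolding e left_diff_distrib mult.assoc ..
      qed
      then show "norm (k (x + h - s) * y s - k (x - s) * y s - complex_of_real h * (vderiv k (x - s) * y s)) \<le> B * h\<^sup>2 * norm (y s)"
        by (simp only: norm_mult) (intro mult_right_mono B, simp)
    qed (use i y in auto)
    finally show ?thesis by (simp add: Y_def)
  qed
  have "((\<lambda>h. norm (convolve k y (x + h) - convolve k y x - h *\<^sub>R convolve (vderiv k) y x) / norm h) \<longlongrightarrow> 0) (at 0)"
  proof (rule Lim_null_comparison)
    show "\<forall>\<^sub>F h in at 0. norm (norm (convolve k y (x + h) - convolve k y x - h *\<^sub>R convolve (vderiv k) y x) / norm h) \<le> B * \<bar>h\<bar> * Y"
    proof (rule always_eventually, rule allI)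
      fix h :: real
      show "norm (norm (convolve k y (x + h) - convolve k y x - h *\<^sub>R convolve (vderiv k) y x) / norm h) \<le> B * \<bar>h\<bar> * Y"
      proof (cases "h = 0")
        case False
        have sq: "h\<^sup>2 = \<bar>h\<bar> * \<bar>h\<bar>" by (simp add: power2_eq_square)
        have eq: "B * h\<^sup>2 * Y = (B * \<bar>h\<bar> * Y) * norm h" unfolding sq by simp
        have "norm (convolve k y (x + h) - convolve k y x - h *\<^sub>R convolve (vderiv k) y x) \<le> (B * \<bar>h\<bar> * Y) * norm h"
          by (rule order_trans[OF est eq_refl[OF eq]])
        then have "norm (convolve k y (x + h) - convolve k y x - h *\<^sub>R convolve (vderiv k) y x) / norm h \<le> B * \<bar>h\<bar> * Y"
          using False by (subst pos_divide_le_eq) auto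
        then show ?thesis by simp
      qed simp
    qed
    have "((\<lambda>h. B * \<bar>h\<bar> * Y) \<longlongrightarrow> B * \<bar>0\<bar> * Y) (at 0)" by (intro tendsto_intros)
    then show "((\<lambda>h. B * \<bar>h\<bar> * Y) \<longlongrightarrow> 0) (at 0)" by simp
  qed
  then show ?thesis unfolding has_vector_derivative_def has_derivative_at by (simp add: bounded_linear_scaleR_left)
qed

lemma vderiv_pow_convolve:
  assumes k: "k \<in> test_functions" and y: "integrable lborel y"
  shows "(vderiv ^^ j) (convolve k y) = convolve ((vderiv ^^ j) k) y"
  by (induction j) (auto intro!: vderiv_eqI convolve_has_vderiv test_vderiv_pow k y)

lemma smooth_convolve:
  assumes k: "k \<in> test_functions" and y: "integrable lborel y"
  shows "smooth (convolve k y)"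
  unfolding smooth_def vderiv_pow_convolve[OF k y]
  using has_vderiv_differentiable[OF convolve_has_vderiv[OF test_vderiv_pow[OF k] y]] by blast

section \<open>Constant-coefficient differential expressions\<close>

text \<open>
  \<open>Q(c d/dx) f\<close>; for \<open>c = i\<close> this is \<open>Q(D) f\<close>.
\<close>

definition poly_deriv :: "complex poly \<Rightarrow> complex \<Rightarrow> (real \<Rightarrow> complex) \<Rightarrow> real \<Rightarrow> complex" where
  "poly_deriv Q c f x = (\<Sum>k\<le>degree Q. coeff Q k * c ^ k * (vderiv ^^ k) f x)"

definition weighted_operator :: "complex poly \<Rightarrow> (real \<Rightarrow> complex) \<Rightarrow> real \<Rightarrow> complex" where
  "weighted_operator Q f x = v_weight x * poly_deriv Q \<i> (\<lambda>\<xi>. v_weight \<xi> * f \<xi>) x"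

text \<open>
  The graph of the adjoint of \<open>v Q(D) v\<close> on test functions.
\<close>

definition weak_solution :: "complex poly \<Rightarrow> (real \<Rightarrow> complex) \<Rightarrow> (real \<Rightarrow> complex) \<Rightarrow> bool" where
  "weak_solution Q g w \<longleftrightarrow> g \<in> L2 lborel \<and> w \<in> L2 lborel \<and>
     (\<forall>\<psi>\<in>test_functions. L2_inner lborel g (weighted_operator Q \<psi>) = L2_inner lborel w \<psi>)"

definition real_poly :: "complex poly \<Rightarrow> bool" where
  "real_poly Q \<longleftrightarrow> (\<forall>k. cnj (coeff Q k) = coeff Q k)"

lemma test_poly_deriv:
  assumes "f \<in> test_functions" shows "poly_deriv Q c f \<in> test_functions"
  unfolding poly_deriv_def[abs_def]
  by (intro test_sum test_mult[OF test_vderiv_pow[OF assms]] smooth_const)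

lemma weighted_operator_test: "f \<in> test_functions \<Longrightarrow> weighted_operator Q f \<in> test_functions"
  unfolding weighted_operator_def[abs_def] by (intro test_mult test_poly_deriv smooth_v_weight)

lemma poly_deriv_cnj:
  assumes "real_poly Q" "smooth f"
  shows "cnj (poly_deriv Q \<i> (\<lambda>x. cnj (f x)) x) = poly_deriv Q (- \<i>) f x"
  using assms by (simp add: poly_deriv_def vderiv_pow_cnj real_poly_def)

lemma dist_D_pow: "(dist_D ^^ k) T \<phi> = (- \<i>) ^ k * T ((vderiv ^^ k) \<phi>)"
proof (induction k arbitrary: \<phi>)
  case (Suc k)
  have "(dist_D ^^ Suc k) T \<phi> = \<i> * - ((dist_D ^^ k) T (vderiv \<phi>))"
    by (simp add: dist_D_def[of "(dist_D ^^ k) T"] dist_deriv_def)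
  then show ?case unfolding Suc vderiv_pow_Suc by simp
qed simp

lemma v_weight_mult_integrable: "g \<in> L2 lborel \<Longrightarrow> integrable lborel (\<lambda>x. v_weight x * g x)"
  by (rule L2_mult_integrable[OF v_weight_L2])

lemma v_weight_mult_L2: "g \<in> L2 lborel \<Longrightarrow> (\<lambda>x. v_weight x * g x) \<in> L2 lborel"
  by (rule L2_mult_bounded[where C="sqrt pi"]) (auto simp: norm_v_weight_le)

lemma cnj_v_weight [simp]: "cnj (v_weight x) = v_weight x" "cnj (inv_v_weight x) = inv_v_weight x"
  by (simp_all add: v_weight_def inv_v_weight_def)

text \<open>
  Moving \<open>D\<close> onto the test function turns \<open>i\<close> into \<open>- i\<close>, and conjugation turns it back; the
  coefficients survive conjugation because they are real.  So the bilinear distributional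
  pairing with \<open>\<phi>\<close> is an inner product with the operator applied to the conjugate of \<open>\<phi>\<close>.
\<close>

lemma weighted_distribution_eq_inner:
  assumes Q: "real_poly Q" and g: "g \<in> L2 lborel" and \<phi>: "\<phi> \<in> test_functions"
  shows "dist_mult v_weight (poly_dist_D Q (dist_of (\<lambda>\<xi>. v_weight \<xi> * g \<xi>))) \<phi>
    = L2_inner lborel g (weighted_operator Q (\<lambda>x. cnj (\<phi> x)))"
proof -
  let ?\<eta> = "\<lambda>x. v_weight x * \<phi> x"
  have \<eta>: "?\<eta> \<in> test_functions" by (intro test_mult \<phi> smooth_v_weight)
  have "dist_mult v_weight (poly_dist_D Q (dist_of (\<lambda>\<xi>. v_weight \<xi> * g \<xi>))) \<phi>
    = (\<Sum>k\<le>degree Q. coeff Q k * ((- \<i>) ^ k * (LINT x|lborel. v_weight x * g x * (vderiv ^^ k) ?\<eta> x)))"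
    unfolding dist_mult_def poly_dist_D_def dist_D_pow dist_of_def ..
  also have "\<dots> = (\<Sum>k\<le>degree Q. (LINT x|lborel. coeff Q k * (- \<i>) ^ k * (v_weight x * g x * (vderiv ^^ k) ?\<eta> x)))"
    by (simp add: mult.assoc)
  also have "\<dots> = (LINT x|lborel. (\<Sum>k\<le>degree Q. coeff Q k * (- \<i>) ^ k * (v_weight x * g x * (vderiv ^^ k) ?\<eta> x)))"
    by (intro Bochner_Integration.integral_sum[symmetric] integrable_mult_right L2_mult_integrable v_weight_mult_L2 g test_L2_integrable test_vderiv_pow \<eta>)
  also have "\<dots> = (LINT x|lborel. g x * cnj (weighted_operator Q (\<lambda>x. cnj (\<phi> x)) x))"
  proof (rule Bochner_Integration.integral_cong[OF refl])
    fix x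
    have "poly_deriv Q (- \<i>) ?\<eta> x = cnj (poly_deriv Q \<i> (\<lambda>x. v_weight x * cnj (\<phi> x)) x)"
      using poly_deriv_cnj[OF Q test_smooth[OF \<eta>], of x] by simp
    then have "g x * cnj (weighted_operator Q (\<lambda>x. cnj (\<phi> x)) x) = g x * (v_weight x * poly_deriv Q (- \<i>) ?\<eta> x)"
      by (simp add: weighted_operator_def)
    then show "(\<Sum>k\<le>degree Q. coeff Q k * (- \<i>) ^ k * (v_weight x * g x * (vderiv ^^ k) ?\<eta> x)) = g x * cnj (weighted_operator Q (\<lambda>x. cnj (\<phi> x)) x)"
      by (simp add: poly_deriv_def sum_distrib_left mult_ac)
  qed
  finally show ?thesis by (simp add: L2_inner_def)
qed

lemma D_star_iff_weak_solution:
  assumes Q: "real_poly (Q_poly P)"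
  shows "g \<in> D_star P \<longleftrightarrow> (\<exists>w. weak_solution (Q_poly P) g w)"
proof -
  have "(\<forall>\<phi>\<in>test_functions. dist_mult v_weight (poly_dist_D (Q_poly P) (dist_of (\<lambda>\<xi>. v_weight \<xi> * g \<xi>))) \<phi> = dist_of w \<phi>)
    \<longleftrightarrow> (\<forall>\<psi>\<in>test_functions. L2_inner lborel g (weighted_operator (Q_poly P) \<psi>) = L2_inner lborel w \<psi>)"
    if g: "g \<in> L2 lborel" for w
  proof (intro iffI ballI)
    fix \<psi> assume \<psi>: "\<psi> \<in> test_functions"
      and "\<forall>\<phi>\<in>test_functions. dist_mult v_weight (poly_dist_D (Q_poly P) (dist_of (\<lambda>\<xi>. v_weight \<xi> * g \<xi>))) \<phi> = dist_of w \<phi>"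
    from this(2)[rule_format, OF test_cnj[OF \<psi>]]
    show "L2_inner lborel g (weighted_operator (Q_poly P) \<psi>) = L2_inner lborel w \<psi>"
      unfolding weighted_distribution_eq_inner[OF Q g test_cnj[OF \<psi>]] by (simp add: dist_of_def L2_inner_def)
  next
    fix \<phi> assume \<phi>: "\<phi> \<in> test_functions"
      and "\<forall>\<psi>\<in>test_functions. L2_inner lborel g (weighted_operator (Q_poly P) \<psi>) = L2_inner lborel w \<psi>"
    from this(2)[rule_format, OF test_cnj[OF \<phi>]]
    show "dist_mult v_weight (poly_dist_D (Q_poly P) (dist_of (\<lambda>\<xi>. v_weight \<xi> * g \<xi>))) \<phi> = dist_of w \<phi>"
      unfolding weighted_distribution_eq_inner[OF Q g \<phi>] by (simp add: dist_of_def L2_inner_def)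
  qed
  then show ?thesis unfolding D_star_def dist_in_L2_def weak_solution_def by blast
qed

text \<open>
  Testing the equation with \<open>\<phi>(s) = k(x - s) / v(s)\<close> shows that convolution with \<open>k\<close> turns the
  distributional equation \<open>Q(D)(v g) = w / v\<close> into a pointwise one.
\<close>

lemma weak_solution_convolve:
  assumes Q: "real_poly Q" and gw: "weak_solution Q g w" and k: "k \<in> test_functions"
  shows "poly_deriv Q \<i> (convolve k (\<lambda>s. v_weight s * g s)) x = convolve k (\<lambda>s. inv_v_weight s * w s) x"
proof -
  have g: "g \<in> L2 lborel" using gw by (simp add: weak_solution_def)
  note y = v_weight_mult_integrable[OF g]
  define \<eta> where "\<eta> s = k (x + (-1) * s)" for s
  have \<eta>: "\<eta> \<in> test_functions" unfolding \<eta>_def by (rule test_affine[OF k]) simp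
  have \<eta>k: "(vderiv ^^ j) \<eta> s = (-1) ^ j * (vderiv ^^ j) k (x + (-1) * s)" for j s
  proof (induction j arbitrary: s)
    case (Suc j)
    have "((\<lambda>s. (-1) ^ j * (vderiv ^^ j) k (x + (-1) * s)) has_vector_derivative (-1) ^ j * (complex_of_real (-1) * vderiv ((vderiv ^^ j) k) (x + (-1) * s))) (at s)" for s
      by (intro has_vector_derivative_mult_right vderiv_affine smooth_differentiable smooth_vderiv_pow test_smooth k)
    note d = vderiv_eqI[OF this]
    have "(vderiv ^^ j) \<eta> = (\<lambda>s. (-1) ^ j * (vderiv ^^ j) k (x + (-1) * s))" by (rule ext) (rule Suc)
    then have "(vderiv ^^ Suc j) \<eta> = (\<lambda>s. (-1) ^ j * (complex_of_real (-1) * vderiv ((vderiv ^^ j) k) (x + (-1) * s)))"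
      using d by simp
    then show ?case by simp
  qed (simp add: \<eta>_def)
  define \<phi> where "\<phi> s = inv_v_weight s * \<eta> s" for s
  have \<phi>: "\<phi> \<in> test_functions" unfolding \<phi>_def by (intro test_mult \<eta> smooth_inv_v_weight)
  have v\<phi>: "(\<lambda>s. v_weight s * \<phi> s) = \<eta>" by (simp add: \<phi>_def)
  have "poly_deriv Q \<i> (convolve k (\<lambda>s. v_weight s * g s)) x
     = (\<Sum>j\<le>degree Q. coeff Q j * \<i> ^ j * (LINT s|lborel. (vderiv ^^ j) k (x - s) * (v_weight s * g s)))"
    unfolding poly_deriv_def vderiv_pow_convolve[OF k y] convolve_def ..
  also have "\<dots> = (\<Sum>j\<le>degree Q. coeff Q j * ((- \<i>) ^ j * (LINT s|lborel. v_weight s * g s * (vderiv ^^ j) \<eta> s)))"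
  proof (rule sum.cong[OF refl])
    fix j
    have "(- \<i>) ^ j * (LINT s|lborel. v_weight s * g s * (vderiv ^^ j) \<eta> s) = (- \<i>) ^ j * (LINT s|lborel. (-1) ^ j * ((vderiv ^^ j) k (x - s) * (v_weight s * g s)))"
      unfolding \<eta>k by (simp add: mult_ac)
    also have "\<dots> = (- \<i>) ^ j * ((-1) ^ j * (LINT s|lborel. (vderiv ^^ j) k (x - s) * (v_weight s * g s)))"
      by simp
    also have "\<dots> = \<i> ^ j * (LINT s|lborel. (vderiv ^^ j) k (x - s) * (v_weight s * g s))"
      by (simp add: mult.assoc[symmetric] power_mult_distrib[symmetric])
    finally show "coeff Q j * \<i> ^ j * (LINT s|lborel. (vderiv ^^ j) k (x - s) * (v_weight s * g s)) = coeff Q j * ((- \<i>) ^ j * (LINT s|lborel. v_weight s * g s * (vderiv ^^ j) \<eta> s))"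
      by (simp add: mult.assoc)
  qed
  also have "\<dots> = dist_mult v_weight (poly_dist_D Q (dist_of (\<lambda>\<xi>. v_weight \<xi> * g \<xi>))) \<phi>"
    unfolding dist_mult_def poly_dist_D_def dist_D_pow dist_of_def v\<phi> ..
  also have "\<dots> = L2_inner lborel w (\<lambda>x. cnj (\<phi> x))"
    using gw test_cnj[OF \<phi>] by (simp add: weighted_distribution_eq_inner[OF Q g \<phi>] weak_solution_def)
  also have "\<dots> = convolve k (\<lambda>s. inv_v_weight s * w s) x"
    unfolding L2_inner_def convolve_def by (simp add: \<phi>_def \<eta>_def mult_ac)
  finally show ?thesis .
qed

text \<open>
  Differentiating the product \<open>\<chi>(x/n) y(x)\<close> once leaves a product of the same kind for \<open>\<chi>\<close> and \<open>y'\<close>,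
  and \<open>1/n\<close> times one for \<open>\<chi>'\<close> and \<open>y\<close>.  By induction on \<open>k\<close>, for all \<open>\<chi>\<close> and \<open>y\<close> at once, both
  converge in \<open>L\<^sup>2\<close>, the second one to zero.
\<close>

lemma cutoff_tendsto:
  assumes "cutoff \<in> test_functions" "smooth y" "m \<in> borel_measurable borel"
    "\<And>j. (\<lambda>x. m x * (vderiv ^^ j) y x) \<in> L2 lborel"
  shows "L2_tendsto lborel (\<lambda>n x. m x * (vderiv ^^ k) (\<lambda>x. cutoff (0 + 1 / real (Suc n) * x) * y x) x) (\<lambda>x. cutoff 0 * (m x * (vderiv ^^ k) y x))"
  using assms
proof (induction k arbitrary: cutoff y)
  case 0
  obtain B where B: "B > 0" "\<And>x. norm (cutoff x) \<le> B" using test_bounded[OF 0(1)] by blast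
  note [measurable] = 0(3) smooth_borel[OF 0(2)] test_borel[OF 0(1)]
  have my: "(\<lambda>x. m x * y x) \<in> L2 lborel" using 0(4)[of 0] by simp
  show ?case unfolding funpow_0
  proof (rule L2_tendsto_dominated)
    show "integrable lborel (\<lambda>x. (norm (complex_of_real B * (m x * y x)))\<^sup>2)"
      by (intro L2_sq_integrable L2_cmult my)
    show "AE x in lborel. norm (m x * (cutoff (0 + 1 / real (Suc n) * x) * y x)) \<le> norm (complex_of_real B * (m x * y x))" for n
    proof (rule AE_I2)
      fix x
      have "norm (cutoff (0 + 1 / real (Suc n) * x)) * norm (m x * y x) \<le> B * norm (m x * y x)"
        by (rule mult_right_mono[OF B(2)]) simp
      then show "norm (m x * (cutoff (0 + 1 / real (Suc n) * x) * y x)) \<le> norm (complex_of_real B * (m x * y x))"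
        using B(1) by (simp add: norm_mult mult_ac)
    qed
    show "AE x in lborel. (\<lambda>n. m x * (cutoff (0 + 1 / real (Suc n) * x) * y x)) \<longlonglongrightarrow> cutoff 0 * (m x * y x)"
    proof (rule AE_I2)
      fix x
      have "(\<lambda>n. inverse (real (Suc n)) * x) \<longlonglongrightarrow> 0 * x"
        by (intro tendsto_intros LIMSEQ_inverse_real_of_nat)
      then have "(\<lambda>n. 0 + 1 / real (Suc n) * x) \<longlonglongrightarrow> 0" by (simp add: divide_inverse)
      from continuous_on_tendsto_compose[OF smooth_continuous[OF test_smooth[OF 0(1)], of UNIV] this]
      have "(\<lambda>n. cutoff (0 + 1 / real (Suc n) * x)) \<longlonglongrightarrow> cutoff 0" by simp
      then have "(\<lambda>n. m x * (cutoff (0 + 1 / real (Suc n) * x) * y x)) \<longlonglongrightarrow> m x * (cutoff 0 * y x)" by (intro tendsto_intros)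
      then show "(\<lambda>n. m x * (cutoff (0 + 1 / real (Suc n) * x) * y x)) \<longlonglongrightarrow> cutoff 0 * (m x * y x)" by (simp add: mult_ac)
    qed
  qed measurable
next
  case (Suc k)
  let ?a = "\<lambda>n. 1 / real (Suc n)"
  define p where "p n x = cutoff (0 + ?a n * x) * vderiv y x" for n x
  define q where "q n x = vderiv cutoff (0 + ?a n * x) * y x" for n x
  have sp: "smooth (p n)" for n unfolding p_def
    by (intro smooth_mult smooth_affine test_smooth smooth_vderiv Suc.prems)
  have sq: "smooth (q n)" for n unfolding q_def
    by (intro smooth_mult smooth_affine test_smooth test_vderiv Suc.prems)
  have d: "vderiv (\<lambda>x. cutoff (0 + ?a n * x) * y x) = (\<lambda>x. p n x + complex_of_real (?a n) * q n x)" for n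
  proof (rule vderiv_eqI)
    fix x
    have "((\<lambda>x. cutoff (0 + ?a n * x) * y x) has_vector_derivative cutoff (0 + ?a n * x) * vderiv y x + complex_of_real (?a n) * vderiv cutoff (0 + ?a n * x) * y x) (at x)"
      by (intro has_vector_derivative_mult vderiv_affine smooth_differentiable test_smooth smooth_has_vderiv Suc.prems)
    then show "((\<lambda>x. cutoff (0 + ?a n * x) * y x) has_vector_derivative p n x + complex_of_real (?a n) * q n x) (at x)"
      by (simp add: p_def q_def mult.assoc)
  qed
  have add: "(vderiv ^^ j) (\<lambda>x. f x + c * g x) = (\<lambda>x. (vderiv ^^ j) f x + c * (vderiv ^^ j) g x)"
    if "smooth f" "smooth g" for j f g c
  proof (induction j)
    case (Suc j)
    have "((\<lambda>x. (vderiv ^^ j) f x + c * (vderiv ^^ j) g x) has_vector_derivative vderiv ((vderiv ^^ j) f) x + c * vderiv ((vderiv ^^ j) g) x) (at x)" for x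
      by (intro has_vector_derivative_add has_vector_derivative_mult_right smooth_has_vderiv smooth_vderiv_pow that)
    from vderiv_eqI[OF this] show ?case using Suc by simp
  qed simp
  have P: "L2_tendsto lborel (\<lambda>n x. m x * (vderiv ^^ k) (p n) x) (\<lambda>x. cutoff 0 * (m x * (vderiv ^^ k) (vderiv y) x))"
    unfolding p_def[abs_def]
  proof (rule Suc.IH)
    show "(\<lambda>x. m x * (vderiv ^^ j) (vderiv y) x) \<in> L2 lborel" for j
      using Suc.prems(4)[of "Suc j"] by (simp only: vderiv_pow_Suc)
  qed (intro Suc.prems smooth_vderiv)+
  have "L2_tendsto lborel (\<lambda>n x. m x * (vderiv ^^ k) (q n) x) (\<lambda>x. vderiv cutoff 0 * (m x * (vderiv ^^ k) y x))"
    unfolding q_def[abs_def] by (rule Suc.IH) (intro Suc.prems test_vderiv)+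
  note Q = this
  have Q0: "L2_tendsto lborel (\<lambda>n x. complex_of_real (?a n) * (m x * (vderiv ^^ k) (q n) x)) (\<lambda>x. 0)"
  proof (rule L2_tendstoI)
    show "(\<lambda>x. complex_of_real (?a n) * (m x * (vderiv ^^ k) (q n) x)) \<in> L2 lborel" for n
      by (intro L2_cmult L2_tendstoD(1)[OF Q])
    have "(\<lambda>n. inverse (real (Suc n)) * L2_norm lborel (\<lambda>x. m x * (vderiv ^^ k) (q n) x)) \<longlonglongrightarrow> 0 * L2_norm lborel (\<lambda>x. vderiv cutoff 0 * (m x * (vderiv ^^ k) y x))"
      by (intro tendsto_mult LIMSEQ_inverse_real_of_nat L2_tendsto_norm[OF Q])
    moreover have "L2_norm lborel (\<lambda>x. complex_of_real (?a n) * (m x * (vderiv ^^ k) (q n) x) - 0) = inverse (real (Suc n)) * L2_norm lborel (\<lambda>x. m x * (vderiv ^^ k) (q n) x)" for n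
      unfolding diff_zero L2_norm_cmult norm_of_real by (simp add: divide_inverse)
    ultimately show "(\<lambda>n. L2_norm lborel (\<lambda>x. complex_of_real (?a n) * (m x * (vderiv ^^ k) (q n) x) - 0)) \<longlonglongrightarrow> 0" by simp
  qed simp
  have "(\<lambda>x. m x * (vderiv ^^ Suc k) (\<lambda>x. cutoff (0 + ?a n * x) * y x) x) = (\<lambda>x. m x * (vderiv ^^ k) (p n) x + complex_of_real (?a n) * (m x * (vderiv ^^ k) (q n) x))" for n
    unfolding vderiv_pow_Suc d add[OF sp sq] by (simp add: algebra_simps)
  with L2_tendsto_add[OF P Q0] show ?case unfolding vderiv_pow_Suc by simp
qed

section \<open>Test functions form a core\<close>

lemma mild_weight_v:
  "mild_weight (pi / 2) (\<lambda>x. norm (v_weight x))" "mild_weight (pi / 2) (\<lambda>x. norm (inv_v_weight x))"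
proof -
  have "inv_v_weight x \<noteq> 0" for x by (simp add: inv_v_weight_def)
  then show "mild_weight (pi / 2) (\<lambda>x. norm (v_weight x))" "mild_weight (pi / 2) (\<lambda>x. norm (inv_v_weight x))"
    using v_weight_shift inv_v_weight_shift unfolding mild_weight_def by auto
qed

lemma of_real_norm_v_weight: "complex_of_real (norm (v_weight x)) = v_weight x" "complex_of_real (norm (inv_v_weight x)) = inv_v_weight x"
  by (simp_all only: norm_v_weight norm_inv_v_weight) (simp_all only: v_weight_def inv_v_weight_def)

text \<open>
  The test functions are a core for the maximal operator: mollification makes \<open>v g\<close> smooth, a cutoff
  makes it compactly supported, and both converge in the graph norm.
\<close>

theorem weak_solution_approx:
  assumes Q: "real_poly Q" and gw: "weak_solution Q g w"
  obtains \<psi> where "\<And>n. \<psi> n \<in> test_functions" "L2_tendsto lborel \<psi> g"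
    "L2_tendsto lborel (\<lambda>n. weighted_operator Q (\<psi> n)) w"
proof -
  have g: "g \<in> L2 lborel" and w: "w \<in> L2 lborel" using gw by (auto simp: weak_solution_def)
  define \<rho> where "\<rho> n r = complex_of_real (real (Suc n)) * mollifier (0 + real (Suc n) * r)" for n r
  have \<rho>: "\<rho> n \<in> test_functions" for n unfolding \<rho>_def[abs_def]
    by (intro test_mult test_affine mollifier_test smooth_const) simp
  \<comment> \<open>mollify \<open>v g\<close> and not \<open>g\<close>: this commutes with \<open>Q(D)\<close>\<close>
  define y where "y n = convolve (\<rho> n) (\<lambda>s. v_weight s * g s)" for n
  note yi = v_weight_mult_integrable[OF g]
  have sy: "smooth (y n)" for n unfolding y_def by (rule smooth_convolve[OF \<rho> yi])
  have yg: "L2_tendsto lborel (\<lambda>n x. inv_v_weight x * y n x) g"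
  proof -
    have "inv_v_weight x * y n x = (LINT t|lborel. mollifier t * weighted_shift (\<lambda>x. norm (v_weight x)) (1 / real (Suc n) * t) g x)" for n x
      using convolve_eq_weighted_shift[OF mild_weight_v(1), of "real (Suc n)" mollifier g x]
      unfolding y_def \<rho>_def[abs_def] of_real_norm_v_weight by (simp del: of_nat_Suc)
    then show ?thesis using mollification_tendsto[OF mild_weight_v(1) g] by simp
  qed
  have Qw: "L2_tendsto lborel (\<lambda>n x. v_weight x * poly_deriv Q \<i> (y n) x) w"
  proof -
    have "v_weight x * poly_deriv Q \<i> (y n) x = (LINT t|lborel. mollifier t * weighted_shift (\<lambda>x. norm (inv_v_weight x)) (1 / real (Suc n) * t) w x)" for n x
      using convolve_eq_weighted_shift[OF mild_weight_v(2), of "real (Suc n)" mollifier w x]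
      unfolding y_def weak_solution_convolve[OF Q gw \<rho>] unfolding \<rho>_def[abs_def] of_real_norm_v_weight by (simp del: of_nat_Suc)
    then show ?thesis using mollification_tendsto[OF mild_weight_v(2) w] by simp
  qed
  \<comment> \<open>derivatives fall on the mollifier, so each one is again a convolution controlled by \<open>v\<close>\<close>
  have yj: "(\<lambda>x. inv_v_weight x * (vderiv ^^ j) (y n) x) \<in> L2 lborel" for n j
  proof -
    have "inv_v_weight x * (vderiv ^^ j) (y n) x = (LINT t|lborel. (vderiv ^^ j) (\<rho> n) t * weighted_shift (\<lambda>x. norm (v_weight x)) t g x)" for x
      using convolve_eq_weighted_shift[OF mild_weight_v(1), of 1 "(vderiv ^^ j) (\<rho> n)" g x]
      unfolding y_def vderiv_pow_convolve[OF \<rho> yi] of_real_norm_v_weight by simp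
    then show ?thesis using L2_weighted_convolution[OF mild_weight_v(1) g test_vderiv_pow[OF \<rho>]] by simp
  qed
  have vyj: "(\<lambda>x. v_weight x * (vderiv ^^ j) (y n) x) \<in> L2 lborel" for n j
    using v_weight_mult_L2[OF v_weight_mult_L2[OF yj[of j n]]] by simp
  \<comment> \<open>\<open>\<chi>(0) = 1\<close> makes \<open>\<chi>(\<xi>/n)\<close> tend to \<open>1\<close> pointwise\<close>
  define cutoff where "cutoff x = complex_of_real (1 / bump 0) * complex_of_real (bump x)" for x
  have cutoff: "cutoff \<in> test_functions" unfolding cutoff_def[abs_def] by (intro test_mult bump_test smooth_const)
  have cutoff0: "cutoff 0 = 1" using bump_0 by (simp add: cutoff_def)
  define \<psi> where "\<psi> n N x = inv_v_weight x * (cutoff (0 + 1 / real (Suc N) * x) * y n x)" for n N x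
  have \<psi>: "\<psi> n N \<in> test_functions" for n N
  proof -
    have "(\<lambda>x. inv_v_weight x * (y n x * cutoff (0 + 1 / real (Suc N) * x))) \<in> test_functions"
      by (intro test_mult test_affine cutoff smooth_inv_v_weight sy) simp
    then show ?thesis unfolding \<psi>_def[abs_def] by (simp add: mult_ac)
  qed
  have l1: "L2_tendsto lborel (\<psi> n) (\<lambda>x. inv_v_weight x * y n x)" for n
    using cutoff_tendsto[OF cutoff sy[of n] v_weight_borel(2) yj, of 0] unfolding \<psi>_def[abs_def] by (simp add: cutoff0)
  have l2: "L2_tendsto lborel (\<lambda>N. weighted_operator Q (\<psi> n N)) (\<lambda>x. v_weight x * poly_deriv Q \<i> (y n) x)" for n
  proof -
    have "weighted_operator Q (\<psi> n N) = (\<lambda>x. \<Sum>k\<le>degree Q. coeff Q k * \<i> ^ k * (v_weight x * (vderiv ^^ k) (\<lambda>x. cutoff (0 + 1 / real (Suc N) * x) * y n x) x))" for N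
      unfolding weighted_operator_def[abs_def] \<psi>_def poly_deriv_def by (simp add: sum_distrib_left mult_ac)
    moreover have "(\<lambda>x. v_weight x * poly_deriv Q \<i> (y n) x) = (\<lambda>x. \<Sum>k\<le>degree Q. coeff Q k * \<i> ^ k * (cutoff 0 * (v_weight x * (vderiv ^^ k) (y n) x)))"
      unfolding poly_deriv_def cutoff0 by (simp add: sum_distrib_left mult_ac)
    ultimately show ?thesis
      using L2_tendsto_sum[of "{..degree Q}" lborel, OF L2_tendsto_cmult[OF cutoff_tendsto[OF cutoff sy[of n] v_weight_borel(1) vyj]]]
      by simp
  qed
  \<comment> \<open>a diagonal sequence\<close>
  have "\<exists>N. L2_norm lborel (\<lambda>x. \<psi> n N x - inv_v_weight x * y n x) < inverse (real (Suc n)) \<and>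
      L2_norm lborel (\<lambda>x. weighted_operator Q (\<psi> n N) x - v_weight x * poly_deriv Q \<i> (y n) x) < inverse (real (Suc n))" for n
  proof -
    have "\<forall>\<^sub>F N in sequentially. L2_norm lborel (\<lambda>x. \<psi> n N x - inv_v_weight x * y n x) < inverse (real (Suc n))"
      using order_tendstoD(2)[OF L2_tendstoD(3)[OF l1[of n]]] by simp
    moreover have "\<forall>\<^sub>F N in sequentially. L2_norm lborel (\<lambda>x. weighted_operator Q (\<psi> n N) x - v_weight x * poly_deriv Q \<i> (y n) x) < inverse (real (Suc n))"
      using order_tendstoD(2)[OF L2_tendstoD(3)[OF l2[of n]]] by simp
    ultimately have "\<forall>\<^sub>F N in sequentially. L2_norm lborel (\<lambda>x. \<psi> n N x - inv_v_weight x * y n x) < inverse (real (Suc n)) \<and>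
      L2_norm lborel (\<lambda>x. weighted_operator Q (\<psi> n N) x - v_weight x * poly_deriv Q \<i> (y n) x) < inverse (real (Suc n))"
      by (rule eventually_conj)
    then show ?thesis using eventually_happens'[OF sequentially_bot] by blast
  qed
  then obtain N where N: "\<And>n. L2_norm lborel (\<lambda>x. \<psi> n (N n) x - inv_v_weight x * y n x) < inverse (real (Suc n))"
      "\<And>n. L2_norm lborel (\<lambda>x. weighted_operator Q (\<psi> n (N n)) x - v_weight x * poly_deriv Q \<i> (y n) x) < inverse (real (Suc n))"
    by metis
  have close: "L2_tendsto lborel a c" if "L2_tendsto lborel b c" "\<And>n. a n \<in> L2 lborel" "\<And>n. L2_norm lborel (\<lambda>x. a n x - b n x) < inverse (real (Suc n))"
    for a b :: "nat \<Rightarrow> real \<Rightarrow> complex" and c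
  proof (rule L2_tendsto_bound)
    note D = L2_tendstoD[OF that(1)]
    show "L2_norm lborel (\<lambda>x. a n x - c x) \<le> inverse (real (Suc n)) + L2_norm lborel (\<lambda>x. b n x - c x)" for n
      using L2_norm_triangle_diff[OF that(2) D(1) D(2), of n n] that(3)[of n] by linarith
    show "(\<lambda>n. inverse (real (Suc n)) + L2_norm lborel (\<lambda>x. b n x - c x)) \<longlonglongrightarrow> 0"
      using tendsto_add[OF LIMSEQ_inverse_real_of_nat D(3)] by simp
  qed (use that L2_tendstoD(2)[OF that(1)] in auto)
  show thesis
  proof (rule that[of "\<lambda>n. \<psi> n (N n)"])
    show "L2_tendsto lborel (\<lambda>n. \<psi> n (N n)) g"
      by (rule close[OF yg test_L2_integrable(2)[OF \<psi>] N(1)])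
    show "L2_tendsto lborel (\<lambda>n. weighted_operator Q (\<psi> n (N n))) w"
      by (rule close[OF Qw test_L2_integrable(2)[OF weighted_operator_test[OF \<psi>]] N(2)])
  qed (rule \<psi>)
qed

section \<open>The Gamma integral in the logarithmic variable\<close>

lemma Gamma_log_integral:
  assumes z: "Re z > 0"
  shows "integrable lborel (\<lambda>s. complex_of_real (exp (- exp s)) * exp (z * complex_of_real s))"
    and "(LINT s|lborel. complex_of_real (exp (- exp s)) * exp (z * complex_of_real s)) = Gamma z"
proof -
  define f where "f t = complex_of_real t powr (z - 1) / complex_of_real (exp t)" for t :: real
  have ai: "set_integrable lebesgue {0<..} f"
    using absolutely_integrable_Gamma_integral'[OF z] unfolding f_def .
  have fm: "f \<in> borel_measurable lborel_pos"
  proof -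
    have "continuous_on {0<..} f" unfolding f_def
      by (intro continuous_intros) (auto simp: complex_nonpos_Reals_iff)
    then have "f \<in> borel_measurable (restrict_space borel {0<..})"
      by (rule borel_measurable_continuous_on_restrict)
    moreover have "sets lborel_pos = sets (restrict_space borel {0<..})" by (rule sets_restrict_space_cong) simp
    ultimately show ?thesis using measurable_cong_sets[OF _ refl] by blast
  qed
  have m: "(\<lambda>t. indicator {0<..} t *\<^sub>R f t) \<in> borel_measurable lborel"
    using fm by (subst (asm) borel_measurable_restrict_space_iff) auto
  have i1: "integrable lborel (\<lambda>t. indicator {0<..} t *\<^sub>R f t)"
    using ai m unfolding set_integrable_def by (simp add: integrable_completion)
  have i2: "integrable lborel_pos f" using i1 by (subst integrable_restrict_space) (auto simp: set_integrable_def)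
  have "(LINT t|lborel_pos. f t) = (LINT t|lborel. indicator {0<..} t *\<^sub>R f t)"
    by (subst integral_restrict_space) (auto simp: set_lebesgue_integral_def)
  also have "\<dots> = (LINT t|lebesgue. indicator {0<..} t *\<^sub>R f t)"
    using m by (intro integral_completion[symmetric]) simp
  also have "\<dots> = integral {0<..} f"
    using set_lebesgue_integral_eq_integral(2)[OF ai] by (simp add: set_lebesgue_integral_def)
  also have "\<dots> = Gamma z"
    unfolding f_def by (rule integral_unique[OF Gamma_integral_complex'[OF z]])
  finally have int: "(LINT t|lborel_pos. f t) = Gamma z" .
  have eq: "exp s *\<^sub>R f (exp s) = complex_of_real (exp (- exp s)) * exp (z * complex_of_real s)" for s
  proof -
    have "complex_of_real (exp s) powr (z - 1) = exp ((z - 1) * complex_of_real s)"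
      by (simp add: powr_def Ln_of_real flip: exp_of_real)
    moreover have "complex_of_real (exp s) * exp ((z - 1) * complex_of_real s) = exp (z * complex_of_real s)"
      by (simp add: exp_of_real[symmetric] exp_add[symmetric] algebra_simps)
    moreover have "complex_of_real (exp (- exp s)) = inverse (complex_of_real (exp (exp s)))"
      by (simp add: exp_minus)
    ultimately show ?thesis unfolding f_def scaleR_conv_of_real divide_inverse
      by (simp only: mult.commute mult.left_commute) (simp add: mult_ac)
  qed
  show "integrable lborel (\<lambda>s. complex_of_real (exp (- exp s)) * exp (z * complex_of_real s))"
    using i2 unfolding integrable_lborel_pos_iff[OF fm] eq .
  show "(LINT s|lborel. complex_of_real (exp (- exp s)) * exp (z * complex_of_real s)) = Gamma z"
    using int unfolding integral_lborel_pos[OF fm] eq .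
qed

section \<open>Elementary integrability\<close>

lemma power_div_fact_le_exp: "(x::real) \<ge> 0 \<Longrightarrow> x ^ k / fact k \<le> exp x"
proof -
  assume x: "x \<ge> 0"
  have "(\<lambda>n. x ^ n /\<^sub>R fact n) sums exp x" by (rule exp_converges)
  then have s: "(\<lambda>n. x ^ n / fact n) sums exp x" by (simp add: divide_inverse mult.commute)
  have "(\<Sum>n\<in>{k}. x ^ n / fact n) \<le> (\<Sum>n. x ^ n / fact n)"
    by (rule sum_le_suminf[OF sums_summable[OF s]]) (use x in auto)
  then show ?thesis using sums_unique[OF s] by simp
qed

lemma integrable_exp_abs_shift: "a > 0 \<Longrightarrow> integrable lborel (\<lambda>y::real. exp (- (a * \<bar>x - y\<bar>)))"
  using lborel_integrable_shift(2)[of "\<lambda>y. exp (- (a * \<bar>y\<bar>))" x] integrable_exp_abs[of a] by simp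

text \<open>
  Half of the exponential absorbs the power.
\<close>

lemma integrable_poly_exp_abs_shift:
  assumes "a > 0" shows "integrable lborel (\<lambda>y::real. \<bar>y\<bar> ^ k * exp (- (a * \<bar>x - y\<bar>)))"
proof (rule Bochner_Integration.integrable_bound)
  show "integrable lborel (\<lambda>y. (fact k * (2 / a) ^ k * exp (a / 2 * \<bar>x\<bar>)) * exp (- (a / 2 * \<bar>x - y\<bar>)))"
    using assms by (intro integrable_mult_right integrable_exp_abs_shift) auto
  show "AE y in lborel. norm (\<bar>y\<bar> ^ k * exp (- (a * \<bar>x - y\<bar>))) \<le> norm ((fact k * (2 / a) ^ k * exp (a / 2 * \<bar>x\<bar>)) * exp (- (a / 2 * \<bar>x - y\<bar>)))"
  proof (rule AE_I2)
    fix y :: real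
    have "\<bar>y\<bar> ^ k = fact k * (2 / a) ^ k * ((a / 2 * \<bar>y\<bar>) ^ k / fact k)"
      using assms by (simp add: power_mult_distrib power_divide)
    also have "\<dots> \<le> fact k * (2 / a) ^ k * exp (a / 2 * \<bar>y\<bar>)"
      using assms by (intro mult_left_mono power_div_fact_le_exp) auto
    also have "\<dots> \<le> fact k * (2 / a) ^ k * exp (a / 2 * \<bar>x\<bar> + a / 2 * \<bar>x - y\<bar>)"
    proof -
      have "a / 2 * \<bar>y\<bar> \<le> a / 2 * (\<bar>x\<bar> + \<bar>x - y\<bar>)" using assms by (intro mult_left_mono) auto
      then show ?thesis using assms by (intro mult_left_mono) (auto simp: distrib_left)
    qed
    finally have "\<bar>y\<bar> ^ k * exp (- (a * \<bar>x - y\<bar>)) \<le> fact k * (2 / a) ^ k * exp (a / 2 * \<bar>x\<bar> + a / 2 * \<bar>x - y\<bar>) * exp (- (a * \<bar>x - y\<bar>))"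
      by (rule mult_right_mono) simp
    also have "\<dots> = fact k * (2 / a) ^ k * exp (a / 2 * \<bar>x\<bar>) * exp (- (a / 2 * \<bar>x - y\<bar>))"
    proof -
      have "exp (a / 2 * \<bar>x\<bar> + a / 2 * \<bar>x - y\<bar>) * exp (- (a * \<bar>x - y\<bar>)) = exp (a / 2 * \<bar>x\<bar>) * exp (- (a / 2 * \<bar>x - y\<bar>))"
        unfolding exp_add[symmetric] by (simp add: algebra_simps)
      then show ?thesis by (simp only: mult.assoc)
    qed
    finally show "norm (\<bar>y\<bar> ^ k * exp (- (a * \<bar>x - y\<bar>))) \<le> norm ((fact k * (2 / a) ^ k * exp (a / 2 * \<bar>x\<bar>)) * exp (- (a / 2 * \<bar>x - y\<bar>)))"
      using assms by simp
  qed
qed measurable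

section \<open>Logarithmic moments and the coefficients of \<open>Q\<close>\<close>

text \<open>
  The density of the Gumbel distribution, reflected at the origin.
\<close>

definition gumbel :: "real \<Rightarrow> real" where
  "gumbel s = exp (- exp s) * exp s"

lemma gumbel_bounds: "0 \<le> gumbel s" "gumbel s \<le> 2 * exp (- \<bar>s\<bar>)"
proof -
  show "0 \<le> gumbel s" by (simp add: gumbel_def)
  show "gumbel s \<le> 2 * exp (- \<bar>s\<bar>)"
  proof (cases "s \<ge> 0")
    case True
    have "(exp s) ^ 2 / fact 2 \<le> exp (exp s)" by (rule power_div_fact_le_exp) simp
    then have "exp (- exp s) \<le> 2 / (exp s)\<^sup>2" by (simp add: exp_minus field_simps)
    then have "gumbel s \<le> 2 / (exp s)\<^sup>2 * exp s" unfolding gumbel_def by (rule mult_right_mono) simp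
    also have "\<dots> = 2 * exp (- s)" by (simp add: power2_eq_square exp_minus divide_inverse)
    finally show ?thesis using True by simp
  next
    case False
    have "gumbel s \<le> 1 * exp s" unfolding gumbel_def by (rule mult_right_mono) auto
    moreover have "exp (- \<bar>s\<bar>) = exp s" using False by simp
    ultimately show ?thesis using exp_gt_zero[of s] by linarith
  qed
qed

lemma gumbel_measurable [measurable]: "gumbel \<in> borel_measurable borel"
  unfolding gumbel_def[abs_def] by measurable

text \<open>
  With \<open>t = e\<^sup>\<tau>\<close> and \<open>\<lambda> = e\<^sup>-\<^sup>\<zeta>\<close> this is \<open>t \<integral> e\<^sup>-\<^sup>t\<^sup>\<lambda> (- ln \<lambda>)\<^sup>k d\<lambda>\<close>.
\<close>

definition log_moment :: "real \<Rightarrow> nat \<Rightarrow> real" where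
  "log_moment \<tau> k = (LINT \<zeta>|lborel. \<zeta> ^ k * gumbel (\<tau> - \<zeta>))"

lemma log_moment_integrable: "integrable lborel (\<lambda>\<zeta>. \<zeta> ^ k * gumbel (\<tau> - \<zeta>))"
proof (rule Bochner_Integration.integrable_bound)
  show "integrable lborel (\<lambda>\<zeta>. 2 * (\<bar>\<zeta>\<bar> ^ k * exp (- (1 * \<bar>\<tau> - \<zeta>\<bar>))))"
    by (intro integrable_mult_right integrable_poly_exp_abs_shift) simp
  show "AE \<zeta> in lborel. norm (\<zeta> ^ k * gumbel (\<tau> - \<zeta>)) \<le> norm (2 * (\<bar>\<zeta>\<bar> ^ k * exp (- (1 * \<bar>\<tau> - \<zeta>\<bar>))))"
  proof (rule AE_I2)
    fix \<zeta>
    have "\<bar>\<zeta>\<bar> ^ k * gumbel (\<tau> - \<zeta>) \<le> \<bar>\<zeta>\<bar> ^ k * (2 * exp (- \<bar>\<tau> - \<zeta>\<bar>))"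
      by (intro mult_left_mono gumbel_bounds) simp
    then show "norm (\<zeta> ^ k * gumbel (\<tau> - \<zeta>)) \<le> norm (2 * (\<bar>\<zeta>\<bar> ^ k * exp (- (1 * \<bar>\<tau> - \<zeta>\<bar>))))"
      using gumbel_bounds(1)[of "\<tau> - \<zeta>"] by (simp add: abs_mult power_abs mult_ac)
  qed
qed measurable

text \<open>
  The right-hand side is \<open>\<integral> e\<^sup>z\<^sup>\<zeta> gumbel(\<tau> - \<zeta>) d\<zeta>\<close>, and the exponential series may be integrated
  term by term, since its partial sums are dominated by \<open>e\<^sup>|\<^sup>z\<^sup>| \<^sup>|\<^sup>\<zeta>\<^sup>|\<close>.
\<close>

lemma log_moment_generating:
  assumes z: "norm z < 1/2"
  shows "(\<lambda>k. complex_of_real (log_moment \<tau> k / fact k) * z ^ k) sums (exp (z * complex_of_real \<tau>) * Gamma (1 - z))"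
proof -
  have Re: "Re (1 - z) > 0" using abs_Re_le_cmod[of z] z by simp
  let ?g = "\<lambda>\<zeta>. complex_of_real (gumbel (\<tau> - \<zeta>))"
  have lim: "(\<lambda>n. LINT \<zeta>|lborel. (\<Sum>k<n. (z * complex_of_real \<zeta>) ^ k / fact k) * ?g \<zeta>) \<longlonglongrightarrow> (LINT \<zeta>|lborel. exp (z * complex_of_real \<zeta>) * ?g \<zeta>)"
  proof (rule integral_dominated_convergence)
    show "integrable lborel (\<lambda>\<zeta>. 2 * exp (\<bar>\<tau>\<bar> / 2) * exp (- (1 / 2 * \<bar>\<tau> - \<zeta>\<bar>)))"
      by (intro integrable_mult_right integrable_exp_abs_shift) simp
    show "AE \<zeta> in lborel. (\<lambda>n. (\<Sum>k<n. (z * complex_of_real \<zeta>) ^ k / fact k) * ?g \<zeta>) \<longlonglongrightarrow> exp (z * complex_of_real \<zeta>) * ?g \<zeta>"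
    proof (rule AE_I2)
      fix \<zeta>
      have "(\<lambda>n. (z * complex_of_real \<zeta>) ^ n /\<^sub>R fact n) sums exp (z * complex_of_real \<zeta>)" by (rule exp_converges)
      then have "(\<lambda>n. (z * complex_of_real \<zeta>) ^ n / fact n) sums exp (z * complex_of_real \<zeta>)"
        by (simp add: scaleR_conv_of_real divide_inverse mult.commute)
      then show "(\<lambda>n. (\<Sum>k<n. (z * complex_of_real \<zeta>) ^ k / fact k) * ?g \<zeta>) \<longlonglongrightarrow> exp (z * complex_of_real \<zeta>) * ?g \<zeta>"
        unfolding sums_def by (rule tendsto_mult_right)
    qed
    show "AE \<zeta> in lborel. norm ((\<Sum>k<n. (z * complex_of_real \<zeta>) ^ k / fact k) * ?g \<zeta>) \<le> 2 * exp (\<bar>\<tau>\<bar> / 2) * exp (- (1 / 2 * \<bar>\<tau> - \<zeta>\<bar>))" for n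
    proof (rule AE_I2)
      fix \<zeta>
      define x where "x = norm z * \<bar>\<zeta>\<bar>"
      have x: "0 \<le> x" "x \<le> \<bar>\<tau>\<bar> / 2 + \<bar>\<tau> - \<zeta>\<bar> / 2"
      proof -
        show "0 \<le> x" by (simp add: x_def)
        have "x \<le> 1/2 * \<bar>\<zeta>\<bar>" unfolding x_def using z by (intro mult_right_mono) auto
        moreover have "\<bar>\<zeta>\<bar> \<le> \<bar>\<tau>\<bar> + \<bar>\<tau> - \<zeta>\<bar>" by arith
        ultimately show "x \<le> \<bar>\<tau>\<bar> / 2 + \<bar>\<tau> - \<zeta>\<bar> / 2" by argo
      qed
      have "(\<lambda>n. x ^ n /\<^sub>R fact n) sums exp x" by (rule exp_converges)
      then have s: "(\<lambda>n. x ^ n / fact n) sums exp x" by (simp add: divide_inverse mult.commute)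
      have "norm (\<Sum>k<n. (z * complex_of_real \<zeta>) ^ k / fact k) \<le> (\<Sum>k<n. norm ((z * complex_of_real \<zeta>) ^ k / fact k))"
        by (rule norm_sum)
      also have "\<dots> = (\<Sum>k<n. x ^ k / fact k)"
        by (simp add: norm_divide norm_power norm_mult x_def)
      also have "\<dots> \<le> exp x"
        using sum_le_suminf[OF sums_summable[OF s], of "{..<n}"] sums_unique[OF s] x(1) by simp
      finally have S: "norm (\<Sum>k<n. (z * complex_of_real \<zeta>) ^ k / fact k) \<le> exp x" .
      have "norm ((\<Sum>k<n. (z * complex_of_real \<zeta>) ^ k / fact k) * ?g \<zeta>) \<le> exp x * (2 * exp (- \<bar>\<tau> - \<zeta>\<bar>))"
        unfolding norm_mult using gumbel_bounds[of "\<tau> - \<zeta>"] by (intro mult_mono S) auto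
      also have "\<dots> \<le> exp (\<bar>\<tau>\<bar> / 2 + \<bar>\<tau> - \<zeta>\<bar> / 2) * (2 * exp (- \<bar>\<tau> - \<zeta>\<bar>))"
        using x(2) by (intro mult_right_mono) auto
      also have "\<dots> = 2 * exp (\<bar>\<tau>\<bar> / 2) * exp (- (1 / 2 * \<bar>\<tau> - \<zeta>\<bar>))"
        by (simp add: exp_add[symmetric] mult.assoc[symmetric])
      finally show "norm ((\<Sum>k<n. (z * complex_of_real \<zeta>) ^ k / fact k) * ?g \<zeta>) \<le> 2 * exp (\<bar>\<tau>\<bar> / 2) * exp (- (1 / 2 * \<bar>\<tau> - \<zeta>\<bar>))" .
    qed
  qed measurable
  have "(LINT \<zeta>|lborel. (\<Sum>k<n. (z * complex_of_real \<zeta>) ^ k / fact k) * ?g \<zeta>) = (\<Sum>k<n. complex_of_real (log_moment \<tau> k / fact k) * z ^ k)" for n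
  proof -
    have "(LINT \<zeta>|lborel. (\<Sum>k<n. (z * complex_of_real \<zeta>) ^ k / fact k) * ?g \<zeta>)
      = (LINT \<zeta>|lborel. (\<Sum>k<n. (z ^ k / fact k) * complex_of_real (\<zeta> ^ k * gumbel (\<tau> - \<zeta>))))"
      unfolding sum_distrib_right power_mult_distrib
      by (intro Bochner_Integration.integral_cong sum.cong refl) simp
    also have "\<dots> = (\<Sum>k<n. (LINT \<zeta>|lborel. (z ^ k / fact k) * complex_of_real (\<zeta> ^ k * gumbel (\<tau> - \<zeta>))))"
      by (intro Bochner_Integration.integral_sum integrable_mult_right integrable_of_real log_moment_integrable)
    also have "\<dots> = (\<Sum>k<n. (z ^ k / fact k) * complex_of_real (log_moment \<tau> k))"
      unfolding integral_mult_right_zero integral_complex_of_real log_moment_def ..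
    finally show ?thesis by (simp add: mult_ac)
  qed
  moreover have "(LINT \<zeta>|lborel. exp (z * complex_of_real \<zeta>) * ?g \<zeta>) = exp (z * complex_of_real \<tau>) * Gamma (1 - z)"
  proof -
    have "(LINT \<zeta>|lborel. exp (z * complex_of_real \<zeta>) * ?g \<zeta>) = (LINT s|lborel. exp (z * complex_of_real (\<tau> - s)) * complex_of_real (gumbel (\<tau> - (\<tau> - s))))"
      by (rule lborel_integral_shift(2)[symmetric])
    also have "\<dots> = (LINT s|lborel. exp (z * complex_of_real \<tau>) * (complex_of_real (exp (- exp s)) * exp ((1 - z) * complex_of_real s)))"
    proof (intro Bochner_Integration.integral_cong refl)
      fix s
      have "exp (z * complex_of_real (\<tau> - s)) * exp (complex_of_real s) = exp (z * complex_of_real \<tau>) * exp ((1 - z) * complex_of_real s)"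
        unfolding exp_add[symmetric] by (simp add: algebra_simps)
      then show "exp (z * complex_of_real (\<tau> - s)) * complex_of_real (gumbel (\<tau> - (\<tau> - s))) = exp (z * complex_of_real \<tau>) * (complex_of_real (exp (- exp s)) * exp ((1 - z) * complex_of_real s))"
        unfolding gumbel_def by (simp add: exp_of_real mult_ac)
    qed
    also have "\<dots> = exp (z * complex_of_real \<tau>) * Gamma (1 - z)"
      unfolding integral_mult_right_zero Gamma_log_integral(2)[OF Re] ..
    finally show ?thesis .
  qed
  ultimately show ?thesis using lim unfolding sums_def by simp
qed

text \<open>
  Comparison of the coefficients of \<open>z\<^sup>n\<close> in \<open>\<omega>(z) e\<^sup>z\<^sup>\<tau> \<Gamma>(1 - z) = e\<^sup>z\<^sup>\<tau>\<close>.
\<close>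

lemma log_moment_recurrence:
  "(\<Sum>i\<le>n. (deriv ^^ i) omega_fun 0 / fact i * complex_of_real (log_moment \<tau> (n - i) / fact (n - i))) = complex_of_real (\<tau> ^ n / fact n)"
proof -
  have "omega_fun analytic_on {0}"
    unfolding omega_fun_def[abs_def] by (intro analytic_intros)
  then have \<omega>: "omega_fun has_fps_expansion fps_expansion omega_fun 0"
    by (rule analytic_at_imp_has_fps_expansion_0)
  define M where "M = Abs_fps (\<lambda>k. complex_of_real (log_moment \<tau> k / fact k))"
  have ball: "\<forall>\<^sub>F z::complex in nhds 0. norm z < 1/2"
    using eventually_nhds_in_open[of "ball (0::complex) (1/2)" 0] by simp
  have G: "(\<lambda>z. exp (z * complex_of_real \<tau>) * Gamma (1 - z)) has_fps_expansion M"
    by (rule has_fps_expansionI) (use ball log_moment_generating in \<open>auto elim!: eventually_mono simp: M_def\<close>)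
  have "\<forall>\<^sub>F z in nhds 0. omega_fun z * (exp (z * complex_of_real \<tau>) * Gamma (1 - z)) = exp (complex_of_real \<tau> * z)"
    using ball
  proof eventually_elim
    case (elim z)
    have "1 - z \<notin> \<int>\<^sub>\<le>\<^sub>0"
    proof
      assume "1 - z \<in> \<int>\<^sub>\<le>\<^sub>0"
      then obtain n where "1 - z = - of_nat n" by (auto elim: nonpos_Ints_cases')
      then have "Re (1 - z) = Re (- of_nat n)" by (rule arg_cong)
      then show False using abs_Re_le_cmod[of z] elim by simp
    qed
    then have "rGamma (1 - z) * Gamma (1 - z) = 1"
      by (simp add: Gamma_def rGamma_eq_zero_iff)
    then show ?case unfolding omega_fun_def by (simp add: mult.left_commute mult.commute)
  qed
  from has_fps_expansion_cong[OF this refl, THEN iffD1, OF has_fps_expansion_mult[OF \<omega> G]]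
  have "(\<lambda>z. exp (complex_of_real \<tau> * z)) has_fps_expansion fps_expansion omega_fun 0 * M" .
  then have "fps_expansion omega_fun 0 * M = fps_exp (complex_of_real \<tau>)"
    using has_fps_expansion_exp fps_expansion_unique_complex by blast
  then have "fps_nth (fps_expansion omega_fun 0 * M) n = fps_nth (fps_exp (complex_of_real \<tau>)) n" by simp
  then show ?thesis unfolding fps_mult_nth fps_nth_fps_expansion[OF \<omega>] M_def
    by (simp add: atLeast0AtMost)
qed

lemma log_moment_0_0: "log_moment 0 0 = 1"
  using log_moment_recurrence[of 0 0] by (simp add: omega_fun_def)

text \<open>
  For \<open>\<tau> = 0\<close> the recurrence is a triangular system with real entries and ones on the diagonal.
\<close>

lemma omega_deriv_real: "cnj ((deriv ^^ n) omega_fun 0) = (deriv ^^ n) omega_fun 0"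
proof (induction n rule: less_induct)
  case (less n)
  let ?c = "\<lambda>i. (deriv ^^ i) omega_fun 0 / fact i"
  have r: "(\<Sum>i<n. ?c i * complex_of_real (log_moment 0 (n - i) / fact (n - i))) + ?c n = complex_of_real (0 ^ n / fact n)"
    using log_moment_recurrence[of 0 n] by (simp add: log_moment_0_0 lessThan_Suc_atMost[symmetric])
  then have "?c n = complex_of_real (0 ^ n / fact n) - (\<Sum>i<n. ?c i * complex_of_real (log_moment 0 (n - i) / fact (n - i)))"
    by (simp add: eq_diff_eq add.commute)
  moreover have "cnj \<dots> = \<dots>" using less by simp
  ultimately have "cnj (?c n) = ?c n" by metis
  then show ?case by simp
qed

lemma coeff_Q_poly: "coeff (Q_poly P) k = (if k \<le> degree P then Q_coeff P k else 0)"
  unfolding Q_poly_def coeff_sum coeff_monom by (simp add: sum.delta)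

lemma real_poly_Q: "real_poly (Q_poly P)"
  unfolding real_poly_def coeff_Q_poly by (simp add: Q_coeff_def omega_deriv_real)

lemma degree_Q_poly: "degree (Q_poly P) \<le> degree P"
  by (rule degree_le) (simp add: coeff_Q_poly)

lemma sum_coeff_Q_poly: "(\<Sum>k\<le>degree (Q_poly P). coeff (Q_poly P) k * f k) = (\<Sum>k\<le>degree P. Q_coeff P k * f k)"
proof -
  have "(\<Sum>k\<le>degree (Q_poly P). coeff (Q_poly P) k * f k) = (\<Sum>k\<le>degree P. coeff (Q_poly P) k * f k)"
    by (rule sum.mono_neutral_left) (use degree_Q_poly[of P] in \<open>auto simp: coeff_eq_0\<close>)
  then show ?thesis by (simp add: coeff_Q_poly)
qed

text \<open>
  The representation \<open>P(\<tau>) = t \<integral> e\<^sup>-\<^sup>t\<^sup>\<lambda> Q(- ln \<lambda>) d\<lambda>\<close> with \<open>t = e\<^sup>\<tau>\<close>: multiply the recurrence for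
  \<open>\<tau>\<^sup>l\<close> by \<open>l!\<close> and the coefficient of \<open>P\<close>, sum over \<open>l\<close>, and collect the terms that contain the
  same moment.
\<close>

lemma poly_eq_Q_moments: "complex_of_real (poly P \<tau>) = (\<Sum>k\<le>degree (Q_poly P). coeff (Q_poly P) k * complex_of_real (log_moment \<tau> k))"
proof -
  let ?d = "degree P"
  have "(\<Sum>k\<le>?d. Q_coeff P k * complex_of_real (log_moment \<tau> k))
    = (\<Sum>k\<le>?d. \<Sum>l=k..?d. of_nat (l choose k) * (deriv ^^ (l - k)) omega_fun 0 * complex_of_real (coeff P l) * complex_of_real (log_moment \<tau> k))"
    unfolding Q_coeff_def by (simp add: sum_distrib_right)
  also have "\<dots> = (\<Sum>l\<le>?d. \<Sum>k\<le>l. of_nat (l choose k) * (deriv ^^ (l - k)) omega_fun 0 * complex_of_real (coeff P l) * complex_of_real (log_moment \<tau> k))"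
    by (subst sum.Sigma, simp, simp, subst sum.Sigma, simp, simp,
        rule sum.reindex_bij_witness[of _ prod.swap prod.swap]) auto
  also have "\<dots> = (\<Sum>l\<le>?d. complex_of_real (coeff P l * \<tau> ^ l))"
  proof (rule sum.cong[OF refl])
    fix l
    have "(\<Sum>k\<le>l. of_nat (l choose k) * (deriv ^^ (l - k)) omega_fun 0 * complex_of_real (coeff P l) * complex_of_real (log_moment \<tau> k))
      = (\<Sum>i\<le>l. of_nat (l choose (l - i)) * (deriv ^^ i) omega_fun 0 * complex_of_real (coeff P l) * complex_of_real (log_moment \<tau> (l - i)))"
      by (rule sum.reindex_bij_witness[of _ "\<lambda>i. l - i" "\<lambda>i. l - i"]) auto
    also have "\<dots> = (\<Sum>i\<le>l. complex_of_real (coeff P l) * fact l * ((deriv ^^ i) omega_fun 0 / fact i * complex_of_real (log_moment \<tau> (l - i) / fact (l - i))))"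
    proof (rule sum.cong[OF refl])
      fix i assume "i \<in> {..l}"
      then have "of_nat (l choose (l - i)) = (fact l / (fact (l - i) * fact i) :: complex)"
        by (subst binomial_fact) auto
      then show "of_nat (l choose (l - i)) * (deriv ^^ i) omega_fun 0 * complex_of_real (coeff P l) * complex_of_real (log_moment \<tau> (l - i))
        = complex_of_real (coeff P l) * fact l * ((deriv ^^ i) omega_fun 0 / fact i * complex_of_real (log_moment \<tau> (l - i) / fact (l - i)))"
        by (simp add: field_simps)
    qed
    also have "\<dots> = complex_of_real (coeff P l * \<tau> ^ l)"
      unfolding sum_distrib_left[symmetric] log_moment_recurrence by simp
    finally show "(\<Sum>k\<le>l. of_nat (l choose k) * (deriv ^^ (l - k)) omega_fun 0 * complex_of_real (coeff P l) * complex_of_real (log_moment \<tau> k)) = complex_of_real (coeff P l * \<tau> ^ l)" .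
  qed
  also have "\<dots> = complex_of_real (poly P \<tau>)" by (simp add: poly_altdef)
  finally show ?thesis by (simp add: sum_coeff_Q_poly)
qed

section \<open>The Laplace transform in the logarithmic variable\<close>

text \<open>
  In the variables \<open>x = ln t\<close> and \<open>\<zeta> = - ln \<lambda>\<close> the Laplace transform, conjugated to act between
  spaces with Lebesgue measure, is integration against this kernel at \<open>x - \<zeta>\<close>.
\<close>

definition laplace_kernel :: "real \<Rightarrow> real" where
  "laplace_kernel s = exp (- exp s) * exp (s / 2)"

lemma laplace_kernel_measurable [measurable]: "laplace_kernel \<in> borel_measurable borel"
  unfolding laplace_kernel_def[abs_def] by measurable

lemma laplace_kernel_bounds: "0 \<le> laplace_kernel s" "laplace_kernel s \<le> exp (- (1 / 2 * \<bar>s\<bar>))"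
proof -
  show "0 \<le> laplace_kernel s" by (simp add: laplace_kernel_def)
  show "laplace_kernel s \<le> exp (- (1 / 2 * \<bar>s\<bar>))"
  proof (cases "s \<ge> 0")
    case True
    have "s \<le> exp s" using exp_ge_add_one_self[of s] by linarith
    then have "laplace_kernel s \<le> exp (- s) * exp (s / 2)" unfolding laplace_kernel_def by (intro mult_right_mono) auto
    also have "\<dots> = exp (- (1 / 2 * \<bar>s\<bar>))" using True by (simp add: exp_add[symmetric])
    finally show ?thesis .
  next
    case False
    have "laplace_kernel s \<le> 1 * exp (s / 2)" unfolding laplace_kernel_def by (intro mult_right_mono) auto
    then show ?thesis using False by simp
  qed
qed

lemma integrable_power_laplace_kernel: "integrable lborel (\<lambda>\<zeta>. \<zeta> ^ k * laplace_kernel (x - \<zeta>))"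
proof (rule Bochner_Integration.integrable_bound)
  show "integrable lborel (\<lambda>\<zeta>. \<bar>\<zeta>\<bar> ^ k * exp (- (1 / 2 * \<bar>x - \<zeta>\<bar>)))"
    by (rule integrable_poly_exp_abs_shift) simp
  show "AE \<zeta> in lborel. norm (\<zeta> ^ k * laplace_kernel (x - \<zeta>)) \<le> norm (\<bar>\<zeta>\<bar> ^ k * exp (- (1 / 2 * \<bar>x - \<zeta>\<bar>)))"
    using laplace_kernel_bounds by (auto simp: abs_mult power_abs intro!: mult_left_mono)
qed measurable

lemma laplace_kernel_fourier:
  "(LINT r|lborel. complex_of_real (laplace_kernel r) * exp (\<i> * complex_of_real (r * \<xi>))) = Gamma (1/2 + \<i> * complex_of_real \<xi>)"
  "integrable lborel (\<lambda>r. complex_of_real (laplace_kernel r))"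
proof -
  have eq: "complex_of_real (laplace_kernel r) * exp (\<i> * complex_of_real (r * \<xi>)) = complex_of_real (exp (- exp r)) * exp ((1/2 + \<i> * complex_of_real \<xi>) * complex_of_real r)" for r \<xi>
    unfolding laplace_kernel_def by (simp add: exp_of_real[symmetric] mult.assoc exp_add[symmetric] algebra_simps)
  show "(LINT r|lborel. complex_of_real (laplace_kernel r) * exp (\<i> * complex_of_real (r * \<xi>))) = Gamma (1/2 + \<i> * complex_of_real \<xi>)"
    unfolding eq by (rule Gamma_log_integral) simp
  have "integrable lborel (\<lambda>r. complex_of_real (exp (- exp r)) * exp ((1/2 + \<i> * complex_of_real 0) * complex_of_real r))"
    by (rule Gamma_log_integral) simp
  then show "integrable lborel (\<lambda>r. complex_of_real (laplace_kernel r))" unfolding eq[symmetric] by simp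
qed

lemma inv_fourier_kernel:
  assumes c: "integrable lborel c" and u: "integrable lborel u"
  shows "(LINT y|lborel. complex_of_real (u y) * inv_fourier c y)
    = complex_of_real ((2 * pi) powr (-1/2)) * (LINT \<xi>|lborel. (LINT y|lborel. complex_of_real (u y) * exp (\<i> * complex_of_real (y * \<xi>))) * c \<xi>)"
proof -
  have "(LINT \<xi>|lborel. (LINT y|lborel. complex_of_real (u y) * exp (\<i> * complex_of_real (y * \<xi>))) * c \<xi>)
    = (LINT y|lborel. complex_of_real (u y) * (LINT \<xi>|lborel. c \<xi> * exp (\<i> * complex_of_real (y * \<xi>))))"
    by (rule Fubini_bounded_kernel[where C=1]) (use c u in auto)
  moreover have "complex_of_real (u y) * inv_fourier c y
      = complex_of_real ((2 * pi) powr (-1/2)) * (complex_of_real (u y) * (LINT \<xi>|lborel. c \<xi> * exp (\<i> * complex_of_real (y * \<xi>))))" for y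
    unfolding inv_fourier_def by (rule mult.left_commute)
  ultimately show ?thesis by (simp only: integral_mult_right_zero)
qed

text \<open>
  Convolution with the kernel, or with its reflection, acts on the Fourier side as multiplication by
  \<open>\<Gamma>(1/2 + i\<xi>)\<close> or by its conjugate.
\<close>

lemma laplace_kernel_inv_fourier:
  assumes c: "integrable lborel c"
  shows "(LINT y|lborel. complex_of_real (laplace_kernel (y - \<zeta>)) * inv_fourier c y) = inv_fourier (\<lambda>\<xi>. Gamma (1/2 + \<i> * complex_of_real \<xi>) * c \<xi>) \<zeta>"
    and "(LINT y|lborel. complex_of_real (laplace_kernel (\<zeta> - y)) * inv_fourier c y) = inv_fourier (\<lambda>\<xi>. cnj (Gamma (1/2 + \<i> * complex_of_real \<xi>)) * c \<xi>) \<zeta>"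
proof -
  have i: "integrable lborel (\<lambda>y. laplace_kernel (y - \<zeta>))" "integrable lborel (\<lambda>y. laplace_kernel (\<zeta> - y))"
    using integrable_Re[OF laplace_kernel_fourier(2)] by (simp_all add: lborel_integrable_shift)
  have e1: "(LINT y|lborel. complex_of_real (laplace_kernel (y - \<zeta>)) * exp (\<i> * complex_of_real (y * \<xi>))) = exp (\<i> * complex_of_real (\<zeta> * \<xi>)) * Gamma (1/2 + \<i> * complex_of_real \<xi>)" for \<xi>
  proof -
    have "(LINT y|lborel. complex_of_real (laplace_kernel (y - \<zeta>)) * exp (\<i> * complex_of_real (y * \<xi>)))
      = (LINT r|lborel. complex_of_real (laplace_kernel (r + \<zeta> - \<zeta>)) * exp (\<i> * complex_of_real ((r + \<zeta>) * \<xi>)))"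
      by (rule lborel_integral_shift(4)[symmetric])
    also have "\<dots> = (LINT r|lborel. exp (\<i> * complex_of_real (\<zeta> * \<xi>)) * (complex_of_real (laplace_kernel r) * exp (\<i> * complex_of_real (r * \<xi>))))"
      by (intro Bochner_Integration.integral_cong refl) (simp add: exp_add distrib_left distrib_right mult_ac)
    finally show ?thesis by (simp only: integral_mult_right_zero laplace_kernel_fourier)
  qed
  have e2: "(LINT y|lborel. complex_of_real (laplace_kernel (\<zeta> - y)) * exp (\<i> * complex_of_real (y * \<xi>))) = exp (\<i> * complex_of_real (\<zeta> * \<xi>)) * cnj (Gamma (1/2 + \<i> * complex_of_real \<xi>))" for \<xi>
  proof -
    have "(LINT y|lborel. complex_of_real (laplace_kernel (\<zeta> - y)) * exp (\<i> * complex_of_real (y * \<xi>)))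
      = (LINT r|lborel. complex_of_real (laplace_kernel (\<zeta> - (\<zeta> - r))) * exp (\<i> * complex_of_real ((\<zeta> - r) * \<xi>)))"
      by (rule lborel_integral_shift(2)[symmetric])
    also have "\<dots> = (LINT r|lborel. exp (\<i> * complex_of_real (\<zeta> * \<xi>)) * cnj (complex_of_real (laplace_kernel r) * exp (\<i> * complex_of_real (r * \<xi>))))"
      by (intro Bochner_Integration.integral_cong refl)
        (simp add: exp_cnj exp_add[symmetric] left_diff_distrib right_diff_distrib exp_diff exp_minus divide_inverse mult_ac)
    finally show ?thesis by (simp only: integral_mult_right_zero Bochner_Integration.integral_cnj laplace_kernel_fourier)
  qed
  show "(LINT y|lborel. complex_of_real (laplace_kernel (y - \<zeta>)) * inv_fourier c y) = inv_fourier (\<lambda>\<xi>. Gamma (1/2 + \<i> * complex_of_real \<xi>) * c \<xi>) \<zeta>"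
    unfolding inv_fourier_kernel[OF c i(1)] e1 unfolding inv_fourier_def by (simp add: mult_ac)
  show "(LINT y|lborel. complex_of_real (laplace_kernel (\<zeta> - y)) * inv_fourier c y) = inv_fourier (\<lambda>\<xi>. cnj (Gamma (1/2 + \<i> * complex_of_real \<xi>)) * c \<xi>) \<zeta>"
    unfolding inv_fourier_kernel[OF c i(2)] e2 unfolding inv_fourier_def by (simp add: mult_ac)
qed

text \<open>
  Integration by parts: multiplication by \<open>x\<close> corresponds to \<open>i d/d\<xi>\<close>.
\<close>

lemma inv_fourier_power:
  assumes "\<phi> \<in> test_functions"
  shows "complex_of_real x ^ k * inv_fourier \<phi> x = inv_fourier (\<lambda>\<xi>. \<i> ^ k * (vderiv ^^ k) \<phi> \<xi>) x"
  using assms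
proof (induction k arbitrary: \<phi>)
  case (Suc k)
  let ?c = "complex_of_real ((2 * pi) powr (-1/2))"
  have d: "((\<lambda>\<xi>. exp (\<i> * complex_of_real (x * \<xi>))) has_vector_derivative \<i> * complex_of_real x * exp (\<i> * complex_of_real (x * \<xi>))) (at \<xi>)" for \<xi>
    by (auto intro!: derivative_eq_intros has_vector_derivative_real_field)
  have s: "smooth (\<lambda>\<xi>. exp (\<i> * complex_of_real (x * \<xi>)))"
    using smooth_holomorphic[of exp UNIV 0 "\<i> * complex_of_real x"] by (simp add: holomorphic_on_exp mult.assoc)
  have i: "integrable lborel (\<lambda>\<xi>. vderiv \<phi> \<xi> * exp (\<i> * complex_of_real (x * \<xi>)))"
    by (intro integrable_mult_unimodular test_L2_integrable test_vderiv Suc.prems) auto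
  have "(LINT \<xi>|lborel. exp (\<i> * complex_of_real (x * \<xi>)) * vderiv \<phi> \<xi>) = - (LINT \<xi>|lborel. \<i> * complex_of_real x * exp (\<i> * complex_of_real (x * \<xi>)) * \<phi> \<xi>)"
    unfolding integral_by_parts_test[OF Suc.prems s] vderiv_eqI[OF d] ..
  also have "\<dots> = - (\<i> * complex_of_real x * (LINT \<xi>|lborel. \<phi> \<xi> * exp (\<i> * complex_of_real (x * \<xi>))))"
    by (subst integral_mult_right_zero[symmetric]) (simp add: mult_ac)
  finally have ibp: "(LINT \<xi>|lborel. exp (\<i> * complex_of_real (x * \<xi>)) * vderiv \<phi> \<xi>) = - (\<i> * complex_of_real x * (LINT \<xi>|lborel. \<phi> \<xi> * exp (\<i> * complex_of_real (x * \<xi>))))" .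
  have "\<i> * - (\<i> * a * b) = a * b" for a b by (simp add: mult.assoc[symmetric])
  then have "\<i> * (LINT \<xi>|lborel. vderiv \<phi> \<xi> * exp (\<i> * complex_of_real (x * \<xi>))) = complex_of_real x * (LINT \<xi>|lborel. \<phi> \<xi> * exp (\<i> * complex_of_real (x * \<xi>)))"
    using ibp by (simp only: mult.commute[of "vderiv \<phi> _"])
  then have one: "complex_of_real x * inv_fourier \<phi> x = \<i> * inv_fourier (vderiv \<phi>) x"
    unfolding inv_fourier_def by (simp add: mult.left_commute)
  have "complex_of_real x ^ Suc k * inv_fourier \<phi> x = complex_of_real x ^ k * (complex_of_real x * inv_fourier \<phi> x)"
    by (simp add: mult_ac)
  also have "\<dots> = \<i> * (complex_of_real x ^ k * inv_fourier (vderiv \<phi>) x)" unfolding one by (simp add: mult_ac)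
  also have "\<dots> = \<i> * inv_fourier (\<lambda>\<xi>. \<i> ^ k * (vderiv ^^ k) (vderiv \<phi>) \<xi>) x"
    unfolding Suc.IH[OF test_vderiv[OF Suc.prems]] ..
  also have "\<dots> = inv_fourier (\<lambda>\<xi>. \<i> ^ Suc k * (vderiv ^^ Suc k) \<phi> \<xi>) x"
    unfolding inv_fourier_def vderiv_pow_Suc by (simp add: mult.assoc)
  finally show ?case .
qed simp

lemma inv_fourier_sum:
  assumes "\<And>i. i \<in> I \<Longrightarrow> integrable lborel (f i)"
  shows "inv_fourier (\<lambda>\<xi>. \<Sum>i\<in>I. c i * f i \<xi>) x = (\<Sum>i\<in>I. c i * inv_fourier (f i) x)"
proof -
  have "(LINT \<xi>|lborel. (\<Sum>i\<in>I. c i * f i \<xi>) * exp (\<i> * complex_of_real (x * \<xi>))) = (LINT \<xi>|lborel. (\<Sum>i\<in>I. c i * (f i \<xi> * exp (\<i> * complex_of_real (x * \<xi>)))))"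
    by (simp add: sum_distrib_right mult.assoc)
  also have "\<dots> = (\<Sum>i\<in>I. (LINT \<xi>|lborel. c i * (f i \<xi> * exp (\<i> * complex_of_real (x * \<xi>)))))"
    by (intro Bochner_Integration.integral_sum integrable_mult_right integrable_mult_unimodular assms) auto
  finally show ?thesis unfolding inv_fourier_def by (simp add: sum_distrib_left mult_ac)
qed

lemma inv_fourier_poly_deriv:
  assumes "\<phi> \<in> test_functions"
  shows "(\<Sum>k\<le>degree Q. coeff Q k * complex_of_real x ^ k) * inv_fourier \<phi> x = inv_fourier (poly_deriv Q \<i> \<phi>) x"
proof -
  have "inv_fourier (poly_deriv Q \<i> \<phi>) x = inv_fourier (\<lambda>\<xi>. \<Sum>k\<le>degree Q. coeff Q k * (\<i> ^ k * (vderiv ^^ k) \<phi> \<xi>)) x"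
    unfolding poly_deriv_def[abs_def] by (simp add: mult.assoc)
  also have "\<dots> = (\<Sum>k\<le>degree Q. coeff Q k * inv_fourier (\<lambda>\<xi>. \<i> ^ k * (vderiv ^^ k) \<phi> \<xi>) x)"
    by (intro inv_fourier_sum integrable_mult_right test_L2_integrable test_vderiv_pow assms)
  finally show ?thesis by (simp add: inv_fourier_power[OF assms, symmetric] sum_distrib_right mult.assoc)
qed

section \<open>The Hankel operator in the logarithmic variable\<close>

text \<open>
  \<open>e\<^sup>(\<^sup>x\<^sup>+\<^sup>y\<^sup>)\<^sup>/\<^sup>2 h(e\<^sup>x + e\<^sup>y)\<close>, the kernel of the Hankel operator after the logarithmic substitution.
\<close>

definition log_hankel_kernel :: "real poly \<Rightarrow> real \<Rightarrow> real \<Rightarrow> real" where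
  "log_hankel_kernel P x y = exp ((x + y) / 2) * (poly P (ln (exp x + exp y)) / (exp x + exp y))"

lemma log_hankel_kernel_measurable [measurable]:
  "(\<lambda>(x, y). log_hankel_kernel P x y) \<in> borel_measurable (borel \<Otimes>\<^sub>M borel)"
proof -
  have [measurable]: "poly P \<in> borel_measurable borel"
    by (intro borel_measurable_continuous_onI continuous_intros)
  show ?thesis unfolding log_hankel_kernel_def by measurable
qed

lemma log_hankel_kernel_measurable1 [measurable]: "log_hankel_kernel P x \<in> borel_measurable borel"
  using measurable_compose[OF measurable_Pair1' log_hankel_kernel_measurable[of P], of x] by simp

lemma log_hankel_kernel_sym: "log_hankel_kernel P x y = log_hankel_kernel P y x"
  by (simp add: log_hankel_kernel_def add.commute)

lemma poly_abs_bound: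
  fixes p :: "real poly"
  shows "\<bar>poly p t\<bar> \<le> (\<Sum>i\<le>degree p. \<bar>coeff p i\<bar>) * (1 + \<bar>t\<bar>) ^ degree p"
proof -
  have "\<bar>poly p t\<bar> \<le> (\<Sum>i\<le>degree p. \<bar>coeff p i * t ^ i\<bar>)" unfolding poly_altdef by (rule sum_abs)
  also have "\<dots> \<le> (\<Sum>i\<le>degree p. \<bar>coeff p i\<bar> * (1 + \<bar>t\<bar>) ^ degree p)"
  proof (rule sum_mono)
    fix i assume "i \<in> {..degree p}"
    have "\<bar>t\<bar> ^ i \<le> (1 + \<bar>t\<bar>) ^ i" by (intro power_mono) auto
    also have "\<dots> \<le> (1 + \<bar>t\<bar>) ^ degree p" using \<open>i \<in> _\<close> by (intro power_increasing) auto
    finally show "\<bar>coeff p i * t ^ i\<bar> \<le> \<bar>coeff p i\<bar> * (1 + \<bar>t\<bar>) ^ degree p"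
      by (simp add: abs_mult power_abs mult_left_mono)
  qed
  finally show ?thesis by (simp add: sum_distrib_right)
qed

text \<open>
  With \<open>r = |x - y|\<close> one has \<open>e\<^sup>(\<^sup>x\<^sup>+\<^sup>y\<^sup>)\<^sup>/\<^sup>2 \<le> e\<^sup>-\<^sup>r\<^sup>/\<^sup>2 (e\<^sup>x + e\<^sup>y)\<close> and \<open>|ln(e\<^sup>x + e\<^sup>y)| \<le> |y| + r + 1\<close>.  Half of
  the exponential decay absorbs the power of \<open>r\<close>.
\<close>

lemma log_hankel_kernel_bound:
  obtains C where "C \<ge> 0" "\<And>x y. \<bar>log_hankel_kernel P x y\<bar> \<le> C * ((1 + \<bar>y\<bar>) ^ degree P * exp (- (1 / 4 * \<bar>x - y\<bar>)))"
proof -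
  let ?K = "degree P"
  define A where "A = (\<Sum>i\<le>?K. \<bar>coeff P i\<bar>)"
  have A: "A \<ge> 0" unfolding A_def by (intro sum_nonneg) auto
  define C where "C = A * (fact ?K * 4 ^ ?K * exp (1 / 2))"
  have "\<bar>log_hankel_kernel P x y\<bar> \<le> C * ((1 + \<bar>y\<bar>) ^ ?K * exp (- (1 / 4 * \<bar>x - y\<bar>)))" for x y
  proof -
    define \<tau> where "\<tau> = ln (exp x + exp y)"
    define r where "r = \<bar>x - y\<bar>"
    have e: "exp \<tau> = exp x + exp y" unfolding \<tau>_def by (simp add: add_pos_pos)
    have "exp (max x y) \<le> exp \<tau>" unfolding e by (simp add: max_def)
    then have lo: "max x y \<le> \<tau>" by simp
    have "exp \<tau> \<le> 2 * exp (max x y)" unfolding e by (simp add: max_def)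
    also have "\<dots> \<le> exp 1 * exp (max x y)"
      using exp_ge_add_one_self[of 1] by (intro mult_right_mono) auto
    finally have "exp \<tau> \<le> exp (1 + max x y)" by (simp add: exp_add)
    then have hi: "\<tau> \<le> 1 + max x y" by simp
    have t: "\<bar>\<tau>\<bar> \<le> \<bar>y\<bar> + r + 1" using lo hi unfolding r_def by linarith
    have "1 + \<bar>\<tau>\<bar> \<le> (1 + \<bar>y\<bar>) * (2 + r)"
    proof -
      have "0 \<le> \<bar>y\<bar> * r" unfolding r_def by simp
      moreover have "(1 + \<bar>y\<bar>) * (2 + r) = 2 + r + 2 * \<bar>y\<bar> + \<bar>y\<bar> * r" by (simp add: algebra_simps)
      ultimately show ?thesis using t by linarith
    qed
    then have "(1 + \<bar>\<tau>\<bar>) ^ ?K \<le> ((1 + \<bar>y\<bar>) * (2 + r)) ^ ?K" by (intro power_mono) auto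
    then have "A * (1 + \<bar>\<tau>\<bar>) ^ ?K \<le> A * ((1 + \<bar>y\<bar>) * (2 + r)) ^ ?K" using A by (rule mult_left_mono)
    with poly_abs_bound[of P \<tau>] have p: "\<bar>poly P \<tau>\<bar> \<le> A * ((1 + \<bar>y\<bar>) ^ ?K * (2 + r) ^ ?K)"
      unfolding A_def by (simp add: power_mult_distrib)
    have "exp ((x + y) / 2) / exp \<tau> = exp ((x + y) / 2 - \<tau>)" by (simp add: exp_diff)
    also have "\<dots> \<le> exp (- (r / 2))"
    proof -
      have "(x + y) / 2 + r / 2 = max x y" by (simp add: r_def max_def abs_if field_simps)
      then have "(x + y) / 2 - \<tau> \<le> - (r / 2)" using lo by linarith
      then show ?thesis by simp
    qed
    finally have k: "exp ((x + y) / 2) / exp \<tau> \<le> exp (- (r / 2))" .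
    have "(2 + r) ^ ?K = fact ?K * 4 ^ ?K * (((2 + r) / 4) ^ ?K / fact ?K)" by (simp add: power_divide)
    also have "\<dots> \<le> fact ?K * 4 ^ ?K * exp ((2 + r) / 4)"
      unfolding r_def by (intro mult_left_mono power_div_fact_le_exp) auto
    finally have q: "(2 + r) ^ ?K \<le> fact ?K * 4 ^ ?K * exp ((2 + r) / 4)" .
    have "\<bar>log_hankel_kernel P x y\<bar> = \<bar>poly P \<tau>\<bar> * (exp ((x + y) / 2) / exp \<tau>)"
      unfolding log_hankel_kernel_def e \<tau>_def by (simp add: abs_mult add_pos_pos)
    also have "\<dots> \<le> (A * ((1 + \<bar>y\<bar>) ^ ?K * (2 + r) ^ ?K)) * exp (- (r / 2))"
      using p k by (intro mult_mono) auto
    also have "\<dots> = (A * (1 + \<bar>y\<bar>) ^ ?K * exp (- (r / 2))) * (2 + r) ^ ?K" by (simp add: mult_ac)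
    also have "\<dots> \<le> (A * (1 + \<bar>y\<bar>) ^ ?K * exp (- (r / 2))) * (fact ?K * 4 ^ ?K * exp ((2 + r) / 4))"
      using A by (intro mult_left_mono q) auto
    also have "\<dots> = A * (fact ?K * 4 ^ ?K) * (1 + \<bar>y\<bar>) ^ ?K * (exp (- (r / 2)) * exp ((2 + r) / 4))" by (simp add: mult_ac)
    also have "exp (- (r / 2)) * exp ((2 + r) / 4) = exp (1 / 2) * exp (- (1 / 4 * r))"
      unfolding exp_add[symmetric] by (simp add: field_simps)
    also have "A * (fact ?K * 4 ^ ?K) * (1 + \<bar>y\<bar>) ^ ?K * (exp (1 / 2) * exp (- (1 / 4 * r))) = C * ((1 + \<bar>y\<bar>) ^ ?K * exp (- (1 / 4 * \<bar>x - y\<bar>)))"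
      unfolding C_def r_def by (simp only: mult_ac)
    finally show ?thesis .
  qed
  moreover have "C \<ge> 0" using A by (simp add: C_def)
  ultimately show thesis using that by blast
qed

text \<open>
  The condition that defines \<open>\<D>\<^sub>0\<close>, after the logarithmic substitution.
\<close>

definition fast_decay :: "nat \<Rightarrow> (real \<Rightarrow> complex) \<Rightarrow> bool" where
  "fast_decay K u \<longleftrightarrow> u \<in> borel_measurable borel \<and> (\<exists>C n :: real. n > real K + 1 \<and>
     (AE x in lborel. norm (u x) \<le> C * (1 + \<bar>x\<bar>) powr (- n)))"

lemma fast_decay_integrable:
  assumes "fast_decay K u"
  shows "integrable lborel (\<lambda>y. complex_of_real ((1 + \<bar>y\<bar>) ^ K) * u y)" "integrable lborel u"
proof -
  obtain C n where n: "n > real K + 1" and ae: "AE x in lborel. norm (u x) \<le> C * (1 + \<bar>x\<bar>) powr (- n)"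
    and [measurable]: "u \<in> borel_measurable borel"
    using assms by (auto simp: fast_decay_def)
  show i: "integrable lborel (\<lambda>y. complex_of_real ((1 + \<bar>y\<bar>) ^ K) * u y)"
  proof (rule Bochner_Integration.integrable_bound)
    show "integrable lborel (\<lambda>y::real. C * (1 + \<bar>y\<bar>) powr (- (n - real K)))"
      using n by (intro integrable_mult_right integrable_powr_abs) simp
    show "AE y in lborel. norm (complex_of_real ((1 + \<bar>y\<bar>) ^ K) * u y) \<le> norm (C * (1 + \<bar>y\<bar>) powr (- (n - real K)))"
      using ae
    proof eventually_elim
      case (elim y)
      have "norm (complex_of_real ((1 + \<bar>y\<bar>) ^ K) * u y) = (1 + \<bar>y\<bar>) ^ K * norm (u y)"
        by (simp only: norm_mult norm_of_real) simp
      also have "\<dots> \<le> (1 + \<bar>y\<bar>) ^ K * (C * (1 + \<bar>y\<bar>) powr (- n))" using elim by (intro mult_left_mono) auto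
      also have "(1 + \<bar>y\<bar>) ^ K * (C * (1 + \<bar>y\<bar>) powr (- n)) = C * (1 + \<bar>y\<bar>) powr (- (n - real K))"
      proof -
        have "(1 + \<bar>y\<bar>) ^ K = (1 + \<bar>y\<bar>) powr real K" by (rule powr_realpow[symmetric]) simp
        then show ?thesis by (simp add: powr_add[symmetric] mult.left_commute)
      qed
      also have "\<dots> \<le> norm (C * (1 + \<bar>y\<bar>) powr (- (n - real K)))" by simp
      finally show ?case .
    qed
  qed measurable
  show "integrable lborel u"
  proof (rule Bochner_Integration.integrable_bound[OF i])
    show "AE y in lborel. norm (u y) \<le> norm (complex_of_real ((1 + \<bar>y\<bar>) ^ K) * u y)"
    proof (rule AE_I2)
      fix y
      have "1 * norm (u y) \<le> (1 + \<bar>y\<bar>) ^ K * norm (u y)" by (intro mult_right_mono one_le_power) auto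
      then show "norm (u y) \<le> norm (complex_of_real ((1 + \<bar>y\<bar>) ^ K) * u y)"
        by (simp only: norm_mult norm_of_real) simp
    qed
  qed simp
qed

definition log_hankel :: "real poly \<Rightarrow> (real \<Rightarrow> complex) \<Rightarrow> real \<Rightarrow> complex" where
  "log_hankel P u x = (LINT y|lborel. complex_of_real (log_hankel_kernel P x y) * u y)"

lemma log_hankel_integrable:
  assumes u: "fast_decay (degree P) u"
  shows "integrable lborel (\<lambda>y. complex_of_real (log_hankel_kernel P x y) * u y)"
proof -
  have [measurable]: "u \<in> borel_measurable borel" using u by (simp add: fast_decay_def)
  obtain C where C: "C \<ge> 0" "\<And>x y. \<bar>log_hankel_kernel P x y\<bar> \<le> C * ((1 + \<bar>y\<bar>) ^ degree P * exp (- (1 / 4 * \<bar>x - y\<bar>)))"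
    using log_hankel_kernel_bound[of P] by blast
  show ?thesis
  proof (rule Bochner_Integration.integrable_bound)
    show "integrable lborel (\<lambda>y. complex_of_real C * (complex_of_real ((1 + \<bar>y\<bar>) ^ degree P) * u y))"
      by (intro integrable_mult_right fast_decay_integrable(1)[OF u])
    show "AE y in lborel. norm (complex_of_real (log_hankel_kernel P x y) * u y) \<le> norm (complex_of_real C * (complex_of_real ((1 + \<bar>y\<bar>) ^ degree P) * u y))"
    proof (rule AE_I2)
      fix y
      have "\<bar>log_hankel_kernel P x y\<bar> \<le> C * ((1 + \<bar>y\<bar>) ^ degree P * 1)"
        by (rule order_trans[OF C(2)]) (intro mult_left_mono C(1), auto)
      then have "\<bar>log_hankel_kernel P x y\<bar> * norm (u y) \<le> C * (1 + \<bar>y\<bar>) ^ degree P * norm (u y)"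
        by (intro mult_right_mono) auto
      then show "norm (complex_of_real (log_hankel_kernel P x y) * u y) \<le> norm (complex_of_real C * (complex_of_real ((1 + \<bar>y\<bar>) ^ degree P) * u y))"
        using C(1) by (simp only: norm_mult norm_of_real) (simp add: mult.assoc)
    qed
  qed measurable
qed

text \<open>
  Against a rapidly decaying function the kernel is dominated by \<open>e\<^sup>-\<^sup>r\<^sup>/\<^sup>4\<close> times an integrable function
  of \<open>y\<close>, so the image is both bounded and integrable.
\<close>

lemma log_hankel_L2:
  assumes u: "fast_decay (degree P) u"
  shows "log_hankel P u \<in> L2 lborel"
proof -
  have um [measurable]: "u \<in> borel_measurable borel" using u by (simp add: fast_decay_def)
  obtain C where C: "C \<ge> 0" "\<And>x y. \<bar>log_hankel_kernel P x y\<bar> \<le> C * ((1 + \<bar>y\<bar>) ^ degree P * exp (- (1 / 4 * \<bar>x - y\<bar>)))"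
    using log_hankel_kernel_bound[of P] by blast
  define a where "a y = C * norm (complex_of_real ((1 + \<bar>y\<bar>) ^ degree P) * u y)" for y
  have a: "integrable lborel a" "\<And>y. a y \<ge> 0"
  proof -
    show "integrable lborel a" unfolding a_def[abs_def]
      by (rule integrable_mult_right[OF integrable_norm[OF fast_decay_integrable(1)[OF u]]])
  qed (simp add: a_def C(1))
  have [measurable]: "a \<in> borel_measurable borel" using borel_measurable_integrable[OF a(1)] by simp
  have bd: "norm (complex_of_real (log_hankel_kernel P x y) * u y) \<le> a y * exp (- (1 / 4 * \<bar>x - y\<bar>))" for x y
  proof -
    have "\<bar>log_hankel_kernel P x y\<bar> * norm (u y) \<le> C * ((1 + \<bar>y\<bar>) ^ degree P * exp (- (1 / 4 * \<bar>x - y\<bar>))) * norm (u y)"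
      by (intro mult_right_mono C) auto
    then show ?thesis unfolding a_def by (simp only: norm_mult norm_of_real) (simp add: mult_ac)
  qed
  have m: "(\<lambda>(y, x). complex_of_real (log_hankel_kernel P x y) * u y) \<in> borel_measurable (borel \<Otimes>\<^sub>M borel)"
  proof -
    have "(\<lambda>p. log_hankel_kernel P (snd p) (fst p)) \<in> borel_measurable (borel \<Otimes>\<^sub>M borel)"
      using measurable_compose[OF measurable_pair_swap' log_hankel_kernel_measurable[of P]] by (simp add: case_prod_beta)
    then show ?thesis unfolding case_prod_beta by measurable
  qed
  define E where "E = (LINT x::real|lborel. exp (- (1 / 4 * \<bar>x\<bar>)))"
  have ei: "integrable lborel (\<lambda>x. exp (- (1 / 4 * \<bar>x - y\<bar>)))" for y :: real
    using lborel_integrable_shift(1)[of "\<lambda>x::real. exp (- (1 / 4 * \<bar>x\<bar>))" y] integrable_exp_abs[of "1/4"] by simp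
  have E: "(LINT x|lborel. exp (- (1 / 4 * \<bar>x - y\<bar>))) = E" for y :: real
    unfolding E_def using lborel_integral_shift(1)[of "\<lambda>x::real. exp (- (1 / 4 * \<bar>x\<bar>))" y] .
  have inner: "integrable lborel (\<lambda>x. complex_of_real (log_hankel_kernel P x y) * u y)" for y
  proof (rule Bochner_Integration.integrable_bound)
    show "integrable lborel (\<lambda>x. a y * exp (- (1 / 4 * \<bar>x - y\<bar>)))" by (intro integrable_mult_right ei)
    have "(\<lambda>x. log_hankel_kernel P x y) \<in> borel_measurable borel"
      using log_hankel_kernel_measurable1[of P y] by (simp add: log_hankel_kernel_sym[of P _ y])
    then show "(\<lambda>x. complex_of_real (log_hankel_kernel P x y) * u y) \<in> borel_measurable lborel" by measurable
  qed (use order_trans[OF bd abs_ge_self] in auto)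
  have "integrable (lborel \<Otimes>\<^sub>M lborel) (\<lambda>(y, x). complex_of_real (log_hankel_kernel P x y) * u y)"
  proof (rule integrable_pairI[OF m _ inner])
    show "integrable lborel (\<lambda>y. a y * E)" by (intro integrable_mult_left a)
    fix y
    have "(LINT x|lborel. norm (complex_of_real (log_hankel_kernel P x y) * u y)) \<le> (LINT x|lborel. a y * exp (- (1 / 4 * \<bar>x - y\<bar>)))"
      by (intro integral_mono integrable_norm inner integrable_mult_right ei bd)
    also have "\<dots> = a y * E" by (simp only: integral_mult_right_zero E)
    finally show "(LINT x|lborel. norm (complex_of_real (log_hankel_kernel P x y) * u y)) \<le> a y * E" .
  qed
  from lborel_pair.integrable_snd[OF this] have i: "integrable lborel (log_hankel P u)"
    unfolding log_hankel_def[abs_def] .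
  define B where "B = (LINT y|lborel. a y)"
  have B: "norm (log_hankel P u x) \<le> B" for x
  proof -
    have "norm (log_hankel P u x) \<le> (LINT y|lborel. norm (complex_of_real (log_hankel_kernel P x y) * u y))"
      unfolding log_hankel_def by (rule integral_norm_bound)
    also have "\<dots> \<le> (LINT y|lborel. a y)"
    proof (intro integral_mono integrable_norm log_hankel_integrable[OF u] a(1))
      fix y
      have "a y * exp (- (1 / 4 * \<bar>x - y\<bar>)) \<le> a y * 1" by (intro mult_left_mono a(2)) simp
      then show "norm (complex_of_real (log_hankel_kernel P x y) * u y) \<le> a y" using bd[of x y] by linarith
    qed
    finally show ?thesis by (simp add: B_def)
  qed
  have hm: "log_hankel P u \<in> borel_measurable borel" using borel_measurable_integrable[OF i] by simp
  show ?thesis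
  proof (rule L2_I)
    show "integrable lborel (\<lambda>x. (norm (log_hankel P u x))\<^sup>2)"
    proof (rule Bochner_Integration.integrable_bound)
      show "integrable lborel (\<lambda>x. B * norm (log_hankel P u x))" by (intro integrable_mult_right integrable_norm i)
      show "AE x in lborel. norm ((norm (log_hankel P u x))\<^sup>2) \<le> norm (B * norm (log_hankel P u x))"
        using B order_trans[OF norm_ge_zero B] by (auto simp: power2_eq_square abs_mult intro!: mult_right_mono order_trans[OF B])
    qed (use hm in measurable)
  qed (use hm in auto)
qed

text \<open>
  Fubini's theorem, with the growth of the kernel in \<open>y\<close> shifted to \<open>u\<close>.
\<close>

lemma log_hankel_symmetric:
  assumes u: "fast_decay (degree P) u" and w: "fast_decay (degree P) w"
  shows "L2_inner lborel (log_hankel P u) w = L2_inner lborel u (log_hankel P w)"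
proof -
  obtain C where C: "C \<ge> 0" "\<And>x y. \<bar>log_hankel_kernel P x y\<bar> \<le> C * ((1 + \<bar>y\<bar>) ^ degree P * exp (- (1 / 4 * \<bar>x - y\<bar>)))"
    using log_hankel_kernel_bound[of P] by blast
  define p where "p y = (1 + \<bar>y\<bar>) ^ degree P" for y :: real
  have p: "p y > 0" for y by (simp add: p_def add_pos_nonneg)
  have [measurable]: "p \<in> borel_measurable borel" unfolding p_def[abs_def] by measurable
  define e where "e y x = complex_of_real (log_hankel_kernel P x y / p y)" for y x
  have pe: "complex_of_real (p y) * u y * e y x = complex_of_real (log_hankel_kernel P x y) * u y" for x y
    using p[of y] unfolding e_def by simp
  have eb: "norm (e y x) \<le> C" for y x
  proof -
    have "\<bar>log_hankel_kernel P x y\<bar> \<le> C * (p y * 1)"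
      unfolding p_def by (rule order_trans[OF C(2)]) (intro mult_left_mono C(1), auto)
    then show ?thesis using p[of y] unfolding e_def norm_of_real by (simp add: divide_le_eq)
  qed
  have em: "(\<lambda>(y, x). e y x) \<in> borel_measurable (borel \<Otimes>\<^sub>M borel)"
  proof -
    have [measurable]: "(\<lambda>q. log_hankel_kernel P (snd q) (fst q)) \<in> borel_measurable (borel \<Otimes>\<^sub>M borel)"
      using measurable_compose[OF measurable_pair_swap' log_hankel_kernel_measurable[of P]] by (simp add: case_prod_beta)
    show ?thesis unfolding case_prod_beta e_def by measurable
  qed
  have "L2_inner lborel (log_hankel P u) w = (LINT x|lborel. (LINT y|lborel. complex_of_real (p y) * u y * e y x) * cnj (w x))"
    unfolding L2_inner_def log_hankel_def pe ..
  also have "\<dots> = (LINT y|lborel. complex_of_real (p y) * u y * (LINT x|lborel. cnj (w x) * e y x))"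
  proof (rule Fubini_bounded_kernel[OF _ _ em eb])
    show "integrable lborel (\<lambda>y. complex_of_real (p y) * u y)" unfolding p_def by (rule fast_decay_integrable[OF u])
    show "integrable lborel (\<lambda>x. cnj (w x))" using fast_decay_integrable(2)[OF w] by simp
  qed
  also have "\<dots> = (LINT y|lborel. u y * cnj (log_hankel P w y))"
  proof (rule Bochner_Integration.integral_cong[OF refl])
    fix y
    have "(LINT x|lborel. cnj (w x) * e y x) = (LINT x|lborel. complex_of_real (1 / p y) * cnj (complex_of_real (log_hankel_kernel P y x) * w x))"
      unfolding e_def log_hankel_kernel_sym[of P _ y] by (intro Bochner_Integration.integral_cong refl) simp
    also have "\<dots> = complex_of_real (1 / p y) * cnj (log_hankel P w y)"
      unfolding integral_mult_right_zero Bochner_Integration.integral_cnj log_hankel_def ..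
    finally show "complex_of_real (p y) * u y * (LINT x|lborel. cnj (w x) * e y x) = u y * cnj (log_hankel P w y)"
      using p[of y] by simp
  qed
  finally show ?thesis by (simp add: L2_inner_def)
qed

section \<open>Diagonalization on test functions\<close>

text \<open>
  The factorization \<open>H = L\<^sup>* Q(- ln \<lambda>) L\<close> at the level of kernels.
\<close>

lemma log_hankel_kernel_expansion:
  "complex_of_real (log_hankel_kernel P x y) = (\<Sum>k\<le>degree (Q_poly P). coeff (Q_poly P) k *
     (LINT \<zeta>|lborel. complex_of_real (\<zeta> ^ k * laplace_kernel (x - \<zeta>) * laplace_kernel (y - \<zeta>))))"
proof -
  define \<tau> where "\<tau> = ln (exp x + exp y)"
  have e: "exp \<tau> = exp x + exp y" unfolding \<tau>_def by (simp add: add_pos_pos)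
  have "exp ((x + y) / 2 - \<tau>) * gumbel (\<tau> - \<zeta>) = laplace_kernel (x - \<zeta>) * laplace_kernel (y - \<zeta>)" for \<zeta>
  proof -
    have "exp (\<tau> - \<zeta>) = exp (x - \<zeta>) + exp (y - \<zeta>)" using e by (simp add: exp_diff add_divide_distrib)
    then have 1: "exp (- exp (\<tau> - \<zeta>)) = exp (- exp (x - \<zeta>)) * exp (- exp (y - \<zeta>))" by (simp add: exp_add[symmetric])
    have 2: "exp ((x + y) / 2 - \<tau>) * exp (\<tau> - \<zeta>) = exp ((x - \<zeta>) / 2) * exp ((y - \<zeta>) / 2)"
      unfolding exp_add[symmetric] by (simp add: field_simps)
    show ?thesis unfolding gumbel_def laplace_kernel_def 1 using 2 by (metis mult.assoc mult.left_commute)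
  qed
  then have m: "exp ((x + y) / 2 - \<tau>) * log_moment \<tau> k = (LINT \<zeta>|lborel. \<zeta> ^ k * laplace_kernel (x - \<zeta>) * laplace_kernel (y - \<zeta>))" for k
    unfolding log_moment_def integral_mult_right_zero[symmetric] by (simp add: mult.left_commute mult.assoc)
  have "log_hankel_kernel P x y = exp ((x + y) / 2 - \<tau>) * poly P \<tau>"
    unfolding log_hankel_kernel_def exp_diff e by (simp add: \<tau>_def)
  then have "complex_of_real (log_hankel_kernel P x y) = complex_of_real (exp ((x + y) / 2 - \<tau>)) * complex_of_real (poly P \<tau>)" by simp
  also have "\<dots> = (\<Sum>k\<le>degree (Q_poly P). coeff (Q_poly P) k * complex_of_real (exp ((x + y) / 2 - \<tau>) * log_moment \<tau> k))"
    unfolding poly_eq_Q_moments sum_distrib_left by (intro sum.cong refl) (simp add: mult.left_commute)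
  finally show ?thesis unfolding m integral_complex_of_real .
qed

lemma laplace_kernel_Fubini:
  assumes um: "u \<in> borel_measurable borel" and B: "\<And>y. norm (u y) \<le> B"
  shows "integrable lborel (\<lambda>y. (LINT \<zeta>|lborel. complex_of_real (\<zeta> ^ k * laplace_kernel (x - \<zeta>) * laplace_kernel (y - \<zeta>))) * u y)"
    and "(LINT y|lborel. (LINT \<zeta>|lborel. complex_of_real (\<zeta> ^ k * laplace_kernel (x - \<zeta>) * laplace_kernel (y - \<zeta>))) * u y)
      = (LINT \<zeta>|lborel. complex_of_real (\<zeta> ^ k * laplace_kernel (x - \<zeta>)) * (LINT y|lborel. complex_of_real (laplace_kernel (y - \<zeta>)) * u y))"
proof -
  note [measurable] = um
  let ?w = "\<lambda>\<zeta>. complex_of_real (\<zeta> ^ k * laplace_kernel (x - \<zeta>))"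
  have w: "integrable lborel ?w" by (intro integrable_of_real integrable_power_laplace_kernel)
  have b: "integrable lborel (\<lambda>y. complex_of_real (laplace_kernel (y - \<zeta>)))" for \<zeta>
    using lborel_integrable_shift(1)[of "\<lambda>y. complex_of_real (laplace_kernel y)" \<zeta>] laplace_kernel_fourier(2) by simp
  have bu: "integrable lborel (\<lambda>y. complex_of_real (laplace_kernel (y - \<zeta>)) * u y)" for \<zeta>
  proof (rule Bochner_Integration.integrable_bound)
    show "integrable lborel (\<lambda>y. complex_of_real (laplace_kernel (y - \<zeta>)) * complex_of_real B)" by (intro integrable_mult_left b)
    show "AE y in lborel. norm (complex_of_real (laplace_kernel (y - \<zeta>)) * u y) \<le> norm (complex_of_real (laplace_kernel (y - \<zeta>)) * complex_of_real B)"
      using order_trans[OF B abs_ge_self] by (auto simp: norm_mult intro!: mult_left_mono)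
  qed measurable
  define I where "I = (LINT y|lborel. norm (complex_of_real (laplace_kernel y)))"
  have "integrable (lborel \<Otimes>\<^sub>M lborel) (\<lambda>(\<zeta>, y). ?w \<zeta> * (complex_of_real (laplace_kernel (y - \<zeta>)) * u y))"
  proof (rule integrable_pairI)
    show "(\<lambda>(\<zeta>, y). ?w \<zeta> * (complex_of_real (laplace_kernel (y - \<zeta>)) * u y)) \<in> borel_measurable (borel \<Otimes>\<^sub>M borel)"
      by measurable
    show "integrable lborel (\<lambda>y. ?w \<zeta> * (complex_of_real (laplace_kernel (y - \<zeta>)) * u y))" for \<zeta>
      by (intro integrable_mult_right bu)
    show "integrable lborel (\<lambda>\<zeta>. norm (?w \<zeta>) * (\<bar>B\<bar> * I))" by (intro integrable_mult_left integrable_norm w)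
    fix \<zeta>
    have "(LINT y|lborel. norm (?w \<zeta> * (complex_of_real (laplace_kernel (y - \<zeta>)) * u y))) \<le> (LINT y|lborel. norm (?w \<zeta>) * (\<bar>B\<bar> * norm (complex_of_real (laplace_kernel (y - \<zeta>)))))"
    proof (intro integral_mono integrable_norm integrable_mult_right bu b)
      fix y
      have "norm (complex_of_real (laplace_kernel (y - \<zeta>))) * norm (u y) \<le> norm (complex_of_real (laplace_kernel (y - \<zeta>))) * \<bar>B\<bar>"
        using order_trans[OF B abs_ge_self] by (intro mult_left_mono) auto
      then have "norm (?w \<zeta>) * (norm (complex_of_real (laplace_kernel (y - \<zeta>))) * norm (u y)) \<le> norm (?w \<zeta>) * (\<bar>B\<bar> * norm (complex_of_real (laplace_kernel (y - \<zeta>))))"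
        by (intro mult_left_mono) (simp_all add: mult.commute)
      then show "norm (?w \<zeta> * (complex_of_real (laplace_kernel (y - \<zeta>)) * u y)) \<le> norm (?w \<zeta>) * (\<bar>B\<bar> * norm (complex_of_real (laplace_kernel (y - \<zeta>))))"
        by (simp only: norm_mult[of "?w \<zeta>"] norm_mult[of "complex_of_real (laplace_kernel (y - \<zeta>))"])
    qed
    also have "\<dots> = norm (?w \<zeta>) * (\<bar>B\<bar> * I)"
      unfolding integral_mult_right_zero I_def using lborel_integral_shift(1)[of "\<lambda>y. norm (complex_of_real (laplace_kernel y))" \<zeta>] by simp
    finally show "(LINT y|lborel. norm (?w \<zeta> * (complex_of_real (laplace_kernel (y - \<zeta>)) * u y))) \<le> norm (?w \<zeta>) * (\<bar>B\<bar> * I)" .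
  qed
  note pair = this
  have e: "(LINT \<zeta>|lborel. ?w \<zeta> * (complex_of_real (laplace_kernel (y - \<zeta>)) * u y)) = (LINT \<zeta>|lborel. complex_of_real (\<zeta> ^ k * laplace_kernel (x - \<zeta>) * laplace_kernel (y - \<zeta>))) * u y" for y
    by (subst integral_mult_left_zero[symmetric]) (simp add: mult.assoc)
  show "integrable lborel (\<lambda>y. (LINT \<zeta>|lborel. complex_of_real (\<zeta> ^ k * laplace_kernel (x - \<zeta>) * laplace_kernel (y - \<zeta>))) * u y)"
    using lborel_pair.integrable_snd[OF pair] unfolding e .
  show "(LINT y|lborel. (LINT \<zeta>|lborel. complex_of_real (\<zeta> ^ k * laplace_kernel (x - \<zeta>) * laplace_kernel (y - \<zeta>))) * u y)
      = (LINT \<zeta>|lborel. complex_of_real (\<zeta> ^ k * laplace_kernel (x - \<zeta>)) * (LINT y|lborel. complex_of_real (laplace_kernel (y - \<zeta>)) * u y))"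
    using lborel_pair.Fubini_integral[OF pair] unfolding e integral_mult_right_zero .
qed

text \<open>
  The operator \<open>F\<^sup>*\<close> on nice functions, before the substitution \<open>x = ln t\<close> is undone.
\<close>

definition phase_inv_fourier :: "(real \<Rightarrow> complex) \<Rightarrow> real \<Rightarrow> complex" where
  "phase_inv_fourier \<phi> = inv_fourier (\<lambda>\<xi>. cnj (gamma_phase \<xi>) * \<phi> \<xi>)"

lemma phase_test: "\<phi> \<in> test_functions \<Longrightarrow> (\<lambda>\<xi>. cnj (gamma_phase \<xi>) * \<phi> \<xi>) \<in> test_functions"
  by (intro test_mult smooth_cnj smooth_gamma_phase)

text \<open>
  The three factors of \<open>L\<^sup>* Q(- ln \<lambda>) L\<close> act one after the other on the inverse Fourier transform of
  the conjugate phase times \<open>\<phi>\<close>: the first multiplies by \<open>\<Gamma>(1/2 + i\<xi>)\<close>, which leaves \<open>v \<phi>\<close>; the second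
  applies \<open>Q(D)\<close>; the third multiplies by the conjugate of \<open>\<Gamma>(1/2 + i\<xi>)\<close>, which brings back \<open>v\<close> and the
  conjugate phase.
\<close>

lemma log_hankel_diagonal:
  assumes \<phi>: "\<phi> \<in> test_functions"
  shows "log_hankel P (phase_inv_fourier \<phi>) x = phase_inv_fourier (weighted_operator (Q_poly P) \<phi>) x"
proof -
  let ?Q = "Q_poly P"
  define c where "c \<xi> = cnj (gamma_phase \<xi>) * \<phi> \<xi>" for \<xi>
  have c: "c \<in> test_functions" unfolding c_def[abs_def] by (rule phase_test[OF \<phi>])
  define \<eta> where "\<eta> \<xi> = v_weight \<xi> * \<phi> \<xi>" for \<xi>
  have \<eta>: "\<eta> \<in> test_functions" unfolding \<eta>_def[abs_def] by (intro test_mult \<phi> smooth_v_weight)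
  have um: "inv_fourier c \<in> borel_measurable borel" using test_borel[OF c] by measurable
  note F = laplace_kernel_Fubini[OF um norm_inv_fourier_le]
  have "(\<lambda>\<xi>. Gamma (1/2 + \<i> * complex_of_real \<xi>) * c \<xi>) = \<eta>"
    unfolding Gamma_half_line c_def \<eta>_def by (simp add: mult.assoc)
  then have b: "(LINT y|lborel. complex_of_real (laplace_kernel (y - \<zeta>)) * inv_fourier c y) = inv_fourier \<eta> \<zeta>" for \<zeta>
    using laplace_kernel_inv_fourier(1)[OF test_L2_integrable(1)[OF c]] by simp
  have i: "integrable lborel (\<lambda>\<zeta>. complex_of_real (\<zeta> ^ k * laplace_kernel (x - \<zeta>)) * inv_fourier \<eta> \<zeta>)" for k
  proof (rule Bochner_Integration.integrable_bound)
    let ?B = "(2 * pi) powr (-1/2) * (LINT x|lborel. norm (\<eta> x))"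
    show "integrable lborel (\<lambda>\<zeta>. complex_of_real (\<zeta> ^ k * laplace_kernel (x - \<zeta>)) * complex_of_real ?B)"
      by (intro integrable_mult_left integrable_of_real integrable_power_laplace_kernel)
    show "AE \<zeta> in lborel. norm (complex_of_real (\<zeta> ^ k * laplace_kernel (x - \<zeta>)) * inv_fourier \<eta> \<zeta>) \<le> norm (complex_of_real (\<zeta> ^ k * laplace_kernel (x - \<zeta>)) * complex_of_real ?B)"
      unfolding norm_mult[of _ "inv_fourier \<eta> _"] norm_mult[of _ "complex_of_real ?B"] norm_of_real[of ?B]
      by (intro AE_I2 mult_left_mono order_trans[OF norm_inv_fourier_le abs_ge_self]) simp
  qed (use test_borel[OF \<eta>] in measurable)
  have "log_hankel P (inv_fourier c) x = (LINT y|lborel. (\<Sum>k\<le>degree ?Q. coeff ?Q k *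
      ((LINT \<zeta>|lborel. complex_of_real (\<zeta> ^ k * laplace_kernel (x - \<zeta>) * laplace_kernel (y - \<zeta>))) * inv_fourier c y)))"
    unfolding log_hankel_def log_hankel_kernel_expansion by (simp add: sum_distrib_right mult.assoc)
  also have "\<dots> = (\<Sum>k\<le>degree ?Q. (LINT y|lborel. coeff ?Q k *
      ((LINT \<zeta>|lborel. complex_of_real (\<zeta> ^ k * laplace_kernel (x - \<zeta>) * laplace_kernel (y - \<zeta>))) * inv_fourier c y)))"
    by (intro Bochner_Integration.integral_sum integrable_mult_right F(1))
  also have "\<dots> = (\<Sum>k\<le>degree ?Q. (LINT \<zeta>|lborel. coeff ?Q k * (complex_of_real (\<zeta> ^ k * laplace_kernel (x - \<zeta>)) * inv_fourier \<eta> \<zeta>)))"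
    unfolding integral_mult_right_zero F(2) b ..
  also have "\<dots> = (LINT \<zeta>|lborel. (\<Sum>k\<le>degree ?Q. coeff ?Q k * (complex_of_real (\<zeta> ^ k * laplace_kernel (x - \<zeta>)) * inv_fourier \<eta> \<zeta>)))"
    by (intro Bochner_Integration.integral_sum[symmetric] integrable_mult_right i)
  also have "\<dots> = (LINT \<zeta>|lborel. complex_of_real (laplace_kernel (x - \<zeta>)) * inv_fourier (poly_deriv ?Q \<i> \<eta>) \<zeta>)"
    unfolding inv_fourier_poly_deriv[OF \<eta>, symmetric] sum_distrib_left sum_distrib_right
    by (intro Bochner_Integration.integral_cong sum.cong refl) (simp add: mult_ac)
  also have "\<dots> = inv_fourier (\<lambda>\<xi>. cnj (Gamma (1/2 + \<i> * complex_of_real \<xi>)) * poly_deriv ?Q \<i> \<eta> \<xi>) x"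
    by (intro laplace_kernel_inv_fourier(2) test_L2_integrable test_poly_deriv \<eta>)
  also have "(\<lambda>\<xi>. cnj (Gamma (1/2 + \<i> * complex_of_real \<xi>)) * poly_deriv ?Q \<i> \<eta> \<xi>) = (\<lambda>\<xi>. cnj (gamma_phase \<xi>) * weighted_operator ?Q \<phi> \<xi>)"
    unfolding Gamma_half_line weighted_operator_def \<eta>_def[abs_def] by (simp add: mult_ac)
  finally show ?thesis unfolding phase_inv_fourier_def c_def[abs_def] .
qed

text \<open>
  Every power of \<open>x\<close> times the inverse transform of a test function is bounded, since it is again such
  an inverse transform.
\<close>

lemma phase_inv_fourier_fast_decay:
  assumes \<phi>: "\<phi> \<in> test_functions" shows "fast_decay K (phase_inv_fourier \<phi>)"
proof -
  define c where "c \<xi> = cnj (gamma_phase \<xi>) * \<phi> \<xi>" for \<xi>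
  have c: "c \<in> test_functions" unfolding c_def[abs_def] by (rule phase_test[OF \<phi>])
  have eq: "phase_inv_fourier \<phi> = inv_fourier c" unfolding phase_inv_fourier_def c_def[abs_def] ..
  \<comment> \<open>the smallest natural number above \<open>K + 1\<close>\<close>
  let ?n = "K + 2"
  define B0 where "B0 = (2 * pi) powr (-1/2) * (LINT x|lborel. norm (c x))"
  define B1 where "B1 = (2 * pi) powr (-1/2) * (LINT x|lborel. norm (\<i> ^ ?n * (vderiv ^^ ?n) c x))"
  have b0: "norm (inv_fourier c x) \<le> B0" for x unfolding B0_def by (rule norm_inv_fourier_le)
  have b1: "\<bar>x\<bar> ^ ?n * norm (inv_fourier c x) \<le> B1" for x
    using norm_inv_fourier_le[of "\<lambda>\<xi>. \<i> ^ ?n * (vderiv ^^ ?n) c \<xi>" x]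
    unfolding inv_fourier_power[OF c, symmetric] B1_def by (simp only: norm_mult norm_power norm_of_real)
  have "norm (inv_fourier c x) \<le> 2 ^ ?n * (B0 + B1) * (1 + \<bar>x\<bar>) powr (- real ?n)" for x
  proof -
    have "(1 + \<bar>x\<bar>) ^ ?n \<le> (2 * max 1 \<bar>x\<bar>) ^ ?n" by (intro power_mono) auto
    also have "\<dots> = 2 ^ ?n * (max 1 \<bar>x\<bar>) ^ ?n" by (rule power_mult_distrib)
    also have "(max 1 \<bar>x\<bar>) ^ ?n \<le> 1 + \<bar>x\<bar> ^ ?n" by (simp add: max_def)
    finally have "(1 + \<bar>x\<bar>) ^ ?n \<le> 2 ^ ?n * (1 + \<bar>x\<bar> ^ ?n)" by simp
    then have "(1 + \<bar>x\<bar>) ^ ?n * norm (inv_fourier c x) \<le> 2 ^ ?n * (1 + \<bar>x\<bar> ^ ?n) * norm (inv_fourier c x)"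
      by (rule mult_right_mono) simp
    also have "\<dots> = 2 ^ ?n * (norm (inv_fourier c x) + \<bar>x\<bar> ^ ?n * norm (inv_fourier c x))" by (simp add: algebra_simps)
    also have "\<dots> \<le> 2 ^ ?n * (B0 + B1)" by (intro mult_left_mono add_mono b0 b1) simp
    finally have le: "(1 + \<bar>x\<bar>) ^ ?n * norm (inv_fourier c x) \<le> 2 ^ ?n * (B0 + B1)" .
    have pos: "(1 + \<bar>x\<bar>) ^ ?n > 0" by (intro zero_less_power) simp
    have pw: "(1 + \<bar>x\<bar>) powr (- real ?n) = 1 / (1 + \<bar>x\<bar>) ^ ?n"
      by (subst powr_minus_divide, subst powr_realpow) simp_all
    have "norm (inv_fourier c x) \<le> 2 ^ ?n * (B0 + B1) / (1 + \<bar>x\<bar>) ^ ?n"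
      using le pos by (subst pos_le_divide_eq) (auto simp: mult.commute)
    then show ?thesis unfolding pw by simp
  qed
  then show ?thesis unfolding fast_decay_def eq
    using test_borel[OF c] by (intro conjI exI[of _ "2 ^ ?n * (B0 + B1)"] exI[of _ "real ?n"]) auto
qed

lemma F_op_phase_inv_fourier:
  assumes "\<phi> \<in> test_functions" shows "(inv_log_substitution (phase_inv_fourier \<phi>), \<phi>) \<in> F_op"
  unfolding phase_inv_fourier_def by (intro F_op_inv_fourier test_L2_integrable assms)

section \<open>Closures and adjoints\<close>

lemma L2_closure_superset:
  assumes "T \<subseteq> L2 M \<times> L2 N" shows "T \<subseteq> L2_closure M N T"
proof
  fix p assume p: "p \<in> T"
  then have "fst p \<in> L2 M" "snd p \<in> L2 N" using assms by auto
  then show "p \<in> L2_closure M N T" using p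
    unfolding L2_closure_def
    by (auto simp: case_prod_beta intro!: exI[of _ "\<lambda>_. fst p"] exI[of _ "\<lambda>_. snd p"] L2_tendsto_const)
qed

text \<open>
  The defining identity of the adjoint is preserved under limits in the graph.
\<close>

lemma L2_adjoint_closure: 
  assumes "T \<subseteq> L2 M \<times> L2 N" shows "L2_adjoint M N (L2_closure M N T) = L2_adjoint M N T"
proof
  show "L2_adjoint M N (L2_closure M N T) \<subseteq> L2_adjoint M N T"
    using L2_closure_superset[OF assms] unfolding L2_adjoint_def by fast
  show "L2_adjoint M N T \<subseteq> L2_adjoint M N (L2_closure M N T)"
  proof
    fix p assume p: "p \<in> L2_adjoint M N T"
    obtain g f where gf: "p = (g, f)" by (cases p)
    have g: "g \<in> L2 N" and f: "f \<in> L2 M" and adj: "\<And>u w. (u, w) \<in> T \<Longrightarrow> L2_inner N w g = L2_inner M u f"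
      using p unfolding gf L2_adjoint_def by auto
    have "L2_inner N w g = L2_inner M u f" if uw: "(u, w) \<in> L2_closure M N T" for u w
    proof -
      obtain us ws where T: "\<And>n. (us n, ws n) \<in> T" and u: "L2_tendsto M us u" and w: "L2_tendsto N ws w"
        using uw by (auto simp: L2_closure_def)
      have "(\<lambda>n. L2_inner N (ws n) g) \<longlonglongrightarrow> L2_inner M u f"
        unfolding adj[OF T] by (rule L2_tendsto_inner_left[OF u f])
      with L2_tendsto_inner_left[OF w g] show ?thesis by (rule LIMSEQ_unique)
    qed
    then show "p \<in> L2_adjoint M N (L2_closure M N T)" unfolding gf L2_adjoint_def using g f by auto
  qed
qed

lemma L2_operatorD:
  assumes "L2_operator M N T"
  shows "T \<subseteq> L2 M \<times> L2 N" "(\<lambda>_. 0, \<lambda>_. 0) \<in> T"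
    "(f, g) \<in> T \<Longrightarrow> (f', g') \<in> T \<Longrightarrow> (\<lambda>x. f x + f' x, \<lambda>y. g y + g' y) \<in> T"
    "(f, g) \<in> T \<Longrightarrow> (\<lambda>x. c * f x, \<lambda>y. c * g y) \<in> T"
proof -
  note D = assms[unfolded L2_operator_def]
  show "T \<subseteq> L2 M \<times> L2 N" "(\<lambda>_. 0, \<lambda>_. 0) \<in> T"
    using conjunct1[OF D] conjunct1[OF conjunct2[OF D]] by auto
  show "(f, g) \<in> T \<Longrightarrow> (f', g') \<in> T \<Longrightarrow> (\<lambda>x. f x + f' x, \<lambda>y. g y + g' y) \<in> T"
    by (rule conjunct1[OF conjunct2[OF conjunct2[OF D]], rule_format]) (rule conjI)
  show "(f, g) \<in> T \<Longrightarrow> (\<lambda>x. c * f x, \<lambda>y. c * g y) \<in> T"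
    by (rule conjunct1[OF conjunct2[OF conjunct2[OF conjunct2[OF D]]], rule_format])
qed

lemma symmetric_closure_subset_adjoint:
  assumes "symmetric_operator M T" shows "L2_closure M M T \<subseteq> L2_adjoint M M T"
proof
  note D = assms[unfolded symmetric_operator_def]
  note T = L2_operatorD(1)[OF conjunct1[OF D]]
  have sym: "L2_inner M g u = L2_inner M f w" if "(f, g) \<in> T" "(u, w) \<in> T" for f g u w
    using bspec[OF conjunct2[OF conjunct2[OF D]] that(1)] that(2) by auto
  fix p assume "p \<in> L2_closure M M T"
  then obtain f g fs gs where p: "p = (f, g)" and t: "\<And>n. (fs n, gs n) \<in> T"
    and f: "L2_tendsto M fs f" and g: "L2_tendsto M gs g"
    by (auto simp: L2_closure_def)
  have "L2_inner M w f = L2_inner M u g" if uw: "(u, w) \<in> T" for u w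
  proof -
    have "u \<in> L2 M" "w \<in> L2 M" using T uw by auto
    then have "(\<lambda>n. L2_inner M w (fs n)) \<longlonglongrightarrow> L2_inner M w f" "(\<lambda>n. L2_inner M u (gs n)) \<longlonglongrightarrow> L2_inner M u g"
      by (auto intro!: L2_tendsto_inner_right f g)
    moreover have "L2_inner M w (fs n) = L2_inner M u (gs n)" for n by (rule sym[OF uw t])
    ultimately show ?thesis using LIMSEQ_unique by simp
  qed
  then show "p \<in> L2_adjoint M M T" unfolding p L2_adjoint_def using L2_tendstoD(2)[OF f] L2_tendstoD(2)[OF g] by auto
qed

text \<open>
  A symmetric operator has its closure contained in its adjoint.  If these two coincide, then the
  closure equals its own adjoint, since an operator and its closure have the same adjoint.  Density
  of the domain makes the closure single-valued.
\<close>

lemma self_adjoint_closure: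
  assumes sym: "symmetric_operator M T" and adj: "L2_adjoint M M T \<subseteq> L2_closure M M T"
  shows "self_adjoint M (L2_closure M M T)"
proof -
  note D = sym[unfolded symmetric_operator_def]
  note dense = conjunct1[OF conjunct2[OF D]]
  note op = L2_operatorD[OF conjunct1[OF D]]
  note T = op(1) and zero = op(2) and add = op(3) and cmult = op(4)
  let ?C = "L2_closure M M T"
  have eq: "?C = L2_adjoint M M T" using symmetric_closure_subset_adjoint[OF sym] adj by blast
  have sub: "?C \<subseteq> L2 M \<times> L2 M" unfolding eq L2_adjoint_def by auto
  note sup = L2_closure_superset[OF T]
  have "L2_operator M M ?C"
    unfolding L2_operator_def
  proof (intro conjI allI impI; (elim conjE)?)
    show "?C \<subseteq> L2 M \<times> L2 M" by (rule sub)
    show "(\<lambda>_. 0, \<lambda>_. 0) \<in> ?C" using zero sup by auto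
  next
    fix f g f' g' assume "(f, g) \<in> ?C" "(f', g') \<in> ?C"
    then obtain fs gs fs' gs' where t: "\<And>n. (fs n, gs n) \<in> T" "\<And>n. (fs' n, gs' n) \<in> T"
      and l: "L2_tendsto M fs f" "L2_tendsto M gs g" "L2_tendsto M fs' f'" "L2_tendsto M gs' g'"
      by (auto simp: L2_closure_def)
    have "\<And>n. ((\<lambda>n x. fs n x + fs' n x) n, (\<lambda>n x. gs n x + gs' n x) n) \<in> T" using add[OF t] by simp
    then show "(\<lambda>x. f x + f' x, \<lambda>y. g y + g' y) \<in> ?C"
      unfolding L2_closure_def mem_Collect_eq prod.case using L2_tendsto_add[OF l(1,3)] L2_tendsto_add[OF l(2,4)]
      by (intro exI[of _ "\<lambda>n x. fs n x + fs' n x"] exI[of _ "\<lambda>n x. gs n x + gs' n x"]) auto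
  next
    fix f g c assume "(f, g) \<in> ?C"
    then obtain fs gs where t: "\<And>n. (fs n, gs n) \<in> T"
      and l: "L2_tendsto M fs f" "L2_tendsto M gs g"
      by (auto simp: L2_closure_def)
    have "\<And>n. ((\<lambda>n x. c * fs n x) n, (\<lambda>n x. c * gs n x) n) \<in> T" using cmult[OF t] by simp
    then show "(\<lambda>x. c * f x, \<lambda>y. c * g y) \<in> ?C"
      unfolding L2_closure_def mem_Collect_eq prod.case using L2_tendsto_cmult[OF l(1)] L2_tendsto_cmult[OF l(2)]
      by (intro exI[of _ "\<lambda>n x. c * fs n x"] exI[of _ "\<lambda>n x. c * gs n x"]) auto
  next
    fix f g f' g' assume fg: "(f, g) \<in> ?C" and f': "f' \<in> L2 M" "AE x in M. f' x = f x" and g': "g' \<in> L2 M" "AE y in M. g' y = g y"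
    then have fgL: "f \<in> L2 M" "g \<in> L2 M" and a: "\<And>u w. (u, w) \<in> T \<Longrightarrow> L2_inner M w f = L2_inner M u g"
      unfolding eq L2_adjoint_def by auto
    have "L2_inner M w f' = L2_inner M u g'" if uw: "(u, w) \<in> T" for u w
    proof -
      have [measurable]: "u \<in> borel_measurable M" "w \<in> borel_measurable M" using uw T by (auto dest: L2_measurable)
      have "L2_inner M w f' = L2_inner M w f" "L2_inner M u g' = L2_inner M u g"
        by (rule L2_inner_cong_AE; use f' g' fgL in \<open>auto dest: L2_measurable\<close>)+
      then show ?thesis using a[OF uw] by simp
    qed
    then show "(f', g') \<in> ?C" unfolding eq L2_adjoint_def using f' g' by auto
  next
    fix f g g' assume "(f, g) \<in> ?C" "(f, g') \<in> ?C"
    then have L: "g \<in> L2 M" "g' \<in> L2 M" and a: "\<And>u w. (u, w) \<in> T \<Longrightarrow> L2_inner M w f = L2_inner M u g"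
        "\<And>u w. (u, w) \<in> T \<Longrightarrow> L2_inner M w f = L2_inner M u g'"
      unfolding eq L2_adjoint_def by auto
    show "AE y in M. g y = g' y"
    proof (rule L2_inner_nondegenerate[OF L])
      fix u assume "u \<in> L2 M"
      then obtain us where us: "\<And>n. us n \<in> Domain T" "L2_tendsto M us u"
        using dense unfolding L2_dense_def by blast
      have "L2_inner M (us n) g = L2_inner M (us n) g'" for n using us(1)[of n] a by (metis Domain.cases)
      then show "L2_inner M u g = L2_inner M u g'"
        using L2_tendsto_inner_left[OF us(2) L(1)] L2_tendsto_inner_left[OF us(2) L(2)] LIMSEQ_unique by simp
    qed
  qed
  moreover have "L2_dense M (Domain ?C)"
  proof -
    have "Domain T \<subseteq> Domain ?C" using sup by auto
    moreover have "Domain ?C \<subseteq> L2 M" using sub by auto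
    ultimately show ?thesis using dense unfolding L2_dense_def by blast
  qed
  moreover have "L2_adjoint M M ?C = ?C" by (rule trans[OF L2_adjoint_closure[OF T] eq[symmetric]])
  ultimately show ?thesis unfolding self_adjoint_def by blast
qed

section \<open>The minimal Hankel operator\<close>

lemma D_zero_iff: "f \<in> D_zero K \<longleftrightarrow> f \<in> L2 lborel_pos \<and> fast_decay K (log_substitution f)"
proof -
  have AE_iff: "(AE t in lborel_pos. norm (f t) \<le> C * t powr (-1/2) * (1 + \<bar>ln t\<bar>) powr (- n))
    \<longleftrightarrow> (AE x in lborel. norm (log_substitution f x) \<le> C * (1 + \<bar>x\<bar>) powr (- n))" for C n
  proof -
    have eq: "norm (f (exp x)) \<le> C * exp x powr (-1/2) * (1 + \<bar>ln (exp x)\<bar>) powr (- n)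
      \<longleftrightarrow> norm (log_substitution f x) \<le> C * (1 + \<bar>x\<bar>) powr (- n)" for x
    proof -
      have e: "exp x powr (-1/2) = exp (- (x / 2))" by (simp add: exp_powr_real)
      have "norm (f (exp x)) \<le> C * exp x powr (-1/2) * (1 + \<bar>ln (exp x)\<bar>) powr (- n)
        \<longleftrightarrow> norm (f (exp x)) \<le> C * (1 + \<bar>x\<bar>) powr (- n) * exp (- (x / 2))"
      proof -
        have "a * b * c = a * c * b" for a b c :: real by simp
        then show ?thesis unfolding e ln_exp by metis
      qed
      also have "\<dots> \<longleftrightarrow> exp (x / 2) * norm (f (exp x)) \<le> exp (x / 2) * (C * (1 + \<bar>x\<bar>) powr (- n) * exp (- (x / 2)))"
        by (simp only: mult_le_cancel_left_pos[OF exp_gt_zero])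
      also have "exp (x / 2) * (C * (1 + \<bar>x\<bar>) powr (- n) * exp (- (x / 2))) = C * (1 + \<bar>x\<bar>) powr (- n)"
        by (simp add: exp_minus)
      also have "exp (x / 2) * norm (f (exp x)) = norm (log_substitution f x)"
        unfolding log_substitution_def norm_mult norm_of_real by simp
      finally show ?thesis .
    qed
    show ?thesis
    proof
      assume "AE t in lborel_pos. norm (f t) \<le> C * t powr (-1/2) * (1 + \<bar>ln t\<bar>) powr (- n)"
      from AE_lborel_posD[OF this] show "AE x in lborel. norm (log_substitution f x) \<le> C * (1 + \<bar>x\<bar>) powr (- n)"
        unfolding eq .
    next
      assume "AE x in lborel. norm (log_substitution f x) \<le> C * (1 + \<bar>x\<bar>) powr (- n)"
      then show "AE t in lborel_pos. norm (f t) \<le> C * t powr (-1/2) * (1 + \<bar>ln t\<bar>) powr (- n)"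
        by (intro AE_lborel_posI) (simp only: eq)
    qed
  qed
  show ?thesis unfolding D_zero_def fast_decay_def mem_Collect_eq AE_iff
    using log_substitution_borel[OF L2_measurable] by blast
qed

lemma fast_decay_add:
  assumes "fast_decay K u" "fast_decay K w" shows "fast_decay K (\<lambda>x. u x + c * w x)"
proof -
  obtain C n where n: "n > real K + 1" and u: "AE x in lborel. norm (u x) \<le> C * (1 + \<bar>x\<bar>) powr (- n)" "u \<in> borel_measurable borel"
    using assms(1) by (auto simp: fast_decay_def)
  obtain C' n' where n': "n' > real K + 1" and w: "AE x in lborel. norm (w x) \<le> C' * (1 + \<bar>x\<bar>) powr (- n')" "w \<in> borel_measurable borel"
    using assms(2) by (auto simp: fast_decay_def)
  let ?n = "min n n'"
  have "AE x in lborel. norm (u x + c * w x) \<le> (\<bar>C\<bar> + norm c * \<bar>C'\<bar>) * (1 + \<bar>x\<bar>) powr (- ?n)"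
    using u(1) w(1)
  proof eventually_elim
    case (elim x)
    have p: "(1 + \<bar>x\<bar>) powr (- n) \<le> (1 + \<bar>x\<bar>) powr (- ?n)" "(1 + \<bar>x\<bar>) powr (- n') \<le> (1 + \<bar>x\<bar>) powr (- ?n)"
      by (intro powr_mono; simp)+
    have "C * (1 + \<bar>x\<bar>) powr (- n) \<le> \<bar>C\<bar> * (1 + \<bar>x\<bar>) powr (- ?n)" by (intro mult_mono p) auto
    then have 1: "norm (u x) \<le> \<bar>C\<bar> * (1 + \<bar>x\<bar>) powr (- ?n)" using elim by linarith
    have "C' * (1 + \<bar>x\<bar>) powr (- n') \<le> \<bar>C'\<bar> * (1 + \<bar>x\<bar>) powr (- ?n)" by (intro mult_mono p) auto
    then have "norm (w x) \<le> \<bar>C'\<bar> * (1 + \<bar>x\<bar>) powr (- ?n)" using elim by linarith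
    then have 2: "norm (c * w x) \<le> norm c * (\<bar>C'\<bar> * (1 + \<bar>x\<bar>) powr (- ?n))" unfolding norm_mult by (rule mult_left_mono) simp
    have "norm (u x + c * w x) \<le> norm (u x) + norm (c * w x)" by (rule norm_triangle_ineq)
    then show ?case using 1 2 by (simp add: distrib_right mult.assoc)
  qed
  moreover have "?n > real K + 1" using n n' by simp
  ultimately show ?thesis using u(2) w(2) unfolding fast_decay_def
    by (intro conjI exI[of _ "\<bar>C\<bar> + norm c * \<bar>C'\<bar>"] exI[of _ ?n]) auto
qed

lemma log_hankel_add:
  assumes "fast_decay (degree P) u" "fast_decay (degree P) w"
  shows "log_hankel P (\<lambda>x. u x + c * w x) x = log_hankel P u x + c * log_hankel P w x"
proof -
  have "log_hankel P (\<lambda>x. u x + c * w x) x = (LINT y|lborel. complex_of_real (log_hankel_kernel P x y) * u y + c * (complex_of_real (log_hankel_kernel P x y) * w y))"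
    unfolding log_hankel_def by (intro Bochner_Integration.integral_cong refl) (simp add: algebra_simps)
  then show ?thesis unfolding log_hankel_def using log_hankel_integrable[OF assms(1)] log_hankel_integrable[OF assms(2)] by simp
qed

locale log_kernel_hankel =
  fixes P :: "real poly" and h :: "real \<Rightarrow> real"
  assumes h: "\<And>t. t > 0 \<Longrightarrow> h t = poly P (ln t) / t"
begin

abbreviation "H_min \<equiv> L2_restrict (hankel_operator h) (D_zero (degree P))"

lemma has_bochner_integral_hankel_iff:
  assumes f: "f \<in> borel_measurable lborel_pos"
  shows "has_bochner_integral lborel_pos (\<lambda>s. complex_of_real (h (exp x + s)) * f s) z
    \<longleftrightarrow> has_bochner_integral lborel (\<lambda>y. complex_of_real (log_hankel_kernel P x y) * log_substitution f y) (complex_of_real (exp (x / 2)) * z)"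
proof -
  have m: "(\<lambda>s. complex_of_real (h (exp x + s)) * f s) \<in> borel_measurable lborel_pos"
  proof -
    have [measurable]: "poly P \<in> borel_measurable borel"
      by (intro borel_measurable_continuous_onI continuous_intros)
    have "(\<lambda>s. complex_of_real (poly P (ln (exp x + s)) / (exp x + s))) \<in> borel_measurable lborel_pos"
      by (intro measurable_restrict_space1) measurable
    then have "(\<lambda>s. complex_of_real (poly P (ln (exp x + s)) / (exp x + s)) * f s) \<in> borel_measurable lborel_pos"
      using f by (rule borel_measurable_times)
    moreover have "(\<lambda>s. complex_of_real (h (exp x + s)) * f s) \<in> borel_measurable lborel_pos
      \<longleftrightarrow> (\<lambda>s. complex_of_real (poly P (ln (exp x + s)) / (exp x + s)) * f s) \<in> borel_measurable lborel_pos"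
      by (rule measurable_cong) (subst h, auto simp: space_restrict_space add_pos_pos)
    ultimately show ?thesis by blast
  qed
  have eq: "complex_of_real (exp (x / 2)) * (exp y *\<^sub>R (complex_of_real (h (exp x + exp y)) * f (exp y)))
    = complex_of_real (log_hankel_kernel P x y) * log_substitution f y" for y
  proof -
    have "exp (x / 2) * exp y = exp ((x + y) / 2) * exp (y / 2)"
      unfolding exp_add[symmetric] by (simp add: field_simps)
    then have "exp (x / 2) * exp y * h (exp x + exp y) = log_hankel_kernel P x y * exp (y / 2)"
      unfolding log_hankel_kernel_def by (simp add: h add_pos_pos)
    then have "complex_of_real (exp (x / 2)) * complex_of_real (exp y) * complex_of_real (h (exp x + exp y)) = complex_of_real (log_hankel_kernel P x y) * complex_of_real (exp (y / 2))"
      by (metis of_real_mult)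
    then show ?thesis unfolding log_substitution_def scaleR_conv_of_real
      by (metis mult.assoc)
  qed
  have "has_bochner_integral lborel_pos (\<lambda>s. complex_of_real (h (exp x + s)) * f s) z
    \<longleftrightarrow> has_bochner_integral lborel (\<lambda>y. exp y *\<^sub>R (complex_of_real (h (exp x + exp y)) * f (exp y))) z"
    unfolding has_bochner_integral_iff integrable_lborel_pos_iff[OF m] integral_lborel_pos[OF m] ..
  also have "\<dots> \<longleftrightarrow> has_bochner_integral lborel (\<lambda>y. complex_of_real (exp (x / 2)) * (exp y *\<^sub>R (complex_of_real (h (exp x + exp y)) * f (exp y)))) (complex_of_real (exp (x / 2)) * z)"
  proof -
    have scale: "has_bochner_integral lborel F z \<longleftrightarrow> has_bochner_integral lborel (\<lambda>y. c * F y) (c * z)"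
      if "c \<noteq> 0" for c and F :: "real \<Rightarrow> complex"
    proof
      assume "has_bochner_integral lborel F z"
      then show "has_bochner_integral lborel (\<lambda>y. c * F y) (c * z)" by (rule has_bochner_integral_mult_right)
    next
      assume "has_bochner_integral lborel (\<lambda>y. c * F y) (c * z)"
      then have "has_bochner_integral lborel (\<lambda>y. 1 / c * (c * F y)) (1 / c * (c * z))" by (rule has_bochner_integral_mult_right)
      then show "has_bochner_integral lborel F z" using that by simp
    qed
    show ?thesis by (rule scale) simp
  qed
  finally show ?thesis unfolding eq .
qed

lemma H_min_iff:
  "(f, g) \<in> H_min \<longleftrightarrow> f \<in> L2 lborel_pos \<and> g \<in> L2 lborel_pos \<and> fast_decay (degree P) (log_substitution f)
     \<and> (AE x in lborel. log_substitution g x = log_hankel P (log_substitution f) x)"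
proof -
  have "(AE t in lborel_pos. has_bochner_integral lborel_pos (\<lambda>s. complex_of_real (h (t + s)) * f s) (g t))
    \<longleftrightarrow> (AE x in lborel. log_substitution g x = log_hankel P (log_substitution f) x)"
    if f: "f \<in> L2 lborel_pos" and d: "fast_decay (degree P) (log_substitution f)"
  proof -
    have eq: "has_bochner_integral lborel_pos (\<lambda>s. complex_of_real (h (exp x + s)) * f s) (g (exp x))
      \<longleftrightarrow> log_substitution g x = log_hankel P (log_substitution f) x" for x
      unfolding has_bochner_integral_hankel_iff[OF L2_measurable[OF f]]
      unfolding has_bochner_integral_iff
      using log_hankel_integrable[OF d, of x] by (auto simp: log_hankel_def log_substitution_def[of g])
    show ?thesis
    proof
      assume "AE t in lborel_pos. has_bochner_integral lborel_pos (\<lambda>s. complex_of_real (h (t + s)) * f s) (g t)"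
      from AE_lborel_posD[OF this] show "AE x in lborel. log_substitution g x = log_hankel P (log_substitution f) x"
        unfolding eq .
    next
      assume "AE x in lborel. log_substitution g x = log_hankel P (log_substitution f) x"
      then show "AE t in lborel_pos. has_bochner_integral lborel_pos (\<lambda>s. complex_of_real (h (t + s)) * f s) (g t)"
        by (intro AE_lborel_posI) (simp only: eq)
    qed
  qed
  then show ?thesis unfolding L2_restrict_def hankel_operator_def by (auto simp: D_zero_iff)
qed

lemma D_zero_subset_Domain: "D_zero (degree P) \<subseteq> Domain H_min"
proof
  fix f assume "f \<in> D_zero (degree P)"
  then have f: "f \<in> L2 lborel_pos" "fast_decay (degree P) (log_substitution f)" by (auto simp: D_zero_iff)
  have "(f, inv_log_substitution (log_hankel P (log_substitution f))) \<in> H_min"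
    unfolding H_min_iff log_substitution_inv
    using f inv_log_substitution_L2[OF log_hankel_L2[OF f(2)]] by simp
  then show "f \<in> Domain H_min" by blast
qed

lemma Domain_H_min: "Domain H_min = D_zero (degree P)"
  using D_zero_subset_Domain by (auto simp: L2_restrict_def)

lemma H_min_add:
  assumes "(f, g) \<in> H_min" "(f', g') \<in> H_min"
  shows "(\<lambda>x. f x + c * f' x, \<lambda>x. g x + c * g' x) \<in> H_min"
proof -
  note a = assms[unfolded H_min_iff]
  have s: "log_substitution (\<lambda>x. a x + c * b x) = (\<lambda>x. log_substitution a x + c * log_substitution b x)" for a b
    by (auto simp: log_substitution_def algebra_simps)
  have "AE x in lborel. log_substitution g x + c * log_substitution g' x = log_hankel P (\<lambda>x. log_substitution f x + c * log_substitution f' x) x"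
  proof -
    have "AE x in lborel. log_substitution g x = log_hankel P (log_substitution f) x" "AE x in lborel. log_substitution g' x = log_hankel P (log_substitution f') x"
      using a by auto
    then show ?thesis by eventually_elim (use a in \<open>simp add: log_hankel_add\<close>)
  qed
  then show ?thesis unfolding H_min_iff s using a by (auto intro: fast_decay_add)
qed

lemma zero_H_min: "(\<lambda>_. 0, \<lambda>_. 0) \<in> H_min"
proof -
  have "fast_decay (degree P) (\<lambda>x. 0)"
    unfolding fast_decay_def by (intro conjI exI[of _ 0] exI[of _ "real (degree P) + 2"]) auto
  moreover have "log_substitution (\<lambda>_. 0) = (\<lambda>_. 0)" by (auto simp: log_substitution_def)
  ultimately show ?thesis unfolding H_min_iff by (simp add: log_hankel_def)
qed

lemma H_min_cong_AE:
  assumes "(f, g) \<in> H_min" "f' \<in> L2 lborel_pos" "g' \<in> L2 lborel_pos"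
    "AE t in lborel_pos. f' t = f t" "AE t in lborel_pos. g' t = g t"
  shows "(f', g') \<in> H_min"
proof -
  note a = assms(1)[unfolded H_min_iff]
  have uf: "AE x in lborel. log_substitution f' x = log_substitution f x" and ug: "AE x in lborel. log_substitution g' x = log_substitution g x"
    by (intro log_substitution_cong_AE assms)+
  have fm: "log_substitution f' \<in> borel_measurable borel" "log_substitution f \<in> borel_measurable borel"
    using a assms(2) by (auto intro!: log_substitution_borel dest: L2_measurable)
  have "fast_decay (degree P) (log_substitution f')"
  proof -
    obtain C n where n: "n > real (degree P) + 1" and ae: "AE x in lborel. norm (log_substitution f x) \<le> C * (1 + \<bar>x\<bar>) powr (- n)"
      using a by (auto simp: fast_decay_def)
    have "AE x in lborel. norm (log_substitution f' x) \<le> C * (1 + \<bar>x\<bar>) powr (- n)"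
      using ae uf by eventually_elim simp
    then show ?thesis using n fm unfolding fast_decay_def by blast
  qed
  moreover have "log_hankel P (log_substitution f') x = log_hankel P (log_substitution f) x" for x
    unfolding log_hankel_def
  proof (rule integral_cong_AE)
    show "AE y in lborel. complex_of_real (log_hankel_kernel P x y) * log_substitution f' y = complex_of_real (log_hankel_kernel P x y) * log_substitution f y"
      using uf by eventually_elim simp
  qed (use fm in measurable)
  moreover have "AE x in lborel. log_substitution g' x = log_hankel P (log_substitution f) x"
    using conjunct2[OF conjunct2[OF conjunct2[OF a]]] ug by eventually_elim simp
  ultimately show ?thesis unfolding H_min_iff using assms(2,3) by simp
qed

text \<open>
  Truncations in the logarithmic variable are bounded with compact support.
\<close>

lemma D_zero_dense: "L2_dense lborel_pos (D_zero (degree P))"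
  unfolding L2_dense_def
proof (intro conjI ballI)
  show "D_zero (degree P) \<subseteq> L2 lborel_pos" by (auto simp: D_zero_iff)
  fix f :: "real \<Rightarrow> complex" assume f: "f \<in> L2 lborel_pos"
  define u where "u = log_substitution f"
  have u: "u \<in> L2 lborel" unfolding u_def using f by (simp add: log_substitution_L2 L2_measurable)
  define us where "us n x = (if \<bar>x\<bar> \<le> real n \<and> norm (u x) \<le> real n then u x else 0)" for n x
  have lim: "L2_tendsto lborel us u" using L2_truncation_tendsto[OF u] unfolding us_def .
  note usL = L2_tendstoD(1)[OF lim]
  define fs where "fs n = inv_log_substitution (us n)" for n
  have fs: "fs n \<in> L2 lborel_pos" for n unfolding fs_def by (rule inv_log_substitution_L2[OF usL])
  have "fast_decay (degree P) (us n)" for n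
  proof -
    let ?p = "real (degree P) + 2"
    have "norm (us n x) \<le> real n * (1 + real n) powr ?p * (1 + \<bar>x\<bar>) powr (- ?p)" for x
    proof (cases "\<bar>x\<bar> \<le> real n")
      case True
      have "1 \<le> (1 + real n) powr ?p * (1 + \<bar>x\<bar>) powr (- ?p)"
      proof -
        have "(1 + \<bar>x\<bar>) powr ?p \<le> (1 + real n) powr ?p" using True by (intro powr_mono2) auto
        then have "(1 + \<bar>x\<bar>) powr ?p * (1 + \<bar>x\<bar>) powr (- ?p) \<le> (1 + real n) powr ?p * (1 + \<bar>x\<bar>) powr (- ?p)"
          by (rule mult_right_mono) simp
        moreover have "(1 + \<bar>x\<bar>) powr ?p * (1 + \<bar>x\<bar>) powr (- ?p) = 1" unfolding powr_add[symmetric] by simp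
        ultimately show ?thesis by simp
      qed
      then have "real n * 1 \<le> real n * ((1 + real n) powr ?p * (1 + \<bar>x\<bar>) powr (- ?p))" by (rule mult_left_mono) simp
      moreover have "norm (us n x) \<le> real n" by (simp add: us_def)
      ultimately show ?thesis by (simp add: mult.assoc)
    qed (simp add: us_def)
    then show ?thesis unfolding fast_decay_def using L2_borel[OF usL]
      by (intro conjI exI[of _ "real n * (1 + real n) powr ?p"] exI[of _ ?p]) auto
  qed
  then have D: "fs n \<in> D_zero (degree P)" for n using fs unfolding D_zero_iff fs_def log_substitution_inv by simp
  have "L2_tendsto lborel_pos fs f"
  proof (rule L2_tendstoI[OF fs f])
    have "L2_norm lborel_pos (\<lambda>t. fs n t - f t) = L2_norm lborel (\<lambda>x. us n x - u x)" for n
    proof -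
      have "log_substitution (\<lambda>t. fs n t - f t) = (\<lambda>x. us n x - u x)"
        using fun_cong[OF log_substitution_inv[of "us n"]] unfolding u_def fs_def by (auto simp: log_substitution_def right_diff_distrib)
      then show ?thesis using log_substitution_L2(2)[of "\<lambda>t. fs n t - f t"] L2_measurable[OF L2_diff[OF fs f]] by simp
    qed
    then show "(\<lambda>n. L2_norm lborel_pos (\<lambda>t. fs n t - f t)) \<longlonglongrightarrow> 0" using L2_tendstoD(3)[OF lim] by simp
  qed
  with D show "\<exists>fs. (\<forall>n. fs n \<in> D_zero (degree P)) \<and> L2_tendsto lborel_pos fs f" by blast
qed

lemma H_min_symmetric: "symmetric_operator lborel_pos H_min"
  unfolding symmetric_operator_def
proof (intro conjI)
  show "L2_dense lborel_pos (Domain H_min)" unfolding Domain_H_min by (rule D_zero_dense)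
  show "L2_operator lborel_pos lborel_pos H_min"
    unfolding L2_operator_def
  proof (intro conjI allI impI; (elim conjE)?)
    show "H_min \<subseteq> L2 lborel_pos \<times> L2 lborel_pos" using H_min_iff by auto
    show "(\<lambda>_. 0, \<lambda>_. 0) \<in> H_min" by (rule zero_H_min)
    show "(\<lambda>x. f x + f' x, \<lambda>y. g y + g' y) \<in> H_min" if "(f, g) \<in> H_min" "(f', g') \<in> H_min" for f g f' g'
      using H_min_add[OF that, of 1] by simp
    show "(\<lambda>x. c * f x, \<lambda>y. c * g y) \<in> H_min" if "(f, g) \<in> H_min" for f g c
      using H_min_add[OF zero_H_min that, of c] by simp
    show "AE y in lborel_pos. g y = g' y" if "(f, g) \<in> H_min" "(f, g') \<in> H_min" for f g g'
    proof (rule log_substitution_eq_AE)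
      have "AE x in lborel. log_substitution g x = log_hankel P (log_substitution f) x" "AE x in lborel. log_substitution g' x = log_hankel P (log_substitution f) x"
        using that by (auto simp: H_min_iff)
      then show "AE x in lborel. log_substitution g x = log_substitution g' x" by eventually_elim simp
    qed
  qed (rule H_min_cong_AE)
  have "L2_inner lborel_pos g u = L2_inner lborel_pos f w" if fg: "(f, g) \<in> H_min" and uw: "(u, w) \<in> H_min" for f g u w
  proof -
    note a = fg[unfolded H_min_iff] uw[unfolded H_min_iff]
    note [measurable] = log_substitution_borel[OF L2_measurable[OF conjunct1[OF a(1)]]] log_substitution_borel[OF L2_measurable[OF conjunct1[OF a(2)]]]
      log_substitution_borel[OF L2_measurable[OF conjunct1[OF conjunct2[OF a(1)]]]] log_substitution_borel[OF L2_measurable[OF conjunct1[OF conjunct2[OF a(2)]]]]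
    have hm: "log_hankel P (log_substitution f) \<in> borel_measurable lborel" "log_hankel P (log_substitution u) \<in> borel_measurable lborel"
      using a log_hankel_L2 L2_measurable by blast+
    have "L2_inner lborel_pos g u = L2_inner lborel (log_substitution g) (log_substitution u)"
      using a by (simp add: log_substitution_inner L2_measurable)
    also have "\<dots> = L2_inner lborel (log_hankel P (log_substitution f)) (log_substitution u)"
      by (rule L2_inner_cong_AE) (use a hm in auto)
    also have "\<dots> = L2_inner lborel (log_substitution f) (log_hankel P (log_substitution u))"
      using a by (intro log_hankel_symmetric) auto
    also have "\<dots> = L2_inner lborel (log_substitution f) (log_substitution w)"
      by (rule L2_inner_cong_AE) (use a hm in \<open>auto elim: eventually_mono\<close>)
    also have "\<dots> = L2_inner lborel_pos f w"
      using a by (simp add: log_substitution_inner L2_measurable)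
    finally show ?thesis .
  qed
  then show "\<forall>(f, g)\<in>H_min. \<forall>(u, w)\<in>H_min. L2_inner lborel_pos g u = L2_inner lborel_pos f w" by blast
qed

lemma H_min_test:
  assumes \<psi>: "\<psi> \<in> test_functions"
  shows "(inv_log_substitution (phase_inv_fourier \<psi>), inv_log_substitution (phase_inv_fourier (weighted_operator (Q_poly P) \<psi>))) \<in> H_min"
  unfolding H_min_iff log_substitution_inv
  using F_op_D(1)[OF F_op_phase_inv_fourier[OF \<psi>]] F_op_D(1)[OF F_op_phase_inv_fourier[OF weighted_operator_test[OF \<psi>]]]
    phase_inv_fourier_fast_decay[OF \<psi>] log_hankel_diagonal[OF \<psi>] by simp

text \<open>
  The adjoint of \<open>H\<^sub>0\<close> is tested only against the functions \<open>F\<^sup>* \<psi>\<close>, on which \<open>H\<^sub>0\<close> is explicit.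
\<close>

lemma H_min_adjoint_imp_weak_solution:
  assumes adj: "(f, k) \<in> L2_adjoint lborel_pos lborel_pos H_min" and g: "(f, g) \<in> F_op" and w: "(k, w) \<in> F_op"
  shows "weak_solution (Q_poly P) g w"
  unfolding weak_solution_def
proof (intro conjI ballI)
  show "g \<in> L2 lborel" "w \<in> L2 lborel" using F_op_D g w by auto
  fix \<psi> assume \<psi>: "\<psi> \<in> test_functions"
  let ?f = "\<lambda>\<psi>. inv_log_substitution (phase_inv_fourier \<psi>)"
  let ?A = "weighted_operator (Q_poly P) \<psi>"
  have "L2_inner lborel_pos (?f ?A) f = L2_inner lborel_pos (?f \<psi>) k"
    using adj H_min_test[OF \<psi>] unfolding L2_adjoint_def by auto
  then have "L2_inner lborel ?A g = L2_inner lborel \<psi> w"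
    using F_op_inner[OF F_op_phase_inv_fourier[OF weighted_operator_test[OF \<psi>]] g] F_op_inner[OF F_op_phase_inv_fourier[OF \<psi>] w] by simp
  then have "cnj (L2_inner lborel ?A g) = cnj (L2_inner lborel \<psi> w)" by simp
  then show "L2_inner lborel g ?A = L2_inner lborel w \<psi>" unfolding L2_inner_cnj .
qed

text \<open>
  \<open>F\<^sup>*\<close> carries an approximation by test functions into one within \<open>\<D>\<^sub>0\<close>.
\<close>

lemma weak_solution_imp_H_min_closure:
  assumes gw: "weak_solution (Q_poly P) g w" and g: "(f, g) \<in> F_op" and w: "(k, w) \<in> F_op"
  shows "(f, k) \<in> L2_closure lborel_pos lborel_pos H_min"
proof -
  obtain \<psi> where \<psi>: "\<And>n. \<psi> n \<in> test_functions" "L2_tendsto lborel \<psi> g" "L2_tendsto lborel (\<lambda>n. weighted_operator (Q_poly P) (\<psi> n)) w"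
    using weak_solution_approx[OF real_poly_Q gw] by blast
  let ?f = "\<lambda>\<psi>. inv_log_substitution (phase_inv_fourier \<psi>)"
  have "L2_tendsto lborel_pos (\<lambda>n. ?f (\<psi> n)) f"
    by (rule F_op_tendsto[OF F_op_phase_inv_fourier[OF \<psi>(1)] g \<psi>(2)])
  moreover have "L2_tendsto lborel_pos (\<lambda>n. ?f (weighted_operator (Q_poly P) (\<psi> n))) k"
    by (rule F_op_tendsto[OF F_op_phase_inv_fourier[OF weighted_operator_test[OF \<psi>(1)]] w \<psi>(3)])
  moreover have "(?f (\<psi> n), ?f (weighted_operator (Q_poly P) (\<psi> n))) \<in> H_min" for n by (rule H_min_test[OF \<psi>(1)])
  ultimately show ?thesis unfolding L2_closure_def mem_Collect_eq prod.case
    by (intro exI[of _ "\<lambda>n. ?f (\<psi> n)"] exI[of _ "\<lambda>n. ?f (weighted_operator (Q_poly P) (\<psi> n))"]) auto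
qed

lemma H_min_adjoint_subset_closure:
  "L2_adjoint lborel_pos lborel_pos H_min \<subseteq> L2_closure lborel_pos lborel_pos H_min"
proof
  fix p assume p: "p \<in> L2_adjoint lborel_pos lborel_pos H_min"
  obtain f k where fk: "p = (f, k)" by (cases p)
  have "f \<in> L2 lborel_pos" "k \<in> L2 lborel_pos" using p unfolding fk L2_adjoint_def by auto
  then obtain g w where g: "(f, g) \<in> F_op" and w: "(k, w) \<in> F_op" using F_op_total by metis
  show "p \<in> L2_closure lborel_pos lborel_pos H_min" unfolding fk
    by (rule weak_solution_imp_H_min_closure[OF H_min_adjoint_imp_weak_solution[OF p[unfolded fk] g w] g w])
qed

lemma Domain_H_min_closure:
  "Domain (L2_closure lborel_pos lborel_pos H_min) = L2_adjoint lborel_pos lborel F_op `` D_star P"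
proof (intro set_eqI iffI)
  fix f assume "f \<in> Domain (L2_closure lborel_pos lborel_pos H_min)"
  then obtain k where "(f, k) \<in> L2_closure lborel_pos lborel_pos H_min" by blast
  then have fk: "(f, k) \<in> L2_adjoint lborel_pos lborel_pos H_min"
    using symmetric_closure_subset_adjoint[OF H_min_symmetric] by blast
  then have "f \<in> L2 lborel_pos" "k \<in> L2 lborel_pos" unfolding L2_adjoint_def by auto
  then obtain g w where g: "(f, g) \<in> F_op" and w: "(k, w) \<in> F_op" using F_op_total by metis
  have "g \<in> D_star P"
    using H_min_adjoint_imp_weak_solution[OF fk g w] D_star_iff_weak_solution[OF real_poly_Q] by blast
  then show "f \<in> L2_adjoint lborel_pos lborel F_op `` D_star P" using g F_op_adjoint_iff by blast
next
  fix f assume "f \<in> L2_adjoint lborel_pos lborel F_op `` D_star P"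
  then obtain g where gD: "g \<in> D_star P" and g: "(f, g) \<in> F_op" using F_op_adjoint_iff by blast
  obtain w where gw: "weak_solution (Q_poly P) g w" using gD D_star_iff_weak_solution[OF real_poly_Q] by blast
  then have "w \<in> L2 lborel" by (simp add: weak_solution_def)
  then obtain k where "(k, w) \<in> F_op" by (rule F_op_surj)
  from weak_solution_imp_H_min_closure[OF gw g this] show "f \<in> Domain (L2_closure lborel_pos lborel_pos H_min)" by blast
qed

end

section \<open>Essential self-adjointness\<close>

theorem theorem3p14:
  fixes P :: "real poly" and h :: "real \<Rightarrow> real"
  assumes "P \<noteq> 0"
    and "\<And>t. t > 0 \<Longrightarrow> h t = poly P (ln t) / t"
  shows "essentially_self_adjoint_on lborel_pos (hankel_operator h) (D_zero (degree P)) \<and>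
    self_adjoint_on lborel_pos
      (L2_closure lborel_pos lborel_pos
        (L2_restrict (hankel_operator h) (D_zero (degree P))))
      (L2_adjoint lborel_pos lborel F_op `` D_star P)"
proof -
  interpret log_kernel_hankel P h using assms(2) by unfold_locales
  have sa: "self_adjoint lborel_pos (L2_closure lborel_pos lborel_pos H_min)"
    by (rule self_adjoint_closure[OF H_min_symmetric H_min_adjoint_subset_closure])
  moreover have "D_zero (degree P) \<subseteq> Domain (hankel_operator h)"
    using D_zero_subset_Domain by (auto simp: L2_restrict_def)
  ultimately show ?thesis
    unfolding essentially_self_adjoint_on_def self_adjoint_on_def
    using H_min_symmetric Domain_H_min_closure by blast
qed

end
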